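(* Let $f_1,\dots,f_n:\mathbb{R}^p\to\mathbb{R}$ be continuously differentiable with $L$-Lipschitz continuous gradients ($L>0$), let $f=\frac1n\sum_{i=1}^n f_i$ be $\mu$-strongly convex ($\mu>0$) with unique minimizer $x^*$, and let the stochastic gradients be independent, unbiased and of variance at most $\sigma^2$ ($\sigma>0$), as specified in the context. For every $k\ge0$ let $\mathbb{G}_k$ be a strongly connected directed graph on $[n]$ with a self-loop at every node, let $A_k$ be row-stochastic and $B_k$ column-stochastic, both compatible with $\mathbb{G}_k$, with $\min^+(A_k)\ge a>0$ and $\min^+(B_k)\ge b>0$ for all $k$. Let $(x_k^i,y_k^i)$ be the iterates of the algorithm in the context, with stepsizes $\alpha_i>0$ and momentum parameters $\beta_i\ge 0$, and set $\bar\alpha=\max_i\alpha_i$, $\bar\beta=\max_i\beta_i$. With the constants $c,\tau,\eta,\varphi,\nu,\varsigma$, the vector $V_k$, the matrix $M(\bar\alpha,\bar\beta)$ and the vector $\mathbf{b}(\bar\alpha)$ defined in the context, assume $$0<\bar\alpha<\min\left\{\frac{2}{n\eta(L+\mu)},\ \frac{1-c^2}{2\varphi\varsigma\sqrt{2(1+c^2)}}\right\}$$ and $$0\le\bar\beta<\min\left\{\bar\alpha\sqrt{\frac{n\eta L^2(1-\tau^2)+32\nu}{48(1-\tau^2)}},\ \sqrt{\frac{(1-c^2)^2}{96(1+c^2)\varphi^2}-\frac{\varsigma^2\bar\alpha^2}{12}}\right\}.$$ Then the spectral radius $\rho_M$ of $M(\bar\alpha,\bar\beta)$ satisfies $\rho_M<1$,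 the vector $(\mathbb{I}-M(\bar\alpha,\bar\beta))^{-1}\mathbf{b}(\bar\alpha)$ has non-negative components, and (componentwise) $$\limsup_{k\to\infty}V_k\le(\mathbb{I}-M(\bar\alpha,\bar\beta))^{-1}\mathbf{b}(\bar\alpha);$$ in particular $$\limsup_{k\to\infty}\mathbb{E}[\|\hat x_k-x^*\|^2]\le[(\mathbb{I}-M(\bar\alpha,\bar\beta))^{-1}\mathbf{b}(\bar\alpha)]_1,\qquad \limsup_{k\to\infty}\mathbb{E}[\|\mathbf{x}_k-\hat{\mathbf{x}}_k\|_{\phi_k}^2]\le[(\mathbb{I}-M(\bar\alpha,\bar\beta))^{-1}\mathbf{b}(\bar\alpha)]_2 .$$ Moreover the convergence is linear with rate of order $\mathcal{O}(\rho_M^k)$, i.e. there is a constant $C\ge0$ such that $V_k\le(\mathbb{I}-M(\bar\alpha,\bar\beta))^{-1}\mathbf{b}(\bar\alpha)+C\rho_M^k\mathbf{1}$ componentwise for all $k\ge 1$.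
   Context: **Notation.** $[n]=\{1,\dots,n\}$; $\mathbf 1$ is the all-ones vector; $\mathbb I$ the identity; $\min(u),\max(u)$ are the smallest/largest entry of a vector $u$; $\min^+(A)$ is the smallest positive entry of a nonnegative matrix $A$. A nonnegative vector is stochastic if its entries sum to 1. Inequalities between vectors/matrices are entrywise. For $\mathbf u=[u_1,\dots,u_n]^{\mathsf T}\in\mathbb R^{n\times p}$ and a positive vector $\mathbf a\in\mathbb{R}^n$, $\|\mathbf u\|_{\mathbf a}^2=\sum_i a_i\|u_i\|^2$, and $\|\mathbf u\|^2=\sum_i\|u_i\|^2$. **Graphs and matrices.** An edge $(j,i)$ of $\mathbb{G}_k$ means that $i$ receives information from $j$; the in-neighbors of $i$ are the $j$ with $(j,i)$ an edge, the out-neighbors of $i$ are the $l$ with $(i,l)$ an edge. $A_k$ compatible with $\mathbb{G}_k$: $[A_k]_{ij}>0$ iff $j=i$ or $j$ is an in-neighbor of $i$, otherwise $[A_k]_{ij}=0$. $B_k$ compatible with $\mathbb{G}_k$: $[B_k]_{ji}>0$ iff $j=i$ or $j$ is an out-neighbor of $i$, otherwise $[B_k]_{ji}=0$. Row-stochastic: nonnegative, $A_k\mathbf 1=\mathbf 1$; column-stochastic: nonnegative, $\mathbf 1^{\mathsf T}B_k=\mathbf 1^{\mathsf T}$. For a strongly connected directed graph $\mathbb{G}$: the diameter $\mathsf D(\mathbb G)$ is the maximal length of a shortest directed path over all ordered pairs of distinct nodes; a shortest-path covering $\mathcal P$ is a collection containing, for each ordered pair of distinct nodes $(j,l)$, one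 shortest directed path from $j$ to $l$; the utility of an edge with respect to $\mathcal P$ is the number of paths in $\mathcal P$ passing through it; the maximal edge-utility $\mathsf K(\mathbb G)$ is the maximum utility over all edges and all shortest-path coverings. **Stochastic gradients.** Agent $i$ at iteration $k$ obtains $g_i(x_k^i,\xi_k^i)$, where the random vectors $\xi_k^i$ ($i\in[n]$, $k\ge0$) are independent, and for all $i$ and $x\in\mathbb R^p$: $\mathbb E[g_i(x,\xi_i)\mid x]=\nabla f_i(x)$ and $\mathbb E[\|g_i(x,\xi_i)-\nabla f_i(x)\|^2\mid x]\le\sigma^2$. **Algorithm.** Arbitrary initial vectors $x_{-1}^i,x_0^i\in\mathbb R^p$, $y_0^i=g_i(x_0^i,\xi_0^i)$, and for $k\ge0$ $$x_{k+1}^i=\sum_{j=1}^n[A_k]_{ij}x_k^j-\alpha_iy_k^i+\beta_i(x_k^i-x_{k-1}^i),$$ $$y_{k+1}^i=\sum_{j=1}^n[B_k]_{ij}y_k^j+g_i(x_{k+1}^i,\xi_{k+1}^i)-g_i(x_k^i,\xi_k^i).$$ Write $\mathbf x_k=[x_k^1,\dots,x_k^n]^{\mathsf T}$, $\mathbf y_k=[y_k^1,\dots,y_k^n]^{\mathsf T}\in\mathbb R^{n\times p}$. **Weight vectors.** $\{\phi_k\}_{k\ge0}$ is a sequence of stochastic vectors with $\phi_{k+1}^{\mathsf T}A_k=\phi_k^{\mathsf T}$ and $[\phi_k]_i\ge a^n/n$ for all $i,k$ (such a sequence exists under the assumptions). $\pi_0=\frac1n\mathbf 1$, $\pi_{k+1}=B_k\pi_k$;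 these are stochastic with $[\pi_k]_i\ge b^n/n$. Put $\hat x_k=\sum_i[\phi_k]_ix_k^i$, $\hat{\mathbf x}_k=\mathbf 1\hat x_k^{\mathsf T}$ (every row equal to $\hat x_k$), and $$S(\mathbf y_k,\pi_k)=\sqrt{\sum_{i=1}^n[\pi_k]_i\Big\|\frac{y_k^i}{[\pi_k]_i}-\sum_{j=1}^ny_k^j\Big\|^2}.$$ **Constants.** $\chi_k=\sqrt{1/\min(\pi_k)}$, $\varphi_k=\sqrt{1/\min(\phi_k)}$, $\psi_k=n(\chi_{k+1}^2-1)$, $$\tau_k=\sqrt{1-\frac{\min^2(\pi_k)\,b^2}{\max^2(\pi_k)\max(\pi_{k+1})\mathsf D(\mathbb G_k)\mathsf K(\mathbb G_k)}},\qquad c_k=\sqrt{1-\frac{\min(\phi_{k+1})\,a^2}{\max^2(\phi_k)\mathsf D(\mathbb G_k)\mathsf K(\mathbb G_k)}}.$$ $c,\tau\in(0,1)$ satisfy $c_k\le c$, $\tau_k\le\tau$ for all $k$; $\eta\in(0,1)$ satisfies $\phi_{k+1}^{\mathsf T}\pi_k\ge\eta$ for all $k$; $\psi>0$, $\chi>1$, $\varphi>1$ satisfy $\psi_k\le\psi$, $\chi_k\le\chi$, $\varphi_k\le\varphi$ for all $k$. Further $$\nu=\frac{6L^2\chi^2\tau^2}{1-\tau^2}+3\psi L^2,\qquad \varsigma^2=\frac{L^2(n\eta\mu^2+12L^2\varphi^2)}{\eta\mu^2}+\frac{8\nu(n\eta^2\mu^2+48L^2\varphi^2)}{n\eta^2\mu^2(1-\tau^2)}\quad(\varsigma>0).$$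 **$V_k$, $M$, $\mathbf b$.** $$V_k=\big[\mathbb E\|\hat x_k-x^*\|^2,\ \mathbb E\|\mathbf x_k-\hat{\mathbf x}_k\|_{\phi_k}^2,\ \mathbb E\|\mathbf x_k-\mathbf x_{k-1}\|^2,\ \mathbb E\,S^2(\mathbf y_k,\pi_k)\big]^{\mathsf T},$$ $$M(\bar\alpha,\bar\beta)=\begin{bmatrix}1-m_1\bar\alpha&m_2\bar\alpha&m_3\bar\beta^2/\bar\alpha&m_3\bar\alpha\\ m_4\bar\alpha^2&\frac{1+c^2}2+m_4\bar\alpha^2&m_5\bar\beta^2&m_5\bar\alpha^2\\ m_7\bar\alpha^2&m_8+m_7\bar\alpha^2&3\bar\beta^2&3\bar\alpha^2\\ m_9\bar\alpha^2&m_{10}+m_9\bar\alpha^2&m_{11}\bar\beta^2&\frac{1+\tau^2}2+m_{11}\bar\alpha^2\end{bmatrix},$$ $\mathbf b(\bar\alpha)=[b_1\bar\alpha^2,\ b_2\bar\alpha^2,\ b_3\bar\alpha^2,\ b_4+b_5\bar\alpha+b_6\bar\alpha^2]^{\mathsf T}$, where $m_1=\frac{n\mu\eta}2$, $m_2=\frac{3L^2\varphi^2}\mu$, $m_3=\frac6{n\mu\eta}$, $m_4=\frac{4nL^2\varphi^2(1+c^2)}{1-c^2}$, $m_5=\frac{2(1+c^2)}{1-c^2}$, $m_7=6nL^2\varphi^2$, $m_8=12\varphi^2$, $m_9=2nL^2\varphi^2\nu$, $m_{10}=4\varphi^2\nu$, $m_{11}=\nu$, $b_1=\frac{3n\sigma^2}2$,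 $b_2=\frac{4n(1+c^2)\sigma^2}{1-c^2}$, $b_3=6n\sigma^2$, $b_4=4n\psi\sigma^2$, $b_5=2Ln\psi\sigma^2$, $b_6=2n\nu\sigma^2$. *)

theory Defs
  imports
    "HOL-Probability.Probability"
    "Graph_Theory.Graph_Theory"
    "Jordan_Normal_Form.Gauss_Jordan_Elimination"
    "Jordan_Normal_Form.Spectral_Radius"
begin

(* Agents form a finite type 'n. Agent-indexed vectors and matrices use the types of HOL-Analysis,
   and a stack of n row vectors in R^p is an element of real^'p^'n, whose norm is the Frobenius
   norm. The 4-dimensional comparison system uses the matrices of Jordan_Normal_Form, for the sake
   of spectral_radius. Its vectors are indexed from 0. Below, $ always refers to HOL-Analysis. *)
no_notation vec_index (infixl \<open>$\<close> 100)
no_notation scalar_prod (infix \<open>\<bullet>\<close> 70)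


subsection \<open>Directed graphs\<close>

definition shortest_path :: "('a, 'b) pre_digraph \<Rightarrow> 'a \<Rightarrow> 'b list \<Rightarrow> 'a \<Rightarrow> bool" where
  "shortest_path G u p v \<longleftrightarrow>
     pre_digraph.apath G u p v \<and> (\<forall>q. pre_digraph.apath G u q v \<longrightarrow> length p \<le> length q)"

(* Sup on nat is the maximum of a finite nonempty set; it is 0 on the empty set, which
   happens only if there are no two distinct nodes. *)
definition graph_diameter :: "('a, 'b) pre_digraph \<Rightarrow> nat" where
  "graph_diameter G =
     Sup {length p | p u v. u \<in> verts G \<and> v \<in> verts G \<and> u \<noteq> v \<and> shortest_path G u p v}"

(* A covering selects one shortest path for each ordered pair of distinct nodes; the values
   on the diagonal are irrelevant. *)
definition shortest_path_covering :: "('a, 'b) pre_digraph \<Rightarrow> ('a \<Rightarrow> 'a \<Rightarrow> 'b list) \<Rightarrow> bool" where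
  "shortest_path_covering G P \<longleftrightarrow>
     (\<forall>u\<in>verts G. \<forall>v\<in>verts G. u \<noteq> v \<longrightarrow> shortest_path G u (P u v) v)"

definition edge_utility :: "('a, 'b) pre_digraph \<Rightarrow> ('a \<Rightarrow> 'a \<Rightarrow> 'b list) \<Rightarrow> 'b \<Rightarrow> nat" where
  "edge_utility G P e = card {(u, v). u \<in> verts G \<and> v \<in> verts G \<and> u \<noteq> v \<and> e \<in> set (P u v)}"

definition max_edge_utility :: "('a, 'b) pre_digraph \<Rightarrow> nat" where
  "max_edge_utility G = Sup {edge_utility G P e | P e. shortest_path_covering G P \<and> e \<in> arcs G}"


subsection \<open>Matrices and weight vectors\<close>

definition min_entry :: "real^'n \<Rightarrow> real" where
  "min_entry u = Min (range (\<lambda>i. u $ i))"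

definition max_entry :: "real^'n \<Rightarrow> real" where
  "max_entry u = Max (range (\<lambda>i. u $ i))"

definition min_pos :: "real^'n^'m \<Rightarrow> real" where
  "min_pos A = Min {A $ i $ j | i j. 0 < A $ i $ j}"

definition stochastic_vec :: "real^'n \<Rightarrow> bool" where
  "stochastic_vec u \<longleftrightarrow> (\<forall>i. 0 \<le> u $ i) \<and> (\<Sum>i\<in>UNIV. u $ i) = 1"

definition row_stochastic :: "real^'n^'n \<Rightarrow> bool" where
  "row_stochastic A \<longleftrightarrow> (\<forall>i j. 0 \<le> A $ i $ j) \<and> A *v 1 = 1"

definition col_stochastic :: "real^'n^'n \<Rightarrow> bool" where
  "col_stochastic B \<longleftrightarrow> (\<forall>i j. 0 \<le> B $ i $ j) \<and> 1 v* B = 1"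

(* The edge (j, i) means that i receives information from j. *)
definition compatible_A :: "'n pair_pre_digraph \<Rightarrow> real^'n^'n \<Rightarrow> bool" where
  "compatible_A G A \<longleftrightarrow>
     (\<forall>i j. if j = i \<or> (j, i) \<in> parcs G then 0 < A $ i $ j else A $ i $ j = 0)"

definition compatible_B :: "'n pair_pre_digraph \<Rightarrow> real^'n^'n \<Rightarrow> bool" where
  "compatible_B G B \<longleftrightarrow>
     (\<forall>i j. if j = i \<or> (i, j) \<in> parcs G then 0 < B $ j $ i else B $ j $ i = 0)"

primrec pi_seq :: "(nat \<Rightarrow> real^'n^'n) \<Rightarrow> nat \<Rightarrow> real^'n" where
  "pi_seq B 0 = (\<chi> i. 1 / real CARD('n))"
| "pi_seq B (Suc k) = B k *v pi_seq B k"

definition tau_k :: "real \<Rightarrow> ('n, 'e) pre_digraph \<Rightarrow> real^'n \<Rightarrow> real^'n \<Rightarrow> real" where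
  "tau_k b G p p' =
     sqrt (1 - (min_entry p)\<^sup>2 * b\<^sup>2
             / ((max_entry p)\<^sup>2 * max_entry p' * real (graph_diameter G) * real (max_edge_utility G)))"

definition c_k :: "real \<Rightarrow> ('n, 'e) pre_digraph \<Rightarrow> real^'n \<Rightarrow> real^'n \<Rightarrow> real" where
  "c_k a G q q' =
     sqrt (1 - min_entry q' * a\<^sup>2
             / ((max_entry q)\<^sup>2 * real (graph_diameter G) * real (max_edge_utility G)))"

definition chi_k :: "real^'n \<Rightarrow> real" where
  "chi_k p = sqrt (1 / min_entry p)"


subsection \<open>Objective and stochastic gradients\<close>

definition strongly_convex :: "real \<Rightarrow> ('a::real_normed_vector \<Rightarrow> real) \<Rightarrow> bool" where
  "strongly_convex mu f \<longleftrightarrow>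
     (\<forall>x y. \<forall>t\<in>{0..1}. f ((1 - t) *\<^sub>R x + t *\<^sub>R y)
        \<le> (1 - t) * f x + t * f y - mu / 2 * t * (1 - t) * (norm (x - y))\<^sup>2)"

(* The sample xi k i of agent i at iteration k takes values in a measurable space Z i. Joint
   measurability of g i, together with independence, makes the conditions for deterministic
   points x the conditional ones along the iterates. *)
definition stochastic_gradients ::
  "'s measure \<Rightarrow> ('n \<Rightarrow> 'z measure) \<Rightarrow> (nat \<Rightarrow> 'n \<Rightarrow> 's \<Rightarrow> 'z) \<Rightarrow>
   ('n \<Rightarrow> real^'p \<Rightarrow> 'z \<Rightarrow> real^'p) \<Rightarrow> ('n \<Rightarrow> real^'p \<Rightarrow> real^'p) \<Rightarrow> real \<Rightarrow> bool" where
  "stochastic_gradients P Z \<xi> g grad \<sigma> \<longleftrightarrow>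
     prob_space P \<and>
     prob_space.indep_vars P (\<lambda>(k, i). Z i) (\<lambda>(k, i). \<xi> k i) (UNIV :: (nat \<times> 'n) set) \<and>
     (\<forall>i. (\<lambda>(x, z). g i x z) \<in> borel_measurable (borel \<Otimes>\<^sub>M Z i)) \<and>
     (\<forall>k i x. integrable P (\<lambda>s. g i x (\<xi> k i s)) \<and>
        (\<integral>s. g i x (\<xi> k i s) \<partial>P) = grad i x) \<and>
     (\<forall>k i x. integrable P (\<lambda>s. (norm (g i x (\<xi> k i s) - grad i x))\<^sup>2) \<and>
        (\<integral>s. (norm (g i x (\<xi> k i s) - grad i x))\<^sup>2 \<partial>P) \<le> \<sigma>\<^sup>2)"


subsection \<open>Iterates and error quantities\<close>

(* x_{k-1}, where the iterate with index -1 is the initial value xm1. *)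
definition prev_iterate :: "'v \<Rightarrow> (nat \<Rightarrow> 's \<Rightarrow> 'v) \<Rightarrow> nat \<Rightarrow> 's \<Rightarrow> 'v" where
  "prev_iterate xm1 x k s = (case k of 0 \<Rightarrow> xm1 | Suc l \<Rightarrow> x l s)"

definition algorithm_iterates ::
  "'s measure \<Rightarrow> (nat \<Rightarrow> 'n \<Rightarrow> 's \<Rightarrow> 'z) \<Rightarrow> ('n \<Rightarrow> real^'p \<Rightarrow> 'z \<Rightarrow> real^'p) \<Rightarrow>
   (nat \<Rightarrow> real^'n^'n) \<Rightarrow> (nat \<Rightarrow> real^'n^'n) \<Rightarrow> real^'n \<Rightarrow> real^'n \<Rightarrow>
   real^'p^'n \<Rightarrow> real^'p^'n \<Rightarrow> (nat \<Rightarrow> 's \<Rightarrow> real^'p^'n) \<Rightarrow> (nat \<Rightarrow> 's \<Rightarrow> real^'p^'n) \<Rightarrow> bool" where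
  "algorithm_iterates P \<xi> g A B \<alpha> \<beta> xm1 x0 x y \<longleftrightarrow>
     (\<forall>s\<in>space P. \<forall>i.
        x 0 s $ i = x0 $ i \<and>
        y 0 s $ i = g i (x0 $ i) (\<xi> 0 i s) \<and>
        (\<forall>k. x (Suc k) s $ i =
               (\<Sum>j\<in>UNIV. A k $ i $ j *\<^sub>R x k s $ j) - \<alpha> $ i *\<^sub>R y k s $ i
                 + \<beta> $ i *\<^sub>R (x k s $ i - prev_iterate xm1 x k s $ i)) \<and>
        (\<forall>k. y (Suc k) s $ i =
               (\<Sum>j\<in>UNIV. B k $ i $ j *\<^sub>R y k s $ j)
                 + g i (x (Suc k) s $ i) (\<xi> (Suc k) i s) - g i (x k s $ i) (\<xi> k i s)))"

definition weighted_norm2 :: "real^'n \<Rightarrow> real^'p^'n \<Rightarrow> real" where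
  "weighted_norm2 a u = (\<Sum>i\<in>UNIV. a $ i * (norm (u $ i))\<^sup>2)"

definition weighted_avg :: "real^'n \<Rightarrow> real^'p^'n \<Rightarrow> real^'p" where
  "weighted_avg q u = (\<Sum>i\<in>UNIV. q $ i *\<^sub>R u $ i)"

definition S_err :: "real^'p^'n \<Rightarrow> real^'n \<Rightarrow> real" where
  "S_err y p =
     sqrt (\<Sum>i\<in>UNIV. p $ i * (norm ((1 / p $ i) *\<^sub>R y $ i - (\<Sum>j\<in>UNIV. y $ j)))\<^sup>2)"

(* The four random errors whose expectations are the components of V_k. *)
definition optimality_err :: "real^'n \<Rightarrow> real^'p \<Rightarrow> real^'p^'n \<Rightarrow> real" where
  "optimality_err q xstar x = (norm (weighted_avg q x - xstar))\<^sup>2"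

definition consensus_err :: "real^'n \<Rightarrow> real^'p^'n \<Rightarrow> real" where
  "consensus_err q x = weighted_norm2 q (x - (\<chi> i. weighted_avg q x))"

definition step_err :: "real^'p^'n \<Rightarrow> real^'p^'n \<Rightarrow> real" where
  "step_err x x' = (norm (x - x'))\<^sup>2"

definition tracking_err :: "real^'p^'n \<Rightarrow> real^'n \<Rightarrow> real" where
  "tracking_err y p = (S_err y p)\<^sup>2"

definition V_vec ::
  "'s measure \<Rightarrow> (nat \<Rightarrow> real^'n) \<Rightarrow> (nat \<Rightarrow> real^'n^'n) \<Rightarrow> real^'p \<Rightarrow> real^'p^'n \<Rightarrow>
   (nat \<Rightarrow> 's \<Rightarrow> real^'p^'n) \<Rightarrow> (nat \<Rightarrow> 's \<Rightarrow> real^'p^'n) \<Rightarrow> nat \<Rightarrow> real Matrix.vec" where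
  "V_vec P \<phi> B xstar xm1 x y k = vec_of_list
     [ \<integral>s. optimality_err (\<phi> k) xstar (x k s) \<partial>P,
       \<integral>s. consensus_err (\<phi> k) (x k s) \<partial>P,
       \<integral>s. step_err (x k s) (prev_iterate xm1 x k s) \<partial>P,
       \<integral>s. tracking_err (y k s) (pi_seq B k) \<partial>P ]"


subsection \<open>Constants of the comparison system\<close>

definition nu_const :: "real \<Rightarrow> real \<Rightarrow> real \<Rightarrow> real \<Rightarrow> real" where
  "nu_const L chi \<tau> \<psi> = 6 * L\<^sup>2 * chi\<^sup>2 * \<tau>\<^sup>2 / (1 - \<tau>\<^sup>2) + 3 * \<psi> * L\<^sup>2"

definition varsigma_const :: "real \<Rightarrow> real \<Rightarrow> real \<Rightarrow> real \<Rightarrow> real \<Rightarrow> real \<Rightarrow> real \<Rightarrow> real" where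
  "varsigma_const n L mu \<eta> vphi \<tau> \<nu> = sqrt
     (L\<^sup>2 * (n * \<eta> * mu\<^sup>2 + 12 * L\<^sup>2 * vphi\<^sup>2) / (\<eta> * mu\<^sup>2)
      + 8 * \<nu> * (n * \<eta>\<^sup>2 * mu\<^sup>2 + 48 * L\<^sup>2 * vphi\<^sup>2) / (n * \<eta>\<^sup>2 * mu\<^sup>2 * (1 - \<tau>\<^sup>2)))"

definition M_mat ::
  "real \<Rightarrow> real \<Rightarrow> real \<Rightarrow> real \<Rightarrow> real \<Rightarrow> real \<Rightarrow> real \<Rightarrow> real \<Rightarrow> real \<Rightarrow> real \<Rightarrow> real Matrix.mat" where
  "M_mat n L mu \<eta> vphi c \<tau> \<nu> \<alpha> \<beta> =
    (let m1 = n * mu * \<eta> / 2;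
         m2 = 3 * L\<^sup>2 * vphi\<^sup>2 / mu;
         m3 = 6 / (n * mu * \<eta>);
         m4 = 4 * n * L\<^sup>2 * vphi\<^sup>2 * (1 + c\<^sup>2) / (1 - c\<^sup>2);
         m5 = 2 * (1 + c\<^sup>2) / (1 - c\<^sup>2);
         m7 = 6 * n * L\<^sup>2 * vphi\<^sup>2;
         m8 = 12 * vphi\<^sup>2;
         m9 = 2 * n * L\<^sup>2 * vphi\<^sup>2 * \<nu>;
         m10 = 4 * vphi\<^sup>2 * \<nu>;
         m11 = \<nu>
     in mat_of_rows_list 4
       [ [1 - m1 * \<alpha>, m2 * \<alpha>,                      m3 * \<beta>\<^sup>2 / \<alpha>, m3 * \<alpha>],
         [m4 * \<alpha>\<^sup>2,    (1 + c\<^sup>2) / 2 + m4 * \<alpha>\<^sup>2, m5 * \<beta>\<^sup>2,     m5 * \<alpha>\<^sup>2],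
         [m7 * \<alpha>\<^sup>2,    m8 + m7 * \<alpha>\<^sup>2,            3 * \<beta>\<^sup>2,      3 * \<alpha>\<^sup>2],
         [m9 * \<alpha>\<^sup>2,    m10 + m9 * \<alpha>\<^sup>2,           m11 * \<beta>\<^sup>2,    (1 + \<tau>\<^sup>2) / 2 + m11 * \<alpha>\<^sup>2] ])"

definition b_vec ::
  "real \<Rightarrow> real \<Rightarrow> real \<Rightarrow> real \<Rightarrow> real \<Rightarrow> real \<Rightarrow> real \<Rightarrow> real Matrix.vec" where
  "b_vec n L \<sigma> c \<psi> \<nu> \<alpha> =
    (let b1 = 3 * n * \<sigma>\<^sup>2 / 2;
         b2 = 4 * n * (1 + c\<^sup>2) * \<sigma>\<^sup>2 / (1 - c\<^sup>2);
         b3 = 6 * n * \<sigma>\<^sup>2;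
         b4 = 4 * n * \<psi> * \<sigma>\<^sup>2;
         b5 = 2 * L * n * \<psi> * \<sigma>\<^sup>2;
         b6 = 2 * n * \<nu> * \<sigma>\<^sup>2
     in vec_of_list [b1 * \<alpha>\<^sup>2, b2 * \<alpha>\<^sup>2, b3 * \<alpha>\<^sup>2, b4 + b5 * \<alpha> + b6 * \<alpha>\<^sup>2])"

end

(* With different step sizes the average of the iterates is not driven by a multiple of the gradient
   sum, so the mean-square inequality V(k+1) <= M V(k) + b is not proved row by row: its first row may
   fail. Instead, V(k) is shown to lie below (I - M)^(-1) b from some k on, which gives the limit
   superior, and also the geometric rate, since the spectral radius of M is positive and the finitely
   many earlier V(k) can be absorbed into the constant.

   The gradient tracker is linear, so the accumulated noise can be split off; its second moment is
   controlled by an energy estimate for column-stochastic matrices. What remains is a system of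
   inequalities between L2-norms in which every source term except the momentum carries the effective
   step size of the average. The graph-dependent contraction factors and the step-size conditions make
   it a small-gain system, hence the errors are eventually dominated by multiples of the noise level.
   The levels obtained in this way are compared with (I - M)^(-1) b, which satisfies the equations
   v = M v + b and is therefore bounded below row by row. *)

theory Submission
  imports Defs
begin

section \<open>Shortest path coverings\<close>

text \<open>Levels of the order of the noise suffice because the entry
  \<open>4 * n * \<psi> * \<sigma>\<^sup>2\<close> of \<open>b_vec\<close> does not shrink with the
  step size. Row 3 makes the tracking component of (I - M)^(-1) b large, row 0 turns this into a
  lower bound for the optimality component in which the step size cancels, and row 1 passes it on to
  consensus. The obstacle lies in the average: it contracts at a rate proportional to its effective
  step \<open>\<theta> k\<close>, so its sources must carry that factor too. For the noise, this is
  why the bound for agent i is proportional to \<open>\<pi> k $ i\<close>; the momentum has no such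
  factor, and the Lyapunov combination \<open>W\<close> is built to absorb it. L2 norms replace mean
  squares because the triangle inequality then costs no Young constants. Room for the numerical
  constants comes from the graph estimates: consensus contracts at no less than twice the rate 1 -
  c^2, and the tracker's rate keeps the extreme weights of the current step, so that it dominates a
  fixed multiple of \<open>chi k\<close>.\<close>

lemma (in fin_digraph) shortest_path_exists:
  assumes "u \<rightarrow>\<^sup>*\<^bsub>G\<^esub> v"
  obtains p where "shortest_path G u p v"
proof -
  obtain p where "apath u p v" using assms reachable_apath by blast
  then obtain q where "apath u q v" "\<And>q'. apath u q' v \<Longrightarrow> length q \<le> length q'"
    using ex_has_least_nat[of "\<lambda>q. apath u q v" p length] by blast
  then show ?thesis using that unfolding shortest_path_def by blast
qed

text \<open>\<open>Sup\<close> on \<open>nat\<close> is an upper bound only of bounded sets; here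
  the number of nodes bounds the length of every simple path.\<close>

lemma (in fin_digraph) length_le_graph_diameter:
  assumes "shortest_path G u p v" "u \<in> verts G" "v \<in> verts G" "u \<noteq> v"
  shows "length p \<le> graph_diameter G"
proof -
  let ?S = "{length p | p u v. u \<in> verts G \<and> v \<in> verts G \<and> u \<noteq> v \<and> shortest_path G u p v}"
  have "?S \<subseteq> {..card (verts G)}"
    using length_apath unfolding shortest_path_def by force
  then have "bdd_above ?S" by (meson bdd_above.I2 bdd_above_mono bdd_above_Iic)
  moreover have "length p \<in> ?S" using assms by blast
  ultimately show ?thesis unfolding graph_diameter_def by (rule cSup_upper[rotated])
qed

lemma (in fin_digraph) edge_utility_le_max:
  assumes "shortest_path_covering G P" "e \<in> arcs G"
  shows "edge_utility G P e \<le> max_edge_utility G"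
proof -
  let ?S = "{edge_utility G P e | P e. shortest_path_covering G P \<and> e \<in> arcs G}"
  have "edge_utility G P e \<le> card (verts G \<times> verts G)" for P e
    unfolding edge_utility_def by (rule card_mono) auto
  then have "?S \<subseteq> {..card (verts G \<times> verts G)}" by auto
  then have "bdd_above ?S" by (meson bdd_above_mono bdd_above_Iic)
  moreover have "edge_utility G P e \<in> ?S" using assms by blast
  ultimately show ?thesis unfolding max_edge_utility_def by (rule cSup_upper[rotated])
qed

lemma (in wf_digraph) awalk_telescoping:
  fixes z :: "'a \<Rightarrow> 'c::real_normed_vector"
  assumes "awalk u p v"
  shows "norm (z u - z v) \<le> (\<Sum>e\<leftarrow>p. norm (z (tail G e) - z (head G e)))"
  using assms
proof (induction p arbitrary: u)
  case Nil then show ?case by (simp add: awalk_Nil_iff)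
next
  case (Cons e p)
  then have "tail G e = u" "norm (z (head G e) - z v) \<le> (\<Sum>e\<leftarrow>p. norm (z (tail G e) - z (head G e)))"
    by (auto simp: awalk_Cons_iff)
  then show ?case
    using norm_triangle_ineq[of "z u - z (head G e)" "z (head G e) - z v"] by auto
qed

text \<open>Each step leaves the node that the previous step entered, so passages through inner
  nodes cancel and only the end points remain. Summed over all pairs, this will balance the paths
  entering and leaving a node.\<close>

lemma (in wf_digraph) awalk_flow_conservation:
  assumes "awalk u p v"
  shows "(\<Sum>e\<leftarrow>p. of_bool (head G e = i)) + of_bool (u = i) =
         (\<Sum>e\<leftarrow>p. of_bool (tail G e = i)) + (of_bool (v = i) :: real)"
  using assms
proof (induction p arbitrary: u)
  case Nil then show ?case by (simp add: awalk_Nil_iff)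
next
  case (Cons e p)
  then have "tail G e = u" "awalk (head G e) p v" by (auto simp: awalk_Cons_iff)
  with Cons.IH[of "head G e"] show ?case by auto
qed

text \<open>The estimates use \<open>D\<close> and \<open>K\<close> as upper bounds for path lengths
  and utilities, so they are free parameters here. Distinctness of each path turns sums over lists
  into sums over sets, and \<open>Q u u\<close> is left unconstrained.\<close>

locale path_covering =
  fixes G :: "'n::finite pair_pre_digraph" and Q :: "'n \<Rightarrow> 'n \<Rightarrow> ('n \<times> 'n) list" and D K :: nat
  assumes walk: "u \<noteq> v \<Longrightarrow> pre_digraph.awalk (with_proj G) u (Q u v) v"
    and dist: "u \<noteq> v \<Longrightarrow> distinct (Q u v)"
    and noloop: "u \<noteq> v \<Longrightarrow> (i, i) \<notin> set (Q u v)"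
    and len: "u \<noteq> v \<Longrightarrow> length (Q u v) \<le> D"
    and util: "e \<in> parcs G \<Longrightarrow> card {(u, v). u \<noteq> v \<and> e \<in> set (Q u v)} \<le> K"
    and wf: "wf_digraph (with_proj G)"
    and nontriv: "CARD('n) \<ge> 2"

lemma strongly_connected_path_covering:
  fixes G :: "'n::finite pair_pre_digraph"
  assumes "pverts G = UNIV" "strongly_connected (with_proj G)" "CARD('n) \<ge> 2"
  obtains Q where "path_covering G Q (graph_diameter (with_proj G)) (max_edge_utility (with_proj G))"
proof -
  interpret G: fin_digraph "with_proj G"
    by unfold_locales (auto simp: assms)
  have "\<exists>p. shortest_path (with_proj G) u p v" for u v
    using assms G.shortest_path_exists[of u v] unfolding strongly_connected_def by (metis UNIV_I with_proj_simps(1))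
  then obtain Q where Q: "\<And>u v. shortest_path (with_proj G) u (Q u v) v" by metis
  then have ap: "\<And>u v. G.apath u (Q u v) v" by (auto simp: shortest_path_def)
  have cov: "shortest_path_covering (with_proj G) Q" using Q by (auto simp: shortest_path_covering_def)
  have "path_covering G Q (graph_diameter (with_proj G)) (max_edge_utility (with_proj G))"
  proof
    fix u v i :: 'n and e :: "'n \<times> 'n"
    show "G.awalk u (Q u v) v" using ap by (rule G.awalkI_apath)
    show "distinct (Q u v)" using ap G.distinct_verts_imp_distinct unfolding G.apath_def by blast
    show "(i, i) \<notin> set (Q u v)" using G.no_loops_in_apath[OF ap, of "(i,i)"] by auto
    show "length (Q u v) \<le> graph_diameter (with_proj G)" if "u \<noteq> v"
      by (rule G.length_le_graph_diameter[OF Q]) (use that assms in auto)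
    show "card {(u, v). u \<noteq> v \<and> e \<in> set (Q u v)} \<le> max_edge_utility (with_proj G)" if "e \<in> parcs G"
      using G.edge_utility_le_max[OF cov, of e] that assms(1) by (simp add: edge_utility_def)
    show "CARD('n) \<ge> 2" by fact
  qed (unfold_locales)
  then show ?thesis by (rule that)
qed

context path_covering begin

interpretation W: wf_digraph "with_proj G" by (rule wf)

definition util_of :: "'n \<times> 'n \<Rightarrow> real" where
  "util_of e = card {(u, v). u \<noteq> v \<and> e \<in> set (Q u v)}"

text \<open>Loops are left out because the diagonal entries of the mixing matrices are estimated
  separately.\<close>

definition E :: "('n \<times> 'n) set" where "E = {e \<in> parcs G. fst e \<noteq> snd e}"

lemma Q_in_E: "u \<noteq> v \<Longrightarrow> set (Q u v) \<subseteq> E"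
  using walk[of u v] noloop[of u v] by (fastforce simp: E_def W.awalk_def)

text \<open>Double counting: an edge contributes once for every path that passes through it.\<close>

lemma sum_paths:
  fixes f :: "'n \<times> 'n \<Rightarrow> real"
  shows "(\<Sum>(u, v)\<in>{(u, v). u \<noteq> v}. \<Sum>e\<in>set (Q u v). f e) = (\<Sum>e\<in>E. util_of e * f e)"
proof -
  let ?P = "{(u :: 'n, v :: 'n). u \<noteq> v}"
  have "(\<Sum>(u, v)\<in>?P. \<Sum>e\<in>set (Q u v). f e) = (\<Sum>p\<in>?P. \<Sum>e\<in>E. if e \<in> set (Q (fst p) (snd p)) then f e else 0)"
  proof (rule sum.cong[OF refl])
    fix p assume "p \<in> ?P"
    then have "set (Q (fst p) (snd p)) \<subseteq> E" using Q_in_E[of "fst p" "snd p"] by (simp add: case_prod_unfold)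
    then show "(case p of (u, v) \<Rightarrow> \<Sum>e\<in>set (Q u v). f e) = (\<Sum>e\<in>E. if e \<in> set (Q (fst p) (snd p)) then f e else 0)"
      by (simp add: case_prod_unfold sum.If_cases Int_absorb1)
  qed
  also have "\<dots> = (\<Sum>e\<in>E. \<Sum>p\<in>?P. if e \<in> set (Q (fst p) (snd p)) then f e else 0)" by (rule sum.swap)
  also have "\<dots> = (\<Sum>e\<in>E. util_of e * f e)"
  proof (rule sum.cong[OF refl])
    fix e
    have "?P \<inter> {p. e \<in> set (Q (fst p) (snd p))} = {(u, v). u \<noteq> v \<and> e \<in> set (Q u v)}" by auto
    then show "(\<Sum>p\<in>?P. if e \<in> set (Q (fst p) (snd p)) then f e else 0) = util_of e * f e"
      by (simp add: sum.If_cases util_of_def)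
  qed
  finally show ?thesis .
qed

lemma util_le: "e \<in> E \<Longrightarrow> util_of e \<le> K"
  using util by (auto simp: util_of_def E_def)

text \<open>Cauchy-Schwarz along the path from u to v gives the factor \<open>D\<close>, and double
  counting replaces paths by utilities. The majorant \<open>F\<close> is inserted before the
  weighting, so that the column-stochastic case can route an edge through a third vector and still
  exploit the utilities.\<close>

lemma sum_pairs_le:
  fixes z :: "'n \<Rightarrow> 'c::real_normed_vector"
  assumes "\<And>e. e \<in> E \<Longrightarrow> (norm (z (fst e) - z (snd e)))\<^sup>2 \<le> F e"
  shows "(\<Sum>u\<in>UNIV. \<Sum>v\<in>UNIV. (norm (z u - z v))\<^sup>2) \<le> D * (\<Sum>e\<in>E. util_of e * F e)"
proof -
  let ?P = "{(u :: 'n, v :: 'n). u \<noteq> v}"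
  have *: "(norm (z u - z v))\<^sup>2 \<le> D * (\<Sum>e\<in>set (Q u v). F e)" if "u \<noteq> v" for u v
  proof -
    have "norm (z u - z v) \<le> (\<Sum>e\<in>set (Q u v). norm (z (fst e) - z (snd e)))"
      using W.awalk_telescoping[OF walk[OF that], of z] dist[OF that] by (simp add: sum_list_distinct_conv_sum_set)
    then have "(norm (z u - z v))\<^sup>2 \<le> (\<Sum>e\<in>set (Q u v). norm (z (fst e) - z (snd e)))\<^sup>2" by (simp add: power_mono)
    also have "\<dots> \<le> real (card (set (Q u v))) * (\<Sum>e\<in>set (Q u v). (norm (z (fst e) - z (snd e)))\<^sup>2)"
      using sum_squared_le_sum_of_squares[of "\<lambda>e. norm (z (fst e) - z (snd e))" "set (Q u v)"] by (simp add: mult.commute)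
    also have "\<dots> \<le> D * (\<Sum>e\<in>set (Q u v). (norm (z (fst e) - z (snd e)))\<^sup>2)"
      using len[OF that] card_length[of "Q u v"] by (intro mult_right_mono sum_nonneg) auto
    also have "\<dots> \<le> D * (\<Sum>e\<in>set (Q u v). F e)"
      using Q_in_E[OF that] assms by (intro mult_left_mono sum_mono) auto
    finally show ?thesis .
  qed
  have "(\<Sum>u\<in>UNIV. \<Sum>v\<in>UNIV. (norm (z u - z v))\<^sup>2) = (\<Sum>p\<in>UNIV. (norm (z (fst p) - z (snd p)))\<^sup>2)"
    by (simp add: sum.cartesian_product case_prod_unfold)
  also have "\<dots> = (\<Sum>p\<in>?P. (norm (z (fst p) - z (snd p)))\<^sup>2)"
    by (rule sum.mono_neutral_right) auto
  also have "\<dots> \<le> (\<Sum>p\<in>?P. D * (\<Sum>e\<in>set (Q (fst p) (snd p)). F e))"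
    using * by (intro sum_mono) auto
  also have "\<dots> = D * (\<Sum>e\<in>E. util_of e * F e)"
    by (simp add: sum_distrib_left[symmetric] sum_paths[symmetric] case_prod_unfold)
  finally show ?thesis .
qed

text \<open>Flow conservation summed over all ordered pairs: swapping the pair shows that a node
  starts as many paths as it ends, so the end point terms cancel.\<close>

lemma util_head_eq_tail:
  "(\<Sum>e\<in>{e\<in>E. snd e = i}. util_of e) = (\<Sum>e\<in>{e\<in>E. fst e = i}. util_of e)"
proof -
  let ?P = "{(u :: 'n, v :: 'n). u \<noteq> v}"
  have fl: "(\<Sum>e\<in>set (Q u v). of_bool (snd e = i)) + of_bool (u = i) =
         (\<Sum>e\<in>set (Q u v). of_bool (fst e = i)) + (of_bool (v = i) :: real)" if "u \<noteq> v" for u v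
    using W.awalk_flow_conservation[OF walk[OF that], of i] dist[OF that] by (simp add: sum_list_distinct_conv_sum_set)
  have "(\<Sum>p\<in>?P. (\<Sum>e\<in>set (Q (fst p) (snd p)). of_bool (snd e = i)) + of_bool (fst p = i)) =
        (\<Sum>p\<in>?P. (\<Sum>e\<in>set (Q (fst p) (snd p)). of_bool (fst e = i)) + (of_bool (snd p = i) :: real))"
    using fl by (intro sum.cong refl) (simp del: sum_of_bool_eq add: case_prod_unfold)
  moreover have "(\<Sum>p\<in>?P. of_bool (fst p = i)) = (\<Sum>p\<in>?P. of_bool (snd p = i) :: real)"
    by (rule sum.reindex_bij_witness[of _ prod.swap prod.swap]) auto
  ultimately have "(\<Sum>e\<in>E. util_of e * of_bool (snd e = i)) = (\<Sum>e\<in>E. util_of e * of_bool (fst e = i))"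
    using sum_paths[of "\<lambda>e. of_bool (snd e = i)"] sum_paths[of "\<lambda>e. of_bool (fst e = i)"]
    by (simp add: sum.distrib case_prod_unfold)
  moreover have "(\<Sum>e\<in>E. util_of e * of_bool (R e)) = (\<Sum>e\<in>{e\<in>E. R e}. util_of e)" for R
    by (simp add: of_bool_def if_distrib sum.If_cases Int_def cong: if_cong)
  ultimately show ?thesis by simp
qed

text \<open>Each of the n - 1 paths starting at i begins with an edge that leaves i.\<close>

lemma paths_from: "real CARD('n) - 1 \<le> (\<Sum>e\<in>{e\<in>E. fst e = i}. util_of e)"
proof -
  let ?P = "{(u :: 'n, v :: 'n). u \<noteq> v}"
  have "(\<Sum>p\<in>?P. of_bool (fst p = i)) \<le> (\<Sum>p\<in>?P. (\<Sum>e\<in>set (Q (fst p) (snd p)). (of_bool (fst e = i) :: real)))"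
  proof (rule sum_mono)
    fix p assume p: "p \<in> ?P"
    have "(of_bool (fst p = i) :: real) \<le> (\<Sum>e\<in>set (Q (fst p) (snd p)). of_bool (fst e = i)) " if "fst p = i"
    proof -
      obtain e es where Q: "Q (fst p) (snd p) = e # es"
        using walk[of "fst p" "snd p"] p by (cases "Q (fst p) (snd p)") (auto simp: W.awalk_Nil_iff)
      then have "fst e = i" using walk[of "fst p" "snd p"] p that by (auto simp: W.awalk_Cons_iff)
      then have "1 = (\<Sum>e\<in>{e}. (of_bool (fst e = i)::real))" by simp
      also have "\<dots> \<le> (\<Sum>e\<in>set (Q (fst p) (snd p)). of_bool (fst e = i))"
        by (rule sum_mono2) (auto simp: Q)
      finally have "1 \<le> (\<Sum>e\<in>set (Q (fst p) (snd p)). (of_bool (fst e = i) :: real))" .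
      moreover have "of_bool (fst p = i) = (1 :: real)" using that by simp
      ultimately show ?thesis by (rule ord_eq_le_trans[rotated])
    qed
    moreover have "0 \<le> (\<Sum>e\<in>set (Q (fst p) (snd p)). of_bool (fst e = i) :: real)"
      by (rule sum_nonneg) simp
    ultimately show "(of_bool (fst p = i) :: real) \<le> (\<Sum>e\<in>set (Q (fst p) (snd p)). of_bool (fst e = i))"
      by (cases "fst p = i") (simp_all only: of_bool_eq simp_thms)
  qed
  also have "\<dots> = (\<Sum>e\<in>E. util_of e * of_bool (fst e = i))"
    using sum_paths[of "\<lambda>e. of_bool (fst e = i)"] by (simp add: case_prod_unfold)
  also have "\<dots> = (\<Sum>e\<in>{e\<in>E. fst e = i}. util_of e)"
    by (simp add: of_bool_def if_distrib sum.If_cases Int_def cong: if_cong)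
  finally have "(\<Sum>p\<in>?P. of_bool (fst p = i)) \<le> (\<Sum>e\<in>{e\<in>E. fst e = i}. util_of e)" .
  moreover have "(\<Sum>p\<in>?P. (of_bool (fst p = i)::real)) = real (card {p \<in> ?P. fst p = i})"
    by (simp add: of_bool_def sum.If_cases Int_def)
  moreover have "{p \<in> ?P. fst p = i} = Pair i ` (UNIV - {i})" by auto
  then have "card {p \<in> ?P. fst p = i} = CARD('n) - 1" by (simp add: card_image inj_on_def card_Diff_singleton)
  ultimately show ?thesis using nontriv by (simp add: of_nat_diff)
qed

lemma util_from_le: "(\<Sum>e\<in>{e\<in>E. fst e = i}. util_of e) \<le> K * card {e\<in>E. fst e = i}"
  using sum_mono[of "{e\<in>E. fst e = i}" util_of "\<lambda>_. real K"] util_le by (simp add: mult.commute)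

lemma D_K_pos: "D \<ge> 1" "K \<ge> 1" "card {e\<in>E. fst e = i} \<ge> 1"
proof -
  have pos: "0 < K * real (card {e\<in>E. fst e = i})"
    using order_trans[OF paths_from util_from_le, of i] nontriv by simp
  then show "K \<ge> 1" "card {e\<in>E. fst e = i} \<ge> 1" by (auto simp: zero_less_mult_iff Suc_le_eq)
  obtain u v :: 'n where "u \<noteq> v" using nontriv by (metis One_nat_def card_1_singleton_iff card_2_iff' ex_card UNIV_I)
  moreover have "Q u v \<noteq> []" using walk[OF \<open>u \<noteq> v\<close>] \<open>u \<noteq> v\<close> by (auto simp: W.awalk_Nil_iff)
  ultimately show "D \<ge> 1" using len[of u v] by (cases "Q u v") auto
qed

end

section \<open>Weighted variances\<close>

text \<open>The parallel-axis identity for total mass \<open>r\<close>. The mean is specified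
  through \<open>r *\<^sub>R m\<close>, which avoids a division by the mass.\<close>

lemma weighted_sum_shift:
  fixes x :: "'n::finite \<Rightarrow> 'v::real_inner"
  assumes "(\<Sum>j\<in>UNIV. w j *\<^sub>R x j) = r *\<^sub>R m" "(\<Sum>j\<in>UNIV. w j) = r"
  shows "(\<Sum>j\<in>UNIV. w j * (norm (x j - u))\<^sup>2) =
         (\<Sum>j\<in>UNIV. w j * (norm (x j - m))\<^sup>2) + r * (norm (m - u))\<^sup>2"
proof -
  have *: "(norm (x j - u))\<^sup>2 = (norm (x j - m))\<^sup>2 + (norm (m - u))\<^sup>2 + 2 * inner (x j) (m - u) - 2 * inner m (m - u)" for j
    by (simp add: power2_norm_eq_inner algebra_simps inner_commute)
  have "(\<Sum>j\<in>UNIV. w j * (norm (x j - u))\<^sup>2) =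
    (\<Sum>j\<in>UNIV. w j * (norm (x j - m))\<^sup>2 + w j * (norm (m - u))\<^sup>2 + 2 * inner (w j *\<^sub>R x j) (m - u) - w j * (2 * inner m (m - u)))"
    unfolding * inner_scaleR_left by (intro sum.cong refl) (simp add: algebra_simps)
  also have "\<dots> = (\<Sum>j\<in>UNIV. w j * (norm (x j - m))\<^sup>2) + r * (norm (m - u))\<^sup>2
      + 2 * inner (\<Sum>j\<in>UNIV. w j *\<^sub>R x j) (m - u) - r * (2 * inner m (m - u))"
    unfolding sum_subtractf sum.distrib sum_distrib_left[symmetric] sum_distrib_right[symmetric] assms(2)
      inner_sum_left by simp
  finally show ?thesis by (simp add: assms(1))
qed

text \<open>The parallel-axis identity is applied with every \<open>x l\<close> as reference point
  and summed against \<open>w l\<close>; the shift term then reproduces the variance, hence the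
  factor 2.\<close>

lemma weighted_variance_pairs:
  fixes x :: "'n::finite \<Rightarrow> 'v::real_inner"
  assumes "(\<Sum>j\<in>UNIV. w j *\<^sub>R x j) = r *\<^sub>R m" "(\<Sum>j\<in>UNIV. w j) = r"
  shows "(\<Sum>j\<in>UNIV. \<Sum>l\<in>UNIV. w j * w l * (norm (x j - x l))\<^sup>2) =
         2 * r * (\<Sum>j\<in>UNIV. w j * (norm (x j - m))\<^sup>2)"
proof -
  define V where "V = (\<Sum>j\<in>UNIV. w j * (norm (x j - m))\<^sup>2)"
  have "(\<Sum>j\<in>UNIV. \<Sum>l\<in>UNIV. w j * w l * (norm (x j - x l))\<^sup>2) =
        (\<Sum>l\<in>UNIV. w l * (\<Sum>j\<in>UNIV. w j * (norm (x j - x l))\<^sup>2))"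
    by (subst sum.swap) (simp add: sum_distrib_left mult_ac)
  also have "\<dots> = (\<Sum>l\<in>UNIV. w l * (V + r * (norm (m - x l))\<^sup>2))"
    unfolding V_def by (intro sum.cong refl arg_cong2[where f = "(*)"] weighted_sum_shift[OF assms])
  also have "\<dots> = (\<Sum>l\<in>UNIV. w l) * V + r * (\<Sum>l\<in>UNIV. w l * (norm (m - x l))\<^sup>2)"
    by (simp add: distrib_left sum.distrib sum_distrib_right sum_distrib_left mult_ac)
  also have "(\<Sum>l\<in>UNIV. w l * (norm (m - x l))\<^sup>2) = V" by (simp add: V_def norm_minus_commute)
  finally show ?thesis by (simp add: assms(2) V_def)
qed

text \<open>The first bound is the pair formula with \<open>w j * w l \<le> M\<^sup>2\<close>; the
  second sums over l the fact that the mean minimises the weighted square deviation. Which one is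
  better depends on whether \<open>CARD('n) * M\<close> exceeds 2, and this is the origin of
  \<open>max 2 (CARD('n) * M)\<close> in the consensus rate.\<close>

lemma weighted_variance_le_pairs:
  fixes x :: "'n::finite \<Rightarrow> 'v::real_inner"
  assumes "\<And>j. 0 \<le> w j" "\<And>j. w j \<le> M" "(\<Sum>j\<in>UNIV. w j) = 1"
  defines "S \<equiv> (\<Sum>j\<in>UNIV. \<Sum>l\<in>UNIV. (norm (x j - x l))\<^sup>2)"
    and "V \<equiv> (\<Sum>j\<in>UNIV. w j * (norm (x j - (\<Sum>j\<in>UNIV. w j *\<^sub>R x j)))\<^sup>2)"
  shows "2 * V \<le> M\<^sup>2 * S" "real CARD('n) * V \<le> M * S"
proof -
  have M: "0 \<le> M" using assms(1,2) order_trans by blast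
  have "2 * V = (\<Sum>j\<in>UNIV. \<Sum>l\<in>UNIV. w j * w l * (norm (x j - x l))\<^sup>2)"
    using weighted_variance_pairs[of w x 1] assms(3) by (simp add: V_def)
  also have "\<dots> \<le> (\<Sum>j\<in>UNIV. \<Sum>l\<in>UNIV. M * M * (norm (x j - x l))\<^sup>2)"
    using assms(1,2) M by (intro sum_mono mult_right_mono mult_mono) auto
  finally show "2 * V \<le> M\<^sup>2 * S" by (simp add: S_def sum_distrib_left power2_eq_square)
  have "V \<le> (\<Sum>j\<in>UNIV. w j * (norm (x j - x l))\<^sup>2)" for l
    using weighted_sum_shift[of w x 1 "\<Sum>j\<in>UNIV. w j *\<^sub>R x j" "x l"] assms(3) by (simp add: V_def)
  also have "(\<Sum>j\<in>UNIV. w j * (norm (x j - x l))\<^sup>2) \<le> (\<Sum>j\<in>UNIV. M * (norm (x j - x l))\<^sup>2)" for l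
    using assms(2) by (intro sum_mono mult_right_mono) auto
  finally have "(\<Sum>l\<in>(UNIV::'n set). V) \<le> (\<Sum>l\<in>UNIV. \<Sum>j\<in>UNIV. M * (norm (x j - x l))\<^sup>2)"
    by (intro sum_mono)
  also have "\<dots> = M * S" unfolding S_def sum_distrib_left by (rule sum.swap)
  finally show "real CARD('n) * V \<le> M * S" by simp
qed

text \<open>The flow \<open>P i j\<close> moves mass from \<open>j\<close> to \<open>i\<close>; averaging along it destroys exactly the
  variance inside the rows.\<close>

lemma flow_variance_decrement:
  fixes x :: "'n::finite \<Rightarrow> 'v::real_inner"
  assumes "\<And>i. (\<Sum>j\<in>UNIV. P i j) = r i" "\<And>j. (\<Sum>i\<in>UNIV. P i j) = c j"
    and "\<And>i. (\<Sum>j\<in>UNIV. P i j *\<^sub>R x j) = r i *\<^sub>R m i"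
  shows "(\<Sum>i\<in>UNIV. r i * (norm (m i - u))\<^sup>2) =
    (\<Sum>j\<in>UNIV. c j * (norm (x j - u))\<^sup>2) - (\<Sum>i\<in>UNIV. \<Sum>j\<in>UNIV. P i j * (norm (x j - m i))\<^sup>2)"
proof -
  have "(\<Sum>j\<in>UNIV. c j * (norm (x j - u))\<^sup>2) = (\<Sum>j\<in>UNIV. \<Sum>i\<in>UNIV. P i j * (norm (x j - u))\<^sup>2)"
    by (simp add: assms(2)[symmetric] sum_distrib_right)
  also have "\<dots> = (\<Sum>i\<in>UNIV. \<Sum>j\<in>UNIV. P i j * (norm (x j - u))\<^sup>2)" by (rule sum.swap)
  also have "\<dots> = (\<Sum>i\<in>UNIV. (\<Sum>j\<in>UNIV. P i j * (norm (x j - m i))\<^sup>2) + r i * (norm (m i - u))\<^sup>2)"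
    by (intro sum.cong refl weighted_sum_shift[OF assms(3) assms(1)])
  finally show ?thesis by (simp add: sum.distrib)
qed

text \<open>In the pair formula for the variance only the pairs containing i are kept; each occurs
  in both orders, which cancels the factor 2.\<close>

lemma row_variance_ge_star:
  fixes x :: "'n::finite \<Rightarrow> 'v::real_inner"
  assumes "\<And>j. 0 \<le> w j" "(\<Sum>j\<in>UNIV. w j *\<^sub>R x j) = r *\<^sub>R m" "(\<Sum>j\<in>UNIV. w j) = r" "0 < r"
  shows "(\<Sum>j\<in>UNIV. w i * w j / r * (norm (x j - x i))\<^sup>2) \<le> (\<Sum>j\<in>UNIV. w j * (norm (x j - m))\<^sup>2)"
proof -
  let ?f = "\<lambda>j l. w j * w l * (norm (x j - x l))\<^sup>2"
  have nn: "0 \<le> ?f j l" for j l using assms(1) by simp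
  have "2 * (\<Sum>j\<in>UNIV. ?f j i) = (\<Sum>j\<in>UNIV. ?f j i) + (\<Sum>l\<in>UNIV. ?f i l)"
    by (simp add: mult_ac norm_minus_commute)
  also have "\<dots> = (\<Sum>j\<in>UNIV - {i}. ?f j i) + (\<Sum>l\<in>UNIV. ?f i l)"
    by (simp add: sum.remove[of UNIV i])
  also have "\<dots> \<le> (\<Sum>j\<in>UNIV - {i}. \<Sum>l\<in>UNIV. ?f j l) + (\<Sum>l\<in>UNIV. ?f i l)"
    using nn by (intro add_right_mono sum_mono member_le_sum) auto
  also have "\<dots> = (\<Sum>j\<in>UNIV. \<Sum>l\<in>UNIV. ?f j l)" by (simp add: sum.remove[of UNIV i])
  also have "\<dots> = 2 * r * (\<Sum>j\<in>UNIV. w j * (norm (x j - m))\<^sup>2)"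
    by (rule weighted_variance_pairs[OF assms(2,3)])
  finally have "(\<Sum>j\<in>UNIV. ?f j i) / r \<le> (\<Sum>j\<in>UNIV. w j * (norm (x j - m))\<^sup>2)"
    using \<open>0 < r\<close> by (simp add: field_simps)
  then show ?thesis by (simp add: sum_divide_distrib mult_ac)
qed

text \<open>The indicator of one node has positive variance because a second node carries positive
  weight; testing with it fixes the sign of \<open>1 - k\<close>.\<close>

lemma contraction_factor_le_1:
  fixes c :: "'n::finite \<Rightarrow> real"
  assumes "\<And>x :: 'n \<Rightarrow> real. 0 \<le> (1 - k) * (\<Sum>j\<in>UNIV. c j * (norm (x j - (\<Sum>j\<in>UNIV. c j *\<^sub>R x j)))\<^sup>2)"
    and "\<And>j. 0 < c j" "(\<Sum>j\<in>UNIV. c j) = 1" "CARD('n) \<ge> 2"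
  shows "k \<le> 1"
proof -
  obtain i l :: 'n where "i \<noteq> l" using assms(4) by (metis One_nat_def card_1_singleton_iff card_2_iff' ex_card UNIV_I)
  define x where "x j = (if j = i then 1 else 0 :: real)" for j
  have m: "(\<Sum>j\<in>UNIV. c j *\<^sub>R x j) = c i" by (simp add: x_def if_distrib cong: if_cong)
  have "0 < c l * (norm (x l - c i))\<^sup>2" using assms(2)[of l] assms(2)[of i] \<open>i \<noteq> l\<close> by (simp add: x_def)
  also have "\<dots> \<le> (\<Sum>j\<in>UNIV. c j * (norm (x j - c i))\<^sup>2)"
    using assms(2) by (intro member_le_sum) (auto simp: less_imp_le)
  finally show ?thesis using assms(1)[of x] unfolding m by (simp add: zero_le_mult_iff)
qed

section \<open>Variance contraction by row- and column-stochastic mixing\<close>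

context path_covering begin

lemma card_fst_snd_sum: "(\<Sum>e\<in>E. f e) = (\<Sum>i\<in>UNIV. \<Sum>e\<in>{e\<in>E. h e = (i::'n)}. f e)"
  for f :: "'n \<times> 'n \<Rightarrow> real"
  using sum.group[of E UNIV h f] by simp

lemma snd_fibre: "{e\<in>E. snd e = i} = (\<lambda>j. (j, i)) ` {j. (j, i) \<in> E}"
  by force

lemma sum_heads: "(\<Sum>e\<in>E. F (fst e) (snd e)) = (\<Sum>i\<in>UNIV. \<Sum>j\<in>{j. (j, i) \<in> E}. F j i)"
  for F :: "'n \<Rightarrow> 'n \<Rightarrow> real"
proof -
  have "(\<Sum>e\<in>{e\<in>E. snd e = i}. F (fst e) (snd e)) = (\<Sum>j\<in>{j. (j, i) \<in> E}. F j i)" for i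
    unfolding snd_fibre by (subst sum.reindex) (auto simp: inj_on_def)
  then show ?thesis using card_fst_snd_sum[of "\<lambda>e. F (fst e) (snd e)" snd] by simp
qed

text \<open>Averaging in row i destroys at least the variance of the star around i. Its edges weigh
  at least \<open>m * a\<^sup>2\<close>, since both \<open>A i i\<close> and \<open>A i j\<close>
  are at least \<open>a\<close>, and the path covering controls all pairs by such edges.\<close>

lemma row_stochastic_contraction:
  fixes x :: "'n \<Rightarrow> 'v::real_inner" and A :: "'n \<Rightarrow> 'n \<Rightarrow> real" and a m M :: real
  assumes A: "\<And>i j. 0 \<le> A i j" "\<And>i. (\<Sum>j\<in>UNIV. A i j) = 1"
    and Ae: "\<And>e. e \<in> E \<Longrightarrow> a \<le> A (snd e) (fst e)" "\<And>i. a \<le> A i i" "0 < a"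
    and q: "\<And>j. (\<Sum>i\<in>UNIV. q' i * A i j) = q j" "(\<Sum>j\<in>UNIV. q j) = 1" "\<And>j. 0 \<le> q j" "\<And>j. q j \<le> M"
    and q': "\<And>i. m \<le> q' i" "0 < m"
  shows "(\<Sum>i\<in>UNIV. q' i * (norm ((\<Sum>j\<in>UNIV. A i j *\<^sub>R x j) - (\<Sum>j\<in>UNIV. q j *\<^sub>R x j)))\<^sup>2)
    \<le> (1 - m * a\<^sup>2 / (M\<^sup>2 * D * K) * max 2 (CARD('n) * M)) *
       (\<Sum>j\<in>UNIV. q j * (norm (x j - (\<Sum>j\<in>UNIV. q j *\<^sub>R x j)))\<^sup>2)"
proof -
  define c where "c = (\<Sum>j\<in>UNIV. q j *\<^sub>R x j)"
  define V where "V = (\<Sum>j\<in>UNIV. q j * (norm (x j - c))\<^sup>2)"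
  define S where "S = (\<Sum>j\<in>UNIV. \<Sum>l\<in>UNIV. (norm (x j - x l))\<^sup>2)"
  have DK: "D \<ge> 1" "K \<ge> 1" by (rule D_K_pos)+
  have q0: "0 \<le> q' i" and a0: "0 \<le> a" and m0: "0 \<le> m" for i using q'(1)[of i] q'(2) \<open>0 < a\<close> by simp_all
  have M: "0 < M"
  proof -
    have "\<exists>j. q j \<noteq> 0" using q(2) by (metis sum.neutral zero_neq_one)
    then obtain j where "q j \<noteq> 0" ..
    then show ?thesis using q(3)[of j] q(4)[of j] by simp
  qed
  define m' where "m' i = (\<Sum>j\<in>UNIV. A i j *\<^sub>R x j)" for i
  have dec: "(\<Sum>i\<in>UNIV. q' i * (norm (m' i - c))\<^sup>2) =
    V - (\<Sum>i\<in>UNIV. \<Sum>j\<in>UNIV. q' i * A i j * (norm (x j - m' i))\<^sup>2)"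
    unfolding V_def
    by (rule flow_variance_decrement) (simp_all add: sum_distrib_left[symmetric] A(2) q(1) m'_def scaleR_sum_right)
  have "(\<Sum>e\<in>E. (norm (x (fst e) - x (snd e)))\<^sup>2) * (m * a\<^sup>2)
      = (\<Sum>i\<in>UNIV. \<Sum>j\<in>{j. (j, i) \<in> E}. m * (a * a) * (norm (x j - x i))\<^sup>2)"
    using sum_heads[of "\<lambda>j i. m * (a * a) * (norm (x j - x i))\<^sup>2"]
    by (simp add: sum_distrib_right sum_distrib_left power2_eq_square mult_ac)
  also have "\<dots> \<le> (\<Sum>i\<in>UNIV. \<Sum>j\<in>UNIV. q' i * A i j * (norm (x j - m' i))\<^sup>2)"
  proof (rule sum_mono)
    fix i
    have "(\<Sum>j\<in>{j. (j, i) \<in> E}. m * (a * a) * (norm (x j - x i))\<^sup>2) \<le>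
      (\<Sum>j\<in>{j. (j, i) \<in> E}. q' i * (A i i * A i j) * (norm (x j - x i))\<^sup>2)"
      using Ae(1)[of "(_, i)"] Ae(2)[of i] q'(1)[of i] q0[of i] a0 m0 A(1) by (intro sum_mono mult_right_mono mult_mono) auto
    also have "\<dots> \<le> (\<Sum>j\<in>UNIV. q' i * (A i i * A i j) * (norm (x j - x i))\<^sup>2)"
      using A(1) q0 by (intro sum_mono2 mult_nonneg_nonneg) auto
    also have "\<dots> = q' i * (\<Sum>j\<in>UNIV. A i i * A i j / 1 * (norm (x j - x i))\<^sup>2)"
      by (simp add: sum_distrib_left mult_ac)
    also have "\<dots> \<le> q' i * (\<Sum>j\<in>UNIV. A i j * (norm (x j - m' i))\<^sup>2)"
      using q0 by (intro mult_left_mono row_variance_ge_star) (auto simp: A m'_def)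
    finally show "(\<Sum>j\<in>{j. (j, i) \<in> E}. m * (a * a) * (norm (x j - x i))\<^sup>2)
      \<le> (\<Sum>j\<in>UNIV. q' i * A i j * (norm (x j - m' i))\<^sup>2)" by (simp add: sum_distrib_left mult_ac)
  qed
  finally have d: "(\<Sum>e\<in>E. (norm (x (fst e) - x (snd e)))\<^sup>2) * (m * a\<^sup>2) \<le> \<dots>" .
  have "S \<le> D * (\<Sum>e\<in>E. util_of e * (norm (x (fst e) - x (snd e)))\<^sup>2)"
    unfolding S_def by (rule sum_pairs_le) simp
  also have "\<dots> \<le> D * (\<Sum>e\<in>E. K * (norm (x (fst e) - x (snd e)))\<^sup>2)"
    using util_le by (intro mult_left_mono sum_mono mult_right_mono) auto
  finally have "S \<le> D * K * (\<Sum>e\<in>E. (norm (x (fst e) - x (snd e)))\<^sup>2)"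
    by (simp add: sum_distrib_left[symmetric] mult_ac)
  then have "S * (m * a\<^sup>2) \<le> D * K * (\<Sum>e\<in>E. (norm (x (fst e) - x (snd e)))\<^sup>2) * (m * a\<^sup>2)"
    using q'(2) by (intro mult_right_mono) auto
  then have S: "S * (m * a\<^sup>2) \<le> D * K * ((\<Sum>e\<in>E. (norm (x (fst e) - x (snd e)))\<^sup>2) * (m * a\<^sup>2))"
    by (simp only: mult.assoc)
  also have "\<dots> \<le> D * K * (\<Sum>i\<in>UNIV. \<Sum>j\<in>UNIV. q' i * A i j * (norm (x j - m' i))\<^sup>2)"
    using d by (intro mult_left_mono) simp_all
  finally have S': "S * (m * a\<^sup>2) / (D * K) \<le> (\<Sum>i\<in>UNIV. \<Sum>j\<in>UNIV. q' i * A i j * (norm (x j - m' i))\<^sup>2)"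
    using DK by (simp add: field_simps)
  have "2 * V \<le> M\<^sup>2 * S" "real CARD('n) * V \<le> M * S"
    using weighted_variance_le_pairs[of q M x] q(2-4) by (auto simp: V_def c_def S_def)
  then have "max 2 (CARD('n) * M) * V \<le> M\<^sup>2 * S"
    using M mult_left_mono[of "real CARD('n) * V" "M * S" M] by (simp add: max_def power2_eq_square mult_ac)
  then have "max 2 (CARD('n) * M) * V * (m * a\<^sup>2 / (M\<^sup>2 * D * K)) \<le> M\<^sup>2 * S * (m * a\<^sup>2 / (M\<^sup>2 * D * K))"
    using q'(2) by (intro mult_right_mono) auto
  also have "\<dots> = S * (m * a\<^sup>2) / (D * K)" using M DK by (simp add: field_simps)
  finally show ?thesis using S' dec unfolding m'_def c_def V_def
    by (simp add: algebra_simps)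
qed

text \<open>Column i of \<open>B\<close> sums to 1 and has an entry of at least \<open>b\<close> for
  i itself and for each out-neighbour.\<close>

lemma out_degree_bound:
  fixes B :: "'n \<Rightarrow> 'n \<Rightarrow> real"
  assumes "\<And>i j. 0 \<le> B i j" "\<And>j. (\<Sum>i\<in>UNIV. B i j) = 1" "0 < b"
    and "\<And>e. e \<in> E \<Longrightarrow> b \<le> B (snd e) (fst e)" "\<And>i. b \<le> B i i"
  shows "b * (1 + card {e\<in>E. fst e = i}) \<le> 1"
proof -
  have eq: "{e\<in>E. fst e = i} = Pair i ` {l. (i, l) \<in> E}" by auto
  have ni: "i \<notin> {l. (i, l) \<in> E}" by (auto simp: E_def)
  have "b * (1 + card {e\<in>E. fst e = i}) = (\<Sum>l\<in>insert i {l. (i, l) \<in> E}. b)"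
    using ni unfolding eq by (simp add: card_image inj_on_def algebra_simps)
  also have "\<dots> \<le> (\<Sum>l\<in>insert i {l. (i, l) \<in> E}. B l i)"
    using assms(4,5) by (intro sum_mono) force
  also have "\<dots> \<le> (\<Sum>l\<in>UNIV. B l i)" using assms(1) by (intro sum_mono2) auto
  finally show ?thesis by (simp add: assms(2))
qed

text \<open>Every node has an outgoing edge, which gives the first bound. For the second, the n - 1
  paths leaving i share at most (1 - b) / b edges, each of utility at most \<open>K\<close>.\<close>

lemma min_weight_le_half:
  fixes B :: "'n \<Rightarrow> 'n \<Rightarrow> real"
  assumes "\<And>i j. 0 \<le> B i j" "\<And>j. (\<Sum>i\<in>UNIV. B i j) = 1" "0 < b"
    and "\<And>e. e \<in> E \<Longrightarrow> b \<le> B (snd e) (fst e)" "\<And>i. b \<le> B i i"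
  shows "b \<le> 1 / 2" "b * (CARD('n) - 1) \<le> (1 - b) * K"
proof -
  fix i :: 'n
  let ?d = "real (card {e\<in>E. fst e = i})"
  have 1: "b * (1 + ?d) \<le> 1" using out_degree_bound[OF assms] by simp
  have "1 \<le> ?d" using D_K_pos(3)[of i] by simp
  then have "b * 2 \<le> b * (1 + ?d)" using assms(3) by simp
  with 1 show "b \<le> 1 / 2" by simp
  have "b * (CARD('n) - 1) \<le> b * (K * ?d)"
    using order_trans[OF paths_from util_from_le, of i] nontriv assms(3) by (intro mult_left_mono) (auto simp: of_nat_diff)
  also have "\<dots> = (b * ?d) * K" by simp
  also have "\<dots> \<le> (1 - b) * K" using 1 by (intro mult_right_mono) (auto simp: algebra_simps)
  finally show "b * (CARD('n) - 1) \<le> (1 - b) * K" .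
qed

text \<open>Comparing both endpoints of an edge with the new value of its head loses only a factor
  \<open>1 / b\<close>: a node is entered by as many paths of the covering as it is left, and it has fewer than
  \<open>1 / b\<close> outgoing edges.\<close>

lemma column_stochastic_contraction:
  fixes z :: "'n \<Rightarrow> 'v::real_inner" and B :: "'n \<Rightarrow> 'n \<Rightarrow> real" and b m M :: real
  assumes B: "\<And>i j. 0 \<le> B i j" "\<And>j. (\<Sum>i\<in>UNIV. B i j) = 1" "0 < b"
    and Be: "\<And>e. e \<in> E \<Longrightarrow> b \<le> B (snd e) (fst e)" "\<And>i. b \<le> B i i"
    and p: "(\<Sum>j\<in>UNIV. p j) = 1" "\<And>j. m \<le> p j" "0 < m" "\<And>j. p j \<le> M"
    and p': "\<And>i. (\<Sum>j\<in>UNIV. B i j * p j) = p' i" "\<And>i. 0 < p' i"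
  shows "(\<Sum>i\<in>UNIV. p' i * (norm ((1 / p' i) *\<^sub>R (\<Sum>j\<in>UNIV. (B i j * p j) *\<^sub>R z j) - (\<Sum>j\<in>UNIV. p j *\<^sub>R z j)))\<^sup>2)
    \<le> (1 - CARD('n) * m * b\<^sup>2 / (2 * M * D * K)) *
       (\<Sum>j\<in>UNIV. p j * (norm (z j - (\<Sum>j\<in>UNIV. p j *\<^sub>R z j)))\<^sup>2)"
proof -
  define c where "c = (\<Sum>j\<in>UNIV. p j *\<^sub>R z j)"
  define V where "V = (\<Sum>j\<in>UNIV. p j * (norm (z j - c))\<^sup>2)"
  define S where "S = (\<Sum>j\<in>UNIV. \<Sum>l\<in>UNIV. (norm (z j - z l))\<^sup>2)"
  define m' where "m' i = (1 / p' i) *\<^sub>R (\<Sum>j\<in>UNIV. (B i j * p j) *\<^sub>R z j)" for i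
  define N where "N = (\<Sum>i\<in>UNIV. \<Sum>j\<in>UNIV. B i j * p j * (norm (z j - m' i))\<^sup>2)"
  have DK: "D \<ge> 1" "K \<ge> 1" by (rule D_K_pos)+
  have M: "0 < M" using p(2-4) by (meson less_le_trans)
  have p0: "0 \<le> p j" for j using p(2,3) by (meson less_imp_le order_trans)
  have b: "b \<le> 1 / 2" by (rule min_weight_le_half[OF B Be])
  have dec: "(\<Sum>i\<in>UNIV. p' i * (norm (m' i - c))\<^sup>2) = V - N"
    unfolding V_def N_def
    using p'(2) by (intro flow_variance_decrement)
      (simp_all add: p'(1) sum_distrib_right[symmetric] B(2) m'_def less_imp_neq[symmetric])
  have e1: "(\<Sum>e\<in>E. b * m * (norm (z (fst e) - m' (snd e)))\<^sup>2) + (\<Sum>i\<in>UNIV. b * m * (norm (z i - m' i))\<^sup>2) \<le> N"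
  proof -
    have "(\<Sum>j\<in>{j. (j, i) \<in> E}. b * m * (norm (z j - m' i))\<^sup>2) + b * m * (norm (z i - m' i))\<^sup>2
       \<le> (\<Sum>j\<in>UNIV. B i j * p j * (norm (z j - m' i))\<^sup>2)" for i
    proof -
      have "i \<notin> {j. (j, i) \<in> E}" by (simp add: E_def)
      then have "(\<Sum>j\<in>{j. (j, i) \<in> E}. b * m * (norm (z j - m' i))\<^sup>2) + b * m * (norm (z i - m' i))\<^sup>2
        = (\<Sum>j\<in>insert i {j. (j, i) \<in> E}. b * m * (norm (z j - m' i))\<^sup>2)" by simp
      also have "\<dots> \<le> (\<Sum>j\<in>insert i {j. (j, i) \<in> E}. B i j * p j * (norm (z j - m' i))\<^sup>2)"
        using Be(1)[of "(_, i)"] Be(2)[of i] p(2) B(1) \<open>0 < b\<close> \<open>0 < m\<close> by (intro sum_mono mult_right_mono mult_mono) auto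
      also have "\<dots> \<le> (\<Sum>j\<in>UNIV. B i j * p j * (norm (z j - m' i))\<^sup>2)"
        using B p0 by (intro sum_mono2 mult_nonneg_nonneg) auto
      finally show ?thesis .
    qed
    then show ?thesis
      unfolding N_def sum_heads[of "\<lambda>j i. b * m * (norm (z j - m' i))\<^sup>2"] sum.distrib[symmetric]
      by (rule sum_mono)
  qed
  have "S \<le> D * (\<Sum>e\<in>E. util_of e * (2 * (norm (z (fst e) - m' (snd e)))\<^sup>2 + 2 * (norm (z (snd e) - m' (snd e)))\<^sup>2))"
    unfolding S_def
  proof (rule sum_pairs_le)
    fix e
    have "z (fst e) - z (snd e) = (z (fst e) - m' (snd e)) - (z (snd e) - m' (snd e))" by simp
    then have "(norm (z (fst e) - z (snd e)))\<^sup>2 \<le> (norm (z (fst e) - m' (snd e)) + norm (z (snd e) - m' (snd e)))\<^sup>2"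
      by (metis norm_triangle_ineq4 norm_ge_zero power_mono)
    also have "\<dots> \<le> 2 * (norm (z (fst e) - m' (snd e)))\<^sup>2 + 2 * (norm (z (snd e) - m' (snd e)))\<^sup>2"
      using sum_squares_bound[of "norm (z (fst e) - m' (snd e))" "norm (z (snd e) - m' (snd e))"] by (simp add: power2_sum)
    finally show "(norm (z (fst e) - z (snd e)))\<^sup>2 \<le> \<dots>" .
  qed
  also have "\<dots> = 2 * D * (\<Sum>e\<in>E. util_of e * (norm (z (fst e) - m' (snd e)))\<^sup>2)
     + 2 * D * (\<Sum>e\<in>E. util_of e * (norm (z (snd e) - m' (snd e)))\<^sup>2)"
    by (simp add: distrib_left sum.distrib sum_distrib_left mult_ac)
  also have "(\<Sum>e\<in>E. util_of e * (norm (z (snd e) - m' (snd e)))\<^sup>2)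
     = (\<Sum>i\<in>UNIV. (\<Sum>e\<in>{e\<in>E. snd e = i}. util_of e) * (norm (z i - m' i))\<^sup>2)"
    by (subst card_fst_snd_sum[where h = snd]) (auto simp: sum_distrib_right intro!: sum.cong)
  also have "2 * D * (\<Sum>e\<in>E. util_of e * (norm (z (fst e) - m' (snd e)))\<^sup>2)
      + 2 * D * (\<Sum>i\<in>UNIV. (\<Sum>e\<in>{e\<in>E. snd e = i}. util_of e) * (norm (z i - m' i))\<^sup>2)
    \<le> 2 * D * (\<Sum>e\<in>E. K / b * (norm (z (fst e) - m' (snd e)))\<^sup>2)
      + 2 * D * (\<Sum>i\<in>UNIV. K / b * (norm (z i - m' i))\<^sup>2)"
  proof -
    \<comment> \<open>The utility bound \<open>K\<close> alone is smaller, but the common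
      coefficient \<open>K / b\<close> allows both sums to be compared with \<open>N\<close> at
      once.\<close>
    have "util_of e \<le> K / b" if "e \<in> E" for e
    proof -
      have "real K * b \<le> real K * 1" using b by (intro mult_left_mono) auto
      then have "real K \<le> K / b" using \<open>0 < b\<close> by (simp add: pos_le_divide_eq)
      then show ?thesis using util_le[OF that] by linarith
    qed
    moreover have "(\<Sum>e\<in>{e\<in>E. snd e = i}. util_of e) \<le> K / b" for i
    proof -
      have "b * card {e\<in>E. fst e = i} \<le> 1" using out_degree_bound[OF B Be, of i] \<open>0 < b\<close> by (simp add: algebra_simps)
      then have "real K * (b * card {e\<in>E. fst e = i}) \<le> real K * 1" by (intro mult_left_mono) auto
      then have "real (K * card {e\<in>E. fst e = i}) \<le> K / b" using \<open>0 < b\<close> by (simp add: field_simps)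
      then show ?thesis using util_from_le[of i] unfolding util_head_eq_tail by linarith
    qed
    ultimately show ?thesis by (intro add_mono mult_left_mono sum_mono mult_right_mono) auto
  qed
  also have "\<dots> = 2 * D * K / (b\<^sup>2 * m) *
     ((\<Sum>e\<in>E. b * m * (norm (z (fst e) - m' (snd e)))\<^sup>2) + (\<Sum>i\<in>UNIV. b * m * (norm (z i - m' i))\<^sup>2))"
    unfolding sum_distrib_left[symmetric] using \<open>0 < b\<close> \<open>0 < m\<close> by (simp add: field_simps power2_eq_square)
  also have "\<dots> \<le> 2 * D * K / (b\<^sup>2 * m) * N"
    using \<open>0 < m\<close> by (intro mult_left_mono e1) auto
  finally have S: "S \<le> 2 * D * K / (b\<^sup>2 * m) * N" .
  have "real CARD('n) * V \<le> M * S"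
    using weighted_variance_le_pairs(2)[of p M z] p p0 by (auto simp: V_def c_def S_def)
  also have "\<dots> \<le> M * (2 * D * K / (b\<^sup>2 * m) * N)" using M S by (intro mult_left_mono) auto
  finally have "CARD('n) * m * b\<^sup>2 / (2 * M * D * K) * V \<le> N"
    using DK M \<open>0 < b\<close> \<open>0 < m\<close> by (simp add: field_simps)
  then show ?thesis using dec unfolding m'_def c_def V_def by (simp add: algebra_simps)
qed

end

text \<open>Column j of \<open>B\<close> is a probability vector, and its diagonal entry alone
  contributes the term with \<open>b\<close> to the variance of \<open>v\<close> under it. The
  estimate is meant for test vectors evolving under the transpose of \<open>B\<close>, where this
  loss pays for the noise injected in a step.\<close>

lemma column_stochastic_energy:
  fixes B :: "'n::finite \<Rightarrow> 'n \<Rightarrow> real" and v :: "'n \<Rightarrow> real"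
  assumes B: "\<And>i j. 0 \<le> B i j" "\<And>j. (\<Sum>i\<in>UNIV. B i j) = 1" "\<And>i. b \<le> B i i"
    and p: "\<And>j. 0 \<le> p j" "\<And>i. (\<Sum>j\<in>UNIV. B i j * p j) = p' i"
  shows "(\<Sum>j\<in>UNIV. p j * ((\<Sum>i\<in>UNIV. v i * B i j)\<^sup>2 + b * ((\<Sum>i\<in>UNIV. v i * B i j) - v j)\<^sup>2))
    \<le> (\<Sum>i\<in>UNIV. p' i * (v i)\<^sup>2)"
proof -
  have col: "(\<Sum>i\<in>UNIV. v i * B i j)\<^sup>2 + b * ((\<Sum>i\<in>UNIV. v i * B i j) - v j)\<^sup>2 \<le> (\<Sum>i\<in>UNIV. B i j * (v i)\<^sup>2)" for j
  proof -
    let ?m = "\<Sum>i\<in>UNIV. v i * B i j"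
    have "(\<Sum>i\<in>UNIV. B i j * (norm (v i - 0))\<^sup>2) = (\<Sum>i\<in>UNIV. B i j * (norm (v i - ?m))\<^sup>2) + 1 * (norm (?m - 0))\<^sup>2"
      by (rule weighted_sum_shift) (simp_all add: B mult.commute)
    moreover have "b * (v j - ?m)\<^sup>2 \<le> B j j * (v j - ?m)\<^sup>2" using B(3) by (intro mult_right_mono) auto
    moreover have "B j j * (v j - ?m)\<^sup>2 \<le> (\<Sum>i\<in>UNIV. B i j * (v i - ?m)\<^sup>2)"
      using B(1) by (intro member_le_sum) auto
    ultimately show ?thesis by (simp add: power2_commute[of "v j" ?m])
  qed
  have "(\<Sum>j\<in>UNIV. p j * ((\<Sum>i\<in>UNIV. v i * B i j)\<^sup>2 + b * ((\<Sum>i\<in>UNIV. v i * B i j) - v j)\<^sup>2))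
    \<le> (\<Sum>j\<in>UNIV. p j * (\<Sum>i\<in>UNIV. B i j * (v i)\<^sup>2))"
    using col p(1) by (intro sum_mono mult_left_mono) auto
  also have "\<dots> = (\<Sum>i\<in>UNIV. p' i * (v i)\<^sup>2)"
    unfolding p(2)[symmetric] sum_distrib_left sum_distrib_right by (subst sum.swap) (simp add: mult_ac)
  finally show ?thesis .
qed

section \<open>Square integrable random variables\<close>

definition sq_integrable :: "'s measure \<Rightarrow> ('s \<Rightarrow> 'v::euclidean_space) \<Rightarrow> bool" where
  "sq_integrable M f \<longleftrightarrow> f \<in> borel_measurable M \<and> integrable M (\<lambda>s. (norm (f s))\<^sup>2)"

definition l2 :: "'s measure \<Rightarrow> ('s \<Rightarrow> real) \<Rightarrow> real" where
  "l2 M f = sqrt (\<integral>s. (f s)\<^sup>2 \<partial>M)"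

lemma sq_integrable_measurable[measurable_dest]: "sq_integrable M f \<Longrightarrow> f \<in> borel_measurable M"
  by (simp add: sq_integrable_def)

lemma sq_integrable_bound:
  assumes "sq_integrable M g" "f \<in> borel_measurable M" "\<And>s. s \<in> space M \<Longrightarrow> norm (f s) \<le> norm (g s)"
  shows "sq_integrable M f"
  unfolding sq_integrable_def
proof
  show "integrable M (\<lambda>s. (norm (f s))\<^sup>2)"
    by (rule Bochner_Integration.integrable_bound[of M "\<lambda>s. (norm (g s))\<^sup>2"])
      (use assms in \<open>auto simp: sq_integrable_def intro!: AE_I2 power_mono\<close>)
qed fact

lemma sq_integrable_norm: "sq_integrable M f \<Longrightarrow> sq_integrable M (\<lambda>s. norm (f s))"
  by (auto simp: sq_integrable_def)

lemma sq_integrable_scaleR: "sq_integrable M f \<Longrightarrow> sq_integrable M (\<lambda>s. c *\<^sub>R f s)"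
  by (auto simp: sq_integrable_def power_mult_distrib)

lemma sq_integrable_cmult: "sq_integrable M f \<Longrightarrow> sq_integrable M (\<lambda>s. c * f s)" for f :: "'s \<Rightarrow> real"
  by (auto simp: sq_integrable_def power_mult_distrib)

lemma sq_integrable_const: "finite_measure M \<Longrightarrow> sq_integrable M (\<lambda>s. c)"
  by (auto simp: sq_integrable_def finite_measure.integrable_const)

lemma sq_integrable_add:
  assumes "sq_integrable M f" "sq_integrable M g"
  shows "sq_integrable M (\<lambda>s. f s + g s)"
  unfolding sq_integrable_def
proof
  note [measurable] = assms
  show m[measurable]: "(\<lambda>s. f s + g s) \<in> borel_measurable M" by measurable
  have "(norm (f s + g s))\<^sup>2 \<le> 2 * (norm (f s))\<^sup>2 + 2 * (norm (g s))\<^sup>2" for s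
    using power_mono[OF norm_triangle_ineq[of "f s" "g s"], of 2] sum_squares_bound[of "norm (f s)" "norm (g s)"]
    by (simp add: power2_sum)
  then have ae: "AE s in M. norm ((norm (f s + g s))\<^sup>2) \<le> norm (2 * (norm (f s))\<^sup>2 + 2 * (norm (g s))\<^sup>2)"
    by (intro AE_I2) (simp only: real_norm_def abs_power2, metis abs_ge_self order_trans)
  have int: "integrable M (\<lambda>s. 2 * (norm (f s))\<^sup>2 + 2 * (norm (g s))\<^sup>2)"
    using assms by (simp add: sq_integrable_def)
  have "(\<lambda>s. (norm (f s + g s))\<^sup>2) \<in> borel_measurable M" by measurable
  then show "integrable M (\<lambda>s. (norm (f s + g s))\<^sup>2)"
    by (rule Bochner_Integration.integrable_bound[OF int _ ae])
qed

lemma sq_integrable_minus: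
  assumes "sq_integrable M f" "sq_integrable M g"
  shows "sq_integrable M (\<lambda>s. f s - g s)"
  using sq_integrable_add[OF assms(1) sq_integrable_scaleR[OF assms(2), of "-1"]] by simp

lemma sq_integrable_sum:
  assumes "finite_measure M" "\<And>i. i \<in> I \<Longrightarrow> sq_integrable M (f i)"
  shows "sq_integrable M (\<lambda>s. \<Sum>i\<in>I. f i s)"
  using assms(2)
proof (induction I rule: infinite_finite_induct)
  case (insert i I)
  then show ?case using sq_integrable_add[of M "f i" "\<lambda>s. \<Sum>i\<in>I. f i s"] by simp
qed (simp_all add: sq_integrable_const assms(1))

lemma l2_nonneg: "0 \<le> l2 M f"
  by (simp add: l2_def)

lemma l2_power2: "(l2 M f)\<^sup>2 = (\<integral>s. (f s)\<^sup>2 \<partial>M)"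
  by (simp add: l2_def)

lemma l2_le_iff: "0 \<le> c \<Longrightarrow> l2 M f \<le> c \<longleftrightarrow> (\<integral>s. (f s)\<^sup>2 \<partial>M) \<le> c\<^sup>2"
  unfolding l2_def by (metis real_sqrt_le_iff real_sqrt_pow2 real_sqrt_power abs_of_nonneg real_sqrt_abs)

lemma l2_mono:
  assumes "sq_integrable M f" "sq_integrable M g" "\<And>s. s \<in> space M \<Longrightarrow> \<bar>f s\<bar> \<le> g s"
  shows "l2 M f \<le> l2 M g"
  unfolding l2_def
  using assms by (intro real_sqrt_le_mono integral_mono) (auto simp: sq_integrable_def abs_le_square_iff[symmetric] intro: order_trans[OF _ abs_ge_self])

lemma l2_cmult: "0 \<le> c \<Longrightarrow> l2 M (\<lambda>s. c * f s) = c * l2 M f"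
  by (simp add: l2_def power_mult_distrib real_sqrt_mult)

lemma l2_triangle:
  assumes f: "sq_integrable M f" and g: "sq_integrable M g"
  shows "l2 M (\<lambda>s. f s + g s) \<le> l2 M f + l2 M g"
proof (rule field_le_epsilon)
  fix e :: real assume "0 < e"
  \<comment> \<open>The two norms, enlarged to be positive, serve as the weights in Young's
    inequality, which is sharp when the functions are in the ratio of their norms.\<close>
  define a where "a = l2 M f + e / 2"
  define b where "b = l2 M g + e / 2"
  have pos: "0 < a" "0 < b" using \<open>0 < e\<close> l2_nonneg[of M f] l2_nonneg[of M g] by (auto simp: a_def b_def)
  have pt: "(f s + g s)\<^sup>2 \<le> (1 + b / a) * (f s)\<^sup>2 + (1 + a / b) * (g s)\<^sup>2" for s
  proof -
    have "0 \<le> (b * f s - a * g s)\<^sup>2 / (a * b)" using pos by simp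
    also have "\<dots> = (b / a) * (f s)\<^sup>2 + (a / b) * (g s)\<^sup>2 - 2 * f s * g s"
      using pos by (simp add: power2_diff field_simps power2_eq_square)
    finally show ?thesis by (simp add: power2_sum algebra_simps)
  qed
  have int: "integrable M (\<lambda>s. (f s)\<^sup>2)" "integrable M (\<lambda>s. (g s)\<^sup>2)" "integrable M (\<lambda>s. (f s + g s)\<^sup>2)"
    using f g sq_integrable_add[OF f g] by (auto simp: sq_integrable_def)
  have "(\<integral>s. (f s + g s)\<^sup>2 \<partial>M) \<le> (\<integral>s. (1 + b / a) * (f s)\<^sup>2 + (1 + a / b) * (g s)\<^sup>2 \<partial>M)"
    using int pt by (intro integral_mono) auto
  also have "\<dots> = (1 + b / a) * (l2 M f)\<^sup>2 + (1 + a / b) * (l2 M g)\<^sup>2"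
    using int by (simp add: l2_power2)
  also have "\<dots> \<le> (1 + b / a) * a\<^sup>2 + (1 + a / b) * b\<^sup>2"
    using pos \<open>0 < e\<close> l2_nonneg[of M f] l2_nonneg[of M g]
    by (intro add_mono mult_left_mono power_mono) (auto simp: a_def b_def)
  also have "\<dots> = (a + b)\<^sup>2" using pos by (simp add: field_simps power2_eq_square)
  finally have "l2 M (\<lambda>s. f s + g s) \<le> a + b" using pos by (simp add: l2_le_iff)
  then show "l2 M (\<lambda>s. f s + g s) \<le> l2 M f + l2 M g + e" by (simp add: a_def b_def)
qed

lemma l2_triangle_sum:
  assumes "finite_measure M" "\<And>i. i \<in> I \<Longrightarrow> sq_integrable M (f i)"
  shows "l2 M (\<lambda>s. \<Sum>i\<in>I. f i s) \<le> (\<Sum>i\<in>I. l2 M (f i))"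
  using assms(2)
proof (induction I rule: infinite_finite_induct)
  case (insert i I)
  have "l2 M (\<lambda>s. f i s + (\<Sum>i\<in>I. f i s)) \<le> l2 M (f i) + l2 M (\<lambda>s. \<Sum>i\<in>I. f i s)"
    using insert.prems by (intro l2_triangle sq_integrable_sum assms(1)) auto
  then show ?case using insert by force
qed (simp_all add: l2_def)


section \<open>Sigma-algebras of past samples\<close>

text \<open>The sigma-algebra generated by the samples in \<open>J\<close>. Its sets are preimages
  of sets in the product space, which is the form in which independence of families is
  available.\<close>

definition history :: "'s measure \<Rightarrow> ('k \<Rightarrow> 'z measure) \<Rightarrow> ('k \<Rightarrow> 's \<Rightarrow> 'z) \<Rightarrow> 'k set \<Rightarrow> 's measure" where
  "history M N X J = vimage_algebra (space M) (\<lambda>s. restrict (\<lambda>j. X j s) J) (PiM J N)"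

lemma space_history[simp]: "space (history M N X J) = space M"
  by (simp add: history_def)

lemma measurable_restrict_family:
  assumes "\<And>j. j \<in> J \<Longrightarrow> X j \<in> measurable M (N j)"
  shows "(\<lambda>s. restrict (\<lambda>j. X j s) J) \<in> measurable M (PiM J N)"
  using assms by (rule measurable_restrict)

lemma measurable_history_component:
  assumes "\<And>j. X j \<in> measurable M (N j)" "j \<in> J"
  shows "X j \<in> measurable (history M N X J) (N j)"
proof -
  have "(\<lambda>s. restrict (\<lambda>j. X j s) J) \<in> space M \<rightarrow> space (PiM J N)"
    using measurable_space[OF measurable_restrict_family[of J X M N]] assms(1) by blast
  then have "(\<lambda>s. restrict (\<lambda>j. X j s) J) \<in> measurable (history M N X J) (PiM J N)"
    unfolding history_def by (rule measurable_vimage_algebra1)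
  from measurable_compose[OF this measurable_component_singleton[OF assms(2)]] show ?thesis
    using assms(2) by simp
qed

lemma measurable_history_mono:
  assumes X: "\<And>j. X j \<in> measurable M (N j)" and "J \<subseteq> J'" "f \<in> measurable (history M N X J) L"
  shows "f \<in> measurable (history M N X J') L"
proof -
  have "(\<lambda>s. s) \<in> measurable (history M N X J') (history M N X J)"
    unfolding history_def[of _ _ _ J]
    by (intro measurable_vimage_algebra2 measurable_restrict measurable_history_component X)
      (use assms(2) in auto)
  from measurable_compose[OF this assms(3)] show ?thesis .
qed

lemma measurable_history_imp:
  assumes X: "\<And>j. X j \<in> measurable M (N j)" and "f \<in> measurable (history M N X J) L"
  shows "f \<in> measurable M L"
proof -
  have "(\<lambda>s. s) \<in> measurable M (history M N X J)"
    unfolding history_def by (intro measurable_vimage_algebra2 measurable_restrict X) auto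
  from measurable_compose[OF this assms(2)] show ?thesis .
qed

text \<open>Independence of the past from a new sample, in the form in which Fubini can freeze the
  past: the joint law is a product. A product measure is determined by rectangles, and on these the
  claim is independence of two subfamilies.\<close>

lemma (in prob_space) distr_history_pair:
  assumes "indep_vars N X UNIV" "j \<notin> J"
  shows "distr M (history M N X J) (\<lambda>s. s) \<Otimes>\<^sub>M distr M (N j) (X j) =
    distr M (history M N X J \<Otimes>\<^sub>M N j) (\<lambda>s. (s, X j s))"
proof -
  let ?H = "history M N X J"
  have X[measurable]: "\<And>j. X j \<in> measurable M (N j)" using assms(1) by (auto simp: indep_vars_def)
  have id[measurable]: "(\<lambda>s. s) \<in> measurable M ?H"
    by (rule measurable_history_imp[where J = J and X = X and M = M and N = N, OF X]) simp
  interpret D1: prob_space "distr M ?H (\<lambda>s. s)" by (rule prob_space_distr) simp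
  interpret D2: prob_space "distr M (N j) (X j)" by (rule prob_space_distr) simp
  let ?Y = "\<lambda>\<omega>. restrict (\<lambda>i. X i \<omega>) J" and ?Z = "\<lambda>\<omega>. restrict (\<lambda>i. X i \<omega>) {j}"
  have ind: "indep_var (PiM J N) ?Y (PiM {j} N) ?Z"
    using assms by (intro indep_var_restrict) auto
  have Y: "?Y \<in> space M \<rightarrow> space (PiM J N)"
    using measurable_space[OF measurable_restrict_family[of J X M N]] X by blast
  show ?thesis
  proof (rule pair_measure_eqI)
    fix A B assume "A \<in> sets (distr M ?H (\<lambda>s. s))" and "B \<in> sets (distr M (N j) (X j))"
    then have A[measurable]: "A \<in> sets ?H" and B[measurable]: "B \<in> sets (N j)" by simp_all
    from A obtain A' where A': "A' \<in> sets (PiM J N)" "A = ?Y -` A' \<inter> space M"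
      unfolding history_def sets_vimage_algebra2[OF Y] by auto
    let ?B = "{f \<in> space (PiM {j} N). f j \<in> B}"
    have B': "?B \<in> sets (PiM {j} N)" by measurable
    have XB: "X j -` B \<inter> space M = ?Z -` ?B \<inter> space M"
      using measurable_space[OF X[of j]] by (auto simp: space_PiM PiE_def)
    have "prob ((\<lambda>x. (?Y x, ?Z x)) -` (A' \<times> ?B) \<inter> space M) = prob (?Y -` A' \<inter> space M) * prob (?Z -` ?B \<inter> space M)"
      by (rule indep_varD[OF ind A'(1) B'])
    moreover have "(\<lambda>x. (?Y x, ?Z x)) -` (A' \<times> ?B) \<inter> space M = (\<lambda>s. (s, X j s)) -` (A \<times> B) \<inter> space M"
      using XB A'(2) by auto
    ultimately have "prob ((\<lambda>s. (s, X j s)) -` (A \<times> B) \<inter> space M) = prob A * prob (X j -` B \<inter> space M)"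
      using XB A'(2) by simp
    moreover have "(\<lambda>s. s) -` A \<inter> space M = A"
      using A'(2) by auto
    ultimately show "emeasure (distr M ?H (\<lambda>s. s)) A * emeasure (distr M (N j) (X j)) B =
        emeasure (distr M (?H \<Otimes>\<^sub>M N j) (\<lambda>s. (s, X j s))) (A \<times> B)"
      by (simp add: emeasure_distr emeasure_eq_measure ennreal_mult[symmetric])
  qed (auto simp: D1.sigma_finite_measure_axioms D2.sigma_finite_measure_axioms cong: sets_pair_measure_cong)
qed

text \<open>With the past frozen, \<open>h\<close> has mean zero and the cross term vanishes in the
  inner integral. The computation runs in nonnegative integrals, so integrability of the result
  comes together with the bound.\<close>

lemma (in prob_space) centered_noise_bound:
  fixes U :: "'a \<Rightarrow> 'v::euclidean_space" and h :: "'x::euclidean_space \<Rightarrow> 'z \<Rightarrow> 'v"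
    and x :: "'a \<Rightarrow> 'x" and H :: "'a measure" and N :: "'z measure" and \<Xi> :: "'a \<Rightarrow> 'z" and v \<sigma> :: real
  assumes pair: "distr M H (\<lambda>s. s) \<Otimes>\<^sub>M distr M N \<Xi> = distr M (H \<Otimes>\<^sub>M N) (\<lambda>s. (s, \<Xi> s))"
    and id[measurable]: "(\<lambda>s. s) \<in> measurable M H" and X[measurable]: "\<Xi> \<in> measurable M N"
    and U[measurable]: "U \<in> borel_measurable H" and x[measurable]: "x \<in> borel_measurable H"
    and h[measurable]: "(\<lambda>(x, z). h x z) \<in> borel_measurable (borel \<Otimes>\<^sub>M N)"
    and Uint: "integrable M (\<lambda>s. (norm (U s))\<^sup>2)"
    and mean: "\<And>x. integrable M (\<lambda>s. h x (\<Xi> s))" "\<And>x. (\<integral>s. h x (\<Xi> s) \<partial>M) = 0"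
    and var: "\<And>x. integrable M (\<lambda>s. (norm (h x (\<Xi> s)))\<^sup>2)" "\<And>x. (\<integral>s. (norm (h x (\<Xi> s)))\<^sup>2 \<partial>M) \<le> \<sigma>\<^sup>2"
  shows "integrable M (\<lambda>s. (norm (U s + v *\<^sub>R h (x s) (\<Xi> s)))\<^sup>2)"
    and "(\<integral>s. (norm (U s + v *\<^sub>R h (x s) (\<Xi> s)))\<^sup>2 \<partial>M) \<le> (\<integral>s. (norm (U s))\<^sup>2 \<partial>M) + v\<^sup>2 * \<sigma>\<^sup>2"
proof -
  interpret DN: prob_space "distr M N \<Xi>" by (rule prob_space_distr) simp
  interpret DH: prob_space "distr M H (\<lambda>s. s)" by (rule prob_space_distr) simp
  let ?F = "\<lambda>(y, z). ennreal ((norm (U y + v *\<^sub>R h (x y) z))\<^sup>2)"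
  have hm[measurable]: "(\<lambda>p. h (x (fst p)) (snd p)) \<in> borel_measurable (H \<Otimes>\<^sub>M N)"
    using measurable_compose[OF _ h, of "\<lambda>p. (x (fst p), snd p)" "H \<Otimes>\<^sub>M N"] by simp
  have F[measurable]: "?F \<in> borel_measurable (H \<Otimes>\<^sub>M N)"
    unfolding case_prod_unfold by measurable
  have inner: "(\<integral>\<^sup>+z. ?F (y, z) \<partial>distr M N \<Xi>) \<le> ennreal ((norm (U y))\<^sup>2 + v\<^sup>2 * \<sigma>\<^sup>2)" if "y \<in> space H" for y
  proof -
    have hy[measurable]: "(\<lambda>z. h (x y) z) \<in> borel_measurable N"
      using measurable_compose[OF measurable_Pair1' h, of "x y"] by simp
    have exp: "(norm (U y + v *\<^sub>R h (x y) z))\<^sup>2 = (norm (U y))\<^sup>2 + (2 * v) * inner (U y) (h (x y) z) + v\<^sup>2 * (norm (h (x y) z))\<^sup>2" for z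
      unfolding power2_norm_eq_inner by (simp add: inner_add_left inner_add_right inner_commute power2_eq_square algebra_simps)
    have int: "integrable M (\<lambda>s. (norm (U y + v *\<^sub>R h (x y) (\<Xi> s)))\<^sup>2)"
      unfolding exp using mean(1) var(1) by (intro Bochner_Integration.integrable_add integrable_mult_right integrable_inner_right) auto
    have "(\<integral>\<^sup>+z. ?F (y, z) \<partial>distr M N \<Xi>) = (\<integral>\<^sup>+s. ennreal ((norm (U y + v *\<^sub>R h (x y) (\<Xi> s)))\<^sup>2) \<partial>M)"
      by (subst nn_integral_distr) auto
    also have "\<dots> = ennreal (\<integral>s. (norm (U y + v *\<^sub>R h (x y) (\<Xi> s)))\<^sup>2 \<partial>M)"
      by (rule nn_integral_eq_integral[OF int]) simp
    also have "(\<integral>s. (norm (U y + v *\<^sub>R h (x y) (\<Xi> s)))\<^sup>2 \<partial>M) =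
        (norm (U y))\<^sup>2 + v\<^sup>2 * (\<integral>s. (norm (h (x y) (\<Xi> s)))\<^sup>2 \<partial>M)"
      unfolding exp using mean(1) mean(2)[of "x y"] var(1)
      by (simp add: prob_space Bochner_Integration.integral_add integrable_inner_right integral_inner_right)
    finally show ?thesis using var(2)[of "x y"] by (simp add: ennreal_leI mult_left_mono)
  qed
  have "(\<integral>\<^sup>+s. ennreal ((norm (U s + v *\<^sub>R h (x s) (\<Xi> s)))\<^sup>2) \<partial>M) = (\<integral>\<^sup>+p. ?F p \<partial>distr M (H \<Otimes>\<^sub>M N) (\<lambda>s. (s, \<Xi> s)))"
    by (subst nn_integral_distr) auto
  also have "\<dots> = (\<integral>\<^sup>+y. \<integral>\<^sup>+z. ?F (y, z) \<partial>distr M N \<Xi> \<partial>distr M H (\<lambda>s. s))"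
    unfolding pair[symmetric] by (subst DN.nn_integral_fst[symmetric]) (auto simp: cong: measurable_cong_sets)
  also have "\<dots> \<le> (\<integral>\<^sup>+y. ennreal ((norm (U y))\<^sup>2 + v\<^sup>2 * \<sigma>\<^sup>2) \<partial>distr M H (\<lambda>s. s))"
    using inner by (intro nn_integral_mono) auto
  also have "\<dots> = (\<integral>\<^sup>+s. ennreal ((norm (U s))\<^sup>2 + v\<^sup>2 * \<sigma>\<^sup>2) \<partial>M)"
    by (subst nn_integral_distr) auto
  also have "\<dots> = ennreal (\<integral>s. (norm (U s))\<^sup>2 + v\<^sup>2 * \<sigma>\<^sup>2 \<partial>M)"
    using Uint by (intro nn_integral_eq_integral) auto
  also have "(\<integral>s. (norm (U s))\<^sup>2 + v\<^sup>2 * \<sigma>\<^sup>2 \<partial>M) = (\<integral>s. (norm (U s))\<^sup>2 \<partial>M) + v\<^sup>2 * \<sigma>\<^sup>2"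
    using Uint by (simp add: prob_space)
  finally have le: "(\<integral>\<^sup>+s. ennreal ((norm (U s + v *\<^sub>R h (x s) (\<Xi> s)))\<^sup>2) \<partial>M) \<le> ennreal ((\<integral>s. (norm (U s))\<^sup>2 \<partial>M) + v\<^sup>2 * \<sigma>\<^sup>2)" .
  have "(\<lambda>s. U s + v *\<^sub>R h (x s) (\<Xi> s)) \<in> borel_measurable M"
  proof -
    have "(\<lambda>s. (s, \<Xi> s)) \<in> measurable M (H \<Otimes>\<^sub>M N)" by measurable
    from measurable_compose[OF this hm] have [measurable]: "(\<lambda>s. h (x s) (\<Xi> s)) \<in> borel_measurable M" by simp
    have [measurable]: "U \<in> borel_measurable M" using measurable_compose[OF id U] .
    show ?thesis by measurable
  qed
  then have [measurable]: "(\<lambda>s. (norm (U s + v *\<^sub>R h (x s) (\<Xi> s)))\<^sup>2) \<in> borel_measurable M" by measurable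
  show *: "integrable M (\<lambda>s. (norm (U s + v *\<^sub>R h (x s) (\<Xi> s)))\<^sup>2)"
    by (rule integrableI_nonneg) (use le in \<open>auto intro: le_less_trans\<close>)
  show "(\<integral>s. (norm (U s + v *\<^sub>R h (x s) (\<Xi> s)))\<^sup>2 \<partial>M) \<le> (\<integral>s. (norm (U s))\<^sup>2 \<partial>M) + v\<^sup>2 * \<sigma>\<^sup>2"
    using le unfolding nn_integral_eq_integral[OF * AE_I2[OF zero_le_power2]]
    by (subst (asm) ennreal_le_iff) (auto intro!: add_nonneg_nonneg integral_nonneg)
qed

text \<open>The samples are added one at a time, each being new relative to a past enlarged by those
  already added. The points \<open>x i\<close> are known from \<open>J\<close>, hence from every
  enlargement.\<close>

lemma (in prob_space) centered_noise_sum_bound: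
  fixes U :: "'a \<Rightarrow> 'v::euclidean_space" and h :: "'i \<Rightarrow> 'x::euclidean_space \<Rightarrow> 'z \<Rightarrow> 'v"
    and X :: "'k \<Rightarrow> 'a \<Rightarrow> 'z" and \<iota> :: "'i \<Rightarrow> 'k" and x :: "'i \<Rightarrow> 'a \<Rightarrow> 'x"
    and v :: "'i \<Rightarrow> real" and \<sigma> :: real
  assumes ind: "indep_vars N X UNIV" and "inj \<iota>" "\<And>i. \<iota> i \<notin> J"
    and U: "U \<in> borel_measurable (history M N X J)" and x: "\<And>i. x i \<in> borel_measurable (history M N X J)"
    and h[measurable]: "\<And>i. (\<lambda>(x, z). h i x z) \<in> borel_measurable (borel \<Otimes>\<^sub>M N (\<iota> i))"
    and Uint: "integrable M (\<lambda>s. (norm (U s))\<^sup>2)"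
    and mean: "\<And>i x. integrable M (\<lambda>s. h i x (X (\<iota> i) s))" "\<And>i x. (\<integral>s. h i x (X (\<iota> i) s) \<partial>M) = 0"
    and var: "\<And>i x. integrable M (\<lambda>s. (norm (h i x (X (\<iota> i) s)))\<^sup>2)"
      "\<And>i x. (\<integral>s. (norm (h i x (X (\<iota> i) s)))\<^sup>2 \<partial>M) \<le> \<sigma>\<^sup>2"
    and "finite I"
  shows "integrable M (\<lambda>s. (norm (U s + (\<Sum>i\<in>I. v i *\<^sub>R h i (x i s) (X (\<iota> i) s))))\<^sup>2) \<and>
    (\<integral>s. (norm (U s + (\<Sum>i\<in>I. v i *\<^sub>R h i (x i s) (X (\<iota> i) s))))\<^sup>2 \<partial>M)
      \<le> (\<integral>s. (norm (U s))\<^sup>2 \<partial>M) + \<sigma>\<^sup>2 * (\<Sum>i\<in>I. (v i)\<^sup>2)"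
  using \<open>finite I\<close>
proof (induction I)
  case empty
  then show ?case using Uint by simp
next
  case (insert i I)
  have X: "\<And>j. X j \<in> measurable M (N j)" using ind by (auto simp: indep_vars_def)
  let ?J = "J \<union> \<iota> ` I"
  have id: "(\<lambda>s. s) \<in> measurable M (history M N X ?J)"
    by (rule measurable_history_imp[where J = ?J and X = X and M = M and N = N, OF X]) simp
  have ni: "\<iota> i \<notin> ?J" using assms(2,3) insert.hyps by (auto dest: injD)
  let ?U = "\<lambda>s. U s + (\<Sum>i\<in>I. v i *\<^sub>R h i (x i s) (X (\<iota> i) s))"
  have xm: "x j \<in> borel_measurable (history M N X ?J)" for j
    by (rule measurable_history_mono[of X M N, OF X _ x]) auto
  have Um: "?U \<in> borel_measurable (history M N X ?J)"
  proof (intro borel_measurable_add borel_measurable_sum borel_measurable_scaleR borel_measurable_const)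
    show "U \<in> borel_measurable (history M N X ?J)"
      by (rule measurable_history_mono[of X M N, OF X _ U]) auto
    fix j assume "j \<in> I"
    then have "X (\<iota> j) \<in> measurable (history M N X ?J) (N (\<iota> j))"
      by (intro measurable_history_component X) auto
    from measurable_compose[OF measurable_Pair[OF xm this] h]
    show "(\<lambda>s. h j (x j s) (X (\<iota> j) s)) \<in> borel_measurable (history M N X ?J)" by simp
  qed
  note step = centered_noise_bound[OF distr_history_pair[OF ind ni] id X[of "\<iota> i"] Um xm[of i] h[of i]
    conjunct1[OF insert.IH] mean(1)[of i] mean(2)[of i] var(1)[of i] var(2)[of i], where v = "v i"]
  show ?case
    using step insert.IH insert.hyps by (simp add: add_ac algebra_simps)
qed

section \<open>Nonnegative matrices with a strict supersolution\<close>

lemma mult_mat_vec_index: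
  assumes "A \<in> carrier_mat n n" "w \<in> carrier_vec n" "i < n"
  shows "vec_index (A *\<^sub>v w) i = (\<Sum>j<n. A $$ (i, j) * vec_index w j)"
  using assms by (auto simp: scalar_prod_def atLeast0LessThan intro!: sum.cong)

lemma max_ratio_index:
  fixes w v :: "nat \<Rightarrow> real"
  assumes "\<And>i. i < n \<Longrightarrow> 0 < v i" "n > 0"
  obtains i t where "i < n" "w i = t * v i" "\<And>j. j < n \<Longrightarrow> w j \<le> t * v j"
proof -
  let ?S = "(\<lambda>j. w j / v j) ` {..<n}"
  have fin: "finite ?S" "?S \<noteq> {}" using assms(2) by auto
  from Max_in[OF fin] obtain i where i: "i < n" "Max ?S = w i / v i" by auto
  have "w j \<le> Max ?S * v j" if "j < n" for j
  proof -
    have "w j / v j \<le> Max ?S" using that by (intro Max_ge fin(1)) auto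
    then show ?thesis using assms(1)[OF that] by (simp add: pos_divide_le_eq)
  qed
  then show ?thesis using that[of i "Max ?S"] i assms(1)[OF i(1)] by simp
qed

text \<open>A positive vector strictly decreased by the matrix is a certificate of Collatz-Wielandt
  type; it drives a discrete maximum principle from which the other facts follow.\<close>

locale nonneg_mat_supersolution =
  fixes A :: "real Matrix.mat" and n :: nat and v :: "nat \<Rightarrow> real"
  assumes carrier: "A \<in> carrier_mat n n" and n_pos: "n > 0"
    and nonneg: "\<And>i j. i < n \<Longrightarrow> j < n \<Longrightarrow> 0 \<le> A $$ (i, j)"
    and v_pos: "\<And>i. i < n \<Longrightarrow> 0 < v i"
    and super: "\<And>i. i < n \<Longrightarrow> (\<Sum>j<n. A $$ (i, j) * v j) < v i"
begin

text \<open>At an index k where w / v is maximal, a positive ratio t would give t v_k = w_k <= (A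
  w)_k <= t (A v)_k < t v_k.\<close>

lemma subsolution_nonpos:
  assumes "\<And>i. i < n \<Longrightarrow> w i \<le> (\<Sum>j<n. A $$ (i, j) * w j)" "i < n"
  shows "w i \<le> 0"
proof -
  from max_ratio_index[of n v w] v_pos n_pos obtain k t where
    k: "k < n" "w k = t * v k" "\<And>j. j < n \<Longrightarrow> w j \<le> t * v j" by blast
  have "t \<le> 0"
  proof (rule ccontr)
    assume "\<not> t \<le> 0"
    have "t * v k \<le> (\<Sum>j<n. A $$ (k, j) * (t * v j))"
      using assms(1)[OF k(1)] k by (smt (verit) sum_mono mult_left_mono nonneg lessThan_iff)
    also have "\<dots> = t * (\<Sum>j<n. A $$ (k, j) * v j)" by (simp add: sum_distrib_left mult_ac)
    also have "\<dots> < t * v k" using super[OF k(1)] \<open>\<not> t \<le> 0\<close> by simp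
    finally show False by simp
  qed
  then show ?thesis using k(3)[OF assms(2)] v_pos[OF assms(2)] by (smt (verit) mult_nonpos_nonneg)
qed

lemma one_minus_vec:
  assumes "w \<in> carrier_vec n" "i < n"
  shows "vec_index ((1\<^sub>m n - A) *\<^sub>v w) i = vec_index w i - (\<Sum>j<n. A $$ (i, j) * vec_index w j)"
proof -
  have "(1\<^sub>m n - A) *\<^sub>v w = w - A *\<^sub>v w"
    using carrier assms by (simp add: minus_mult_distrib_mat_vec[of _ n n])
  then show ?thesis using assms carrier mult_mat_vec_index[OF carrier assms] by simp
qed

text \<open>A kernel vector of I - A and its negative are both subsolutions, hence zero, which gives
  invertibility. The negative of the solution is a subsolution too, hence nonpositive.\<close>

lemma inverse_solution:
  assumes b: "b \<in> carrier_vec n" "\<And>i. i < n \<Longrightarrow> 0 \<le> vec_index b i"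
  defines "r \<equiv> the (mat_inverse (1\<^sub>m n - A)) *\<^sub>v b"
  assumes "i < n"
  shows "vec_index r i = (\<Sum>j<n. A $$ (i, j) * vec_index r j) + vec_index b i" "0 \<le> vec_index r i"
proof -
  have C: "1\<^sub>m n - A \<in> carrier_mat n n" by (rule minus_carrier_mat[OF carrier])
  have "det (1\<^sub>m n - A) \<noteq> 0"
  proof
    assume "det (1\<^sub>m n - A) = 0"
    then obtain w where w: "w \<in> carrier_vec n" "w \<noteq> 0\<^sub>v n" "(1\<^sub>m n - A) *\<^sub>v w = 0\<^sub>v n"
      using det_0_iff_vec_prod_zero_field[OF C] by blast
    have eq: "vec_index w i = (\<Sum>j<n. A $$ (i, j) * vec_index w j)" if "i < n" for i
      using one_minus_vec[OF w(1) that] w(3) that by simp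
    have "vec_index w i = 0" if "i < n" for i
    proof (rule antisym)
      show "vec_index w i \<le> 0" by (rule subsolution_nonpos[OF eq_refl[OF eq] that])
      have "- vec_index w k = (\<Sum>j<n. A $$ (k, j) * (- vec_index w j))" if "k < n" for k
        using eq[OF that] by (simp only: mult_minus_right sum_negf)
      then have "- vec_index w i \<le> 0" by (rule subsolution_nonpos[OF eq_refl that])
      then show "0 \<le> vec_index w i" by simp
    qed
    then have "w = 0\<^sub>v n" using w(1) by (intro eq_vecI) auto
    with w(2) show False by contradiction
  qed
  then have "1\<^sub>m n - A \<in> Units (ring_mat TYPE(real) n ())" by (rule det_non_zero_imp_unit[OF C])
  then obtain B where B: "mat_inverse (1\<^sub>m n - A) = Some B" using mat_inverse(1)[OF C] by fastforce
  then have inv: "(1\<^sub>m n - A) * B = 1\<^sub>m n" and Bc: "B \<in> carrier_mat n n" using mat_inverse(2)[OF C B] by auto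
  have r: "r = B *\<^sub>v b" by (simp add: r_def B)
  have rc: "r \<in> carrier_vec n" using Bc b by (simp add: r)
  have "(1\<^sub>m n - A) *\<^sub>v r = b" unfolding r using assoc_mult_mat_vec[OF C Bc b(1)] inv b(1) by simp
  then have eq: "vec_index r i = (\<Sum>j<n. A $$ (i, j) * vec_index r j) + vec_index b i" if "i < n" for i
    using one_minus_vec[OF rc that] by simp
  show "vec_index r i = (\<Sum>j<n. A $$ (i, j) * vec_index r j) + vec_index b i" by (rule eq) fact
  have "- vec_index r k \<le> (\<Sum>j<n. A $$ (k, j) * (- vec_index r j))" if "k < n" for k
    using eq[OF that] b(2)[OF that] by (simp only: mult_minus_right sum_negf)
  then have "- vec_index r i \<le> 0" by (rule subsolution_nonpos[OF _ \<open>i < n\<close>])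
  then show "0 \<le> vec_index r i" by simp
qed

text \<open>For an eigenvalue of modulus at least 1 the moduli of the eigenvector would form a
  subsolution and therefore vanish.\<close>

lemma spectral_radius_less_1: "spectral_radius (map_mat complex_of_real A) < 1"
proof -
  let ?A = "map_mat complex_of_real A"
  have Ac: "?A \<in> carrier_mat n n" using carrier by simp
  from spectral_radius_mem_max(1)[OF Ac n_pos] obtain z where z: "eigenvalue ?A z" "spectral_radius ?A = norm z"
    by (auto simp: spectrum_def)
  then obtain w where w: "w \<in> carrier_vec n" "w \<noteq> 0\<^sub>v n" "?A *\<^sub>v w = z \<cdot>\<^sub>v w"
    using carrier by (auto simp: eigenvalue_def eigenvector_def)
  have le: "norm z * norm (vec_index w i) \<le> (\<Sum>j<n. A $$ (i, j) * norm (vec_index w j))" if "i < n" for i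
  proof -
    have "z * vec_index w i = vec_index (?A *\<^sub>v w) i" using w that by simp
    also have "\<dots> = (\<Sum>j<n. complex_of_real (A $$ (i, j)) * vec_index w j)"
      using mult_mat_vec_index[OF Ac w(1) that] carrier that by simp
    finally have "norm z * norm (vec_index w i) = norm \<dots>" by (metis norm_mult)
    also have "\<dots> \<le> (\<Sum>j<n. A $$ (i, j) * norm (vec_index w j))"
      using nonneg that by (intro sum_norm_le) (auto simp: norm_mult)
    finally show ?thesis .
  qed
  show ?thesis
  proof (rule ccontr)
    assume "\<not> ?thesis"
    then have "1 \<le> norm z" using z by simp
    have "norm (vec_index w i) \<le> 0" if "i < n" for i
    proof (rule subsolution_nonpos[OF _ that])
      fix k assume "k < n"
      have "norm (vec_index w k) \<le> norm z * norm (vec_index w k)"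
        using \<open>1 \<le> norm z\<close> mult_right_mono[of 1 "norm z" "norm (vec_index w k)"] by simp
      also note le[OF \<open>k < n\<close>]
      finally show "norm (vec_index w k) \<le> (\<Sum>j<n. A $$ (k, j) * norm (vec_index w j))" .
    qed
    then have "w = 0\<^sub>v n" using w(1) by (intro eq_vecI) auto
    with w(2) show False by contradiction
  qed
qed

end

text \<open>Staying at i all the time is one of the closed walks counted, with nonnegative weights,
  by the diagonal entry of the power.\<close>

lemma nonneg_mat_power_diag:
  fixes A :: "real Matrix.mat"
  assumes A: "A \<in> carrier_mat n n" "\<And>i j. i < n \<Longrightarrow> j < n \<Longrightarrow> 0 \<le> A $$ (i, j)" and "i < n"
  shows "(A $$ (i, i)) ^ k \<le> (A ^\<^sub>m k) $$ (i, i)"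
proof -
  have pc: "A ^\<^sub>m k \<in> carrier_mat n n" for k using A(1) by simp
  have mult: "(A ^\<^sub>m Suc k) $$ (i, j) = (\<Sum>l<n. (A ^\<^sub>m k) $$ (i, l) * A $$ (l, j))" if "i < n" "j < n" for i j k
    using A(1) pc[of k] that by (auto simp: scalar_prod_def atLeast0LessThan intro!: sum.cong)
  have nn: "\<And>i j. i < n \<Longrightarrow> j < n \<Longrightarrow> 0 \<le> (A ^\<^sub>m k) $$ (i, j)" for k
  proof (induction k)
    case 0 then show ?case using A(1) by simp
  next
    case (Suc k) then show ?case unfolding mult[OF Suc.prems] using A(2) by (intro sum_nonneg) auto
  qed
  show ?thesis
  proof (induction k)
    case 0 then show ?case using A(1) \<open>i < n\<close> by simp
  next
    case (Suc k)
    have "A $$ (i, i) ^ Suc k \<le> (A ^\<^sub>m k) $$ (i, i) * A $$ (i, i)"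
      using Suc A(2) \<open>i < n\<close> by (simp add: mult.commute mult_left_mono)
    also have "\<dots> \<le> (\<Sum>l<n. (A ^\<^sub>m k) $$ (i, l) * A $$ (l, i))"
      using nn A(2) \<open>i < n\<close> by (intro member_le_sum[where f = "\<lambda>l. (A ^\<^sub>m k) $$ (i, l) * A $$ (l, i)"]) auto
    finally show ?case using mult[OF \<open>i < n\<close> \<open>i < n\<close>] by simp
  qed
qed

text \<open>If all eigenvalues vanished, the powers of every multiple of the matrix would be bounded.\<close>

lemma spectral_radius_pos:
  fixes A :: "real Matrix.mat"
  assumes A: "A \<in> carrier_mat n n" "\<And>i j. i < n \<Longrightarrow> j < n \<Longrightarrow> 0 \<le> A $$ (i, j)"
    and i: "i < n" "0 < A $$ (i, i)"
  shows "0 < spectral_radius (map_mat complex_of_real A)"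
proof (rule ccontr)
  assume contr: "\<not> ?thesis"
  let ?C = "map_mat complex_of_real"
  \<comment> \<open>The scaled matrix has diagonal entry 2 at i, so the corresponding entries of its
    powers grow at least like 2^k.\<close>
  define t where "t = 2 / A $$ (i, i)"
  have t: "0 < t" using i by (simp add: t_def)
  define B where "B = t \<cdot>\<^sub>m A"
  have Bc: "B \<in> carrier_mat n n" using A(1) by (simp add: B_def)
  have CB: "?C B \<in> carrier_mat n n" and CA: "?C A \<in> carrier_mat n n" using Bc A(1) by simp_all
  have n: "n > 0" using i by simp
  have "spectral_radius (?C B) < 1"
  proof -
    from spectral_radius_mem_max(1)[OF CB n] obtain z where z: "eigenvalue (?C B) z" "spectral_radius (?C B) = norm z"
      by (auto simp: spectrum_def)
    then obtain w where w: "w \<in> carrier_vec n" "w \<noteq> 0\<^sub>v n" "?C B *\<^sub>v w = z \<cdot>\<^sub>v w"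
      using Bc by (auto simp: eigenvalue_def eigenvector_def)
    have "?C A *\<^sub>v w = (z / t) \<cdot>\<^sub>v w"
    proof (rule eq_vecI)
      fix j assume "j < dim_vec ((z / t) \<cdot>\<^sub>v w)"
      then have j: "j < n" using w(1) by simp
      have "vec_index (?C B *\<^sub>v w) j = (\<Sum>l<n. of_real (t * A $$ (j, l)) * vec_index w l)"
        using mult_mat_vec_index[OF CB w(1) j] A(1) j by (simp add: B_def)
      also have "\<dots> = t * (\<Sum>l<n. of_real (A $$ (j, l)) * vec_index w l)"
        by (simp add: sum_distrib_left mult_ac)
      also have "\<dots> = t * vec_index (?C A *\<^sub>v w) j"
        using mult_mat_vec_index[OF CA w(1) j] A(1) j by simp
      finally show "vec_index (?C A *\<^sub>v w) j = vec_index ((z / t) \<cdot>\<^sub>v w) j"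
        using w j t by (simp add: field_simps)
    qed (use A(1) w(1) in simp)
    then have "eigenvalue (?C A) (z / t)"
      using w A(1) unfolding eigenvalue_def eigenvector_def by auto
    then have "norm (z / t) \<le> spectral_radius (?C A)"
      by (intro spectral_radius_mem_max(2)[OF CA n]) (auto simp: spectrum_def)
    then have "norm (z / t) \<le> 0" using contr by linarith
    then show ?thesis using z t by simp
  qed
  from spectral_radius_jnf_norm_bound_less_1_upper_triangular[OF CB this]
  obtain c where c: "norm_bound (?C B ^\<^sub>m k) c" for k by blast
  have "2 ^ k \<le> c" for k
  proof -
    have "2 ^ k = (B $$ (i, i)) ^ k" using i A(1) by (simp add: B_def t_def)
    also have "\<dots> \<le> (B ^\<^sub>m k) $$ (i, i)"
      using A t i by (intro nonneg_mat_power_diag[OF Bc]) (auto simp: B_def)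
    also have "\<dots> \<le> norm ((?C B ^\<^sub>m k) $$ (i, i))"
    proof -
      have "?C B ^\<^sub>m k = ?C (B ^\<^sub>m k)" by (simp add: of_real_hom.mat_hom_pow[OF Bc])
      moreover have "?C (B ^\<^sub>m k) $$ (i, i) = of_real ((B ^\<^sub>m k) $$ (i, i))"
        using pow_carrier_mat[OF Bc, of k] i by (intro index_map_mat) auto
      ultimately show ?thesis by simp
    qed
    also have "\<dots> \<le> c" using c[of k] carrier_matD[OF pow_carrier_mat[OF CB, of k]] i unfolding norm_bound_def by metis
    finally show ?thesis .
  qed
  moreover obtain k :: nat where "c < 2 ^ k" using real_arch_pow[of 2 c] by auto
  ultimately show False by (meson not_le)
qed

section \<open>The comparison matrix\<close>

lemma sum_lessThan_4: "(\<Sum>j<4. f j) = f 0 + f 1 + f 2 + f (3 :: nat)" for f :: "nat \<Rightarrow> real"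
  by (simp add: numeral_eq_Suc)

lemma less_4_iff: "i < (4 :: nat) \<longleftrightarrow> i = 0 \<or> i = 1 \<or> i = 2 \<or> i = 3"
  by auto

text \<open>\<open>vs2\<close> is the square of varsigma; \<open>budget\<close> and
  \<open>momentum\<close> are the two upper bounds on the momentum parameter after squaring.\<close>

locale comparison_system =
  fixes n L mu \<eta> \<phi> c \<tau> \<nu> \<alpha> \<beta> vs2 :: real
  assumes n: "1 \<le> n" and L: "0 < L" and mu: "0 < mu" and \<eta>: "0 < \<eta>" and \<phi>: "1 < \<phi>"
    and c: "0 < c" "c < 1" and \<tau>: "0 < \<tau>" "\<tau> < 1" and \<nu>: "0 < \<nu>" and \<alpha>: "0 < \<alpha>" and \<beta>: "0 \<le> \<beta>"
    and step: "\<alpha> < 2 / (n * \<eta> * (L + mu))"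
    and vs2: "vs2 = L\<^sup>2 * (n * \<eta> * mu\<^sup>2 + 12 * L\<^sup>2 * \<phi>\<^sup>2) / (\<eta> * mu\<^sup>2)
      + 8 * \<nu> * (n * \<eta>\<^sup>2 * mu\<^sup>2 + 48 * L\<^sup>2 * \<phi>\<^sup>2) / (n * \<eta>\<^sup>2 * mu\<^sup>2 * (1 - \<tau>\<^sup>2))"
    and budget: "vs2 * \<alpha>\<^sup>2 + 12 * \<beta>\<^sup>2 < (1 - c\<^sup>2)\<^sup>2 / (8 * (1 + c\<^sup>2) * \<phi>\<^sup>2)"
    and momentum: "\<beta>\<^sup>2 < \<alpha>\<^sup>2 * ((n * \<eta> * L\<^sup>2 * (1 - \<tau>\<^sup>2) + 32 * \<nu>) / (48 * (1 - \<tau>\<^sup>2)))"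
begin

abbreviation "M \<equiv> M_mat n L mu \<eta> \<phi> c \<tau> \<nu> \<alpha> \<beta>"

lemma c2: "0 < 1 - c\<^sup>2" "0 < 1 - \<tau>\<^sup>2" "c\<^sup>2 < 1" "\<tau>\<^sup>2 < 1"
  using c \<tau> by (simp_all add: power_less_one_iff)

lemma M_carrier: "M \<in> carrier_mat 4 4"
  by (rule carrier_matI) (simp_all add: M_mat_def Let_def mat_of_rows_list_def)

text \<open>The value for which row 0 becomes an equality when \<open>\<beta>\<^sup>2\<close> equals
  its upper bound in \<open>momentum\<close>.\<close>

definition v1 :: real where
  "v1 = 12 * L\<^sup>2 * \<phi>\<^sup>2 / (n * \<eta> * mu\<^sup>2) + 384 * \<phi>\<^sup>2 * \<nu> / (n\<^sup>2 * \<eta>\<^sup>2 * mu\<^sup>2 * (1 - \<tau>\<^sup>2))"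

text \<open>Normalised to 1 at the consensus component. The last two entries are twice what the
  consensus terms of rows 2 and 3 require by themselves, so these rows tolerate any bracket
  \<open>Q\<close> below \<open>4 * \<phi>\<^sup>2\<close>.\<close>

definition supervec :: "nat \<Rightarrow> real" where
  "supervec i = [v1, 1, 24 * \<phi>\<^sup>2, 16 * \<nu> * \<phi>\<^sup>2 / (1 - \<tau>\<^sup>2)] ! i"

lemma v1_pos: "0 < v1"
  using n L mu \<eta> \<phi> \<nu> c2 by (auto simp: v1_def intro!: add_pos_pos divide_pos_pos mult_pos_pos)

text \<open>Explains varsigma: up to the factor \<open>2 * \<phi>\<^sup>2\<close>, its square is the
  coefficient of \<open>\<alpha>\<^sup>2\<close> in \<open>Q\<close>.\<close>

lemma vs2_eq: "vs2 = n * L\<^sup>2 * (v1 + 1) + 8 * \<nu> / (1 - \<tau>\<^sup>2)"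
proof -
  have "n \<noteq> 0" "\<eta> \<noteq> 0" "mu \<noteq> 0" "1 - \<tau>\<^sup>2 \<noteq> 0" using n \<eta> mu c2 by auto
  then show ?thesis unfolding vs2 v1_def
    by (simp add: divide_simps) (simp add: algebra_simps power2_eq_square)
qed

lemma step_small: "n * mu * \<eta> / 2 * \<alpha> < 1"
proof -
  have "n * \<eta> * (L + mu) * \<alpha> < 2"
    using step n L mu \<eta> by (subst (asm) pos_less_divide_eq) (auto simp: mult_ac)
  moreover have "n * mu * \<eta> * \<alpha> \<le> n * \<eta> * (L + mu) * \<alpha>"
    using n L mu \<eta> \<alpha> by (simp add: algebra_simps)
  ultimately show ?thesis by simp
qed

lemma budget_2: "vs2 * \<alpha>\<^sup>2 + 12 * \<beta>\<^sup>2 < 2"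
proof -
  have "(1 - c\<^sup>2)\<^sup>2 / (8 * (1 + c\<^sup>2) * \<phi>\<^sup>2) \<le> 1 / 8"
  proof -
    have "(1 - c\<^sup>2)\<^sup>2 \<le> 1" using c2 by (simp add: power_le_one)
    moreover have "1 \<le> (1 + c\<^sup>2) * \<phi>\<^sup>2" using \<phi> mult_mono[of 1 "1 + c\<^sup>2" 1 "\<phi>\<^sup>2"] by simp
    moreover have "1 / 8 * (8 * (1 + c\<^sup>2) * \<phi>\<^sup>2) = (1 + c\<^sup>2) * \<phi>\<^sup>2"
      by simp
    ultimately have "(1 - c\<^sup>2)\<^sup>2 \<le> 1 / 8 * (8 * (1 + c\<^sup>2) * \<phi>\<^sup>2)" by linarith
    moreover have "0 < 8 * (1 + c\<^sup>2) * \<phi>\<^sup>2" using \<phi> by (intro mult_pos_pos) (auto simp: add_pos_nonneg)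
    ultimately show ?thesis by (simp only: pos_divide_le_eq)
  qed
  with budget show ?thesis by linarith
qed

text \<open>With \<open>\<beta>\<^sup>2\<close> replaced by its upper bound the three gains add up
  to exactly the loss, so the strictness is that of \<open>momentum\<close>.\<close>

lemma row1:
  "(1 - n * mu * \<eta> / 2 * \<alpha>) * v1 + 3 * L\<^sup>2 * \<phi>\<^sup>2 / mu * \<alpha> + 6 / (n * mu * \<eta>) * \<beta>\<^sup>2 / \<alpha> * (24 * \<phi>\<^sup>2)
   + 6 / (n * mu * \<eta>) * \<alpha> * (16 * \<nu> * \<phi>\<^sup>2 / (1 - \<tau>\<^sup>2)) < v1"
proof -
  have nz: "n \<noteq> 0" "\<eta> \<noteq> 0" "mu \<noteq> 0" "1 - \<tau>\<^sup>2 \<noteq> 0" "\<alpha> \<noteq> 0" using n \<eta> mu c2 \<alpha> by auto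
  have "6 / (n * mu * \<eta>) * \<beta>\<^sup>2 / \<alpha> * (24 * \<phi>\<^sup>2) = \<beta>\<^sup>2 * (144 * \<phi>\<^sup>2 / (n * mu * \<eta> * \<alpha>))"
    using nz by (simp add: field_simps)
  also have "\<dots> < \<alpha>\<^sup>2 * ((n * \<eta> * L\<^sup>2 * (1 - \<tau>\<^sup>2) + 32 * \<nu>) / (48 * (1 - \<tau>\<^sup>2))) * (144 * \<phi>\<^sup>2 / (n * mu * \<eta> * \<alpha>))"
    using momentum n mu \<eta> \<alpha> \<phi> by (intro mult_strict_right_mono divide_pos_pos mult_pos_pos) auto
  also have "\<dots> = n * mu * \<eta> / 2 * \<alpha> * v1 - 3 * L\<^sup>2 * \<phi>\<^sup>2 / mu * \<alpha> - 6 / (n * mu * \<eta>) * \<alpha> * (16 * \<nu> * \<phi>\<^sup>2 / (1 - \<tau>\<^sup>2))"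
    unfolding v1_def using nz by (simp add: divide_simps) (simp add: algebra_simps power2_eq_square)
  finally show ?thesis by (simp add: algebra_simps)
qed

text \<open>The bracket shared by rows 1, 2 and 3 of \<open>M\<close>, evaluated at
  \<open>supervec\<close>.\<close>

definition Q :: real where
  "Q = 2 * n * L\<^sup>2 * \<phi>\<^sup>2 * \<alpha>\<^sup>2 * (v1 + 1) + \<beta>\<^sup>2 * (24 * \<phi>\<^sup>2) + \<alpha>\<^sup>2 * (16 * \<nu> * \<phi>\<^sup>2 / (1 - \<tau>\<^sup>2))"

lemma Q_eq: "Q = 2 * \<phi>\<^sup>2 * (vs2 * \<alpha>\<^sup>2 + 12 * \<beta>\<^sup>2)"
  unfolding Q_def vs2_eq by (simp add: algebra_simps)

lemma Q_less_1: "Q < 4 * \<phi>\<^sup>2"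
  unfolding Q_eq using budget_2 \<phi> by simp

text \<open>The right-hand side is the slack of row 1, whose diagonal contains (1 + c^2) / 2;
  \<open>budget\<close> is this very inequality solved for the parameters.\<close>

lemma Q_less_2: "2 * (1 + c\<^sup>2) / (1 - c\<^sup>2) * Q < (1 - c\<^sup>2) / 2"
proof -
  have "2 * (1 + c\<^sup>2) / (1 - c\<^sup>2) * Q = 4 * \<phi>\<^sup>2 * (1 + c\<^sup>2) / (1 - c\<^sup>2) * (vs2 * \<alpha>\<^sup>2 + 12 * \<beta>\<^sup>2)"
    unfolding Q_eq by (simp only: times_divide_eq_left times_divide_eq_right) (simp add: mult_ac)
  also have "\<dots> < 4 * \<phi>\<^sup>2 * (1 + c\<^sup>2) / (1 - c\<^sup>2) * ((1 - c\<^sup>2)\<^sup>2 / (8 * (1 + c\<^sup>2) * \<phi>\<^sup>2))"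
    using budget \<phi> c2 by (intro mult_strict_left_mono divide_pos_pos mult_pos_pos) (auto simp: add_pos_nonneg)
  also have "\<dots> = (1 - c\<^sup>2) / 2"
  proof -
    have nz: "1 + c\<^sup>2 \<noteq> 0" "1 - c\<^sup>2 \<noteq> 0" "\<phi> \<noteq> 0"
      using c2 \<phi> by (simp_all, smt (verit) zero_le_power2)
    then show ?thesis by (simp add: divide_simps) (simp add: power2_eq_square)
  qed
  finally show ?thesis .
qed

lemmas M_simps = M_mat_def Let_def mat_of_rows_list_def less_4_iff

lemma M_row_sums:
  fixes r :: "nat \<Rightarrow> real"
  shows "(\<Sum>j<4. M $$ (0, j) * r j) = (1 - n * mu * \<eta> / 2 * \<alpha>) * r 0 + 3 * L\<^sup>2 * \<phi>\<^sup>2 / mu * \<alpha> * r 1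
      + 6 / (n * mu * \<eta>) * \<beta>\<^sup>2 / \<alpha> * r 2 + 6 / (n * mu * \<eta>) * \<alpha> * r 3"
    and "(\<Sum>j<4. M $$ (1, j) * r j) = (1 + c\<^sup>2) / 2 * r 1 + 2 * (1 + c\<^sup>2) / (1 - c\<^sup>2) *
      (2 * n * L\<^sup>2 * \<phi>\<^sup>2 * \<alpha>\<^sup>2 * (r 0 + r 1) + \<beta>\<^sup>2 * r 2 + \<alpha>\<^sup>2 * r 3)"
    and "(\<Sum>j<4. M $$ (2, j) * r j) = 12 * \<phi>\<^sup>2 * r 1 + 3 *
      (2 * n * L\<^sup>2 * \<phi>\<^sup>2 * \<alpha>\<^sup>2 * (r 0 + r 1) + \<beta>\<^sup>2 * r 2 + \<alpha>\<^sup>2 * r 3)"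
    and "(\<Sum>j<4. M $$ (3, j) * r j) = (1 + \<tau>\<^sup>2) / 2 * r 3 + 4 * \<phi>\<^sup>2 * \<nu> * r 1 + \<nu> *
      (2 * n * L\<^sup>2 * \<phi>\<^sup>2 * \<alpha>\<^sup>2 * (r 0 + r 1) + \<beta>\<^sup>2 * r 2 + \<alpha>\<^sup>2 * r 3)"
  by (simp_all add: sum_lessThan_4 M_simps algebra_simps add_divide_distrib diff_divide_distrib)

lemma M_nonneg: "i < 4 \<Longrightarrow> j < 4 \<Longrightarrow> 0 \<le> M $$ (i, j)"
  using step_small n L mu \<eta> \<phi> \<nu> \<alpha> \<beta> c2
  by (auto simp: M_simps intro!: add_nonneg_nonneg divide_nonneg_nonneg mult_nonneg_nonneg)

sublocale nonneg_mat_supersolution M 4 supervec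
proof
  show "M \<in> carrier_mat 4 4" by (rule M_carrier)
  show "0 < supervec i" if "i < 4" for i
    using that v1_pos \<phi> \<nu> c2 by (auto simp: less_4_iff supervec_def)
  have s: "supervec 0 = v1" "supervec 1 = 1" "supervec 2 = 24 * \<phi>\<^sup>2" "supervec 3 = 16 * \<nu> * \<phi>\<^sup>2 / (1 - \<tau>\<^sup>2)"
    by (simp_all add: supervec_def)
  have Q: "2 * n * L\<^sup>2 * \<phi>\<^sup>2 * \<alpha>\<^sup>2 * (supervec 0 + supervec 1) + \<beta>\<^sup>2 * supervec 2 + \<alpha>\<^sup>2 * supervec 3 = Q"
    unfolding s Q_def ..
  have "(\<Sum>j<4. M $$ (0, j) * supervec j) < supervec 0"
    unfolding M_row_sums s using row1 by simp
  moreover have "(\<Sum>j<4. M $$ (1, j) * supervec j) < supervec 1"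
    unfolding M_row_sums(2) Q unfolding s using Q_less_2 by (simp add: add_divide_distrib diff_divide_distrib)
  moreover have "(\<Sum>j<4. M $$ (2, j) * supervec j) < supervec 2"
    unfolding M_row_sums(3) Q unfolding s using Q_less_1 by simp
  moreover have "(\<Sum>j<4. M $$ (3, j) * supervec j) < supervec 3"
  proof -
    define Y where "Y = 16 * \<nu> * \<phi>\<^sup>2 / (1 - \<tau>\<^sup>2)"
    have "Y * (1 - \<tau>\<^sup>2) = 16 * \<nu> * \<phi>\<^sup>2" using c2 by (simp add: Y_def)
    then have "Y - Y * \<tau>\<^sup>2 = 16 * (\<nu> * \<phi>\<^sup>2)" by (simp add: right_diff_distrib)
    then have "(Y + Y * \<tau>\<^sup>2) / 2 + 8 * (\<nu> * \<phi>\<^sup>2) = (Y + Y * \<tau>\<^sup>2) / 2 + (Y - Y * \<tau>\<^sup>2) / 2" by simp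
    also have "\<dots> = Y" by (simp only: add_divide_distrib[symmetric]) simp
    finally have "Y = (Y + Y * \<tau>\<^sup>2) / 2 + 8 * (\<nu> * \<phi>\<^sup>2)" ..
    also have "(Y + Y * \<tau>\<^sup>2) / 2 = (1 + \<tau>\<^sup>2) / 2 * Y" by (simp add: algebra_simps)
    finally have "Y = (1 + \<tau>\<^sup>2) / 2 * Y + 8 * (\<nu> * \<phi>\<^sup>2)" .
    moreover have "\<nu> * Q < 4 * (\<nu> * \<phi>\<^sup>2)" using mult_strict_left_mono[OF Q_less_1 \<nu>] by simp
    moreover have "4 * \<phi>\<^sup>2 * \<nu> * 1 = 4 * (\<nu> * \<phi>\<^sup>2)" by simp
    ultimately show ?thesis unfolding M_row_sums(4) Q unfolding s Y_def[symmetric] by linarith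
  qed
  ultimately show "(\<Sum>j<4. M $$ (i, j) * supervec j) < supervec i" if "i < 4" for i
    using that by (auto simp: less_4_iff)
qed (use M_nonneg in auto)

text \<open>The consensus entry of the diagonal is at least (1 + c^2) / 2.\<close>

lemma M_spectral_radius_pos: "0 < spectral_radius (map_mat complex_of_real M)"
  by (rule spectral_radius_pos[OF M_carrier M_nonneg, of 1])
    (use n L \<phi> \<alpha> c2 c in \<open>auto simp: M_simps intro!: add_pos_nonneg\<close>)

end

section \<open>A small-gain argument for the mean square errors\<close>

text \<open>A box of size t shrinks by \<open>1 - r\<close> per step as long as t is at least 1, so
  the sizes \<open>max 1 ((1 - r) ^ j * t0)\<close> remain valid and reach 1 after finitely many
  steps. The restriction to t >= 1 lets constant sources be absorbed, since Z <= t Z.\<close>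

lemma eventually_le_of_scaling_step:
  fixes S :: "nat \<Rightarrow> 'i \<Rightarrow> real" and v :: "'i \<Rightarrow> real"
  assumes "finite I" and v: "\<And>i. i \<in> I \<Longrightarrow> 0 < v i" and r: "0 < r" "r < 1"
    and step: "\<And>k t. k \<ge> k0 \<Longrightarrow> 1 \<le> t \<Longrightarrow> (\<And>i. i \<in> I \<Longrightarrow> S k i \<le> t * v i) \<Longrightarrow>
      (\<And>i. i \<in> I \<Longrightarrow> S (Suc k) i \<le> (1 - r) * t * v i)"
  shows "\<exists>K\<ge>k0. \<forall>k\<ge>K. \<forall>i\<in>I. S k i \<le> v i"
proof -
  define t0 where "t0 = 1 + (\<Sum>i\<in>I. \<bar>S k0 i\<bar> / v i)"
  have nn: "0 \<le> \<bar>S k0 i\<bar> / v i" if "i \<in> I" for i using v[OF that] by simp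
  have t0: "1 \<le> t0" by (simp add: t0_def sum_nonneg nn)
  have S0: "S k0 i \<le> t0 * v i" if "i \<in> I" for i
  proof -
    have "\<bar>S k0 i\<bar> / v i \<le> t0"
      using member_le_sum[OF that, of "\<lambda>i. \<bar>S k0 i\<bar> / v i"] nn \<open>finite I\<close> by (simp add: t0_def)
    then show ?thesis using v[OF that] by (simp add: pos_divide_le_eq)
  qed
  have main: "S (k0 + j) i \<le> max 1 ((1 - r) ^ j * t0) * v i" if "i \<in> I" for i j
    using that
  proof (induction j arbitrary: i)
    case 0
    then show ?case using S0 t0 by (simp add: max_def)
  next
    case (Suc j)
    let ?t = "max 1 ((1 - r) ^ j * t0)"
    have "S (k0 + Suc j) i \<le> (1 - r) * ?t * v i"
      using step[of "k0 + j" ?t i] Suc by simp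
    also have "(1 - r) * ?t \<le> max 1 ((1 - r) ^ Suc j * t0)"
      using r by (cases "1 \<le> (1 - r) ^ j * t0") (simp_all add: mult.assoc le_max_iff_disj max_absorb1 max_absorb2)
    finally show ?case using v[OF Suc.prems] by (simp add: mult_right_mono)
  qed
  have "0 < 1 / t0" "1 - r < 1" using t0 r by auto
  from real_arch_pow_inv[OF this] obtain J where J: "(1 - r) ^ J < 1 / t0" ..
  have "S k i \<le> v i" if "k \<ge> k0 + J" "i \<in> I" for k i
  proof -
    define j where "j = k - k0"
    have j: "k = k0 + j" "J \<le> j" using that(1) by (auto simp: j_def)
    have "(1 - r) ^ j * t0 \<le> (1 - r) ^ J * t0"
      using j r t0 by (intro mult_right_mono power_decreasing) auto
    also have "\<dots> \<le> 1"
    proof -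
      have "0 < t0" using t0 by simp
      then show ?thesis using J by (simp add: pos_less_divide_eq)
    qed
    finally show ?thesis using main[OF that(2), of j] j by (simp add: max_absorb1)
  qed
  then show ?thesis by (intro exI[of _ "k0 + J"]) auto
qed

text \<open>\<open>C\<close> and \<open>H\<close> stand for \<open>1 - c\<^sup>2\<close> and \<open>1 - \<tau>\<^sup>2\<close>, \<open>s\<close> for the square root of \<open>n\<close>, and \<open>x\<close>
  bounds the local factors \<open>chi k\<close>. \<open>\<theta> k\<close> is the effective step of the average, which may be far
  smaller than \<open>\<alpha>\<close>; every source term except the momentum is proportional to it. The tracking
  error is recorded before (\<open>T\<close>) and after (\<open>P\<close>) the mixing step.\<close>

locale error_recursion =
  fixes s L mu \<eta> \<phi> C H G \<alpha> \<beta> x Z \<theta>min \<kappa>min :: real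
    and \<theta> chi \<kappa> X D U P T :: "nat \<Rightarrow> real"
  assumes s: "2 \<le> s\<^sup>2" "0 < s" and mu: "0 < mu" "mu \<le> L" and \<eta>: "0 < \<eta>"
    and \<phi>: "s \<le> \<phi>" and x: "s \<le> x" and C: "0 < C" and H: "0 < H" "H \<le> 1"
    and G: "2 * C \<le> G" "s\<^sup>2 * \<eta> * C \<le> G" "G \<le> 1"
    and \<alpha>: "0 < \<alpha>" "96 * \<alpha> * L\<^sup>2 * \<phi>\<^sup>2 * x \<le> C * H * s * \<eta> * mu"
    and \<beta>: "0 \<le> \<beta>" "64 * \<beta> * L * \<phi>\<^sup>2 \<le> C * s * \<eta> * mu"
    and Z: "0 < Z"
    and \<theta>: "\<And>k. k \<ge> 1 \<Longrightarrow> \<theta>min \<le> \<theta> k \<and> \<theta> k \<le> \<alpha>" "0 < \<theta>min"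
    and \<kappa>: "\<And>k. k \<ge> 1 \<Longrightarrow> \<kappa>min \<le> \<kappa> k \<and> \<kappa> k \<le> 1" "0 < \<kappa>min"
    and chi: "\<And>k. k \<ge> 1 \<Longrightarrow> 0 \<le> chi k" "\<And>k. k \<ge> 1 \<Longrightarrow> chi k \<le> x"
      "\<And>k. k \<ge> 1 \<Longrightarrow> chi k \<le> \<kappa> k * (2 / (H * s * \<eta>))" "\<And>k. k \<ge> 1 \<Longrightarrow> chi k * H \<le> s / 2"
    and nonneg: "\<And>k. 0 \<le> X k" "\<And>k. 0 \<le> D k" "\<And>k. 0 \<le> U k" "\<And>k. 0 \<le> P k" "\<And>k. 0 \<le> T k"
    and X_step: "\<And>k. k \<ge> 1 \<Longrightarrow> X (Suc k) \<le> (1 - 99 / 100 * mu * s\<^sup>2 * \<theta> k) * X k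
      + \<theta> k * (L * s * \<phi> * D k + chi k * T k + Z) + \<beta> * U k"
    and D_step: "\<And>k. k \<ge> 1 \<Longrightarrow> D (Suc k) \<le> (1 - G / 2) * D k
      + \<phi> * \<theta> k * (chi k * T k + s\<^sup>2 * L * X k + L * s * \<phi> * D k + Z) + \<beta> * U k"
    and U_step: "\<And>k. k \<ge> 1 \<Longrightarrow> U (Suc k) \<le> 2 * \<phi> * D k
      + \<phi>\<^sup>2 * \<theta> k * (chi k * T k + s\<^sup>2 * L * X k + L * s * \<phi> * D k + Z) + \<beta> * U k"
    and P_step: "\<And>k. k \<ge> 1 \<Longrightarrow> P (Suc k) \<le> (1 - \<kappa> k / 2) * T k"
    and T_bound: "\<And>k. k \<ge> 1 \<Longrightarrow> T k \<le> P k + chi k * L * U k"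
begin

text \<open>The inverse condition number.\<close>

definition m :: real where "m = mu / L"

lemma basic: "7 / 5 \<le> s" "0 < L" "0 < m" "m \<le> 1" "0 < G" "7 / 5 \<le> \<phi>" "0 < x" "mu = m * L"
proof -
  \<comment> \<open>7/5 is a rational lower bound for the square root of 2.\<close>
  show "7 / 5 \<le> s" by (rule power2_le_imp_le) (use s in \<open>auto simp: power2_eq_square\<close>)
  then show "7 / 5 \<le> \<phi>" "0 < x" using \<phi> x by auto
  show "0 < L" "0 < m" "m \<le> 1" "0 < G" "mu = m * L" using mu C G by (auto simp: m_def)
qed

lemma sC: "s * (s * \<eta> * C) \<le> G" "0 \<le> s * \<eta> * C"
  using G s \<eta> C by (auto simp: power2_eq_square mult_ac)

lemma alpha_x: "96 * (\<alpha> * L * \<phi>\<^sup>2 * x) \<le> (s * \<eta> * C) * H * m"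
proof -
  have "L * (96 * (\<alpha> * L * \<phi>\<^sup>2 * x)) = 96 * \<alpha> * L\<^sup>2 * \<phi>\<^sup>2 * x" by (simp add: power2_eq_square)
  also have "\<dots> \<le> C * H * s * \<eta> * mu" by (rule \<alpha>(2))
  also have "\<dots> = L * ((s * \<eta> * C) * H * m)" by (subst basic(8)) simp
  finally show ?thesis using basic(2) by simp
qed

lemma alpha_x': "96 * s * (\<alpha> * L * \<phi>\<^sup>2 * x) \<le> G * m"
proof -
  have "96 * s * (\<alpha> * L * \<phi>\<^sup>2 * x) \<le> s * ((s * \<eta> * C) * H * m)"
    using mult_left_mono[OF alpha_x, of s] s by (simp add: mult_ac)
  also have "\<dots> = (s * (s * \<eta> * C)) * (H * m)" by (simp add: mult_ac)
  also have "\<dots> \<le> G * (1 * m)"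
    using sC s \<eta> C H basic by (intro mult_mono) auto
  finally show ?thesis by simp
qed

lemma alpha_s: "96 * s * (\<alpha> * L * s * \<phi>\<^sup>2) \<le> G * m"
proof -
  have "(\<alpha> * L * \<phi>\<^sup>2) * s \<le> (\<alpha> * L * \<phi>\<^sup>2) * x" using x \<alpha>(1) basic by (intro mult_left_mono) auto
  then have "96 * s * (\<alpha> * L * s * \<phi>\<^sup>2) \<le> 96 * s * (\<alpha> * L * \<phi>\<^sup>2 * x)"
    using s by (intro mult_left_mono) (auto simp: mult_ac)
  then show ?thesis using alpha_x' by linarith
qed

lemma alpha_mu: "mu * s\<^sup>2 * \<alpha> \<le> G / 192"
proof -
  have "s\<^sup>2 \<le> \<phi>\<^sup>2" using \<phi> s by (intro power_mono) auto
  then have "192 * (mu * s\<^sup>2 * \<alpha>) \<le> 96 * 2 * (L * \<phi>\<^sup>2 * \<alpha>)"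
    using mu \<alpha> by (auto intro!: mult_mono)
  also have "\<dots> \<le> 96 * s\<^sup>2 * (L * \<phi>\<^sup>2 * \<alpha>)"
    using s basic \<alpha> by (intro mult_right_mono) auto
  also have "\<dots> = 96 * s * (\<alpha> * L * s * \<phi>\<^sup>2)" by (simp add: power2_eq_square mult_ac)
  also have "\<dots> \<le> G * m" by (rule alpha_s)
  also have "\<dots> \<le> G" using basic by (simp add: mult_left_le)
  finally show ?thesis by simp
qed

lemma beta_phi: "64 * s * (\<beta> * \<phi>\<^sup>2) \<le> G * m"
proof -
  have "L * (64 * s * (\<beta> * \<phi>\<^sup>2)) = s * (64 * \<beta> * L * \<phi>\<^sup>2)" by (simp add: mult_ac)
  also have "\<dots> \<le> s * (C * s * \<eta> * mu)" using \<beta>(2) s by (intro mult_left_mono) auto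
  also have "\<dots> = L * ((s * (s * \<eta> * C)) * m)" using basic(8) by (simp add: mult_ac)
  also have "\<dots> \<le> L * (G * m)" using sC basic by (intro mult_left_mono mult_right_mono) auto
  finally show ?thesis using basic(2) by simp
qed

lemma beta_phi': "80 * (\<beta> * \<phi>\<^sup>2) \<le> G * m"
proof -
  have "80 * (\<beta> * \<phi>\<^sup>2) \<le> 64 * s * (\<beta> * \<phi>\<^sup>2)" using basic(1) \<beta>(1) by (intro mult_right_mono) auto
  then show ?thesis using beta_phi by linarith
qed

lemma alpha_s': "134 * (\<alpha> * L * s * \<phi>\<^sup>2) \<le> G * m"
proof -
  have "134 * (\<alpha> * L * s * \<phi>\<^sup>2) \<le> 96 * s * (\<alpha> * L * s * \<phi>\<^sup>2)"
    using basic(1,2) \<alpha>(1) s by (intro mult_right_mono) auto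
  then show ?thesis using alpha_s by linarith
qed

text \<open>The loss \<open>lam * G / 2\<close> of the weighted \<open>D\<close> has to cover
  \<open>4 * \<phi> * \<beta>\<close> returning from \<open>2 * \<beta> * U\<close> and
  \<open>6 / 5 * \<alpha> * L * s * \<phi>\<close> from the average; the coefficients 10 and 4 leave
  a margin.\<close>

definition lam :: real where "lam = (10 * \<phi> * \<beta> + 4 * \<alpha> * L * s * \<phi>) / G"
text \<open>The factor with which a source of the average reappears in \<open>W\<close> through
  \<open>D\<close> and \<open>U\<close>.\<close>

definition h :: real where "h = lam * \<phi> + 2 * \<beta> * \<phi>\<^sup>2"
text \<open>The decay of \<open>X\<close> is only of order \<open>\<theta> k\<close>, while its
  momentum term \<open>\<beta> * U k\<close> lacks this factor. Adding
  \<open>2 * \<beta> * U\<close> lets the fast decay of \<open>U\<close> absorb that term, and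
  \<open>lam * D\<close> pays for what \<open>U\<close> receives from \<open>D\<close>.\<close>

definition W :: "nat \<Rightarrow> real" where "W k = X k + lam * D k + 2 * \<beta> * U k"

lemma lam_nonneg: "0 \<le> lam"
  using basic \<alpha> \<beta> s by (auto simp: lam_def intro!: divide_nonneg_pos add_nonneg_nonneg mult_nonneg_nonneg)

lemma lam_G: "lam * G = 10 * \<phi> * \<beta> + 4 * \<alpha> * L * s * \<phi>"
  using basic by (simp add: lam_def)

lemma h_bound: "h \<le> m / 5" "0 \<le> h"
proof -
  have "G * (lam * \<phi>) = 10 * (\<beta> * \<phi>\<^sup>2) + 4 * (\<alpha> * L * s * \<phi>\<^sup>2)"
    using arg_cong[OF lam_G, of "\<lambda>t. t * \<phi>"] by (simp add: power2_eq_square algebra_simps)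
  also have "\<dots> \<le> 10 / 80 * (G * m) + 4 / 134 * (G * m)" using beta_phi' alpha_s' by simp
  also have "\<dots> \<le> G * (16 / 100 * m)" using basic by (simp add: algebra_simps)
  finally have 1: "lam * \<phi> \<le> 16 / 100 * m" using basic by simp
  have "G * m \<le> 1 * m" using G basic by (intro mult_right_mono) auto
  then have "80 * (\<beta> * \<phi>\<^sup>2) \<le> m" using beta_phi' by linarith
  then have "2 * \<beta> * \<phi>\<^sup>2 \<le> 3 / 100 * m" using basic by simp
  with 1 show "h \<le> m / 5" using basic unfolding h_def by linarith
  show "0 \<le> h" using lam_nonneg \<beta> basic by (simp add: h_def)
qed

lemma lam_small: "lam + 2 * \<beta> \<le> 1 / 5"
proof -
  have "lam * 1 + 2 * \<beta> * 1 \<le> lam * \<phi> + 2 * \<beta> * \<phi>\<^sup>2"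
    using lam_nonneg \<beta> basic by (intro add_mono mult_left_mono) (auto simp: one_le_power)
  then show ?thesis using h_bound basic unfolding h_def by linarith
qed

text \<open>Coefficients of \<open>X\<close>, \<open>D\<close> and \<open>U\<close> are collected;
  each must lose the common fraction 3/4 \<open>mu * s\<^sup>2 * \<theta> k\<close>. For
  \<open>X\<close> it is available because 99/100 minus the 1/5 returned through \<open>h\<close>
  exceeds 3/4.\<close>

lemma W_step:
  assumes k: "k \<ge> 1"
  shows "W (Suc k) \<le> (1 - 3 / 4 * mu * s\<^sup>2 * \<theta> k) * W k + 6 / 5 * \<theta> k * (chi k * T k + Z)"
proof -
  let ?t = "\<theta> k" and ?R = "chi k * T k + s\<^sup>2 * L * X k + L * s * \<phi> * D k + Z"
  have t: "0 < ?t" "?t \<le> \<alpha>" using \<theta>(1)[OF k] \<theta>(2) by auto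
  have "mu * s\<^sup>2 * ?t \<le> mu * s\<^sup>2 * \<alpha>" using t mu by (intro mult_left_mono) auto
  then have ms: "mu * s\<^sup>2 * ?t \<le> G / 192" using alpha_mu by linarith
  have TZ: "0 \<le> chi k * T k + Z" using chi(1)[OF k] nonneg(5)[of k] Z by simp
  have "W (Suc k) \<le> ((1 - 99 / 100 * mu * s\<^sup>2 * ?t) * X k + ?t * (L * s * \<phi> * D k + chi k * T k + Z) + \<beta> * U k)
     + lam * ((1 - G / 2) * D k + \<phi> * ?t * ?R + \<beta> * U k)
     + 2 * \<beta> * (2 * \<phi> * D k + \<phi>\<^sup>2 * ?t * ?R + \<beta> * U k)"
    unfolding W_def using lam_nonneg \<beta>(1)
    by (intro add_mono mult_left_mono X_step[OF k] D_step[OF k] U_step[OF k]) auto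
  also have "\<dots> = X k * (1 - 99 / 100 * mu * s\<^sup>2 * ?t + h * ?t * s\<^sup>2 * L)
     + D k * (lam * (1 - G / 2) + 4 * \<phi> * \<beta> + ?t * L * s * \<phi> * (1 + h))
     + U k * (\<beta> * (1 + lam + 2 * \<beta>)) + (1 + h) * ?t * (chi k * T k + Z)"
    unfolding h_def by (simp add: algebra_simps power2_eq_square)
  also have "\<dots> \<le> X k * (1 - 3 / 4 * mu * s\<^sup>2 * ?t) + D k * (lam * (1 - 3 / 4 * mu * s\<^sup>2 * ?t))
     + U k * (2 * \<beta> * (1 - 3 / 4 * mu * s\<^sup>2 * ?t)) + 6 / 5 * ?t * (chi k * T k + Z)"
  proof (intro add_mono mult_left_mono nonneg mult_right_mono TZ)
    have "h * (?t * s\<^sup>2 * L) \<le> m / 5 * (?t * s\<^sup>2 * L)"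
      using h_bound t basic by (intro mult_right_mono) auto
    also have "\<dots> = 1 / 5 * (mu * s\<^sup>2 * ?t)" by (subst basic(8)) simp
    finally have hL: "h * (?t * s\<^sup>2 * L) \<le> 1 / 5 * (mu * s\<^sup>2 * ?t)" .
    show "1 - 99 / 100 * mu * s\<^sup>2 * ?t + h * ?t * s\<^sup>2 * L \<le> 1 - 3 / 4 * mu * s\<^sup>2 * ?t"
    proof -
      note hL
      moreover have "0 \<le> mu * s\<^sup>2 * ?t" using t mu by simp
      moreover have "99 / 100 * mu * s\<^sup>2 * ?t = 99 / 100 * (mu * s\<^sup>2 * ?t)"
        "3 / 4 * mu * s\<^sup>2 * ?t = 3 / 4 * (mu * s\<^sup>2 * ?t)" "h * ?t * s\<^sup>2 * L = h * (?t * s\<^sup>2 * L)" by simp_all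
      ultimately show ?thesis by linarith
    qed
    have "?t * L * s * \<phi> * (1 + h) \<le> \<alpha> * L * s * \<phi> * (6 / 5)"
      using t h_bound basic s by (intro mult_mono) auto
    moreover have "lam * (3 / 4 * (mu * s\<^sup>2 * ?t)) \<le> lam * (1 / 100 * G)"
      using ms lam_nonneg basic(5) by (intro mult_left_mono) linarith+
    moreover have "0 \<le> \<phi> * \<beta>" "0 \<le> \<alpha> * L * s * \<phi>" using basic \<beta> \<alpha> s by auto
    ultimately show "lam * (1 - G / 2) + 4 * \<phi> * \<beta> + ?t * L * s * \<phi> * (1 + h) \<le> lam * (1 - 3 / 4 * mu * s\<^sup>2 * ?t)"
      using lam_G by (simp add: algebra_simps)
    have "\<beta> * (1 + (lam + 2 * \<beta>)) \<le> \<beta> * (2 - 3 / 2 * (mu * s\<^sup>2 * ?t))"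
      using lam_small ms G(3) \<beta>(1) by (intro mult_left_mono) linarith+
    then show "\<beta> * (1 + lam + 2 * \<beta>) \<le> 2 * \<beta> * (1 - 3 / 4 * mu * s\<^sup>2 * ?t)" by (simp add: algebra_simps)
    show "1 + h \<le> 6 / 5" "0 \<le> ?t" using h_bound basic t by auto
  qed
  also have "\<dots> = (1 - 3 / 4 * mu * s\<^sup>2 * \<theta> k) * W k + 6 / 5 * \<theta> k * (chi k * T k + Z)"
    unfolding W_def by (simp add: algebra_simps)
  finally show ?thesis .
qed

text \<open>The levels at which the recursions balance with a small margin: \<open>w\<close> matches
  a source of \<open>2 * Z\<close> at rate 2/3 instead of 3/4, \<open>r\<close> bounds the common
  source, \<open>d\<close> and \<open>u\<close> are proportional to \<open>\<alpha> * r\<close>, and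
  \<open>p\<close> balances the loss of the mixing step against
  \<open>chi k * L * u\<close>.\<close>

definition w :: real where "w = 18 / 5 * Z / (mu * s\<^sup>2)"
definition r :: real where "r = 143 / 25 * Z / m"
definition d :: real where "d = 12 / 5 * \<phi> * \<alpha> * r / G"
definition u :: real where "u = 6 * \<phi>\<^sup>2 * \<alpha> * r / G"
definition p :: real where "p = 21 / 5 / (H * s * \<eta>) * L * u"

lemma v_pos: "0 < w" "0 < r" "0 < d" "0 < u" "0 < p"
  using basic mu s Z \<alpha> H \<eta> by (auto simp: w_def r_def d_def u_def p_def intro!: divide_pos_pos mult_pos_pos)

lemma p_bound: "x * p \<le> 13125 / 100000 * (m * r)"
proof -
  have nz: "H * s * \<eta> > 0" and nz': "H \<noteq> 0" "s \<noteq> 0" "\<eta> \<noteq> 0" "G \<noteq> 0" using H s \<eta> basic(5) by simp_all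
  have "(x * p) * (G * (H * s * \<eta>)) = 126 / 5 * (\<alpha> * L * \<phi>\<^sup>2 * x) * r"
    using nz' by (simp add: p_def u_def field_simps)
  also have "\<dots> \<le> 126 / 5 * ((s * \<eta> * C) * H * m / 96) * r"
    using alpha_x v_pos by (intro mult_right_mono mult_left_mono) auto
  also have "\<dots> = 126 / 480 * (m * r) * (C * (H * s * \<eta>))" by simp
  also have "\<dots> \<le> 126 / 480 * (m * r) * (G / 2 * (H * s * \<eta>))"
    using G(1) nz basic v_pos by (intro mult_left_mono mult_right_mono) auto
  also have "\<dots> = (13125 / 100000 * (m * r)) * (G * (H * s * \<eta>))" by simp
  finally show ?thesis using nz basic(5) by (metis mult_le_cancel_right_pos mult_pos_pos)
qed

lemma chi_u_bound:
  assumes "k \<ge> 1"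
  shows "x * (chi k * L * u) \<le> 3125 / 100000 * (m * r)"
proof -
  have "(x * (chi k * L * u)) * G = 6 * ((\<alpha> * L * \<phi>\<^sup>2 * x) * (chi k * r))"
    using basic(5) by (simp add: u_def field_simps)
  also have "\<dots> \<le> 6 * (((s * \<eta> * C) * H * m / 96) * (chi k * r))"
    using alpha_x chi(1)[OF assms] v_pos by (intro mult_right_mono mult_left_mono) auto
  also have "\<dots> = 6 / 96 * (m * r * (s * \<eta> * C)) * (chi k * H)" by simp
  also have "\<dots> \<le> 6 / 96 * (m * r * (s * \<eta> * C)) * (s / 2)"
    using chi(4)[OF assms] basic v_pos sC by (intro mult_left_mono) auto
  also have "\<dots> = 3 / 96 * (m * r) * (s * (s * \<eta> * C))" by simp
  also have "\<dots> \<le> 3 / 96 * (m * r) * G"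
    using sC basic v_pos by (intro mult_left_mono) auto
  finally have "(x * (chi k * L * u)) * G \<le> (3125 / 100000 * (m * r)) * G" by simp
  then show ?thesis using basic(5) by simp
qed

text \<open>The loop closes here: steps of size \<open>u\<close> excite the tracker by no more than
  the noise level \<open>Z\<close> from which \<open>u\<close> was computed. The shares 0.13125 and
  0.03125 of \<open>m * r\<close>, which is \<open>143 / 25 * Z\<close>, add up to less than
  \<open>Z\<close>.\<close>

lemma tracking_level:
  assumes "k \<ge> 1"
  shows "x * (p + chi k * L * u) \<le> Z" "chi k * (p + chi k * L * u) \<le> Z"
proof -
  have "m * r = 143 / 25 * Z" using basic by (simp add: r_def)
  then show 1: "x * (p + chi k * L * u) \<le> Z"
    using p_bound chi_u_bound[OF assms] Z by (simp add: distrib_left)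
  have "chi k * (p + chi k * L * u) \<le> x * (p + chi k * L * u)"
    using chi(1,2)[OF assms] v_pos basic by (intro mult_right_mono) auto
  then show "chi k * (p + chi k * L * u) \<le> Z" using 1 by linarith
qed

text \<open>Origin of 143/25: the three sources amount to 2, 18/5 and 11/100 times
  \<open>Z / m\<close>, together 571/100.\<close>

lemma R_level: "2 * Z + s\<^sup>2 * L * w + L * s * \<phi> * d \<le> r"
proof -
  have "L * s * \<phi> * d = 12 / 5 * (\<alpha> * L * s * \<phi>\<^sup>2) * (r / G)"
    by (simp add: d_def power2_eq_square)
  also have "\<dots> \<le> 12 / 5 * (G * m / 134) * (r / G)"
    using alpha_s' basic v_pos by (intro mult_right_mono mult_left_mono) auto
  also have "\<dots> = 12 / 670 * (m * r)" using basic by simp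
  also have "m * r = 143 / 25 * Z" using basic by (simp add: r_def)
  finally have 1: "L * s * \<phi> * d \<le> 11 / 100 * Z" using Z by simp
  have 2: "s\<^sup>2 * L * w = 18 / 5 * (Z / m)" using basic s mu by (simp add: w_def m_def)
  have 3: "Z \<le> Z / m" using basic Z by (simp add: pos_le_divide_eq mult_left_le)
  have 4: "r = 143 / 25 * (Z / m)" by (simp add: r_def)
  show ?thesis using 1 2 3 4 Z by linarith
qed

text \<open>The recursions map the box of size t into a strictly smaller one. For \<open>W\<close>
  and \<open>P\<close> the decrease depends on k, and it becomes uniform through
  \<open>\<theta>min\<close> and \<open>\<kappa>min\<close>.\<close>

lemma step_levels:
  assumes k: "k \<ge> 1" and t: "1 \<le> t"
    and "W k \<le> t * w" "D k \<le> t * d" "U k \<le> t * u" "P k \<le> t * p"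
  shows "W (Suc k) \<le> (1 - 1 / 20 * mu * s\<^sup>2 * \<theta>min) * t * w" "D (Suc k) \<le> (1 - 1 / 20 * G) * t * d"
    "U (Suc k) \<le> (1 - 1 / 50) * t * u" "P (Suc k) \<le> (1 - 1 / 50 * \<kappa>min) * t * p"
proof -
  have t': "0 < \<theta> k" "\<theta> k \<le> \<alpha>" "\<theta>min \<le> \<theta> k" using \<theta>(1)[OF k] \<theta>(2) by auto
  have T: "T k \<le> t * (p + chi k * L * u)"
  proof -
    have "chi k * L * U k \<le> chi k * L * (t * u)"
      using assms chi(1)[OF k] basic by (intro mult_left_mono) auto
    then show ?thesis using T_bound[OF k] assms(6) by (simp add: algebra_simps)
  qed
  have cT: "chi k * T k \<le> t * Z"
  proof -
    have "chi k * T k \<le> chi k * (t * (p + chi k * L * u))" using T chi(1)[OF k] by (rule mult_left_mono)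
    also have "\<dots> = t * (chi k * (p + chi k * L * u))" by simp
    also have "\<dots> \<le> t * Z" using tracking_level(2)[OF k] t by (intro mult_left_mono) auto
    finally show ?thesis .
  qed
  have tZ: "Z \<le> t * Z" using t Z by simp
  have Xk: "X k \<le> t * w"
    using assms(3) nonneg(2,3)[of k] lam_nonneg \<beta>(1) mult_nonneg_nonneg[of lam "D k"] mult_nonneg_nonneg[of "2 * \<beta>" "U k"]
    unfolding W_def by linarith
  have R: "chi k * T k + s\<^sup>2 * L * X k + L * s * \<phi> * D k + Z \<le> t * r"
  proof -
    have "chi k * T k + s\<^sup>2 * L * X k + L * s * \<phi> * D k + Z \<le> t * Z + s\<^sup>2 * L * (t * w) + L * s * \<phi> * (t * d) + t * Z"
      using cT tZ Xk assms(4) basic s by (intro add_mono mult_left_mono) auto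
    also have "\<dots> = t * (2 * Z + s\<^sup>2 * L * w + L * s * \<phi> * d)" by (simp add: algebra_simps)
    also have "\<dots> \<le> t * r" using R_level t by (intro mult_left_mono) auto
    finally show ?thesis .
  qed
  show "W (Suc k) \<le> (1 - 1 / 20 * mu * s\<^sup>2 * \<theta>min) * t * w"
  proof -
    have "mu * s\<^sup>2 * \<theta> k \<le> mu * s\<^sup>2 * \<alpha>" using t' mu by (intro mult_left_mono) auto
    then have ms: "mu * s\<^sup>2 * \<theta> k \<le> 1 / 192" using alpha_mu G(3) by linarith
    have "W (Suc k) \<le> (1 - 3 / 4 * mu * s\<^sup>2 * \<theta> k) * (t * w) + 6 / 5 * \<theta> k * (t * Z + t * Z)"
    proof -
      have "(1 - 3 / 4 * mu * s\<^sup>2 * \<theta> k) * W k \<le> (1 - 3 / 4 * mu * s\<^sup>2 * \<theta> k) * (t * w)"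
        using ms by (intro mult_left_mono assms(3)) simp
      moreover have "6 / 5 * \<theta> k * (chi k * T k + Z) \<le> 6 / 5 * \<theta> k * (t * Z + t * Z)"
        using cT tZ t' by (intro mult_left_mono add_mono) auto
      ultimately show ?thesis using W_step[OF k] by linarith
    qed
    also have "6 / 5 * \<theta> k * (t * Z + t * Z) = 2 / 3 * (mu * s\<^sup>2 * \<theta> k) * (t * w)"
      using mu s by (simp add: w_def)
    also have "(1 - 3 / 4 * mu * s\<^sup>2 * \<theta> k) * (t * w) + 2 / 3 * (mu * s\<^sup>2 * \<theta> k) * (t * w) = (1 - 1 / 12 * (mu * s\<^sup>2 * \<theta> k)) * (t * w)"
      by (simp add: algebra_simps)
    also have "\<dots> \<le> (1 - 1 / 20 * mu * s\<^sup>2 * \<theta>min) * (t * w)"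
    proof (intro mult_right_mono)
      have "mu * s\<^sup>2 * \<theta>min \<le> mu * s\<^sup>2 * \<theta> k" using t' mu by (intro mult_left_mono) auto
      moreover have "0 \<le> mu * s\<^sup>2 * \<theta>min" using mu \<theta>(2) by simp
      moreover have "1 / 20 * mu * s\<^sup>2 * \<theta>min = 1 / 20 * (mu * s\<^sup>2 * \<theta>min)" by simp
      ultimately show "1 - 1 / 12 * (mu * s\<^sup>2 * \<theta> k) \<le> 1 - 1 / 20 * mu * s\<^sup>2 * \<theta>min" by linarith
    qed (use t v_pos in auto)
    finally show ?thesis by (simp add: mult.assoc)
  qed
  have ar: "\<phi> * \<alpha> * r = 5 / 12 * (G * d)" using basic by (simp add: d_def)
  have \<theta>R: "\<theta> k * (chi k * T k + s\<^sup>2 * L * X k + L * s * \<phi> * D k + Z) \<le> \<alpha> * (t * r)"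
    using R t' nonneg[of k] chi(1)[OF k] basic s Z by (intro mult_mono add_nonneg_nonneg mult_nonneg_nonneg) auto
  have b\<phi>: "\<beta> * \<phi> \<le> G / 112"
  proof -
    have "112 * (\<beta> * \<phi>) = 80 * (\<beta> * \<phi> * (7 / 5))" by simp
    also have "\<dots> \<le> 80 * (\<beta> * \<phi> * \<phi>)" using basic \<beta> by (intro mult_left_mono) auto
    also have "\<dots> \<le> G * m" using beta_phi' by (simp add: power2_eq_square mult.assoc)
    also have "\<dots> \<le> G" using basic by (simp add: mult_left_le)
    finally show ?thesis by simp
  qed
  show "D (Suc k) \<le> (1 - 1 / 20 * G) * t * d"
  proof -
    have "\<beta> * u = 6 * (\<beta> * \<phi>) * (\<phi> * \<alpha> * r) / G" by (simp add: u_def power2_eq_square)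
    also have "\<dots> \<le> 6 * (G / 112) * (\<phi> * \<alpha> * r) / G"
      using b\<phi> basic \<alpha> v_pos by (intro divide_right_mono mult_right_mono mult_left_mono) auto
    also have "\<dots> = 6 / 112 * (5 / 12 * (G * d))" unfolding ar[symmetric] using basic(5) by simp
    finally have bu: "\<beta> * u \<le> 1 / 40 * (G * d)" using mult_pos_pos[OF basic(5) v_pos(3)] by linarith
    have "D (Suc k) \<le> (1 - G / 2) * (t * d) + \<phi> * (\<alpha> * (t * r)) + \<beta> * (t * u)"
    proof -
      have "\<phi> * \<theta> k * (chi k * T k + s\<^sup>2 * L * X k + L * s * \<phi> * D k + Z) \<le> \<phi> * (\<alpha> * (t * r))"
        unfolding mult.assoc[of \<phi> "\<theta> k"] using \<theta>R basic by (intro mult_left_mono) auto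
      moreover have "(1 - G / 2) * D k \<le> (1 - G / 2) * (t * d)" using assms(4) G(3) by (intro mult_left_mono) auto
      moreover have "\<beta> * U k \<le> \<beta> * (t * u)" using assms(5) \<beta>(1) by (rule mult_left_mono)
      ultimately show ?thesis using D_step[OF k] by linarith
    qed
    also have "\<dots> = t * ((1 - G / 2) * d + \<phi> * \<alpha> * r + \<beta> * u)" by (simp add: algebra_simps)
    also have "\<dots> \<le> t * ((1 - 1 / 20 * G) * d)"
    proof (intro mult_left_mono)
      have e: "(1 - G / 2) * d = d - 1 / 2 * (G * d)" "(1 - 1 / 20 * G) * d = d - 1 / 20 * (G * d)"
        by (simp_all add: algebra_simps)
      show "(1 - G / 2) * d + \<phi> * \<alpha> * r + \<beta> * u \<le> (1 - 1 / 20 * G) * d"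
        unfolding e ar using bu mult_pos_pos[OF basic(5) v_pos(3)] by linarith
    qed (use t in auto)
    finally show ?thesis by (simp add: mult_ac)
  qed
  have b: "\<beta> \<le> 1 / 100"
  proof -
    have "112 * \<beta> * 1 \<le> 112 * \<beta> * \<phi>" using basic \<beta> by (intro mult_left_mono) auto
    then show ?thesis using b\<phi> G(3) by simp
  qed
  show "U (Suc k) \<le> (1 - 1 / 50) * t * u"
  proof -
    define Y where "Y = \<phi>\<^sup>2 * \<alpha> * r / G"
    have 1: "2 * \<phi> * d = 24 / 5 * Y" by (simp add: d_def Y_def power2_eq_square)
    have 2: "\<phi>\<^sup>2 * \<alpha> * r \<le> Y" unfolding Y_def
      using basic G(3) \<alpha> v_pos by (simp add: pos_le_divide_eq mult_left_le)
    have 3: "u = 6 * Y" by (simp add: u_def Y_def)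
    have 4: "\<beta> * u \<le> 1 / 100 * u" using b v_pos by (intro mult_right_mono) auto
    have "U (Suc k) \<le> 2 * \<phi> * (t * d) + \<phi>\<^sup>2 * (\<alpha> * (t * r)) + \<beta> * (t * u)"
    proof -
      have "\<phi>\<^sup>2 * \<theta> k * (chi k * T k + s\<^sup>2 * L * X k + L * s * \<phi> * D k + Z) \<le> \<phi>\<^sup>2 * (\<alpha> * (t * r))"
        unfolding mult.assoc[of "\<phi>\<^sup>2" "\<theta> k"] using \<theta>R by (intro mult_left_mono) auto
      moreover have "2 * \<phi> * D k \<le> 2 * \<phi> * (t * d)" using assms(4) basic by (intro mult_left_mono) auto
      moreover have "\<beta> * U k \<le> \<beta> * (t * u)" using assms(5) \<beta>(1) by (rule mult_left_mono)
      ultimately show ?thesis using U_step[OF k] by linarith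
    qed
    also have "\<dots> = t * (2 * \<phi> * d + \<phi>\<^sup>2 * \<alpha> * r + \<beta> * u)" by (simp add: algebra_simps)
    also have "\<dots> \<le> t * ((1 - 1 / 50) * u)"
    proof (intro mult_left_mono)
      have e: "(1 - 1 / 50) * u = 49 / 50 * u" by simp
      show "2 * \<phi> * d + \<phi>\<^sup>2 * \<alpha> * r + \<beta> * u \<le> (1 - 1 / 50) * u"
        unfolding e using v_pos(4) 1 2 3 4 by linarith
    qed (use t in auto)
    finally show ?thesis by (simp add: mult_ac)
  qed
  show "P (Suc k) \<le> (1 - 1 / 50 * \<kappa>min) * t * p"
  proof -
    have kk: "\<kappa>min \<le> \<kappa> k" "\<kappa> k \<le> 1" "0 < \<kappa> k" using \<kappa>(1)[OF k] \<kappa>(2) by auto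
    have "chi k * L * u \<le> (\<kappa> k * (2 / (H * s * \<eta>))) * L * u"
      using chi(3)[OF k] basic v_pos by (intro mult_right_mono) auto
    also have "\<dots> = 10 / 21 * \<kappa> k * p" by (simp add: p_def mult_ac)
    finally have cu: "chi k * L * u \<le> 10 / 21 * \<kappa> k * p" .
    have "P (Suc k) \<le> (1 - \<kappa> k / 2) * (t * (p + chi k * L * u))"
      using P_step[OF k] mult_left_mono[OF T, of "1 - \<kappa> k / 2"] kk by linarith
    also have "\<dots> \<le> (1 - \<kappa> k / 2) * (t * (p + 10 / 21 * \<kappa> k * p))"
      using cu kk t by (intro mult_left_mono) auto
    also have "\<dots> = t * p * ((1 - \<kappa> k / 2) * (1 + 10 / 21 * \<kappa> k))" by (simp add: algebra_simps)
    also have "\<dots> \<le> t * p * (1 - 1 / 50 * \<kappa>min)"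
    proof (intro mult_left_mono)
      have "(1 - \<kappa> k / 2) * (1 + 10 / 21 * \<kappa> k) = 1 - 1 / 42 * \<kappa> k - 5 / 21 * (\<kappa> k * \<kappa> k)" by (simp add: field_simps)
      moreover have "0 \<le> \<kappa> k * \<kappa> k" by simp
      ultimately show "(1 - \<kappa> k / 2) * (1 + 10 / 21 * \<kappa> k) \<le> 1 - 1 / 50 * \<kappa>min"
        using kk by linarith
    qed (use t v_pos in auto)
    finally show ?thesis by (simp add: mult_ac)
  qed
qed

theorem eventually_small:
  "\<exists>K\<ge>1. \<forall>k\<ge>K. X k \<le> 18 / 5 * Z / (mu * s\<^sup>2) \<and> D k \<le> 12 / 5 * \<phi> * \<alpha> * (143 / 25 * Z * L / mu) / G \<and> x * T k \<le> Z"
proof -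
  let ?S = "\<lambda>k i. [W k, D k, U k, P k] ! i" and ?v = "\<lambda>i. [w, d, u, p] ! i"
  let ?rs = "[1 / 20 * mu * s\<^sup>2 * \<theta>min, 1 / 20 * G, 1 / 50, 1 / 50 * \<kappa>min]"
  define r0 where "r0 = Min (set ?rs)"
  have rs: "\<And>i. i < 4 \<Longrightarrow> r0 \<le> ?rs ! i" unfolding r0_def by (intro Min_le nth_mem) simp_all
  have r0: "0 < r0" unfolding r0_def using mu s \<theta>(2) \<kappa>(2) basic by auto
  have r1: "r0 < 1" using rs[of 2] by simp
  have lt4: "i < (4::nat) \<Longrightarrow> i = 0 \<or> i = 1 \<or> i = 2 \<or> i = 3" for i by auto
  have "\<exists>K\<ge>1. \<forall>k\<ge>K. \<forall>i\<in>{..<4}. ?S k i \<le> ?v i"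
  proof (rule eventually_le_of_scaling_step[where r = r0])
    show "0 < ?v i" if "i \<in> {..<4}" for i using that v_pos by (auto dest!: lt4)
    fix k :: nat and t :: real and i
    assume k: "k \<ge> 1" and t: "1 \<le> t" and le: "\<And>i. i \<in> {..<4} \<Longrightarrow> ?S k i \<le> t * ?v i" and i: "i \<in> {..<4::nat}"
    have "?S (Suc k) i \<le> (1 - ?rs ! i) * t * ?v i"
      using step_levels[OF k t] le[of 0] le[of 1] le[of 2] le[of 3] i by (auto dest!: lt4)
    also have "\<dots> \<le> (1 - r0) * t * ?v i"
      using rs[of i] i t v_pos by (intro mult_right_mono) (auto dest!: lt4)
    finally show "?S (Suc k) i \<le> (1 - r0) * t * ?v i" .
  qed (use r0 r1 in auto)
  then obtain K where K: "K \<ge> 1" "\<And>k i. k \<ge> K \<Longrightarrow> i < 4 \<Longrightarrow> ?S k i \<le> ?v i" by auto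
  have "X k \<le> 18 / 5 * Z / (mu * s\<^sup>2) \<and> D k \<le> 12 / 5 * \<phi> * \<alpha> * (143 / 25 * Z * L / mu) / G \<and> x * T k \<le> Z"
    if "k \<ge> K" for k
  proof (intro conjI)
    have k: "k \<ge> 1" using that K by simp
    have le: "W k \<le> w" "D k \<le> d" "U k \<le> u" "P k \<le> p"
      using K(2)[OF that, of 0] K(2)[OF that, of 1] K(2)[OF that, of 2] K(2)[OF that, of 3] by auto
    have "X k \<le> W k"
      using nonneg(2,3)[of k] lam_nonneg \<beta>(1) by (simp add: W_def)
    then show "X k \<le> 18 / 5 * Z / (mu * s\<^sup>2)" using le(1) by (simp add: w_def)
    show "D k \<le> 12 / 5 * \<phi> * \<alpha> * (143 / 25 * Z * L / mu) / G"
      using le(2) by (simp add: d_def r_def m_def)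
    have "chi k * L * U k \<le> chi k * L * u" using le(3) chi(1)[OF k] basic by (intro mult_left_mono) auto
    then have "T k \<le> p + chi k * L * u" using T_bound[OF k] le(4) by linarith
    then have "x * T k \<le> x * (p + chi k * L * u)" using basic by (intro mult_left_mono) auto
    then show "x * T k \<le> Z" using tracking_level(1)[OF k] by linarith
  qed
  then show ?thesis using K(1) by blast
qed

end

section \<open>Weighted norms of stacked vectors\<close>

text \<open>The square root of \<open>weighted_norm2\<close> for nonnegative weights, written as an
  \<open>L2_set\<close> so that Minkowski's inequality applies.\<close>

definition wn :: "real^'n \<Rightarrow> real^'p^'n \<Rightarrow> real" where
  "wn q u = L2_set (\<lambda>i. sqrt (q $ i) * norm (u $ i)) UNIV"

lemma wn_nonneg: "0 \<le> wn q u"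
  by (simp add: wn_def L2_set_nonneg)

lemma wn_power2: "(\<And>i. 0 \<le> q $ i) \<Longrightarrow> (wn q u)\<^sup>2 = weighted_norm2 q u"
  by (simp add: wn_def L2_set_def weighted_norm2_def power_mult_distrib sum_nonneg)

lemma L2_set_norm_triangle:
  fixes f g :: "'i \<Rightarrow> 'v::real_normed_vector"
  assumes "\<And>i. 0 \<le> c i"
  shows "L2_set (\<lambda>i. c i * norm (f i + g i)) I \<le> L2_set (\<lambda>i. c i * norm (f i)) I + L2_set (\<lambda>i. c i * norm (g i)) I"
proof -
  have "L2_set (\<lambda>i. c i * norm (f i + g i)) I \<le> L2_set (\<lambda>i. c i * norm (f i) + c i * norm (g i)) I"
    using assms by (intro L2_set_mono) (auto simp: distrib_left[symmetric] intro: mult_left_mono norm_triangle_ineq)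
  also have "\<dots> \<le> L2_set (\<lambda>i. c i * norm (f i)) I + L2_set (\<lambda>i. c i * norm (g i)) I"
    by (rule L2_set_triangle_ineq)
  finally show ?thesis .
qed

lemma wn_triangle: "(\<And>i. 0 \<le> q $ i) \<Longrightarrow> wn q (u + v) \<le> wn q u + wn q v"
  unfolding wn_def vector_add_component by (rule L2_set_norm_triangle) simp

lemma wn_uminus: "wn q (- u) = wn q u"
  by (simp add: wn_def)

lemma wn_diff: "(\<And>i. 0 \<le> q $ i) \<Longrightarrow> wn q (u - v) \<le> wn q u + wn q v"
  using wn_triangle[of q u "- v"] by (simp add: wn_uminus)

lemma norm_eq_L2: "norm u = L2_set (\<lambda>i. norm (u $ i)) UNIV" for u :: "real^'p^'n"
  by (simp add: norm_vec_def)

lemma norm_power2_sum: "(norm u)\<^sup>2 = (\<Sum>i\<in>UNIV. (norm (u $ i))\<^sup>2)" for u :: "real^'p^'n"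
  by (simp add: norm_eq_L2 L2_set_def sum_nonneg)

lemma wn_le_norm:
  assumes "\<And>i. 0 \<le> q $ i" "\<And>i. q $ i \<le> 1"
  shows "wn q u \<le> norm u"
  unfolding wn_def norm_eq_L2 using assms by (intro L2_set_mono) (auto intro: mult_left_le_one_le)

lemma norm_le_wn:
  assumes "\<And>i. 1 / c\<^sup>2 \<le> q $ i" "0 < c"
  shows "norm u \<le> c * wn q u"
proof -
  have "norm (u $ i) \<le> c * (sqrt (q $ i) * norm (u $ i))" for i
  proof -
    have "sqrt (1 / c\<^sup>2) \<le> sqrt (q $ i)" using assms(1) by (rule real_sqrt_le_mono)
    then have "1 \<le> c * sqrt (q $ i)" using assms(2) by (simp add: real_sqrt_divide field_simps)
    from mult_right_mono[OF this, of "norm (u $ i)"] show ?thesis by (simp add: mult.assoc)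
  qed
  then have "norm u \<le> L2_set (\<lambda>i. c * (sqrt (q $ i) * norm (u $ i))) UNIV"
    unfolding norm_eq_L2 by (intro L2_set_mono) auto
  also have "\<dots> = c * wn q u"
    using assms(2) by (simp add: wn_def L2_set_right_distrib)
  finally show ?thesis .
qed

text \<open>Weights of at least \<open>1 / c\<^sup>2\<close> satisfy
  \<open>sqrt (q $ i) \<le> c * q $ i\<close>. Passing to a sum linear in the weights is what later
  assembles the individual step sizes into \<open>\<theta> k\<close>.\<close>

lemma wn_le_sum:
  assumes "\<And>i. 1 / c\<^sup>2 \<le> q $ i" "0 < c"
  shows "wn q u \<le> c * (\<Sum>i\<in>UNIV. q $ i * norm (u $ i))"
proof -
  have q: "0 \<le> q $ i" for i using assms(1)[of i] zero_le_divide_1_iff[of "c\<^sup>2"] by (meson order_trans zero_le_power2)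
  have "wn q u \<le> (\<Sum>i\<in>UNIV. sqrt (q $ i) * norm (u $ i))"
    unfolding wn_def using q by (intro L2_set_le_sum) auto
  also have "\<dots> \<le> (\<Sum>i\<in>UNIV. c * q $ i * norm (u $ i))"
  proof (intro sum_mono mult_right_mono)
    fix i
    have "sqrt (1 / c\<^sup>2) \<le> sqrt (q $ i)" using assms(1) by (rule real_sqrt_le_mono)
    then have "1 \<le> c * sqrt (q $ i)" using assms(2) by (simp add: real_sqrt_divide field_simps)
    then have "1 * sqrt (q $ i) \<le> c * sqrt (q $ i) * sqrt (q $ i)" using q by (intro mult_right_mono) auto
    also have "\<dots> = c * q $ i" using q by (simp add: mult.assoc)
    finally show "sqrt (q $ i) \<le> c * q $ i" by simp
  qed auto
  finally show ?thesis by (simp add: sum_distrib_left mult.assoc)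
qed

lemma norm_le_sum: "norm u \<le> (\<Sum>i\<in>UNIV. norm (u $ i))" for u :: "real^'p^'n"
  unfolding norm_eq_L2 by (rule L2_set_le_sum) auto

definition rep :: "real^'p \<Rightarrow> real^'p^'n" where "rep v = (\<chi> i. v)"

lemma rep_nth[simp]: "rep v $ i = v" by (simp add: rep_def)

lemma rep_0[simp]: "rep 0 = 0" by (simp add: rep_def Finite_Cartesian_Product.vec_eq_iff)

lemma weighted_avg_add: "weighted_avg q (u + v) = weighted_avg q u + weighted_avg q v"
  and weighted_avg_diff: "weighted_avg q (u - v) = weighted_avg q u - weighted_avg q v"
  by (simp_all add: weighted_avg_def scaleR_add_right scaleR_diff_right sum.distrib sum_subtractf)

lemma stochastic_vec_le_1: "stochastic_vec q \<Longrightarrow> q $ i \<le> 1"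
  using member_le_sum[of i UNIV "\<lambda>i. q $ i"] by (simp add: stochastic_vec_def)

lemma weighted_norm2_shift:
  assumes "stochastic_vec q"
  shows "weighted_norm2 q (u - rep v) = weighted_norm2 q (u - rep (weighted_avg q u)) + (norm (weighted_avg q u - v))\<^sup>2"
  using weighted_sum_shift[of "\<lambda>i. q $ i" "\<lambda>i. u $ i" 1 "weighted_avg q u" v] assms
  by (simp add: weighted_norm2_def weighted_avg_def stochastic_vec_def)

lemma wn_centre:
  assumes "stochastic_vec q"
  shows "wn q (u - rep (weighted_avg q u)) \<le> wn q u"
proof (rule power2_le_imp_le[OF _ wn_nonneg])
  show "(wn q (u - rep (weighted_avg q u)))\<^sup>2 \<le> (wn q u)\<^sup>2"
    using weighted_norm2_shift[OF assms, of u 0] assms by (simp add: wn_power2 stochastic_vec_def)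
qed

lemma norm_weighted_avg_le:
  assumes "stochastic_vec q"
  shows "norm (weighted_avg q u) \<le> wn q u"
proof (rule power2_le_imp_le[OF _ wn_nonneg])
  have "0 \<le> weighted_norm2 q (u - rep (weighted_avg q u))"
    using assms by (auto simp: weighted_norm2_def stochastic_vec_def intro!: sum_nonneg)
  then show "(norm (weighted_avg q u))\<^sup>2 \<le> (wn q u)\<^sup>2"
    using weighted_norm2_shift[OF assms, of u 0] assms by (simp add: wn_power2 stochastic_vec_def)
qed


section \<open>The tracking seminorm\<close>

lemma S_err_eq_L2:
  "(\<And>i. 0 \<le> p $ i) \<Longrightarrow> S_err y p = L2_set (\<lambda>i. sqrt (p $ i) * norm ((1 / p $ i) *\<^sub>R y $ i - (\<Sum>j\<in>UNIV. y $ j))) UNIV"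
  by (simp add: S_err_def L2_set_def power_mult_distrib)

lemma S_err_nonneg: "(\<And>i. 0 \<le> p $ i) \<Longrightarrow> 0 \<le> S_err y p"
  by (simp add: S_err_eq_L2 L2_set_nonneg)

lemma S_err_triangle:
  assumes "\<And>i. 0 \<le> p $ i"
  shows "S_err (u + v) p \<le> S_err u p + S_err v p"
proof -
  have *: "(1 / p $ i) *\<^sub>R (u + v) $ i - (\<Sum>j\<in>UNIV. (u + v) $ j) =
      ((1 / p $ i) *\<^sub>R u $ i - (\<Sum>j\<in>UNIV. u $ j)) + ((1 / p $ i) *\<^sub>R v $ i - (\<Sum>j\<in>UNIV. v $ j))" for i
    by (simp add: scaleR_add_right sum.distrib)
  show ?thesis unfolding S_err_eq_L2[OF assms] * by (rule L2_set_norm_triangle) (simp add: assms)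
qed

locale positive_weights =
  fixes p :: "real^'n"
  assumes pos: "\<And>i. 0 < p $ i" and sum1: "(\<Sum>i\<in>UNIV. p $ i) = 1"
begin

text \<open>The parallel-axis identity with reference point 0, applied to the ratios of y to p,
  whose weighted mean is the sum of the components of y.\<close>

lemma S_err_power2:
  "(S_err y p)\<^sup>2 = (\<Sum>i\<in>UNIV. (norm (y $ i))\<^sup>2 / p $ i) - (norm (\<Sum>j\<in>UNIV. y $ j))\<^sup>2"
proof -
  have "(\<Sum>i\<in>UNIV. p $ i * (norm ((1 / p $ i) *\<^sub>R y $ i - 0))\<^sup>2) =
    (\<Sum>i\<in>UNIV. p $ i * (norm ((1 / p $ i) *\<^sub>R y $ i - (\<Sum>j\<in>UNIV. y $ j)))\<^sup>2) + 1 * (norm ((\<Sum>j\<in>UNIV. y $ j) - 0))\<^sup>2"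
    using pos by (intro weighted_sum_shift) (auto simp: sum1 less_imp_neq[symmetric])
  moreover have "p $ i * (norm ((1 / p $ i) *\<^sub>R y $ i - 0))\<^sup>2 = (norm (y $ i))\<^sup>2 / p $ i" for i
    using pos[of i] by (simp add: power_divide field_simps power2_eq_square)
  ultimately show ?thesis
    using pos by (simp add: S_err_def sum_nonneg less_imp_le)
qed

lemma le_1: "p $ i \<le> 1"
  using member_le_sum[of i UNIV "\<lambda>i. p $ i"] pos sum1 by (simp add: less_imp_le)

lemma norm_power2_le: "(norm y)\<^sup>2 \<le> (S_err y p)\<^sup>2 + (norm (\<Sum>j\<in>UNIV. y $ j))\<^sup>2"
proof -
  have "(norm y)\<^sup>2 \<le> (\<Sum>i\<in>UNIV. (norm (y $ i))\<^sup>2 / p $ i)"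
    unfolding norm_power2_sum using pos le_1
    by (intro sum_mono) (simp add: pos_le_divide_eq mult_left_le)
  then show ?thesis by (simp add: S_err_power2)
qed

lemma S_err_le_norm:
  assumes "\<And>i. 1 / c\<^sup>2 \<le> p $ i" "0 < c"
  shows "S_err y p \<le> c * norm y"
proof (rule power2_le_imp_le)
  have "(S_err y p)\<^sup>2 \<le> (\<Sum>i\<in>UNIV. (norm (y $ i))\<^sup>2 / p $ i)" by (simp add: S_err_power2)
  also have "\<dots> \<le> (\<Sum>i\<in>UNIV. c\<^sup>2 * (norm (y $ i))\<^sup>2)"
  proof (rule sum_mono)
    fix i
    have "1 \<le> c\<^sup>2 * p $ i" using assms(1)[of i] assms(2) by (simp add: field_simps)
    then have "(norm (y $ i))\<^sup>2 * 1 \<le> (norm (y $ i))\<^sup>2 * (c\<^sup>2 * p $ i)" by (intro mult_left_mono) auto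
    then show "(norm (y $ i))\<^sup>2 / p $ i \<le> c\<^sup>2 * (norm (y $ i))\<^sup>2"
      using pos[of i] by (simp add: pos_divide_le_eq mult_ac)
  qed
  also have "\<dots> = (c * norm y)\<^sup>2" by (simp add: norm_power2_sum power_mult_distrib sum_distrib_left)
  finally show "(S_err y p)\<^sup>2 \<le> (c * norm y)\<^sup>2" .
qed (use assms(2) in auto)

lemma norm_component_le:
  assumes "\<And>i. 1 / c\<^sup>2 \<le> p $ i" "0 < c"
  shows "norm ((1 / p $ i) *\<^sub>R y $ i - (\<Sum>j\<in>UNIV. y $ j)) \<le> c * S_err y p"
proof -
  let ?a = "norm ((1 / p $ i) *\<^sub>R y $ i - (\<Sum>j\<in>UNIV. y $ j))"
  have "sqrt (1 / c\<^sup>2) \<le> sqrt (p $ i)" using assms(1) by (rule real_sqrt_le_mono)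
  then have "1 \<le> c * sqrt (p $ i)" using assms(2) by (simp add: real_sqrt_divide field_simps)
  then have "?a \<le> c * sqrt (p $ i) * ?a" using mult_right_mono[of 1 "c * sqrt (p $ i)" ?a] by simp
  also have "\<dots> \<le> c * S_err y p"
    unfolding S_err_eq_L2[OF less_imp_le[OF pos]] mult.assoc using assms(2) member_le_L2_set[of UNIV i "\<lambda>i. sqrt (p $ i) * norm ((1 / p $ i) *\<^sub>R y $ i - (\<Sum>j\<in>UNIV. y $ j))"]
    by (intro mult_left_mono) auto
  finally show ?thesis .
qed

end

text \<open>The square root of 1 - k is at most 1 - k / 2. The case \<open>b = 0\<close> is separate
  because \<open>k \<le> 1\<close> is inferred from the first assumption with b nonzero.\<close>

lemma power2_contraction:
  fixes a b k :: real
  assumes "a\<^sup>2 \<le> (1 - k) * b\<^sup>2" "0 \<le> a" "0 \<le> b" "0 \<le> k"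
  shows "a \<le> (1 - k / 2) * b"
proof (cases "b = 0")
  case True
  then show ?thesis using assms by simp
next
  case False
  have k: "k \<le> 1"
  proof (rule ccontr)
    assume "\<not> k \<le> 1"
    then have "(1 - k) * b\<^sup>2 < 0" using False by (simp add: mult_neg_pos)
    then show False using assms(1) zero_le_power2[of a] by linarith
  qed
  have "(1 - k) * b\<^sup>2 \<le> (1 - k / 2)\<^sup>2 * b\<^sup>2"
    by (intro mult_right_mono) (simp_all add: power2_eq_square algebra_simps)
  then have "a\<^sup>2 \<le> ((1 - k / 2) * b)\<^sup>2" using assms(1) by (simp add: power_mult_distrib)
  then show ?thesis by (rule power2_le_imp_le) (use k assms(3) in simp)
qed

text \<open>When the square is expanded, the quadratic term costs at most a fiftieth of
  \<open>t * M\<close>, and 2 - 1/50 is twice 99/100, the linear coefficient of the squared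
  factor.\<close>

lemma gradient_step_contraction:
  fixes v d :: "'v::real_inner"
  assumes "M * (norm d)\<^sup>2 \<le> inner v d" "norm v \<le> K * norm d" "0 \<le> t" "t * K\<^sup>2 \<le> M / 50" "t * M \<le> 1"
  shows "norm (d - t *\<^sub>R v) \<le> (1 - 99 / 100 * (t * M)) * norm d"
proof (rule power2_le_imp_le)
  have "(norm (d - t *\<^sub>R v))\<^sup>2 = (norm d)\<^sup>2 - 2 * t * inner v d + t\<^sup>2 * (norm v)\<^sup>2"
    unfolding power2_norm_eq_inner by (simp add: algebra_simps inner_commute power2_eq_square)
  also have "\<dots> \<le> (norm d)\<^sup>2 - 2 * t * (M * (norm d)\<^sup>2) + t\<^sup>2 * (K * norm d)\<^sup>2"
    using assms by (intro add_mono diff_mono mult_left_mono power_mono) auto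
  also have "\<dots> = (1 - 2 * (t * M) + t * (t * K\<^sup>2)) * (norm d)\<^sup>2"
    by (simp add: power_mult_distrib power2_eq_square algebra_simps)
  also have "\<dots> \<le> (1 - 99 / 100 * (t * M))\<^sup>2 * (norm d)\<^sup>2"
  proof (intro mult_right_mono)
    have "t * (t * K\<^sup>2) \<le> t * (M / 50)" using assms by (intro mult_left_mono) auto
    moreover have "t * (M / 50) = 1 / 50 * (t * M)" by simp
    moreover have *: "(1 - 99 / 100 * (t * M))\<^sup>2 = 1 - 99 / 50 * (t * M) + (99 / 100 * (t * M))\<^sup>2"
      by (simp add: power2_eq_square field_simps)
    moreover have "0 \<le> (99 / 100 * (t * M))\<^sup>2" by simp
    ultimately show "1 - 2 * (t * M) + t * (t * K\<^sup>2) \<le> (1 - 99 / 100 * (t * M))\<^sup>2"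
      unfolding * by linarith
  qed simp
  finally show "(norm (d - t *\<^sub>R v))\<^sup>2 \<le> ((1 - 99 / 100 * (t * M)) * norm d)\<^sup>2" by (simp add: power_mult_distrib)
  show "0 \<le> (1 - 99 / 100 * (t * M)) * norm d" using assms(5) by (intro mult_nonneg_nonneg) auto
qed

section \<open>The stochastic iteration\<close>

text \<open>Strong convexity enters through \<open>critical\<close> and \<open>monotone\<close>, and
  the graphs through the weight vectors and the diagonal of \<open>B\<close>; contraction rates are
  added in an extension of this locale.\<close>

locale push_pull =
  fixes P :: "'s measure" and Z :: "'n::finite \<Rightarrow> 'z measure" and \<xi> :: "nat \<Rightarrow> 'n \<Rightarrow> 's \<Rightarrow> 'z"
    and g :: "'n \<Rightarrow> real^'p \<Rightarrow> 'z \<Rightarrow> real^'p" and grad :: "'n \<Rightarrow> real^'p \<Rightarrow> real^'p"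
    and A B :: "nat \<Rightarrow> real^'n^'n" and \<alpha> \<beta> :: "real^'n" and xm1 x0 :: "real^'p^'n"
    and x y :: "nat \<Rightarrow> 's \<Rightarrow> real^'p^'n" and \<phi> :: "nat \<Rightarrow> real^'n" and xstar :: "real^'p"
    and n L mu \<sigma> b abar bbar vphi mm :: real
  assumes n_card: "n = real CARD('n)"
    and sg: "stochastic_gradients P Z \<xi> g grad \<sigma>"
    and alg: "algorithm_iterates P \<xi> g A B \<alpha> \<beta> xm1 x0 x y"
    and L: "0 < L" and mu: "0 < mu" and \<sigma>: "0 < \<sigma>"
    and lip: "\<And>i u v. norm (grad i u - grad i v) \<le> L * norm (u - v)"
    and A: "\<And>k. row_stochastic (A k)" and B: "\<And>k. col_stochastic (B k)"
    and b: "0 < b" "\<And>k i. b \<le> B k $ i $ i"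
    and \<phi>: "\<And>k. stochastic_vec (\<phi> k)" "\<And>k. \<phi> (Suc k) v* A k = \<phi> k" "\<And>k i. 1 / vphi\<^sup>2 \<le> \<phi> k $ i" "0 < vphi"
    and mm: "0 < mm" "\<And>k i. mm \<le> pi_seq B k $ i"
    and \<alpha>: "\<And>i. 0 < \<alpha> $ i" "\<And>i. \<alpha> $ i \<le> abar" and \<beta>: "\<And>i. 0 \<le> \<beta> $ i" "\<And>i. \<beta> $ i \<le> bbar"
    and critical: "(\<Sum>i\<in>UNIV. grad i xstar) = 0"
    and monotone: "\<And>u. n * mu * (norm (u - xstar))\<^sup>2 \<le> inner (\<Sum>i\<in>UNIV. grad i u) (u - xstar)"
    and mu_L: "mu \<le> L"
    and small: "n * abar * L\<^sup>2 \<le> mu / 96"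
begin

abbreviation "\<pi> \<equiv> pi_seq B"
abbreviation "sample \<equiv> (\<lambda>(k, i). \<xi> k i)"
abbreviation "sp \<equiv> (\<lambda>(k :: nat, i). Z i)"
text \<open>The inequality is strict because the k-th iterate x uses samples before time k, whereas
  the tracker y of index k already uses those of time k.\<close>

abbreviation hist :: "nat \<Rightarrow> 's measure" where
  "hist k \<equiv> history P sp sample {(t, i). t < k}"

lemma n_pos: "0 < n" by (simp add: n_card)

lemma prob_space_P: "prob_space P" using sg by (simp add: stochastic_gradients_def)

sublocale prob_space P by (rule prob_space_P)

lemma indep: "indep_vars sp sample UNIV"
  using sg by (simp add: stochastic_gradients_def)

lemma sample_measurable: "sample j \<in> measurable P (sp j)"
  using indep unfolding indep_vars_def by blast

lemma g_measurable[measurable]: "(\<lambda>(x, z). g i x z) \<in> borel_measurable (borel \<Otimes>\<^sub>M Z i)"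
  using sg by (simp add: stochastic_gradients_def)

lemma grad_continuous: "continuous_on UNIV (grad i)"
  using lip L by (intro lipschitz_on_continuous_on[of L] lipschitz_onI) (auto simp: dist_norm)

lemma grad_measurable[measurable]: "grad i \<in> borel_measurable borel"
  by (rule borel_measurable_continuous_onI[OF grad_continuous])

definition h :: "'n \<Rightarrow> real^'p \<Rightarrow> 'z \<Rightarrow> real^'p" where "h i u z = g i u z - grad i u"

lemma h_measurable[measurable]: "(\<lambda>(x, z). h i x z) \<in> borel_measurable (borel \<Otimes>\<^sub>M Z i)"
proof -
  have "(\<lambda>p. g i (fst p) (snd p)) \<in> borel_measurable (borel \<Otimes>\<^sub>M Z i)"
    using g_measurable[of i] by (simp add: case_prod_unfold)
  then show ?thesis unfolding h_def case_prod_unfold by measurable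
qed

lemma h_mean: "integrable P (\<lambda>s. h i u (\<xi> k i s))" "(\<integral>s. h i u (\<xi> k i s) \<partial>P) = 0"
  using sg by (simp_all add: stochastic_gradients_def h_def prob_space)

lemma h_var: "integrable P (\<lambda>s. (norm (h i u (\<xi> k i s)))\<^sup>2)" "(\<integral>s. (norm (h i u (\<xi> k i s)))\<^sup>2 \<partial>P) \<le> \<sigma>\<^sup>2"
  using sg by (simp_all add: stochastic_gradients_def h_def)

lemma x_0: "s \<in> space P \<Longrightarrow> x 0 s $ i = x0 $ i"
  and y_0: "s \<in> space P \<Longrightarrow> y 0 s $ i = g i (x0 $ i) (\<xi> 0 i s)"
  and x_Suc: "s \<in> space P \<Longrightarrow> x (Suc k) s $ i = (\<Sum>j\<in>UNIV. A k $ i $ j *\<^sub>R x k s $ j) - \<alpha> $ i *\<^sub>R y k s $ i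
      + \<beta> $ i *\<^sub>R (x k s $ i - prev_iterate xm1 x k s $ i)"
  and y_Suc: "s \<in> space P \<Longrightarrow> y (Suc k) s $ i = (\<Sum>j\<in>UNIV. B k $ i $ j *\<^sub>R y k s $ j)
      + g i (x (Suc k) s $ i) (\<xi> (Suc k) i s) - g i (x k s $ i) (\<xi> k i s)"
  using alg by (simp_all add: algorithm_iterates_def)

definition nz :: "nat \<Rightarrow> 'n \<Rightarrow> 's \<Rightarrow> real^'p" where "nz k i s = h i (x k s $ i) (\<xi> k i s)"

lemma g_eq: "g i (x k s $ i) (\<xi> k i s) = grad i (x k s $ i) + nz k i s"
  by (simp add: nz_def h_def)

lemma hist_mono: "j \<le> k \<Longrightarrow> f \<in> measurable (hist j) N \<Longrightarrow> f \<in> measurable (hist k) N"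
  by (rule measurable_history_mono[where X = sample and M = P and N = sp and J = "{(t, i). t < j}", OF sample_measurable]) auto

lemma hist_imp: "f \<in> measurable (hist k) N \<Longrightarrow> f \<in> measurable P N"
  by (rule measurable_history_imp[where X = sample and M = P and N = sp, OF sample_measurable])

lemma xi_hist: "t < k \<Longrightarrow> \<xi> t i \<in> measurable (hist k) (Z i)"
  using measurable_history_component[where X = sample and M = P and N = sp and J = "{(t, i). t < k}" and j = "(t, i)", OF sample_measurable] by simp

lemma g_hist:
  assumes "(\<lambda>s. u s $ i) \<in> borel_measurable (hist k)" "t < k"
  shows "(\<lambda>s. g i (u s $ i) (\<xi> t i s)) \<in> borel_measurable (hist k)"
  using measurable_compose[OF measurable_Pair[OF assms(1) xi_hist[OF assms(2), of i]] g_measurable[of i]] by simp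

lemma xy_hist:
  "(\<forall>i. (\<lambda>s. x k s $ i) \<in> borel_measurable (hist k)) \<and>
   (\<forall>i. (\<lambda>s. prev_iterate xm1 x k s $ i) \<in> borel_measurable (hist k)) \<and>
   (\<forall>i. (\<lambda>s. y k s $ i) \<in> borel_measurable (hist (Suc k)))"
proof (induction k)
  case 0
  have x: "(\<lambda>s. x 0 s $ i) \<in> borel_measurable (hist k)" for i k
    by (subst measurable_cong[where g = "\<lambda>s. x0 $ i"]) (simp_all add: x_0)
  have p: "(\<lambda>s. prev_iterate xm1 x 0 s $ i) \<in> borel_measurable (hist 0)" for i
    by (simp add: prev_iterate_def)
  have y: "(\<lambda>s. y 0 s $ i) \<in> borel_measurable (hist (Suc 0))" for i
  proof (subst measurable_cong[where g = "\<lambda>s. g i (x 0 s $ i) (\<xi> 0 i s)"])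
    show "(\<lambda>s. g i (x 0 s $ i) (\<xi> 0 i s)) \<in> borel_measurable (hist (Suc 0))" by (rule g_hist[OF x]) simp
  qed (simp add: y_0 x_0)
  show ?case using x p y by blast
next
  case (Suc k)
  have xk: "(\<lambda>s. x k s $ i) \<in> borel_measurable (hist (Suc k))"
    and pk: "(\<lambda>s. prev_iterate xm1 x k s $ i) \<in> borel_measurable (hist (Suc k))"
    and yk: "(\<lambda>s. y k s $ i) \<in> borel_measurable (hist (Suc k))" for i
    using Suc hist_mono[of k "Suc k"] by auto
  have x': "(\<lambda>s. x (Suc k) s $ i) \<in> borel_measurable (hist (Suc k))" for i
  proof (subst measurable_cong[where g = "\<lambda>s. (\<Sum>j\<in>UNIV. A k $ i $ j *\<^sub>R x k s $ j) - \<alpha> $ i *\<^sub>R y k s $ i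
      + \<beta> $ i *\<^sub>R (x k s $ i - prev_iterate xm1 x k s $ i)"])
    show "(\<lambda>s. (\<Sum>j\<in>UNIV. A k $ i $ j *\<^sub>R x k s $ j) - \<alpha> $ i *\<^sub>R y k s $ i
      + \<beta> $ i *\<^sub>R (x k s $ i - prev_iterate xm1 x k s $ i)) \<in> borel_measurable (hist (Suc k))"
      using xk pk yk by measurable
  qed (simp add: x_Suc)
  have p': "(\<lambda>s. prev_iterate xm1 x (Suc k) s $ i) \<in> borel_measurable (hist (Suc k))" for i
    using xk by (simp add: prev_iterate_def)
  have "(\<lambda>s. y (Suc k) s $ i) \<in> borel_measurable (hist (Suc (Suc k)))" for i
  proof (subst measurable_cong[where g = "\<lambda>s. (\<Sum>j\<in>UNIV. B k $ i $ j *\<^sub>R y k s $ j)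
      + g i (x (Suc k) s $ i) (\<xi> (Suc k) i s) - g i (x k s $ i) (\<xi> k i s)"])
    have [measurable]: "(\<lambda>s. y k s $ j) \<in> borel_measurable (hist (Suc (Suc k)))" for j
      by (rule hist_mono[OF _ yk]) simp
    have [measurable]: "(\<lambda>s. g i (x (Suc k) s $ i) (\<xi> (Suc k) i s)) \<in> borel_measurable (hist (Suc (Suc k)))"
      by (rule g_hist[OF hist_mono[OF _ x']]) simp_all
    have [measurable]: "(\<lambda>s. g i (x k s $ i) (\<xi> k i s)) \<in> borel_measurable (hist (Suc (Suc k)))"
      by (rule g_hist[OF hist_mono[OF _ xk]]) simp_all
    show "(\<lambda>s. (\<Sum>j\<in>UNIV. B k $ i $ j *\<^sub>R y k s $ j)
      + g i (x (Suc k) s $ i) (\<xi> (Suc k) i s) - g i (x k s $ i) (\<xi> k i s)) \<in> borel_measurable (hist (Suc (Suc k)))"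
      by measurable
  qed (simp add: y_Suc)
  then show ?case using x' p' by blast
qed

lemma x_hist: "(\<lambda>s. x k s $ i) \<in> borel_measurable (hist k)"
  using xy_hist by blast

lemma noise_bound:
  assumes U: "U \<in> borel_measurable (hist k)" "integrable P (\<lambda>s. (norm (U s))\<^sup>2)"
  shows "integrable P (\<lambda>s. (norm (U s + (\<Sum>i\<in>I. v i *\<^sub>R nz k i s)))\<^sup>2) \<and>
    (\<integral>s. (norm (U s + (\<Sum>i\<in>I. v i *\<^sub>R nz k i s)))\<^sup>2 \<partial>P) \<le> (\<integral>s. (norm (U s))\<^sup>2 \<partial>P) + \<sigma>\<^sup>2 * (\<Sum>i\<in>I. (v i)\<^sup>2)"
  using centered_noise_sum_bound[where N = sp and X = sample and \<iota> = "\<lambda>i. (k, i)" and J = "{(t, i). t < k}"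
      and U = U and x = "\<lambda>i s. x k s $ i" and h = h and \<sigma> = \<sigma> and I = I and v = v, OF indep]
  unfolding nz_def using U x_hist h_measurable h_mean h_var by (simp add: inj_on_def)

lemma nz_sq_integrable: "sq_integrable P (nz k i)"
proof -
  have "integrable P (\<lambda>s. (norm (nz k i s))\<^sup>2)"
    using noise_bound[where U = "\<lambda>_. 0" and k = k and I = "{i}" and v = "\<lambda>_. 1"] by simp
  moreover have "nz k i \<in> borel_measurable P"
  proof -
    have [measurable]: "(\<lambda>s. x k s $ i) \<in> borel_measurable P" by (rule hist_imp[OF x_hist])
    have "(\<lambda>s. g i (x k s $ i) (\<xi> k i s)) \<in> borel_measurable P"
      by (rule hist_imp[OF g_hist[OF hist_mono[OF _ x_hist]], of k "Suc k"]) simp_all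
    then show ?thesis unfolding nz_def h_def by measurable
  qed
  ultimately show ?thesis by (simp add: sq_integrable_def)
qed

lemma sq_grad:
  assumes "sq_integrable P u"
  shows "sq_integrable P (\<lambda>s. grad i (u s))"
proof (rule sq_integrable_bound)
  have [measurable]: "u \<in> borel_measurable P" using assms by (rule sq_integrable_measurable)
  show "(\<lambda>s. grad i (u s)) \<in> borel_measurable P" by measurable
  show "sq_integrable P (\<lambda>s. norm (grad i 0) + L * norm (u s))"
    by (intro sq_integrable_add sq_integrable_const sq_integrable_cmult sq_integrable_norm assms finite_measure_axioms)
  show "norm (grad i (u s)) \<le> norm (norm (grad i 0) + L * norm (u s))" for s
    using norm_triangle_sub[of "grad i (u s)" "grad i 0"] lip[of i "u s" 0] L by simp
qed

lemma sq_cong: "(\<And>s. s \<in> space P \<Longrightarrow> f s = f' s) \<Longrightarrow> sq_integrable P f' \<Longrightarrow> sq_integrable P f"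
  using sq_integrable_bound[of P f' f] measurable_cong[of P f f' borel] by (auto dest: sq_integrable_measurable)

lemma sq_g: "sq_integrable P (\<lambda>s. x k s $ i) \<Longrightarrow> sq_integrable P (\<lambda>s. g i (x k s $ i) (\<xi> k i s))"
  unfolding g_eq by (intro sq_integrable_add sq_grad nz_sq_integrable)

lemma xy_sq:
  "(\<forall>i. sq_integrable P (\<lambda>s. x k s $ i)) \<and> (\<forall>i. sq_integrable P (\<lambda>s. prev_iterate xm1 x k s $ i))
    \<and> (\<forall>i. sq_integrable P (\<lambda>s. y k s $ i))"
proof (induction k)
  case 0
  have x: "sq_integrable P (\<lambda>s. x 0 s $ i)" for i
    by (rule sq_cong[OF _ sq_integrable_const[OF finite_measure_axioms, of "x0 $ i"]]) (simp add: x_0)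
  have "sq_integrable P (\<lambda>s. y 0 s $ i)" for i
    by (rule sq_cong[OF _ sq_g[OF x]]) (simp add: y_0 x_0)
  then show ?case using x by (simp add: prev_iterate_def sq_integrable_const[OF finite_measure_axioms])
next
  case (Suc k)
  note sums = sq_integrable_add sq_integrable_minus sq_integrable_scaleR sq_integrable_sum[OF finite_measure_axioms]
  have x: "sq_integrable P (\<lambda>s. x (Suc k) s $ i)" for i
  proof (rule sq_cong)
    show "sq_integrable P (\<lambda>s. (\<Sum>j\<in>UNIV. A k $ i $ j *\<^sub>R x k s $ j) - \<alpha> $ i *\<^sub>R y k s $ i
      + \<beta> $ i *\<^sub>R (x k s $ i - prev_iterate xm1 x k s $ i))" using Suc by (intro sums) auto
  qed (simp add: x_Suc)
  have "sq_integrable P (\<lambda>s. y (Suc k) s $ i)" for i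
  proof (rule sq_cong)
    show "sq_integrable P (\<lambda>s. (\<Sum>j\<in>UNIV. B k $ i $ j *\<^sub>R y k s $ j)
      + g i (x (Suc k) s $ i) (\<xi> (Suc k) i s) - g i (x k s $ i) (\<xi> k i s))"
      using Suc x by (intro sums sq_g) auto
  qed (simp add: y_Suc)
  then show ?case using Suc x by (simp add: prev_iterate_def)
qed

lemmas x_sq = xy_sq[THEN conjunct1, rule_format]
  and prev_sq = xy_sq[THEN conjunct2, THEN conjunct1, rule_format]
  and y_sq = xy_sq[THEN conjunct2, THEN conjunct2, rule_format]

text \<open>By linearity the tracker splits into the part driven by the noise and a part in which the
  noise occurs only through the iterates.\<close>

primrec zeta :: "nat \<Rightarrow> 's \<Rightarrow> real^'p^'n" where
  "zeta 0 s = (\<chi> i. nz 0 i s)"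
| "zeta (Suc k) s = (\<chi> i. (\<Sum>j\<in>UNIV. B k $ i $ j *\<^sub>R zeta k s $ j) + nz (Suc k) i s - nz k i s)"

definition ybar :: "nat \<Rightarrow> 's \<Rightarrow> real^'p^'n" where "ybar k s = y k s - zeta k s"

definition mixB :: "nat \<Rightarrow> real^'p^'n \<Rightarrow> real^'p^'n" where
  "mixB k u = (\<chi> i. \<Sum>j\<in>UNIV. B k $ i $ j *\<^sub>R u $ j)"

definition mixA :: "nat \<Rightarrow> real^'p^'n \<Rightarrow> real^'p^'n" where
  "mixA k u = (\<chi> i. \<Sum>j\<in>UNIV. A k $ i $ j *\<^sub>R u $ j)"

definition gradx :: "real^'p^'n \<Rightarrow> real^'p^'n" where "gradx u = (\<chi> i. grad i (u $ i))"

lemma ybar_Suc: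
  assumes "s \<in> space P"
  shows "ybar (Suc k) s = mixB k (ybar k s) + (gradx (x (Suc k) s) - gradx (x k s))"
  using assms unfolding Finite_Cartesian_Product.vec_eq_iff
  by (auto simp: ybar_def mixB_def gradx_def y_Suc g_eq scaleR_diff_right sum_subtractf)

lemma ybar_0: "s \<in> space P \<Longrightarrow> ybar 0 s = gradx (x 0 s)"
  unfolding Finite_Cartesian_Product.vec_eq_iff by (auto simp: ybar_def gradx_def y_0 nz_def h_def x_0)

lemma colB: "(\<Sum>i\<in>UNIV. B k $ i $ j) = 1" "0 \<le> B k $ i $ j"
  using B[of k] by (auto simp: col_stochastic_def Finite_Cartesian_Product.vec_eq_iff vector_matrix_mult_def)

lemma \<phi>A: "(\<Sum>i\<in>UNIV. \<phi> (Suc k) $ i * A k $ i $ j) = \<phi> k $ j"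
  using arg_cong[OF \<phi>(2)[of k], of "\<lambda>v. v $ j"] by (simp add: vector_matrix_mult_def mult.commute)

lemma \<pi>B: "(\<Sum>j\<in>UNIV. B k $ i $ j * \<pi> k $ j) = \<pi> (Suc k) $ i"
  by (simp add: matrix_vector_mult_def)

lemma \<phi>_pos: "0 < \<phi> k $ i" "0 \<le> \<phi> k $ i" "\<phi> k $ i \<le> 1" "(\<Sum>i\<in>UNIV. \<phi> k $ i) = 1"
proof -
  have "0 < 1 / vphi\<^sup>2" using \<phi>(4) by simp
  then show "0 < \<phi> k $ i" using \<phi>(3)[of k i] by linarith
  then show "0 \<le> \<phi> k $ i" by simp
  show "\<phi> k $ i \<le> 1" by (rule stochastic_vec_le_1[OF \<phi>(1)])
  show "(\<Sum>i\<in>UNIV. \<phi> k $ i) = 1" using \<phi>(1) by (simp add: stochastic_vec_def)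
qed

lemma \<pi>_sum: "(\<Sum>i\<in>UNIV. \<pi> k $ i) = 1"
proof (induction k)
  case 0 then show ?case by simp
next
  case (Suc k)
  have "(\<Sum>i\<in>UNIV. \<pi> (Suc k) $ i) = (\<Sum>j\<in>UNIV. \<Sum>i\<in>UNIV. B k $ i $ j * \<pi> k $ j)"
    unfolding \<pi>B[symmetric] by (rule sum.swap)
  also have "\<dots> = 1" by (simp add: sum_distrib_right[symmetric] colB Suc)
  finally show ?case .
qed

sublocale pw: positive_weights "\<pi> k" for k
  by unfold_locales (use mm \<pi>_sum in \<open>auto intro: less_le_trans\<close>)

lemma sum_mixB: "(\<Sum>i\<in>UNIV. mixB k u $ i) = (\<Sum>j\<in>UNIV. u $ j)"
proof -
  have "(\<Sum>i\<in>UNIV. mixB k u $ i) = (\<Sum>j\<in>UNIV. \<Sum>i\<in>UNIV. B k $ i $ j *\<^sub>R u $ j)"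
    unfolding mixB_def by (simp, rule sum.swap)
  also have "\<dots> = (\<Sum>j\<in>UNIV. u $ j)" by (simp add: scaleR_left.sum[symmetric] colB)
  finally show ?thesis .
qed

text \<open>Column-stochastic mixing preserves the sum, so the gradient increments telescope to the
  gradients at the current iterates.\<close>

lemma sum_ybar: "s \<in> space P \<Longrightarrow> (\<Sum>i\<in>UNIV. ybar k s $ i) = (\<Sum>i\<in>UNIV. grad i (x k s $ i))"
  by (induction k) (simp_all add: ybar_0 ybar_Suc sum.distrib sum_subtractf sum_mixB gradx_def)

lemma weighted_avg_mixA: "weighted_avg (\<phi> (Suc k)) (mixA k u) = weighted_avg (\<phi> k) u"
proof -
  have "weighted_avg (\<phi> (Suc k)) (mixA k u) = (\<Sum>j\<in>UNIV. \<Sum>i\<in>UNIV. (\<phi> (Suc k) $ i * A k $ i $ j) *\<^sub>R u $ j)"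
    unfolding mixA_def weighted_avg_def by (simp add: scaleR_sum_right, rule sum.swap)
  also have "\<dots> = weighted_avg (\<phi> k) u"
    by (simp add: weighted_avg_def scaleR_left.sum[symmetric] \<phi>A)
  finally show ?thesis .
qed


subsection \<open>Second moments of the accumulated noise\<close>

text \<open>Without its newest sample the accumulated noise is known before time k, so
  \<open>nz k\<close> is new relative to it.\<close>

lemma zeta_hist: "(\<lambda>s. zeta k s $ i - nz k i s) \<in> borel_measurable (hist k) \<and> (\<lambda>s. zeta k s $ i) \<in> borel_measurable (hist (Suc k))"
proof (induction k arbitrary: i)
  have nzm: "nz k i \<in> borel_measurable (hist (Suc k))" for k i
  proof -
    have [measurable]: "(\<lambda>s. x k s $ i) \<in> borel_measurable (hist (Suc k))" by (rule hist_mono[OF _ x_hist]) simp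
    have [measurable]: "(\<lambda>s. g i (x k s $ i) (\<xi> k i s)) \<in> borel_measurable (hist (Suc k))" by (rule g_hist) simp_all
    show ?thesis unfolding nz_def h_def by measurable
  qed
  {
    case 0
    show ?case using nzm[of 0 i] by simp
  next
    case (Suc k)
    have [measurable]: "(\<lambda>s. zeta k s $ j) \<in> borel_measurable (hist (Suc k))" for j using Suc by blast
    have [measurable]: "nz k i \<in> borel_measurable (hist (Suc k))" by (rule nzm)
    have 1: "(\<lambda>s. zeta (Suc k) s $ i - nz (Suc k) i s) \<in> borel_measurable (hist (Suc k))"
      by simp measurable
    have "(\<lambda>s. (zeta (Suc k) s $ i - nz (Suc k) i s) + nz (Suc k) i s) \<in> borel_measurable (hist (Suc (Suc k)))"
      by (intro borel_measurable_add nzm hist_mono[OF _ 1]) simp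
    then have "(\<lambda>s. zeta (Suc k) s $ i) \<in> borel_measurable (hist (Suc (Suc k)))" by (simp only: diff_add_cancel)
    then show ?case using 1 by blast
  }
qed

lemma zeta_sq: "sq_integrable P (\<lambda>s. zeta k s $ i)"
  by (induction k arbitrary: i)
    (auto intro!: sq_integrable_add sq_integrable_minus sq_integrable_scaleR sq_integrable_sum[OF finite_measure_axioms] nz_sq_integrable)

text \<open>All linear functionals are bounded at once, because one step replaces the test vector v
  by its image w under the transpose of \<open>B k\<close>. A sample enters with coefficient 1 and
  is subtracted one step later, so it is left with coefficient w - v, and
  \<open>column_stochastic_energy\<close> pays for the square of this. The bound therefore does not
  grow with k.\<close>

lemma zeta_moment:
  "(\<integral>s. (norm (\<Sum>i\<in>UNIV. v i *\<^sub>R (zeta k s $ i - nz k i s)))\<^sup>2 \<partial>P) \<le> \<sigma>\<^sup>2 / (b * mm) * (\<Sum>i\<in>UNIV. \<pi> k $ i * (v i)\<^sup>2)"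
proof (induction k arbitrary: v)
  case 0
  have "0 \<le> \<sigma>\<^sup>2 / (b * mm) * (\<Sum>i\<in>UNIV. \<pi> 0 $ i * (v i)\<^sup>2)"
    using b(1) mm(1) less_imp_le[OF pw.pos] by (intro mult_nonneg_nonneg sum_nonneg) auto
  then show ?case by simp
next
  case (Suc k)
  define w where "w j = (\<Sum>i\<in>UNIV. v i * B k $ i $ j)" for j
  let ?U = "\<lambda>s. \<Sum>j\<in>UNIV. w j *\<^sub>R (zeta k s $ j - nz k j s)"
  have eq: "(\<Sum>i\<in>UNIV. v i *\<^sub>R (zeta (Suc k) s $ i - nz (Suc k) i s)) = ?U s + (\<Sum>j\<in>UNIV. (w j - v j) *\<^sub>R nz k j s)" for s
  proof -
    have "(\<Sum>i\<in>UNIV. v i *\<^sub>R (\<Sum>j\<in>UNIV. B k $ i $ j *\<^sub>R zeta k s $ j)) = (\<Sum>j\<in>UNIV. w j *\<^sub>R zeta k s $ j)"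
      unfolding w_def scaleR_sum_right scaleR_scaleR scaleR_left.sum by (rule sum.swap)
    then show ?thesis
      by (simp add: scaleR_diff_right scaleR_diff_left sum_subtractf)
  qed
  have U: "?U \<in> borel_measurable (hist k)"
    using zeta_hist by (intro borel_measurable_sum borel_measurable_scaleR borel_measurable_const) blast
  have Usq: "sq_integrable P ?U"
    by (intro sq_integrable_sum[OF finite_measure_axioms] sq_integrable_scaleR sq_integrable_minus zeta_sq nz_sq_integrable)
  have "(\<integral>s. (norm (\<Sum>i\<in>UNIV. v i *\<^sub>R (zeta (Suc k) s $ i - nz (Suc k) i s)))\<^sup>2 \<partial>P)
      \<le> (\<integral>s. (norm (?U s))\<^sup>2 \<partial>P) + \<sigma>\<^sup>2 * (\<Sum>j\<in>UNIV. (w j - v j)\<^sup>2)"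
    unfolding eq using noise_bound[OF U] Usq by (simp add: sq_integrable_def)
  also have "\<dots> \<le> \<sigma>\<^sup>2 / (b * mm) * (\<Sum>j\<in>UNIV. \<pi> k $ j * (w j)\<^sup>2) + \<sigma>\<^sup>2 / (b * mm) * (\<Sum>j\<in>UNIV. \<pi> k $ j * (b * (w j - v j)\<^sup>2))"
  proof (rule add_mono[OF Suc.IH])
    have "\<sigma>\<^sup>2 * (w j - v j)\<^sup>2 \<le> \<sigma>\<^sup>2 / (b * mm) * (\<pi> k $ j * (b * (w j - v j)\<^sup>2))" for j
    proof -
      have "\<sigma>\<^sup>2 * (w j - v j)\<^sup>2 = \<sigma>\<^sup>2 / (b * mm) * (mm * (b * (w j - v j)\<^sup>2))" using b mm by simp
      also have "\<dots> \<le> \<sigma>\<^sup>2 / (b * mm) * (\<pi> k $ j * (b * (w j - v j)\<^sup>2))"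
        using mm b by (intro mult_left_mono mult_right_mono) auto
      finally show ?thesis .
    qed
    then show "\<sigma>\<^sup>2 * (\<Sum>j\<in>UNIV. (w j - v j)\<^sup>2) \<le> \<sigma>\<^sup>2 / (b * mm) * (\<Sum>j\<in>UNIV. \<pi> k $ j * (b * (w j - v j)\<^sup>2))"
      unfolding sum_distrib_left by (rule sum_mono)
  qed
  also have "\<dots> = \<sigma>\<^sup>2 / (b * mm) * (\<Sum>j\<in>UNIV. \<pi> k $ j * ((w j)\<^sup>2 + b * (w j - v j)\<^sup>2))"
    by (simp add: distrib_left sum.distrib)
  also have "\<dots> \<le> \<sigma>\<^sup>2 / (b * mm) * (\<Sum>i\<in>UNIV. \<pi> (Suc k) $ i * (v i)\<^sup>2)"
    unfolding w_def using b mm pw.pos[of k] by (intro mult_left_mono column_stochastic_energy) (auto simp: colB \<pi>B less_imp_le simp del: pi_seq.simps)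
  finally show ?case .
qed

text \<open>The indicator of i serves as test vector, and the newest sample adds its own
  variance.\<close>

lemma zeta_component_moment: "(\<integral>s. (norm (zeta k s $ i))\<^sup>2 \<partial>P) \<le> \<sigma>\<^sup>2 * (\<pi> k $ i / (b * mm) + 1)"
proof -
  let ?v = "\<lambda>j. if j = i then 1 else 0 :: real"
  have v: "(\<Sum>j\<in>UNIV. ?v j *\<^sub>R u j) = u i" for u :: "'n \<Rightarrow> real^'p"
    by (simp add: if_distrib[of "\<lambda>c. c *\<^sub>R _"] cong: if_cong)
  have "(\<integral>s. (norm ((zeta k s $ i - nz k i s) + (\<Sum>j\<in>{i}. 1 *\<^sub>R nz k j s)))\<^sup>2 \<partial>P)
     \<le> (\<integral>s. (norm (zeta k s $ i - nz k i s))\<^sup>2 \<partial>P) + \<sigma>\<^sup>2 * (\<Sum>j\<in>{i}. 1\<^sup>2)"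
    using noise_bound[where U = "\<lambda>s. zeta k s $ i - nz k i s" and k = k and I = "{i}" and v = "\<lambda>_. 1"] zeta_hist[of k i]
      sq_integrable_minus[OF zeta_sq nz_sq_integrable, of k i k i] by (simp add: sq_integrable_def)
  also have "(\<integral>s. (norm (zeta k s $ i - nz k i s))\<^sup>2 \<partial>P) \<le> \<sigma>\<^sup>2 / (b * mm) * \<pi> k $ i"
  proof -
    have "\<pi> k $ j * (?v j)\<^sup>2 = (if j = i then \<pi> k $ j else 0)" for j by simp
    then have "(\<Sum>j\<in>UNIV. \<pi> k $ j * (?v j)\<^sup>2) = \<pi> k $ i" by simp
    then show ?thesis using zeta_moment[of ?v k] unfolding v by simp
  qed
  finally show ?thesis by (simp add: algebra_simps)
qed

text \<open>The factor \<open>1 / mm\<close> is the price of a bound proportional to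
  \<open>\<pi> k $ i\<close>, which makes the noise enter the average with factor
  \<open>\<theta> k\<close>.\<close>

definition noise_level :: real where "noise_level = \<sigma> / mm * sqrt (1 + 1 / b)"

lemma noise_level_pos: "0 < noise_level"
proof -
  have "0 < 1 + 1 / b" using b by (simp add: add_pos_pos)
  then show ?thesis using \<sigma> mm by (simp add: noise_level_def)
qed

lemma zeta_l2: "l2 P (\<lambda>s. norm (zeta k s $ i)) \<le> \<pi> k $ i * noise_level"
proof -
  have p: "0 < \<pi> k $ i" "mm \<le> \<pi> k $ i" using pw.pos mm by auto
  have "\<sigma>\<^sup>2 * (\<pi> k $ i / (b * mm) + 1) \<le> \<sigma>\<^sup>2 * ((\<pi> k $ i)\<^sup>2 / mm\<^sup>2 * (1 + 1 / b))"
  proof (intro mult_left_mono)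
    have r: "1 \<le> \<pi> k $ i / mm" using p mm by simp
    then have "\<pi> k $ i / mm * 1 \<le> \<pi> k $ i / mm * (\<pi> k $ i / mm)" by (intro mult_left_mono) auto
    then have 1: "\<pi> k $ i / mm \<le> (\<pi> k $ i)\<^sup>2 / mm\<^sup>2" by (simp add: power2_eq_square)
    have "\<pi> k $ i / (b * mm) + 1 = \<pi> k $ i / mm * (1 / b) + 1" by simp
    also have "\<dots> \<le> (\<pi> k $ i)\<^sup>2 / mm\<^sup>2 * (1 / b) + (\<pi> k $ i)\<^sup>2 / mm\<^sup>2"
      using 1 r b by (intro add_mono mult_right_mono) auto
    also have "\<dots> = (\<pi> k $ i)\<^sup>2 / mm\<^sup>2 * (1 + 1 / b)" by (simp only: distrib_left mult_1_right add.commute)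
    finally show "\<pi> k $ i / (b * mm) + 1 \<le> (\<pi> k $ i)\<^sup>2 / mm\<^sup>2 * (1 + 1 / b)" .
  qed simp
  also have "\<dots> = (\<pi> k $ i * noise_level)\<^sup>2"
    using b by (simp add: noise_level_def power_mult_distrib power_divide add_nonneg_nonneg)
  finally have "(\<integral>s. (norm (zeta k s $ i))\<^sup>2 \<partial>P) \<le> (\<pi> k $ i * noise_level)\<^sup>2"
    using zeta_component_moment[of k i] by linarith
  then show ?thesis using p noise_level_pos by (subst l2_le_iff) auto
qed

text \<open>Summing the component moments directly costs one factor \<open>1 / mm\<close>, whereas
  the square of \<open>noise_level\<close> contains two.\<close>

lemma tracking_noise: "(\<integral>s. (S_err (zeta k s) (\<pi> k))\<^sup>2 \<partial>P) \<le> n * \<sigma>\<^sup>2 / mm * (1 + 1 / b)"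
  and S_zeta_sq: "sq_integrable P (\<lambda>s. S_err (zeta k s) (\<pi> k))"
proof -
  have sq: "sq_integrable P (\<lambda>s. (1 / \<pi> k $ i) *\<^sub>R zeta k s $ i)" for i by (intro sq_integrable_scaleR zeta_sq)
  have int: "integrable P (\<lambda>s. (norm (zeta k s $ i))\<^sup>2 / \<pi> k $ i)" for i
    using zeta_sq[of k i] by (simp add: sq_integrable_def)
  have [measurable]: "(\<lambda>s. zeta k s $ i) \<in> borel_measurable P" for i by (rule sq_integrable_measurable[OF zeta_sq])
  have m[measurable]: "(\<lambda>s. S_err (zeta k s) (\<pi> k)) \<in> borel_measurable P" unfolding S_err_def by measurable
  have le: "(S_err (zeta k s) (\<pi> k))\<^sup>2 \<le> (\<Sum>i\<in>UNIV. (norm (zeta k s $ i))\<^sup>2 / \<pi> k $ i)" for s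
    by (simp add: pw.S_err_power2)
  have int2: "integrable P (\<lambda>s. (S_err (zeta k s) (\<pi> k))\<^sup>2)"
  proof (rule Bochner_Integration.integrable_bound)
    show "integrable P (\<lambda>s. \<Sum>i\<in>UNIV. (norm (zeta k s $ i))\<^sup>2 / \<pi> k $ i)" using int by (rule Bochner_Integration.integrable_sum)
    show "AE s in P. norm ((S_err (zeta k s) (\<pi> k))\<^sup>2) \<le> norm (\<Sum>i\<in>UNIV. (norm (zeta k s $ i))\<^sup>2 / \<pi> k $ i)"
      using order_trans[OF le abs_ge_self] by (intro AE_I2) simp
  qed measurable
  then show "sq_integrable P (\<lambda>s. S_err (zeta k s) (\<pi> k))" by (simp add: sq_integrable_def m)
  have "(\<integral>s. (S_err (zeta k s) (\<pi> k))\<^sup>2 \<partial>P) \<le> (\<integral>s. (\<Sum>i\<in>UNIV. (norm (zeta k s $ i))\<^sup>2 / \<pi> k $ i) \<partial>P)"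
    using int int2 le by (intro integral_mono) auto
  also have "\<dots> = (\<Sum>i\<in>UNIV. (\<integral>s. (norm (zeta k s $ i))\<^sup>2 \<partial>P) / \<pi> k $ i)"
    using int by (subst Bochner_Integration.integral_sum) auto
  also have "\<dots> \<le> (\<Sum>i\<in>(UNIV :: 'n set). \<sigma>\<^sup>2 / mm * (1 + 1 / b))"
  proof (rule sum_mono)
    fix i
    have p: "0 < \<pi> k $ i" "mm \<le> \<pi> k $ i" using pw.pos mm by auto
    have "(\<integral>s. (norm (zeta k s $ i))\<^sup>2 \<partial>P) / \<pi> k $ i \<le> \<sigma>\<^sup>2 * (\<pi> k $ i / (b * mm) + 1) / \<pi> k $ i"
      using zeta_component_moment p by (intro divide_right_mono) auto
    also have "\<dots> = \<sigma>\<^sup>2 * (1 / (b * mm) + 1 / \<pi> k $ i)" using p(1) b(1) mm(1) by (simp add: field_simps)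
    also have "\<dots> \<le> \<sigma>\<^sup>2 * (1 / (b * mm) + 1 / mm)" using p mm(1) by (intro mult_left_mono add_left_mono divide_left_mono mult_pos_pos) auto
    finally show "(\<integral>s. (norm (zeta k s $ i))\<^sup>2 \<partial>P) / \<pi> k $ i \<le> \<sigma>\<^sup>2 / mm * (1 + 1 / b)"
      using mm(1) b(1) by (simp add: field_simps)
  qed
  finally show "(\<integral>s. (S_err (zeta k s) (\<pi> k))\<^sup>2 \<partial>P) \<le> n * \<sigma>\<^sup>2 / mm * (1 + 1 / b)" by (simp add: n_card)
qed

end

section \<open>One-step inequalities for the errors in L2\<close>

lemma l2_le_combination:
  assumes "sq_integrable M F" "sq_integrable M f1" "sq_integrable M f2" "sq_integrable M f3" "sq_integrable M f4" "sq_integrable M f5"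
    and "0 \<le> a1" "0 \<le> a2" "0 \<le> a3" "0 \<le> a4" "0 \<le> a5"
    and "\<And>s. s \<in> space M \<Longrightarrow> 0 \<le> F s"
    and "\<And>s. s \<in> space M \<Longrightarrow> F s \<le> a1 * f1 s + a2 * f2 s + a3 * f3 s + a4 * f4 s + a5 * f5 s"
  shows "l2 M F \<le> a1 * l2 M f1 + a2 * l2 M f2 + a3 * l2 M f3 + a4 * l2 M f4 + a5 * l2 M f5"
proof -
  note sq = sq_integrable_cmult[OF assms(2), of a1] sq_integrable_cmult[OF assms(3), of a2]
    sq_integrable_cmult[OF assms(4), of a3] sq_integrable_cmult[OF assms(5), of a4] sq_integrable_cmult[OF assms(6), of a5]
  have "l2 M F \<le> l2 M (\<lambda>s. a1 * f1 s + a2 * f2 s + a3 * f3 s + a4 * f4 s + a5 * f5 s)"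
    using assms(12,13) by (intro l2_mono sq_integrable_add sq assms(1)) simp
  also have "\<dots> \<le> l2 M (\<lambda>s. a1 * f1 s) + l2 M (\<lambda>s. a2 * f2 s) + l2 M (\<lambda>s. a3 * f3 s) + l2 M (\<lambda>s. a4 * f4 s) + l2 M (\<lambda>s. a5 * f5 s)"
    using l2_triangle[OF sq(1) sq(2)]
      l2_triangle[OF sq_integrable_add[OF sq(1) sq(2)] sq(3)]
      l2_triangle[OF sq_integrable_add[OF sq_integrable_add[OF sq(1) sq(2)] sq(3)] sq(4)]
      l2_triangle[OF sq_integrable_add[OF sq_integrable_add[OF sq_integrable_add[OF sq(1) sq(2)] sq(3)] sq(4)] sq(5)]
    by linarith
  finally show ?thesis using assms(7-11) by (simp add: l2_cmult)
qed

lemma norm_triangle_5: "norm (a - b - c - d + e) \<le> norm a + norm b + norm c + norm d + norm e"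
  for a b c d e :: "'v::real_normed_vector"
  using norm_triangle_ineq[of "a - b - c - d" e] norm_triangle_ineq4[of "a - b - c" d]
    norm_triangle_ineq4[of "a - b" c] norm_triangle_ineq4[of a b] by linarith

lemma sum_norm_le_sqrt_card:
  fixes u :: "real^'p^'n"
  shows "(\<Sum>i\<in>UNIV. norm (u $ i)) \<le> sqrt (real CARD('n)) * norm u"
proof -
  have "(\<Sum>i\<in>UNIV. norm (u $ i))\<^sup>2 \<le> real CARD('n) * (norm u)\<^sup>2"
    using sum_squared_le_sum_of_squares[of "\<lambda>i. norm (u $ i)" UNIV] by (simp add: norm_power2_sum mult.commute)
  then have "(\<Sum>i\<in>UNIV. norm (u $ i))\<^sup>2 \<le> (sqrt (real CARD('n)) * norm u)\<^sup>2" by (simp add: power_mult_distrib)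
  then show ?thesis by (rule power2_le_imp_le) simp
qed

definition scal :: "real^'n \<Rightarrow> real^'p^'n \<Rightarrow> real^'p^'n" where "scal a u = (\<chi> i. a $ i *\<^sub>R u $ i)"

lemma norm_scal_le:
  assumes "\<And>i. 0 \<le> a $ i" "\<And>i. a $ i \<le> c"
  shows "norm (scal a u) \<le> c * norm u"
proof -
  have c: "0 \<le> c" using assms order_trans by blast
  have "norm (scal a u) \<le> L2_set (\<lambda>i. c * norm (u $ i)) UNIV"
    unfolding norm_eq_L2 using assms by (intro L2_set_mono) (auto simp: scal_def intro!: mult_right_mono)
  also have "\<dots> = c * norm u" using c by (simp add: norm_eq_L2 L2_set_right_distrib)
  finally show ?thesis .
qed

lemma sq_integrable_norm_vec:
  fixes u :: "'s \<Rightarrow> real^'p^'n"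
  assumes "finite_measure M" "\<And>i. sq_integrable M (\<lambda>s. u s $ i)"
  shows "sq_integrable M (\<lambda>s. norm (u s))"
proof (rule sq_integrable_bound)
  have [measurable]: "(\<lambda>s. u s $ i) \<in> borel_measurable M" for i using assms(2) by (rule sq_integrable_measurable)
  show "(\<lambda>s. norm (u s)) \<in> borel_measurable M" unfolding norm_eq_L2 L2_set_def by measurable
  show "sq_integrable M (\<lambda>s. \<Sum>i\<in>UNIV. norm (u s $ i))"
    by (intro sq_integrable_sum sq_integrable_norm assms)
  show "norm (norm (u s)) \<le> norm (\<Sum>i\<in>UNIV. norm (u s $ i))" for s
    using norm_le_sum[of "u s"] by simp
qed

lemma sq_integrable_wn:
  fixes u :: "'s \<Rightarrow> real^'p^'n"
  assumes "finite_measure M" "\<And>i. sq_integrable M (\<lambda>s. u s $ i)" "stochastic_vec q"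
  shows "sq_integrable M (\<lambda>s. wn q (u s))"
proof (rule sq_integrable_bound[OF sq_integrable_norm_vec[OF assms(1,2)]])
  have [measurable]: "(\<lambda>s. u s $ i) \<in> borel_measurable M" for i using assms(2) by (rule sq_integrable_measurable)
  show "(\<lambda>s. wn q (u s)) \<in> borel_measurable M" unfolding wn_def L2_set_def by measurable
  show "norm (wn q (u s)) \<le> norm (norm (u s))" for s
    using wn_le_norm[of q "u s"] assms(3) stochastic_vec_le_1[OF assms(3)] wn_nonneg[of q "u s"]
    by (simp add: stochastic_vec_def)
qed

context push_pull begin

lemma sq_integrable_S_err:
  assumes "\<And>i. sq_integrable P (\<lambda>s. u s $ i)"
  shows "sq_integrable P (\<lambda>s. S_err (u s) (\<pi> k))"
proof (rule sq_integrable_bound)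
  have [measurable]: "(\<lambda>s. u s $ i) \<in> borel_measurable P" for i using assms by (rule sq_integrable_measurable)
  show "(\<lambda>s. S_err (u s) (\<pi> k)) \<in> borel_measurable P" unfolding S_err_def by measurable
  show "sq_integrable P (\<lambda>s. 1 / sqrt mm * norm (u s))"
    by (intro sq_integrable_cmult sq_integrable_norm_vec finite_measure_axioms assms)
  show "norm (S_err (u s) (\<pi> k)) \<le> norm (1 / sqrt mm * norm (u s))" for s
    using pw.S_err_le_norm[of "1 / sqrt mm" k "u s"] mm S_err_nonneg[of "\<pi> k" "u s"] less_imp_le[OF pw.pos[of k]]
    by (simp add: power_divide del: pi_seq.simps)
qed

abbreviation "gsum k s \<equiv> (\<Sum>i\<in>UNIV. grad i (x k s $ i))"

definition xh :: "nat \<Rightarrow> 's \<Rightarrow> real^'p" where "xh k s = weighted_avg (\<phi> k) (x k s)"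
definition eX :: "nat \<Rightarrow> 's \<Rightarrow> real" where "eX k s = norm (xh k s - xstar)"
definition eD :: "nat \<Rightarrow> 's \<Rightarrow> real" where "eD k s = wn (\<phi> k) (x k s - rep (xh k s))"
definition eU :: "nat \<Rightarrow> 's \<Rightarrow> real" where "eU k s = norm (x k s - prev_iterate xm1 x k s)"
definition eT :: "nat \<Rightarrow> 's \<Rightarrow> real" where "eT k s = S_err (ybar k s) (\<pi> k)"
text \<open>The tracker after mixing and before the new gradient increments, already measured with
  the new weights; the index \<open>k - 1\<close> is meaningful for k at least 1.\<close>

definition eP :: "nat \<Rightarrow> 's \<Rightarrow> real" where "eP k s = S_err (mixB (k - 1) (ybar (k - 1) s)) (\<pi> k)"
definition eN :: "nat \<Rightarrow> 's \<Rightarrow> real" where "eN k s = (\<Sum>i\<in>UNIV. \<phi> (Suc k) $ i * \<alpha> $ i * norm (zeta k s $ i))"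
text \<open>The effective step of the average: the coefficient of the summed gradients when every
  agent's tracker equals its share \<open>\<pi> k $ i\<close> of them.\<close>

definition \<theta> :: "nat \<Rightarrow> real" where "\<theta> k = (\<Sum>i\<in>UNIV. \<phi> (Suc k) $ i * \<alpha> $ i * \<pi> k $ i)"

lemma e_nonneg: "0 \<le> eX k s" "0 \<le> eD k s" "0 \<le> eU k s" "0 \<le> eT k s" "0 \<le> eP k s" "0 \<le> eN k s"
  unfolding eX_def eD_def eU_def eT_def eP_def eN_def
  using less_imp_le[OF pw.pos] less_imp_le[OF \<alpha>(1)] \<phi>_pos(2)
  by (auto intro!: wn_nonneg S_err_nonneg sum_nonneg mult_nonneg_nonneg simp del: pi_seq.simps)

lemmas sq_intros = sq_integrable_add sq_integrable_minus sq_integrable_scaleR sq_integrable_sum[OF finite_measure_axioms]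
  sq_integrable_const[OF finite_measure_axioms]

lemma e_sq: "sq_integrable P (eX k)" "sq_integrable P (eD k)" "sq_integrable P (eU k)" "sq_integrable P (eT k)"
  "sq_integrable P (eP k)" "sq_integrable P (eN k)"
proof -
  have xh: "sq_integrable P (xh k)" unfolding xh_def weighted_avg_def by (intro sq_intros x_sq)
  show "sq_integrable P (eX k)" unfolding eX_def by (intro sq_integrable_norm sq_intros xh)
  show "sq_integrable P (eD k)" unfolding eD_def
    by (intro sq_integrable_wn finite_measure_axioms \<phi>) (simp, intro sq_intros x_sq xh)
  show "sq_integrable P (eU k)" unfolding eU_def
    by (intro sq_integrable_norm_vec finite_measure_axioms) (simp, intro sq_intros x_sq prev_sq)
  have yb: "sq_integrable P (\<lambda>s. ybar k s $ i)" for k i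
    unfolding ybar_def by (simp, intro sq_intros y_sq zeta_sq)
  show "sq_integrable P (eT k)" unfolding eT_def by (intro sq_integrable_S_err yb)
  show "sq_integrable P (eP k)" unfolding eP_def
    by (intro sq_integrable_S_err) (simp add: mixB_def, intro sq_intros yb)
  show "sq_integrable P (eN k)" unfolding eN_def
    by (intro sq_intros sq_integrable_cmult sq_integrable_norm zeta_sq)
qed

text \<open>The factor \<open>\<pi> k $ i\<close> in \<open>zeta_l2\<close> reassembles the
  effective step.\<close>

lemma eN_l2: "l2 P (eN k) \<le> \<theta> k * noise_level"
proof -
  have c: "0 \<le> \<phi> (Suc k) $ i * \<alpha> $ i" for i using \<phi>_pos(2) less_imp_le[OF \<alpha>(1)] by simp
  have "l2 P (eN k) \<le> (\<Sum>i\<in>UNIV. l2 P (\<lambda>s. \<phi> (Suc k) $ i * \<alpha> $ i * norm (zeta k s $ i)))"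
    unfolding eN_def by (intro l2_triangle_sum finite_measure_axioms sq_integrable_cmult sq_integrable_norm zeta_sq)
  also have "\<dots> = (\<Sum>i\<in>UNIV. \<phi> (Suc k) $ i * \<alpha> $ i * l2 P (\<lambda>s. norm (zeta k s $ i)))"
    using c by (simp add: l2_cmult)
  also have "\<dots> \<le> (\<Sum>i\<in>UNIV. \<phi> (Suc k) $ i * \<alpha> $ i * (\<pi> k $ i * noise_level))"
    using c by (intro sum_mono mult_left_mono zeta_l2)
  finally show ?thesis by (simp add: \<theta>_def sum_distrib_right mult.assoc)
qed

lemma \<theta>_bounds: "1 / vphi\<^sup>2 * \<alpha> $ i * mm \<le> \<theta> k" "0 \<le> \<theta> k" "\<theta> k \<le> abar"
proof -
  have nn: "0 \<le> \<phi> (Suc k) $ i * \<alpha> $ i * \<pi> k $ i" for i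
    using \<phi>_pos(2) less_imp_le[OF \<alpha>(1)] less_imp_le[OF pw.pos[of k]] by simp
  have "1 / vphi\<^sup>2 * \<alpha> $ i * mm \<le> \<phi> (Suc k) $ i * \<alpha> $ i * \<pi> k $ i"
    using \<phi>(3)[of "Suc k" i] mm less_imp_le[OF \<alpha>(1)[of i]] \<phi>_pos(2)[of "Suc k" i]
    by (intro mult_mono mult_nonneg_nonneg) (auto simp del: pi_seq.simps)
  also have "\<dots> \<le> \<theta> k" unfolding \<theta>_def using nn
    by (intro member_le_sum[where f = "\<lambda>i. \<phi> (Suc k) $ i * \<alpha> $ i * \<pi> k $ i"]) auto
  finally show "1 / vphi\<^sup>2 * \<alpha> $ i * mm \<le> \<theta> k" .
  show "0 \<le> \<theta> k" unfolding \<theta>_def by (intro sum_nonneg nn)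
  have "\<theta> k \<le> (\<Sum>i\<in>UNIV. \<phi> (Suc k) $ i * abar * 1)"
    unfolding \<theta>_def using \<alpha> \<phi>_pos(2)[of "Suc k"] pw.le_1[of k] less_imp_le[OF \<alpha>(1)] less_imp_le[OF pw.pos[of k]]
      order_trans[OF less_imp_le[OF \<alpha>(1)] \<alpha>(2)]
    by (intro sum_mono mult_mono mult_nonneg_nonneg) (auto simp del: pi_seq.simps)
  also have "\<dots> = abar" by (simp add: sum_distrib_right[symmetric] \<phi>_pos)
  finally show "\<theta> k \<le> abar" .
qed

lemma abar_pos: "0 < abar" using \<alpha>(1)[of undefined] \<alpha>(2)[of undefined] by linarith
lemma bbar_nonneg: "0 \<le> bbar" using \<beta>(1)[of undefined] \<beta>(2)[of undefined] by linarith

lemma grad_difference_sum: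
  "norm ((\<Sum>i\<in>UNIV. grad i (u $ i)) - (\<Sum>i\<in>UNIV. grad i v)) \<le> L * sqrt n * norm (u - rep v)"
proof -
  have "norm ((\<Sum>i\<in>UNIV. grad i (u $ i)) - (\<Sum>i\<in>UNIV. grad i v)) \<le> (\<Sum>i\<in>UNIV. norm (grad i (u $ i) - grad i v))"
    unfolding sum_subtractf[symmetric] by (rule norm_sum)
  also have "\<dots> \<le> (\<Sum>i\<in>UNIV. L * norm ((u - rep v) $ i))" using lip by (intro sum_mono) simp
  also have "\<dots> = L * (\<Sum>i\<in>UNIV. norm ((u - rep v) $ i))" by (simp add: sum_distrib_left)
  also have "\<dots> \<le> L * (sqrt n * norm (u - rep v))"
    unfolding n_card using L by (intro mult_left_mono sum_norm_le_sqrt_card) auto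
  finally show ?thesis by simp
qed

lemma grad_sum_bound: "norm (\<Sum>i\<in>UNIV. grad i u) \<le> n * L * norm (u - xstar)"
proof -
  have "norm (\<Sum>i\<in>UNIV. grad i u) = norm ((\<Sum>i\<in>UNIV. grad i u) - (\<Sum>i\<in>UNIV. grad i xstar))" by (simp add: critical)
  also have "\<dots> \<le> (\<Sum>i\<in>(UNIV :: 'n set). norm (grad i u - grad i xstar))"
    unfolding sum_subtractf[symmetric] by (rule norm_sum)
  also have "\<dots> \<le> (\<Sum>i\<in>(UNIV :: 'n set). L * norm (u - xstar))" by (intro sum_mono lip)
  finally show ?thesis by (simp add: n_card)
qed

lemma norm_dev_le: "norm (x k s - rep (xh k s)) \<le> vphi * eD k s"
  unfolding eD_def using \<phi>(3,4) by (intro norm_le_wn)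

lemma gsum_dev: "norm (gsum k s - (\<Sum>i\<in>UNIV. grad i (xh k s))) \<le> L * sqrt n * vphi * eD k s"
proof -
  have "L * sqrt n * norm (x k s - rep (xh k s)) \<le> L * sqrt n * (vphi * eD k s)"
    using L n_pos norm_dev_le by (intro mult_left_mono) auto
  then show ?thesis using grad_difference_sum[of "x k s" "xh k s"] by (simp add: mult.assoc)
qed

lemma gsum_bound: "norm (gsum k s) \<le> n * L * eX k s + L * sqrt n * vphi * eD k s"
  using gsum_dev[of k s] grad_sum_bound[of "xh k s"]
    norm_triangle_sub[of "gsum k s" "\<Sum>i\<in>UNIV. grad i (xh k s)"] unfolding eX_def by linarith

lemma x_Suc_vec: "s \<in> space P \<Longrightarrow> x (Suc k) s = mixA k (x k s) - scal \<alpha> (y k s) + scal \<beta> (x k s - prev_iterate xm1 x k s)"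
  unfolding Finite_Cartesian_Product.vec_eq_iff by (simp add: x_Suc mixA_def scal_def)

end

text \<open>The rates are required from k = 1 on, because the lower bound \<open>\<eta>\<close> on
  the largest entry of \<open>\<phi> k\<close> comes from pairing it with the previous vector
  \<open>\<pi> (k - 1)\<close>.\<close>

locale push_pull_contracting = push_pull +
  fixes G :: real and \<kappa> chi :: "nat \<Rightarrow> real"
  assumes G: "0 \<le> G" "G \<le> 1"
    and consensus_contraction: "\<And>k u. 1 \<le> k \<Longrightarrow>
      weighted_norm2 (\<phi> (Suc k)) (mixA k u - rep (weighted_avg (\<phi> k) u))
        \<le> (1 - G) * weighted_norm2 (\<phi> k) (u - rep (weighted_avg (\<phi> k) u))"
    and tracking_contraction: "\<And>k u. 1 \<le> k \<Longrightarrow>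
      (S_err (mixB k u) (\<pi> (Suc k)))\<^sup>2 \<le> (1 - \<kappa> k) * (S_err u (\<pi> k))\<^sup>2"
    and \<kappa>: "\<And>k. 1 \<le> k \<Longrightarrow> 0 \<le> \<kappa> k"
    and chi: "\<And>k i. 1 / (chi k)\<^sup>2 \<le> \<pi> k $ i" "\<And>k. 0 < chi k"
begin

lemma mixA_dev:
  assumes "1 \<le> k"
  shows "wn (\<phi> (Suc k)) (mixA k (x k s) - rep (xh k s)) \<le> (1 - G / 2) * eD k s"
  unfolding eD_def xh_def
  by (rule power2_contraction) (use consensus_contraction[OF assms] G wn_nonneg in \<open>auto simp: wn_power2 \<phi>_pos\<close>)

lemma ybar_component:
  assumes s: "s \<in> space P"
  shows "norm (ybar k s $ i) \<le> \<pi> k $ i * (chi k * eT k s + norm (gsum k s))"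
proof -
  have p: "0 < \<pi> k $ i" by (rule pw.pos)
  have "norm ((1 / \<pi> k $ i) *\<^sub>R ybar k s $ i - gsum k s) \<le> chi k * eT k s"
    unfolding eT_def sum_ybar[OF s, symmetric] by (rule pw.norm_component_le[OF chi])
  then have "norm ((1 / \<pi> k $ i) *\<^sub>R ybar k s $ i) \<le> chi k * eT k s + norm (gsum k s)"
    using norm_triangle_sub[of "(1 / \<pi> k $ i) *\<^sub>R ybar k s $ i" "gsum k s"] by linarith
  then have "\<pi> k $ i * norm ((1 / \<pi> k $ i) *\<^sub>R ybar k s $ i) \<le> \<pi> k $ i * (chi k * eT k s + norm (gsum k s))"
    using p by (intro mult_left_mono) auto
  then show ?thesis using p by (simp del: pi_seq.simps)
qed

text \<open>Up to the tracking error each agent holds the share \<open>\<pi> k $ i\<close> of the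
  gradient sum, so weighting by the step sizes reproduces \<open>\<theta> k\<close>.\<close>

lemma weighted_y_sum:
  assumes s: "s \<in> space P"
  shows "(\<Sum>i\<in>UNIV. \<phi> (Suc k) $ i * norm (scal \<alpha> (y k s) $ i))
    \<le> \<theta> k * (chi k * eT k s + (n * L * eX k s + L * sqrt n * vphi * eD k s)) + eN k s"
proof -
  have "(\<Sum>i\<in>UNIV. \<phi> (Suc k) $ i * norm (scal \<alpha> (y k s) $ i))
      \<le> (\<Sum>i\<in>UNIV. \<phi> (Suc k) $ i * (\<alpha> $ i * (\<pi> k $ i * (chi k * eT k s + norm (gsum k s)) + norm (zeta k s $ i))))"
  proof (intro sum_mono mult_left_mono)
    fix i
    have "norm (y k s $ i) \<le> \<pi> k $ i * (chi k * eT k s + norm (gsum k s)) + norm (zeta k s $ i)"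
    proof -
      have "norm (y k s $ i) \<le> norm (ybar k s $ i) + norm (zeta k s $ i)"
        using norm_triangle_ineq[of "ybar k s $ i" "zeta k s $ i"] by (simp add: ybar_def)
      then show ?thesis using ybar_component[OF s, of k i] by linarith
    qed
    then show "norm (scal \<alpha> (y k s) $ i) \<le> \<alpha> $ i * (\<pi> k $ i * (chi k * eT k s + norm (gsum k s)) + norm (zeta k s $ i))"
      using \<alpha>(1)[of i] by (simp add: scal_def del: pi_seq.simps)
  qed (rule \<phi>_pos)
  also have "\<dots> = \<theta> k * (chi k * eT k s + norm (gsum k s)) + eN k s"
    unfolding \<theta>_def eN_def sum_distrib_right sum.distrib[symmetric]
    by (intro sum.cong refl) (simp only: distrib_left mult.assoc)
  also have "\<dots> \<le> \<theta> k * (chi k * eT k s + (n * L * eX k s + L * sqrt n * vphi * eD k s)) + eN k s"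
    using \<theta>_bounds(2) gsum_bound by (intro add_right_mono mult_left_mono add_left_mono)
  finally show ?thesis .
qed

lemma momentum_bound:
  "wn (\<phi> (Suc k)) (scal \<beta> (x k s - prev_iterate xm1 x k s)) \<le> bbar * eU k s"
  "norm (scal \<beta> (x k s - prev_iterate xm1 x k s)) \<le> bbar * eU k s"
proof -
  show 1: "norm (scal \<beta> (x k s - prev_iterate xm1 x k s)) \<le> bbar * eU k s"
    unfolding eU_def using \<beta> by (rule norm_scal_le)
  show "wn (\<phi> (Suc k)) (scal \<beta> (x k s - prev_iterate xm1 x k s)) \<le> bbar * eU k s"
    by (rule order_trans[OF wn_le_norm 1]) (rule \<phi>_pos)+
qed

text \<open>Mixing preserves the weighted average, so apart from the contracted deviation there is
  the centred update, and centring does not increase the weighted norm.\<close>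

lemma eD_step:
  assumes k: "1 \<le> k" and s: "s \<in> space P"
  shows "eD (Suc k) s \<le> (1 - G / 2) * eD k s
    + vphi * (\<theta> k * (chi k * eT k s + (n * L * eX k s + L * sqrt n * vphi * eD k s)) + eN k s) + bbar * eU k s"
proof -
  let ?q = "\<phi> (Suc k)"
  let ?a = "scal \<alpha> (y k s)" and ?b = "scal \<beta> (x k s - prev_iterate xm1 x k s)"
  let ?u = "?b - ?a"
  have xx: "x (Suc k) s = mixA k (x k s) + ?u" by (simp add: x_Suc_vec[OF s])
  have "x (Suc k) s - rep (xh (Suc k) s) = (mixA k (x k s) - rep (xh k s)) + (?u - rep (weighted_avg ?q ?u))"
    unfolding xh_def xx weighted_avg_add weighted_avg_mixA
    by (simp add: rep_def Finite_Cartesian_Product.vec_eq_iff)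
  then have "eD (Suc k) s \<le> wn ?q (mixA k (x k s) - rep (xh k s)) + wn ?q (?u - rep (weighted_avg ?q ?u))"
    unfolding eD_def using wn_triangle[OF \<phi>_pos(2)] by metis
  also have "\<dots> \<le> (1 - G / 2) * eD k s + wn ?q ?u"
    by (intro add_mono mixA_dev k wn_centre \<phi>)
  also have "wn ?q ?u \<le> bbar * eU k s + wn ?q ?a"
    using wn_diff[OF \<phi>_pos(2), of "Suc k" ?b ?a] momentum_bound(1)[of k s] by linarith
  also have "wn ?q ?a \<le> vphi * (\<Sum>i\<in>UNIV. ?q $ i * norm (?a $ i))"
    using \<phi>(3,4) by (intro wn_le_sum)
  also have "\<dots> \<le> vphi * (\<theta> k * (chi k * eT k s + (n * L * eX k s + L * sqrt n * vphi * eD k s)) + eN k s)"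
    using weighted_y_sum[OF s] \<phi>(4) by (intro mult_left_mono) auto
  finally show ?thesis by simp
qed

text \<open>Before and after mixing, the iterates lie within \<open>vphi * eD k s\<close> of the
  consensus point.\<close>

lemma mixA_move:
  assumes k: "1 \<le> k"
  shows "norm (mixA k (x k s) - x k s) \<le> 2 * vphi * eD k s"
proof -
  have "norm (mixA k (x k s) - rep (xh k s)) \<le> vphi * wn (\<phi> (Suc k)) (mixA k (x k s) - rep (xh k s))"
    using \<phi>(3,4) by (intro norm_le_wn)
  also have "\<dots> \<le> vphi * ((1 - G / 2) * eD k s)" using \<phi>(4) by (intro mult_left_mono mixA_dev k) auto
  also have "\<dots> \<le> vphi * (1 * eD k s)" using \<phi>(4) G e_nonneg by (intro mult_left_mono mult_right_mono) auto
  finally have "norm (mixA k (x k s) - rep (xh k s)) \<le> vphi * eD k s" by simp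
  moreover have "norm (mixA k (x k s) - x k s) \<le> norm (mixA k (x k s) - rep (xh k s)) + norm (x k s - rep (xh k s))"
    using norm_triangle_ineq4[of "mixA k (x k s) - rep (xh k s)" "x k s - rep (xh k s)"] by simp
  ultimately show ?thesis using norm_dev_le[of k s] by linarith
qed

lemma eU_step:
  assumes k: "1 \<le> k" and s: "s \<in> space P"
  shows "eU (Suc k) s \<le> 2 * vphi * eD k s
    + vphi\<^sup>2 * (\<theta> k * (chi k * eT k s + (n * L * eX k s + L * sqrt n * vphi * eD k s)) + eN k s) + bbar * eU k s"
proof -
  let ?q = "\<phi> (Suc k)"
  let ?a = "scal \<alpha> (y k s)" and ?b = "scal \<beta> (x k s - prev_iterate xm1 x k s)"
  have prev: "prev_iterate xm1 x (Suc k) s = x k s" by (simp add: prev_iterate_def)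
  have "x (Suc k) s - x k s = (mixA k (x k s) - x k s) - ?a + ?b" by (simp add: x_Suc_vec[OF s])
  then have "eU (Suc k) s = norm ((mixA k (x k s) - x k s) - ?a + ?b)" unfolding eU_def prev by (rule arg_cong)
  then have "eU (Suc k) s \<le> norm (mixA k (x k s) - x k s) + norm ?a + norm ?b"
    using norm_triangle_ineq[of "(mixA k (x k s) - x k s) - ?a" ?b] norm_triangle_ineq4[of "mixA k (x k s) - x k s" ?a]
    by linarith
  moreover have "norm ?a \<le> vphi\<^sup>2 * (\<Sum>i\<in>UNIV. ?q $ i * norm (?a $ i))"
  proof -
    have "norm ?a \<le> vphi * wn ?q ?a" using \<phi>(3,4) by (intro norm_le_wn)
    also have "\<dots> \<le> vphi * (vphi * (\<Sum>i\<in>UNIV. ?q $ i * norm (?a $ i)))"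
      using \<phi>(3,4) by (intro mult_left_mono wn_le_sum) auto
    finally show ?thesis by (simp add: power2_eq_square mult.assoc)
  qed
  moreover have "\<dots> \<le> vphi\<^sup>2 * (\<theta> k * (chi k * eT k s + (n * L * eX k s + L * sqrt n * vphi * eD k s)) + eN k s)"
    using weighted_y_sum[OF s] by (intro mult_left_mono) auto
  ultimately show ?thesis using mixA_move[OF k, of s] momentum_bound(2)[of k s] by linarith
qed

lemma small_step: "\<theta> k * (n * L)\<^sup>2 \<le> n * mu / 50" "\<theta> k * (n * mu) \<le> 1"
proof -
  have "\<theta> k * (n * L)\<^sup>2 \<le> abar * (n * L)\<^sup>2" using \<theta>_bounds(3) by (intro mult_right_mono) auto
  also have "\<dots> = n * (n * abar * L\<^sup>2)" by (simp add: power2_eq_square)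
  also have "\<dots> \<le> n * (mu / 96)" using small n_pos by (intro mult_left_mono) auto
  finally show 1: "\<theta> k * (n * L)\<^sup>2 \<le> n * mu / 50" using mult_pos_pos[OF n_pos mu] by linarith
  have "L * (n * abar * L) \<le> L * (1 / 96)" using small mu_L by (simp add: power2_eq_square mult_ac)
  then have 2: "n * abar * L \<le> 1 / 96" using L by simp
  have "\<theta> k * (n * mu) \<le> abar * (n * L)"
    using \<theta>_bounds(2,3)[of k] mu_L n_pos mu abar_pos by (intro mult_mono) auto
  then show "\<theta> k * (n * mu) \<le> 1" using 2 by (simp add: mult_ac)
qed

text \<open>The average makes an exact gradient step of size \<open>\<theta> k\<close> at its own
  position, perturbed by the consensus error, the tracking error, the noise and the
  momentum.\<close>

lemma eX_step:
  assumes k: "1 \<le> k" and s: "s \<in> space P"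
  shows "eX (Suc k) s \<le> (1 - 99 / 100 * (\<theta> k * (n * mu))) * eX k s
    + \<theta> k * (L * sqrt n * vphi * eD k s + chi k * eT k s) + eN k s + bbar * eU k s"
proof -
  let ?q = "\<phi> (Suc k)"
  let ?a = "scal \<alpha> (y k s)" and ?b = "scal \<beta> (x k s - prev_iterate xm1 x k s)"
  let ?G = "\<Sum>i\<in>UNIV. grad i (xh k s)"
  have c: "0 \<le> ?q $ i * \<alpha> $ i" for i using \<phi>_pos(2) less_imp_le[OF \<alpha>(1)] by simp
  have xx: "xh (Suc k) s = xh k s - weighted_avg ?q ?a + weighted_avg ?q ?b"
    unfolding xh_def by (simp add: x_Suc_vec[OF s] weighted_avg_add weighted_avg_diff weighted_avg_mixA)
  have a: "weighted_avg ?q ?a = \<theta> k *\<^sub>R gsum k s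
      + (\<Sum>i\<in>UNIV. (?q $ i * \<alpha> $ i) *\<^sub>R (ybar k s $ i - \<pi> k $ i *\<^sub>R gsum k s)) + (\<Sum>i\<in>UNIV. (?q $ i * \<alpha> $ i) *\<^sub>R zeta k s $ i)"
  proof -
    have "weighted_avg ?q ?a = (\<Sum>i\<in>UNIV. (?q $ i * \<alpha> $ i) *\<^sub>R (ybar k s $ i + zeta k s $ i))"
      unfolding weighted_avg_def scal_def by (intro sum.cong refl) (simp add: ybar_def)
    also have "\<dots> = (\<Sum>i\<in>UNIV. (?q $ i * \<alpha> $ i * \<pi> k $ i) *\<^sub>R gsum k s
       + (?q $ i * \<alpha> $ i) *\<^sub>R (ybar k s $ i - \<pi> k $ i *\<^sub>R gsum k s) + (?q $ i * \<alpha> $ i) *\<^sub>R zeta k s $ i)"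
      by (intro sum.cong refl) (simp add: scaleR_diff_right scaleR_add_right del: pi_seq.simps)
    finally show ?thesis by (simp only: sum.distrib \<theta>_def scaleR_left.sum)
  qed
  have e: "norm (\<Sum>i\<in>UNIV. (?q $ i * \<alpha> $ i) *\<^sub>R (ybar k s $ i - \<pi> k $ i *\<^sub>R gsum k s)) \<le> \<theta> k * (chi k * eT k s)"
  proof -
    have "norm (ybar k s $ i - \<pi> k $ i *\<^sub>R gsum k s) \<le> \<pi> k $ i * (chi k * eT k s)" for i
    proof -
      have p: "0 < \<pi> k $ i" by (rule pw.pos)
      have "ybar k s $ i - \<pi> k $ i *\<^sub>R gsum k s = \<pi> k $ i *\<^sub>R ((1 / \<pi> k $ i) *\<^sub>R ybar k s $ i - gsum k s)"
        using p by (simp add: scaleR_diff_right del: pi_seq.simps)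
      moreover have "norm ((1 / \<pi> k $ i) *\<^sub>R ybar k s $ i - gsum k s) \<le> chi k * eT k s"
        unfolding eT_def sum_ybar[OF s, symmetric] by (rule pw.norm_component_le[OF chi])
      ultimately show ?thesis using p by (simp del: pi_seq.simps)
    qed
    then have "norm (\<Sum>i\<in>UNIV. (?q $ i * \<alpha> $ i) *\<^sub>R (ybar k s $ i - \<pi> k $ i *\<^sub>R gsum k s))
       \<le> (\<Sum>i\<in>UNIV. (?q $ i * \<alpha> $ i) * (\<pi> k $ i * (chi k * eT k s)))"
      using c by (intro sum_norm_le) (simp add: mult_left_mono del: pi_seq.simps)
    then show ?thesis by (simp add: \<theta>_def sum_distrib_right mult.assoc)
  qed
  have z: "norm (\<Sum>i\<in>UNIV. (?q $ i * \<alpha> $ i) *\<^sub>R zeta k s $ i) \<le> eN k s"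
    unfolding eN_def using c by (intro sum_norm_le) simp
  have b: "norm (weighted_avg ?q ?b) \<le> bbar * eU k s"
    using norm_weighted_avg_le[OF \<phi>(1), of "Suc k" ?b] momentum_bound(1)[of k s] by linarith
  have g: "norm (\<theta> k *\<^sub>R (gsum k s - ?G)) \<le> \<theta> k * (L * sqrt n * vphi * eD k s)"
    using gsum_dev[of k s] \<theta>_bounds(2)[of k] by (simp add: mult_left_mono)
  have d: "norm ((xh k s - xstar) - \<theta> k *\<^sub>R ?G) \<le> (1 - 99 / 100 * (\<theta> k * (n * mu))) * norm (xh k s - xstar)"
    by (rule gradient_step_contraction[OF monotone grad_sum_bound \<theta>_bounds(2) small_step])
  have "xh (Suc k) s - xstar = ((xh k s - xstar) - \<theta> k *\<^sub>R ?G) - \<theta> k *\<^sub>R (gsum k s - ?G)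
      - (\<Sum>i\<in>UNIV. (?q $ i * \<alpha> $ i) *\<^sub>R (ybar k s $ i - \<pi> k $ i *\<^sub>R gsum k s))
      - (\<Sum>i\<in>UNIV. (?q $ i * \<alpha> $ i) *\<^sub>R zeta k s $ i) + weighted_avg ?q ?b"
    unfolding xx a by (simp add: scaleR_diff_right del: pi_seq.simps)
  then have "eX (Suc k) s \<le> norm ((xh k s - xstar) - \<theta> k *\<^sub>R ?G) + norm (\<theta> k *\<^sub>R (gsum k s - ?G))
      + norm (\<Sum>i\<in>UNIV. (?q $ i * \<alpha> $ i) *\<^sub>R (ybar k s $ i - \<pi> k $ i *\<^sub>R gsum k s))
      + norm (\<Sum>i\<in>UNIV. (?q $ i * \<alpha> $ i) *\<^sub>R zeta k s $ i) + norm (weighted_avg ?q ?b)"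
    unfolding eX_def by (simp only: norm_triangle_5)
  moreover have "\<theta> k * (L * sqrt n * vphi * eD k s + chi k * eT k s)
      = \<theta> k * (L * sqrt n * vphi * eD k s) + \<theta> k * (chi k * eT k s)" by (rule distrib_left)
  ultimately show ?thesis using e z b g d unfolding eX_def by linarith
qed

lemma eP_step:
  assumes "1 \<le> k"
  shows "eP (Suc k) s \<le> (1 - \<kappa> k / 2) * eT k s"
  unfolding eP_def eT_def diff_Suc_1
  by (rule power2_contraction[OF tracking_contraction[OF assms] S_err_nonneg S_err_nonneg \<kappa>[OF assms]])
    (rule less_imp_le[OF pw.pos])+

text \<open>Beyond mixing, the tracker changes by the gradient increment, which Lipschitz continuity
  bounds by \<open>L\<close> times the last step.\<close>

lemma eT_bound:
  assumes "1 \<le> k" "s \<in> space P"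
  shows "eT k s \<le> eP k s + chi k * L * eU k s"
proof -
  obtain l where l: "k = Suc l" using assms(1) by (cases k) auto
  have p: "0 \<le> \<pi> k $ i" for i by (rule less_imp_le[OF pw.pos])
  have "eT k s \<le> eP k s + S_err (gradx (x k s) - gradx (x l s)) (\<pi> k)"
    unfolding eT_def eP_def l ybar_Suc[OF assms(2)] diff_Suc_1 by (rule S_err_triangle) (use p l in simp)
  also have "S_err (gradx (x k s) - gradx (x l s)) (\<pi> k) \<le> chi k * norm (gradx (x k s) - gradx (x l s))"
    by (rule pw.S_err_le_norm[OF chi])
  also have "norm (gradx (x k s) - gradx (x l s)) \<le> L * eU k s"
  proof -
    have "norm (gradx (x k s) - gradx (x l s)) \<le> L2_set (\<lambda>i. L * norm ((x k s - x l s) $ i)) UNIV"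
      unfolding norm_eq_L2 using lip by (intro L2_set_mono) (auto simp: gradx_def)
    also have "\<dots> = L * eU k s" using L by (simp add: eU_def l prev_iterate_def norm_eq_L2 L2_set_right_distrib)
    finally show ?thesis .
  qed
  finally show ?thesis using chi(2)[of k] by (simp add: mult.assoc)
qed

end

context push_pull_contracting begin

text \<open>The third component is treated in mean square in order to match row 2 of
  \<open>M\<close> with its own noise term. Besides the tracking error, y is controlled by its sum,
  in which only the current samples survive, with second moment at most
  \<open>n * \<sigma>\<^sup>2\<close>.\<close>

lemma step_err_recursion:
  assumes k: "1 \<le> k"
  shows "(\<integral>s. (eU (Suc k) s)\<^sup>2 \<partial>P) \<le> 12 * vphi\<^sup>2 * (\<integral>s. (eD k s)\<^sup>2 \<partial>P) + 3 * bbar\<^sup>2 * (\<integral>s. (eU k s)\<^sup>2 \<partial>P)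
    + 3 * abar\<^sup>2 * ((\<integral>s. (S_err (y k s) (\<pi> k))\<^sup>2 \<partial>P)
      + 2 * n * L\<^sup>2 * vphi\<^sup>2 * ((\<integral>s. (eX k s)\<^sup>2 \<partial>P) + (\<integral>s. (eD k s)\<^sup>2 \<partial>P)) + 2 * n * \<sigma>\<^sup>2)"
proof -
  let ?N = "\<lambda>s. \<Sum>i\<in>UNIV. nz k i s"
  let ?S = "\<lambda>s. S_err (y k s) (\<pi> k)"
  have N: "integrable P (\<lambda>s. (norm (?N s))\<^sup>2)" "(\<integral>s. (norm (?N s))\<^sup>2 \<partial>P) \<le> n * \<sigma>\<^sup>2"
    using noise_bound[where U = "\<lambda>_. 0" and k = k and I = UNIV and v = "\<lambda>_. 1"] by (simp_all add: n_card mult.commute)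
  have Ssq: "sq_integrable P ?S" by (intro sq_integrable_S_err y_sq)
  have int: "integrable P (\<lambda>s. (eX k s)\<^sup>2)" "integrable P (\<lambda>s. (eD k s)\<^sup>2)" "integrable P (\<lambda>s. (eU k s)\<^sup>2)"
    "integrable P (\<lambda>s. (?S s)\<^sup>2)" "integrable P (\<lambda>s. (eU (Suc k) s)\<^sup>2)"
    using e_sq[of k] e_sq(3)[of "Suc k"] Ssq by (simp_all add: sq_integrable_def)
  have pt: "(eU (Suc k) s)\<^sup>2 \<le> 12 * vphi\<^sup>2 * (eD k s)\<^sup>2 + 3 * bbar\<^sup>2 * (eU k s)\<^sup>2
    + 3 * abar\<^sup>2 * ((?S s)\<^sup>2 + 2 * n * L\<^sup>2 * vphi\<^sup>2 * ((eX k s)\<^sup>2 + (eD k s)\<^sup>2) + 2 * (norm (?N s))\<^sup>2)"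
    if s: "s \<in> space P" for s
  proof -
    let ?a = "scal \<alpha> (y k s)" and ?b = "scal \<beta> (x k s - prev_iterate xm1 x k s)"
    have prev: "prev_iterate xm1 x (Suc k) s = x k s" by (simp add: prev_iterate_def)
    have "x (Suc k) s - x k s = (mixA k (x k s) - x k s) - ?a + ?b" by (simp add: x_Suc_vec[OF s])
    then have "eU (Suc k) s = norm ((mixA k (x k s) - x k s) - ?a + ?b)" unfolding eU_def prev by (rule arg_cong)
    then have "eU (Suc k) s \<le> norm (mixA k (x k s) - x k s) + norm ?a + norm ?b"
      using norm_triangle_ineq[of "(mixA k (x k s) - x k s) - ?a" ?b] norm_triangle_ineq4[of "mixA k (x k s) - x k s" ?a]
      by linarith
    moreover have "norm ?a \<le> abar * norm (y k s)" using \<alpha> by (intro norm_scal_le) (auto intro: less_imp_le)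
    ultimately have "eU (Suc k) s \<le> 2 * vphi * eD k s + abar * norm (y k s) + bbar * eU k s"
      using mixA_move[OF k, of s] momentum_bound(2)[of k s] by linarith
    then have "(eU (Suc k) s)\<^sup>2 \<le> (2 * vphi * eD k s + abar * norm (y k s) + bbar * eU k s)\<^sup>2"
      using e_nonneg by (intro power_mono) auto
    also have "\<dots> \<le> 3 * ((2 * vphi * eD k s)\<^sup>2 + (abar * norm (y k s))\<^sup>2 + (bbar * eU k s)\<^sup>2)"
      using sum_squares_bound[of "2 * vphi * eD k s" "abar * norm (y k s)"]
        sum_squares_bound[of "2 * vphi * eD k s" "bbar * eU k s"]
        sum_squares_bound[of "abar * norm (y k s)" "bbar * eU k s"]
      by (simp add: power2_sum algebra_simps)
    also have "\<dots> = 12 * vphi\<^sup>2 * (eD k s)\<^sup>2 + 3 * bbar\<^sup>2 * (eU k s)\<^sup>2 + 3 * abar\<^sup>2 * (norm (y k s))\<^sup>2"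
      by (simp add: power_mult_distrib algebra_simps)
    also have "(norm (y k s))\<^sup>2 \<le> (?S s)\<^sup>2 + 2 * n * L\<^sup>2 * vphi\<^sup>2 * ((eX k s)\<^sup>2 + (eD k s)\<^sup>2) + 2 * (norm (?N s))\<^sup>2"
    proof -
      \<comment> \<open>Mixing preserves the sum, so the noise increments telescope as well.\<close>
      have "(\<Sum>i\<in>UNIV. zeta k s $ i) = ?N s"
      proof -
        have sm: "(\<Sum>i\<in>UNIV. \<Sum>j\<in>UNIV. B l $ i $ j *\<^sub>R zeta l s $ j) = (\<Sum>j\<in>UNIV. zeta l s $ j)" for l
          using sum_mixB[of l "zeta l s"] by (simp add: mixB_def)
        show ?thesis by (induction k) (simp_all add: sum.distrib sum_subtractf sm)
      qed
      then have "(\<Sum>i\<in>UNIV. y k s $ i) = gsum k s + ?N s"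
        using sum_ybar[OF s, of k] by (simp add: ybar_def sum_subtractf algebra_simps)
      then have "(norm (\<Sum>i\<in>UNIV. y k s $ i))\<^sup>2 \<le> 2 * (norm (gsum k s))\<^sup>2 + 2 * (norm (?N s))\<^sup>2"
        using power_mono[OF norm_triangle_ineq[of "gsum k s" "?N s"], of 2] sum_squares_bound[of "norm (gsum k s)" "norm (?N s)"]
        by (simp add: power2_sum)
      moreover have "(norm (gsum k s))\<^sup>2 \<le> n * L\<^sup>2 * vphi\<^sup>2 * ((eX k s)\<^sup>2 + (eD k s)\<^sup>2)"
      proof -
        have "norm (gsum k s) \<le> L * sqrt n * norm (x k s - rep xstar)"
          using grad_difference_sum[of "x k s" xstar] by (simp add: critical)
        also have "\<dots> \<le> L * sqrt n * (vphi * wn (\<phi> k) (x k s - rep xstar))"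
          using \<phi>(3,4) L n_pos by (intro mult_left_mono norm_le_wn) auto
        finally have "(norm (gsum k s))\<^sup>2 \<le> (L * sqrt n * (vphi * wn (\<phi> k) (x k s - rep xstar)))\<^sup>2"
          by (intro power_mono) auto
        also have "\<dots> = n * L\<^sup>2 * vphi\<^sup>2 * weighted_norm2 (\<phi> k) (x k s - rep xstar)"
          using n_pos by (simp add: power_mult_distrib wn_power2 \<phi>_pos)
        also have "weighted_norm2 (\<phi> k) (x k s - rep xstar) = (eX k s)\<^sup>2 + (eD k s)\<^sup>2"
          unfolding eX_def eD_def xh_def wn_power2[OF \<phi>_pos(2)] by (subst weighted_norm2_shift[OF \<phi>(1)]) simp
        finally show ?thesis .
      qed
      ultimately show ?thesis using pw.norm_power2_le[of "y k s" k] by linarith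
    qed
    finally show ?thesis by (simp add: mult_left_mono)
  qed
  have "(\<integral>s. (eU (Suc k) s)\<^sup>2 \<partial>P) \<le> (\<integral>s. 12 * vphi\<^sup>2 * (eD k s)\<^sup>2 + 3 * bbar\<^sup>2 * (eU k s)\<^sup>2
    + 3 * abar\<^sup>2 * ((?S s)\<^sup>2 + 2 * n * L\<^sup>2 * vphi\<^sup>2 * ((eX k s)\<^sup>2 + (eD k s)\<^sup>2) + 2 * (norm (?N s))\<^sup>2) \<partial>P)"
    using int N(1) pt by (intro integral_mono) auto
  also have "\<dots> = 12 * vphi\<^sup>2 * (\<integral>s. (eD k s)\<^sup>2 \<partial>P) + 3 * bbar\<^sup>2 * (\<integral>s. (eU k s)\<^sup>2 \<partial>P)
    + 3 * abar\<^sup>2 * ((\<integral>s. (?S s)\<^sup>2 \<partial>P) + 2 * n * L\<^sup>2 * vphi\<^sup>2 * ((\<integral>s. (eX k s)\<^sup>2 \<partial>P) + (\<integral>s. (eD k s)\<^sup>2 \<partial>P))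
      + 2 * (\<integral>s. (norm (?N s))\<^sup>2 \<partial>P))"
    using int N(1) by simp
  also have "\<dots> \<le> 12 * vphi\<^sup>2 * (\<integral>s. (eD k s)\<^sup>2 \<partial>P) + 3 * bbar\<^sup>2 * (\<integral>s. (eU k s)\<^sup>2 \<partial>P)
    + 3 * abar\<^sup>2 * ((\<integral>s. (?S s)\<^sup>2 \<partial>P) + 2 * n * L\<^sup>2 * vphi\<^sup>2 * ((\<integral>s. (eX k s)\<^sup>2 \<partial>P) + (\<integral>s. (eD k s)\<^sup>2 \<partial>P))
      + 2 * (n * \<sigma>\<^sup>2))"
    using N(2) by (intro add_left_mono mult_left_mono) auto
  finally show ?thesis by (simp add: mult.assoc)
qed

end

locale push_pull_small = push_pull_contracting +
  fixes \<eta> C H \<kappa>min :: real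
  assumes n2: "2 \<le> n" and \<eta>: "0 < \<eta>" and C: "0 < C" and H: "0 < H" "H \<le> 1"
    and G_C: "2 * C \<le> G" "n * \<eta> * C \<le> G"
    and vphi_n: "sqrt n \<le> vphi" and mm_n: "sqrt n \<le> 1 / sqrt mm"
    and abar_small: "96 * abar * L\<^sup>2 * vphi\<^sup>2 * (1 / sqrt mm) \<le> C * H * sqrt n * \<eta> * mu"
    and bbar_small: "64 * bbar * L * vphi\<^sup>2 \<le> C * sqrt n * \<eta> * mu"
    and \<kappa>_bounds: "\<And>k. 1 \<le> k \<Longrightarrow> \<kappa>min \<le> \<kappa> k \<and> \<kappa> k \<le> 1" "0 < \<kappa>min"
    and chi_bounds: "\<And>k. chi k \<le> 1 / sqrt mm"
      "\<And>k. 1 \<le> k \<Longrightarrow> chi k \<le> \<kappa> k * (2 / (H * sqrt n * \<eta>))" "\<And>k. 1 \<le> k \<Longrightarrow> chi k * H \<le> sqrt n / 2"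
begin

text \<open>\<open>\<alpha> $ undefined\<close> is the step size of an arbitrary agent: any uniform
  positive lower bound for \<open>\<theta> k\<close> serves, as the limiting levels do not depend on
  it.\<close>

sublocale rec: error_recursion "sqrt n" L mu \<eta> vphi C H G abar bbar "1 / sqrt mm" noise_level
    "1 / vphi\<^sup>2 * \<alpha> $ undefined * mm" \<kappa>min \<theta> chi \<kappa>
    "\<lambda>k. l2 P (eX k)" "\<lambda>k. l2 P (eD k)" "\<lambda>k. l2 P (eU k)" "\<lambda>k. l2 P (eP k)" "\<lambda>k. l2 P (eT k)"
proof
  have sn: "(sqrt n)\<^sup>2 = n" using n2 by simp
  show "2 \<le> (sqrt n)\<^sup>2" "0 < sqrt n" using n2 by auto
  show "(sqrt n)\<^sup>2 * \<eta> * C \<le> G" using G_C sn by simp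
  show "0 < 1 / vphi\<^sup>2 * \<alpha> $ undefined * mm" using \<phi>(4) \<alpha>(1) mm(1) by simp
  fix k :: nat
  show "1 / vphi\<^sup>2 * \<alpha> $ undefined * mm \<le> \<theta> k \<and> \<theta> k \<le> abar" using \<theta>_bounds by blast
  assume k: "1 \<le> k"
  have t: "0 \<le> \<theta> k" and c: "0 \<le> chi k" by (rule \<theta>_bounds, rule less_imp_le[OF chi(2)])
  have th: "\<theta> k * (n * mu) \<le> 1" by (rule small_step)
  have LD: "0 \<le> L * sqrt n * vphi" using L n_pos \<phi>(4) by simp
  have nL: "0 \<le> n * L" using L n_pos by simp
  note dist = distrib_left distrib_right mult.assoc add.assoc
  have "l2 P (eX (Suc k)) \<le> (1 - 99 / 100 * (\<theta> k * (n * mu))) * l2 P (eX k) + \<theta> k * (L * sqrt n * vphi) * l2 P (eD k)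
      + \<theta> k * chi k * l2 P (eT k) + 1 * l2 P (eN k) + bbar * l2 P (eU k)"
    by (rule l2_le_combination[OF e_sq(1) e_sq(1,2,4,6,3)])
      (use th t c LD bbar_nonneg e_nonneg eX_step[OF k] in \<open>auto simp: dist\<close>)
  then show "l2 P (eX (Suc k)) \<le> (1 - 99 / 100 * mu * (sqrt n)\<^sup>2 * \<theta> k) * l2 P (eX k)
      + \<theta> k * (L * sqrt n * vphi * l2 P (eD k) + chi k * l2 P (eT k) + noise_level) + bbar * l2 P (eU k)"
    using eN_l2[of k] unfolding sn by (simp add: algebra_simps)
  have DD: "0 \<le> vphi * \<theta> k * (L * sqrt n * vphi)" "0 \<le> vphi * \<theta> k * (n * L)" "0 \<le> vphi\<^sup>2 * \<theta> k * (n * L)"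
      "0 \<le> vphi\<^sup>2 * \<theta> k * (L * sqrt n * vphi)"
    using t LD nL \<phi>(4) by simp_all
  have "l2 P (eD (Suc k)) \<le> (1 - G / 2 + vphi * \<theta> k * (L * sqrt n * vphi)) * l2 P (eD k) + vphi * \<theta> k * chi k * l2 P (eT k)
      + vphi * \<theta> k * (n * L) * l2 P (eX k) + vphi * l2 P (eN k) + bbar * l2 P (eU k)"
    by (rule l2_le_combination[OF e_sq(2) e_sq(2,4,1,6,3)])
      (use DD G t c LD nL \<phi>(4) bbar_nonneg e_nonneg eD_step[OF k] in \<open>auto simp: algebra_simps\<close>)
  moreover have "vphi * l2 P (eN k) \<le> vphi * (\<theta> k * noise_level)" using eN_l2[of k] \<phi>(4) by simp
  ultimately show "l2 P (eD (Suc k)) \<le> (1 - G / 2) * l2 P (eD k)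
      + vphi * \<theta> k * (chi k * l2 P (eT k) + (sqrt n)\<^sup>2 * L * l2 P (eX k) + L * sqrt n * vphi * l2 P (eD k) + noise_level) + bbar * l2 P (eU k)"
    unfolding sn by (simp add: algebra_simps)
  have "l2 P (eU (Suc k)) \<le> (2 * vphi + vphi\<^sup>2 * \<theta> k * (L * sqrt n * vphi)) * l2 P (eD k) + vphi\<^sup>2 * \<theta> k * chi k * l2 P (eT k)
      + vphi\<^sup>2 * \<theta> k * (n * L) * l2 P (eX k) + vphi\<^sup>2 * l2 P (eN k) + bbar * l2 P (eU k)"
    by (rule l2_le_combination[OF e_sq(3) e_sq(2,4,1,6,3)])
      (use DD t c LD nL \<phi>(4) bbar_nonneg e_nonneg eU_step[OF k] in \<open>auto simp: algebra_simps\<close>)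
  moreover have "vphi\<^sup>2 * l2 P (eN k) \<le> vphi\<^sup>2 * (\<theta> k * noise_level)" using eN_l2[of k] by (intro mult_left_mono) auto
  ultimately show "l2 P (eU (Suc k)) \<le> 2 * vphi * l2 P (eD k)
      + vphi\<^sup>2 * \<theta> k * (chi k * l2 P (eT k) + (sqrt n)\<^sup>2 * L * l2 P (eX k) + L * sqrt n * vphi * l2 P (eD k) + noise_level) + bbar * l2 P (eU k)"
    unfolding sn by (simp add: algebra_simps)
  have k1: "0 \<le> 1 - \<kappa> k / 2" using \<kappa>_bounds(1)[OF k] by simp
  have "l2 P (eP (Suc k)) \<le> l2 P (\<lambda>s. (1 - \<kappa> k / 2) * eT k s)"
    using eP_step[OF k] e_nonneg by (intro l2_mono e_sq sq_integrable_cmult) simp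
  then show "l2 P (eP (Suc k)) \<le> (1 - \<kappa> k / 2) * l2 P (eT k)" using k1 by (simp add: l2_cmult)
  have "l2 P (eT k) \<le> l2 P (\<lambda>s. eP k s + chi k * L * eU k s)"
    using eT_bound[OF k] e_nonneg by (intro l2_mono sq_integrable_add e_sq sq_integrable_cmult) simp
  also have "\<dots> \<le> l2 P (eP k) + l2 P (\<lambda>s. chi k * L * eU k s)"
    by (intro l2_triangle e_sq sq_integrable_cmult)
  finally show "l2 P (eT k) \<le> l2 P (eP k) + chi k * L * l2 P (eU k)" using c L by (simp add: l2_cmult)
qed (use mu mu_L \<eta> C H G G_C vphi_n mm_n abar_pos abar_small bbar_nonneg bbar_small noise_level_pos \<kappa>_bounds
    chi_bounds less_imp_le[OF chi(2)] l2_nonneg in auto)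

lemma eventually_levels:
  "\<exists>K\<ge>1. \<forall>k\<ge>K. (\<integral>s. (eX k s)\<^sup>2 \<partial>P) \<le> (18 / 5 * noise_level / (mu * n))\<^sup>2
    \<and> (\<integral>s. (eD k s)\<^sup>2 \<partial>P) \<le> (12 / 5 * vphi * abar * (143 / 25 * noise_level * L / mu) / G)\<^sup>2
    \<and> (\<integral>s. (S_err (y k s) (\<pi> k))\<^sup>2 \<partial>P) \<le> \<sigma>\<^sup>2 / mm * (1 + 1 / b) * (1 + sqrt n)\<^sup>2"
proof -
  obtain K where K: "K \<ge> 1" "\<And>k. k \<ge> K \<Longrightarrow> l2 P (eX k) \<le> 18 / 5 * noise_level / (mu * (sqrt n)\<^sup>2)
     \<and> l2 P (eD k) \<le> 12 / 5 * vphi * abar * (143 / 25 * noise_level * L / mu) / G \<and> 1 / sqrt mm * l2 P (eT k) \<le> noise_level"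
    using rec.eventually_small by blast
  show ?thesis
  proof (intro exI[of _ K] conjI allI impI K(1))
    fix k assume k: "K \<le> k"
    have "l2 P (eX k) \<le> 18 / 5 * noise_level / (mu * n)" using K(2)[OF k] n2 by simp
    then show "(\<integral>s. (eX k s)\<^sup>2 \<partial>P) \<le> (18 / 5 * noise_level / (mu * n))\<^sup>2"
      unfolding l2_power2[symmetric] by (intro power_mono l2_nonneg)
    show "(\<integral>s. (eD k s)\<^sup>2 \<partial>P) \<le> (12 / 5 * vphi * abar * (143 / 25 * noise_level * L / mu) / G)\<^sup>2"
      unfolding l2_power2[symmetric] using K(2)[OF k] by (intro power_mono l2_nonneg) simp
    \<comment> \<open>The common unit for the tracking error: \<open>ybar\<close> contributes at
      most \<open>q\<close> and the accumulated noise at most \<open>sqrt n * q\<close>, whence the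
      factor \<open>(1 + sqrt n)\<^sup>2\<close>.\<close>
    define q where "q = \<sigma> / sqrt mm * sqrt (1 + 1 / b)"
    have smm: "0 < sqrt mm" "sqrt mm * sqrt mm = mm" using mm(1) by simp_all
    have q: "0 \<le> q" "q\<^sup>2 = \<sigma>\<^sup>2 / mm * (1 + 1 / b)"
      using \<sigma> mm(1) b(1) by (simp_all add: q_def power_mult_distrib power_divide add_nonneg_nonneg)
    have nl: "sqrt mm * noise_level = q"
      using smm by (simp add: noise_level_def q_def field_simps)
    have "l2 P (eT k) \<le> sqrt mm * noise_level" using K(2)[OF k] smm by (simp add: field_simps)
    then have T: "l2 P (eT k) \<le> q" using nl by simp
    have Z: "l2 P (\<lambda>s. S_err (zeta k s) (\<pi> k)) \<le> sqrt n * q"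
    proof (subst l2_le_iff)
      show "(\<integral>s. (S_err (zeta k s) (\<pi> k))\<^sup>2 \<partial>P) \<le> (sqrt n * q)\<^sup>2"
        using tracking_noise[of k] n2 by (simp add: power_mult_distrib q(2))
    qed (use q n2 in auto)
    have p: "0 \<le> \<pi> k $ i" for i by (rule less_imp_le[OF pw.pos])
    have "S_err (y k s) (\<pi> k) \<le> eT k s + S_err (zeta k s) (\<pi> k)" for s
      using S_err_triangle[of "\<pi> k" "ybar k s" "zeta k s"] p by (simp add: ybar_def eT_def)
    moreover have nn: "0 \<le> S_err (y k s) (\<pi> k)" for s by (rule S_err_nonneg[OF p])
    ultimately have "l2 P (\<lambda>s. S_err (y k s) (\<pi> k)) \<le> l2 P (\<lambda>s. eT k s + S_err (zeta k s) (\<pi> k))"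
      using nn by (intro l2_mono sq_integrable_add sq_integrable_S_err y_sq e_sq zeta_sq) simp
    also have "\<dots> \<le> l2 P (eT k) + l2 P (\<lambda>s. S_err (zeta k s) (\<pi> k))"
      by (intro l2_triangle e_sq S_zeta_sq)
    also have "\<dots> \<le> q * (1 + sqrt n)" using T Z by (simp add: algebra_simps)
    finally have "(l2 P (\<lambda>s. S_err (y k s) (\<pi> k)))\<^sup>2 \<le> (q * (1 + sqrt n))\<^sup>2"
      by (intro power_mono l2_nonneg)
    then show "(\<integral>s. (S_err (y k s) (\<pi> k))\<^sup>2 \<partial>P) \<le> \<sigma>\<^sup>2 / mm * (1 + 1 / b) * (1 + sqrt n)\<^sup>2"
      unfolding l2_power2 by (simp add: power_mult_distrib q(2))
  qed
qed

end

section \<open>Consequences of the step-size conditions and lower bounds for the comparison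
  solution\<close>

context comparison_system begin

text \<open>Inserting the upper bound \<open>momentum\<close> for \<open>\<beta>\<^sup>2\<close>
  produces exactly two of the four terms of \<open>vs2\<close>.\<close>

lemma momentum_budget: "576 * L\<^sup>2 * \<phi>\<^sup>2 / (n * \<eta>\<^sup>2 * mu\<^sup>2) * \<beta>\<^sup>2 \<le> vs2 * \<alpha>\<^sup>2"
proof -
  have nz: "n \<noteq> 0" "\<eta> \<noteq> 0" "mu \<noteq> 0" "1 - \<tau>\<^sup>2 \<noteq> 0" using n \<eta> mu c2 by auto
  have "576 * L\<^sup>2 * \<phi>\<^sup>2 / (n * \<eta>\<^sup>2 * mu\<^sup>2) * \<beta>\<^sup>2
    \<le> 576 * L\<^sup>2 * \<phi>\<^sup>2 / (n * \<eta>\<^sup>2 * mu\<^sup>2) * (\<alpha>\<^sup>2 * ((n * \<eta> * L\<^sup>2 * (1 - \<tau>\<^sup>2) + 32 * \<nu>) / (48 * (1 - \<tau>\<^sup>2))))"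
    using momentum n by (intro mult_left_mono) auto
  also have "\<dots> = (12 * L\<^sup>2 * L\<^sup>2 * \<phi>\<^sup>2 / (\<eta> * mu\<^sup>2) + 384 * L\<^sup>2 * \<phi>\<^sup>2 * \<nu> / (n * \<eta>\<^sup>2 * mu\<^sup>2 * (1 - \<tau>\<^sup>2))) * \<alpha>\<^sup>2"
  proof -
    obtain H where H: "1 - \<tau>\<^sup>2 = H" "H \<noteq> 0" using nz by blast
    show ?thesis unfolding H(1) using nz H(2) by (simp add: field_simps power2_eq_square)
  qed
  also have "\<dots> \<le> vs2 * \<alpha>\<^sup>2"
  proof (rule mult_right_mono)
    have "vs2 = (12 * L\<^sup>2 * L\<^sup>2 * \<phi>\<^sup>2 / (\<eta> * mu\<^sup>2) + 384 * L\<^sup>2 * \<phi>\<^sup>2 * \<nu> / (n * \<eta>\<^sup>2 * mu\<^sup>2 * (1 - \<tau>\<^sup>2)))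
      + (n * L\<^sup>2 + 8 * \<nu> / (1 - \<tau>\<^sup>2))"
    proof -
      obtain H where H: "1 - \<tau>\<^sup>2 = H" "H \<noteq> 0" using nz by blast
      show ?thesis unfolding vs2 H(1) using nz H(2) by (simp add: field_simps power2_eq_square)
    qed
    moreover have "0 \<le> n * L\<^sup>2 + 8 * \<nu> / (1 - \<tau>\<^sup>2)" using n \<nu> c2 by simp
    ultimately show "12 * L\<^sup>2 * L\<^sup>2 * \<phi>\<^sup>2 / (\<eta> * mu\<^sup>2) + 384 * L\<^sup>2 * \<phi>\<^sup>2 * \<nu> / (n * \<eta>\<^sup>2 * mu\<^sup>2 * (1 - \<tau>\<^sup>2)) \<le> vs2" by linarith
  qed simp
  finally show ?thesis .
qed

lemma step_budget_nonneg: "0 \<le> vs2 * \<alpha>\<^sup>2"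
  by (rule order_trans[OF _ momentum_budget]) (use n in simp)

lemma step_budget: "8 * \<phi>\<^sup>2 * (vs2 * \<alpha>\<^sup>2) \<le> (1 - c\<^sup>2)\<^sup>2"
proof -
  have p: "0 < 8 * (1 + c\<^sup>2) * \<phi>\<^sup>2" using \<phi> by (intro mult_pos_pos) (auto simp: add_pos_nonneg)
  have "vs2 * \<alpha>\<^sup>2 \<le> (1 - c\<^sup>2)\<^sup>2 / (8 * (1 + c\<^sup>2) * \<phi>\<^sup>2)" using budget zero_le_power2[of \<beta>] by linarith
  then have "vs2 * \<alpha>\<^sup>2 * (8 * (1 + c\<^sup>2) * \<phi>\<^sup>2) \<le> (1 - c\<^sup>2)\<^sup>2" using p by (simp add: pos_le_divide_eq)
  moreover have "8 * \<phi>\<^sup>2 * (vs2 * \<alpha>\<^sup>2) \<le> vs2 * \<alpha>\<^sup>2 * (8 * (1 + c\<^sup>2) * \<phi>\<^sup>2)"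
  proof -
    have "0 \<le> vs2 * \<alpha>\<^sup>2 * (8 * c\<^sup>2 * \<phi>\<^sup>2)" by (intro mult_nonneg_nonneg step_budget_nonneg) auto
    then show ?thesis by (simp add: algebra_simps)
  qed
  ultimately show ?thesis by linarith
qed

text \<open>After squaring, \<open>momentum_budget\<close> and \<open>step_budget\<close> combine,
  since 64^2 is less than 8 * 576.\<close>

lemma momentum_bound: "64 * \<beta> * L * \<phi>\<^sup>2 \<le> (1 - c\<^sup>2) * sqrt n * \<eta> * mu"
proof (rule power2_le_imp_le)
  have nz: "n \<noteq> 0" "\<eta> \<noteq> 0" "mu \<noteq> 0" "0 < n" using n \<eta> mu by auto
  have "(64 * \<beta> * L * \<phi>\<^sup>2)\<^sup>2 \<le> n * \<eta>\<^sup>2 * mu\<^sup>2 * (8 * \<phi>\<^sup>2 * (576 * L\<^sup>2 * \<phi>\<^sup>2 / (n * \<eta>\<^sup>2 * mu\<^sup>2) * \<beta>\<^sup>2))"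
    using nz by (simp add: power_mult_distrib)
  also have "\<dots> \<le> n * \<eta>\<^sup>2 * mu\<^sup>2 * (8 * \<phi>\<^sup>2 * (vs2 * \<alpha>\<^sup>2))"
    using nz by (intro mult_left_mono momentum_budget) auto
  also have "\<dots> \<le> n * \<eta>\<^sup>2 * mu\<^sup>2 * (1 - c\<^sup>2)\<^sup>2"
    using nz by (intro mult_left_mono step_budget) auto
  also have "\<dots> = ((1 - c\<^sup>2) * sqrt n * \<eta> * mu)\<^sup>2" using nz by (simp add: power_mult_distrib)
  finally show "(64 * \<beta> * L * \<phi>\<^sup>2)\<^sup>2 \<le> ((1 - c\<^sup>2) * sqrt n * \<eta> * mu)\<^sup>2" .
qed (use n \<eta> mu c2 in auto)

end

text \<open>\<open>X\<close> is a bound for the numbers \<open>1 / min_entry (\<pi> k)\<close> that is sharp enough for the two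
  inequalities between \<open>\<tau>\<close> and \<open>X\<close>.\<close>

locale comparison_levels = comparison_system +
  fixes \<psi> \<sigma> b X G :: real
  assumes n2: "2 \<le> n" and \<sigma>: "0 < \<sigma>" and b: "0 < b" "b \<le> 1 / 2" and \<eta>1: "\<eta> \<le> 1"
    and X: "n \<le> X" "n * (X - 1) \<le> \<psi>" "(1 - \<tau>\<^sup>2) * \<eta>\<^sup>2 * X\<^sup>2 \<le> n * b\<^sup>2" "(1 - \<tau>\<^sup>2) * X\<^sup>2 \<le> n ^ 3 * b\<^sup>2"
    and \<nu>X: "3 * L\<^sup>2 * X \<le> (1 - \<tau>\<^sup>2) * \<nu>" and G: "2 * (1 - c\<^sup>2) \<le> G" and \<phi>n: "n \<le> \<phi>\<^sup>2"
begin

text \<open>The term of \<open>vs2\<close> with coefficient 384 is estimated from below by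
  \<open>\<nu>X\<close>; the constants match because 8 * 384 * 3 = 96^2.\<close>

lemma step_bound: "96 * \<alpha> * L\<^sup>2 * \<phi>\<^sup>2 * sqrt X \<le> (1 - c\<^sup>2) * (1 - \<tau>\<^sup>2) * sqrt n * \<eta> * mu"
proof (rule power2_le_imp_le)
  have nz: "n \<noteq> 0" "\<eta> \<noteq> 0" "mu \<noteq> 0" "1 - \<tau>\<^sup>2 \<noteq> 0" "0 < n" "0 \<le> X" using n \<eta> mu c2 X(1) by auto
  let ?q = "n * \<eta>\<^sup>2 * mu\<^sup>2 * (1 - \<tau>\<^sup>2)\<^sup>2"
  have "vs2 = 384 * L\<^sup>2 * \<phi>\<^sup>2 * ((1 - \<tau>\<^sup>2) * \<nu>) / ?q
      + (12 * L\<^sup>2 * L\<^sup>2 * \<phi>\<^sup>2 / (\<eta> * mu\<^sup>2) + n * L\<^sup>2 + 8 * \<nu> / (1 - \<tau>\<^sup>2))"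
  proof -
    obtain H where H: "1 - \<tau>\<^sup>2 = H" "H \<noteq> 0" using nz by blast
    show ?thesis unfolding vs2 H(1) using nz H(2) by (simp add: field_simps power2_eq_square)
  qed
  moreover have "0 \<le> 12 * L\<^sup>2 * L\<^sup>2 * \<phi>\<^sup>2 / (\<eta> * mu\<^sup>2) + n * L\<^sup>2 + 8 * \<nu> / (1 - \<tau>\<^sup>2)"
    using n \<nu> c2 \<eta> by simp
  moreover have "384 * L\<^sup>2 * \<phi>\<^sup>2 * (3 * L\<^sup>2 * X) / ?q \<le> 384 * L\<^sup>2 * \<phi>\<^sup>2 * ((1 - \<tau>\<^sup>2) * \<nu>) / ?q"
    using nz by (intro divide_right_mono mult_left_mono \<nu>X) auto
  ultimately have v: "384 * L\<^sup>2 * \<phi>\<^sup>2 * (3 * L\<^sup>2 * X) / ?q \<le> vs2" by linarith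
  have "(96 * \<alpha> * L\<^sup>2 * \<phi>\<^sup>2 * sqrt X)\<^sup>2 = ?q * (8 * \<phi>\<^sup>2 * (384 * L\<^sup>2 * \<phi>\<^sup>2 * (3 * L\<^sup>2 * X) / ?q * \<alpha>\<^sup>2))"
    using nz by (simp add: power_mult_distrib) (simp add: power2_eq_square power4_eq_xxxx)
  also have "\<dots> \<le> ?q * (8 * \<phi>\<^sup>2 * (vs2 * \<alpha>\<^sup>2))"
    using nz by (intro mult_left_mono mult_right_mono v) auto
  also have "\<dots> \<le> ?q * (1 - c\<^sup>2)\<^sup>2" using nz by (intro mult_left_mono step_budget) auto
  also have "\<dots> = ((1 - c\<^sup>2) * (1 - \<tau>\<^sup>2) * sqrt n * \<eta> * mu)\<^sup>2" using nz by (simp add: power_mult_distrib)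
  finally show "(96 * \<alpha> * L\<^sup>2 * \<phi>\<^sup>2 * sqrt X)\<^sup>2 \<le> ((1 - c\<^sup>2) * (1 - \<tau>\<^sup>2) * sqrt n * \<eta> * mu)\<^sup>2" .
qed (use n \<eta> mu c2 in auto)

lemma small_step: "n * \<alpha> * L\<^sup>2 \<le> mu / 96"
proof -
  have "sqrt n * (96 * (n * \<alpha> * L\<^sup>2)) \<le> sqrt X * (96 * (\<phi>\<^sup>2 * \<alpha> * L\<^sup>2))"
    using n X(1) \<phi>n \<alpha> by (intro mult_mono mult_left_mono mult_right_mono) auto
  also have "\<dots> \<le> (1 - c\<^sup>2) * (1 - \<tau>\<^sup>2) * sqrt n * \<eta> * mu" using step_bound by (simp add: mult_ac)
  also have "\<dots> \<le> 1 * 1 * sqrt n * 1 * mu"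
    using n \<eta> \<eta>1 mu c2 by (intro mult_mono) auto
  finally have "sqrt n * (96 * (n * \<alpha> * L\<^sup>2)) \<le> sqrt n * mu" by simp
  then show ?thesis using n by simp
qed

definition level :: "nat \<Rightarrow> real" where
  "level = vec_index (the (mat_inverse (1\<^sub>m 4 - M)) *\<^sub>v b_vec n L \<sigma> c \<psi> \<nu> \<alpha>)"

lemma \<psi>_X: "n * X / 2 \<le> \<psi>"
proof -
  have "n * 2 \<le> n * X" using n2 X(1) by (intro mult_left_mono) auto
  moreover have "n * (X - 1) = n * X - n" by (simp add: algebra_simps)
  ultimately show ?thesis using X(2) by linarith
qed

lemma b_vec_simps:
  "vec_index (b_vec n L \<sigma> c \<psi> \<nu> \<alpha>) 0 = 3 * n * \<sigma>\<^sup>2 / 2 * \<alpha>\<^sup>2"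
  "vec_index (b_vec n L \<sigma> c \<psi> \<nu> \<alpha>) 1 = 4 * n * (1 + c\<^sup>2) * \<sigma>\<^sup>2 / (1 - c\<^sup>2) * \<alpha>\<^sup>2"
  "vec_index (b_vec n L \<sigma> c \<psi> \<nu> \<alpha>) 2 = 6 * n * \<sigma>\<^sup>2 * \<alpha>\<^sup>2"
  "vec_index (b_vec n L \<sigma> c \<psi> \<nu> \<alpha>) 3 = 4 * n * \<psi> * \<sigma>\<^sup>2 + 2 * L * n * \<psi> * \<sigma>\<^sup>2 * \<alpha> + 2 * n * \<nu> * \<sigma>\<^sup>2 * \<alpha>\<^sup>2"
  by (simp_all add: b_vec_def Let_def numeral_eq_Suc)

lemma \<psi>_pos: "0 < \<psi>"
  using \<psi>_X n2 X(1) by (intro less_le_trans[OF _ \<psi>_X]) auto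

lemma level_eq: "i < 4 \<Longrightarrow> level i = (\<Sum>j<4. M $$ (i, j) * level j) + vec_index (b_vec n L \<sigma> c \<psi> \<nu> \<alpha>) i"
  and level_nonneg: "i < 4 \<Longrightarrow> 0 \<le> level i"
proof -
  have 1: "b_vec n L \<sigma> c \<psi> \<nu> \<alpha> \<in> carrier_vec 4"
    by (rule carrier_vecI) (simp add: b_vec_def Let_def)
  have 2: "0 \<le> vec_index (b_vec n L \<sigma> c \<psi> \<nu> \<alpha>) i" if "i < 4" for i
  proof -
    have "0 \<le> 3 * n * \<sigma>\<^sup>2 / 2 * \<alpha>\<^sup>2" "0 \<le> 4 * n * (1 + c\<^sup>2) * \<sigma>\<^sup>2 / (1 - c\<^sup>2) * \<alpha>\<^sup>2" "0 \<le> 6 * n * \<sigma>\<^sup>2 * \<alpha>\<^sup>2"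
      "0 \<le> 4 * n * \<psi> * \<sigma>\<^sup>2 + 2 * L * n * \<psi> * \<sigma>\<^sup>2 * \<alpha> + 2 * n * \<nu> * \<sigma>\<^sup>2 * \<alpha>\<^sup>2"
      using n \<psi>_pos \<nu> L \<alpha> c2 by (intro add_nonneg_nonneg mult_nonneg_nonneg divide_nonneg_nonneg; simp)+
    then show ?thesis using that unfolding less_4_iff by (elim disjE) (simp_all only: b_vec_simps)
  qed
  show "i < 4 \<Longrightarrow> level i = (\<Sum>j<4. M $$ (i, j) * level j) + vec_index (b_vec n L \<sigma> c \<psi> \<nu> \<alpha>) i"
    "i < 4 \<Longrightarrow> 0 \<le> level i"
    unfolding level_def by (rule inverse_solution[OF 1 2]; assumption)+
qed

lemmas level_rows = level_eq[of 0, unfolded M_row_sums(1) b_vec_simps] level_eq[of 1, unfolded M_row_sums(2) b_vec_simps]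
  level_eq[of 2, unfolded M_row_sums(3) b_vec_simps] level_eq[of 3, unfolded M_row_sums(4) b_vec_simps]

lemma step_source_nonneg: "0 \<le> 2 * n * L\<^sup>2 * \<phi>\<^sup>2 * \<alpha>\<^sup>2 * (level 0 + level 1) + \<beta>\<^sup>2 * level 2 + \<alpha>\<^sup>2 * level 3"
  using n level_nonneg by simp

text \<open>Row 3 with its nonnegative couplings dropped: the noise floor
  \<open>4 * n * \<psi> * \<sigma>\<^sup>2\<close> stands against the loss (1 - \<tau>^2) /
  2.\<close>

lemma level_3: "8 * n * \<psi> * \<sigma>\<^sup>2 \<le> (1 - \<tau>\<^sup>2) * level 3"
proof -
  define q where "q = 2 * n * L\<^sup>2 * \<phi>\<^sup>2 * \<alpha>\<^sup>2 * (level 0 + level 1) + \<beta>\<^sup>2 * level 2 + \<alpha>\<^sup>2 * level 3"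
  have q: "0 \<le> q" unfolding q_def by (rule step_source_nonneg)
  have "level 3 = (1 + \<tau>\<^sup>2) / 2 * level 3 + 4 * \<phi>\<^sup>2 * \<nu> * level 1 + \<nu> * q
    + (4 * n * \<psi> * \<sigma>\<^sup>2 + 2 * L * n * \<psi> * \<sigma>\<^sup>2 * \<alpha> + 2 * n * \<nu> * \<sigma>\<^sup>2 * \<alpha>\<^sup>2)"
    using level_rows(4) by (simp add: q_def)
  moreover have "0 \<le> 4 * \<phi>\<^sup>2 * \<nu> * level 1" "0 \<le> \<nu> * q" "0 \<le> 2 * L * n * \<psi> * \<sigma>\<^sup>2 * \<alpha>" "0 \<le> 2 * n * \<nu> * \<sigma>\<^sup>2 * \<alpha>\<^sup>2"
    using \<nu> q L n \<psi>_pos \<alpha> level_nonneg[of 1] by simp_all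
  moreover have "level 3 - (1 + \<tau>\<^sup>2) / 2 * level 3 = (1 - \<tau>\<^sup>2) * level 3 / 2" by (simp add: field_simps)
  ultimately show ?thesis by linarith
qed

text \<open>In row 0 the loss and the tracking source are both proportional to
  \<open>\<alpha>\<close>, which therefore cancels.\<close>

lemma level_0_ge: "12 * level 3 \<le> (n * mu * \<eta>)\<^sup>2 * level 0"
proof -
  let ?m = "n * mu * \<eta>"
  have m: "0 < ?m" using n mu \<eta> by simp
  have "level 0 = (1 - ?m / 2 * \<alpha>) * level 0 + 3 * L\<^sup>2 * \<phi>\<^sup>2 / mu * \<alpha> * level 1
    + 6 / ?m * \<beta>\<^sup>2 / \<alpha> * level 2 + 6 / ?m * \<alpha> * level 3 + 3 * n * \<sigma>\<^sup>2 / 2 * \<alpha>\<^sup>2"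
    using level_rows(1) by simp
  moreover have "0 \<le> 3 * L\<^sup>2 * \<phi>\<^sup>2 / mu * \<alpha> * level 1" "0 \<le> 6 / ?m * \<beta>\<^sup>2 / \<alpha> * level 2" "0 \<le> 3 * n * \<sigma>\<^sup>2 / 2 * \<alpha>\<^sup>2"
    using m mu \<alpha> n level_nonneg[of 1] level_nonneg[of 2] by simp_all
  moreover have "(1 - ?m / 2 * \<alpha>) * level 0 = level 0 - \<alpha> * (?m * level 0) / 2" by (simp add: algebra_simps)
  moreover have "6 / ?m * \<alpha> * level 3 = \<alpha> * (12 * level 3 / ?m) / 2" by (simp add: mult_ac)
  moreover have "v \<le> u" if "l = l' + p + p' + q + r" "0 \<le> p" "0 \<le> p'" "0 \<le> r" "l' = l - u / 2" "q = v / 2"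
    for l l' p p' q r u v :: real using that by linarith
  ultimately have "\<alpha> * (12 * level 3 / ?m) \<le> \<alpha> * (?m * level 0)" by blast
  then have "12 * level 3 / ?m \<le> ?m * level 0" by (simp only: mult_le_cancel_left_pos[OF \<alpha>])
  then show ?thesis using m by (simp add: pos_divide_le_eq power2_eq_square mult_ac)
qed

text \<open>Row 1 with only the optimality source kept; one factor 1 - c^2 is the loss, the other
  the denominator of the source.\<close>

lemma level_1_ge: "8 * n * L\<^sup>2 * \<phi>\<^sup>2 * \<alpha>\<^sup>2 * level 0 \<le> (1 - c\<^sup>2)\<^sup>2 * level 1"
proof -
  define q where "q = 2 * n * L\<^sup>2 * \<phi>\<^sup>2 * \<alpha>\<^sup>2 * (level 0 + level 1) + \<beta>\<^sup>2 * level 2 + \<alpha>\<^sup>2 * level 3"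
  define C where "C = 1 - c\<^sup>2"
  have C: "0 < C" using c2 by (simp add: C_def)
  have q: "2 * n * L\<^sup>2 * \<phi>\<^sup>2 * \<alpha>\<^sup>2 * level 0 \<le> q" "0 \<le> q"
    using n level_nonneg step_source_nonneg by (simp_all add: q_def distrib_left)
  have "level 1 = (1 + c\<^sup>2) / 2 * level 1 + 2 * (1 + c\<^sup>2) / C * q + 4 * n * (1 + c\<^sup>2) * \<sigma>\<^sup>2 / C * \<alpha>\<^sup>2"
    using level_rows(2) by (simp add: q_def C_def)
  moreover have "0 \<le> 4 * n * (1 + c\<^sup>2) * \<sigma>\<^sup>2 / C * \<alpha>\<^sup>2" using n C by simp
  moreover have "level 1 - (1 + c\<^sup>2) / 2 * level 1 = C * level 1 / 2" by (simp add: C_def field_simps)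
  moreover have "2 / C * q \<le> 2 * (1 + c\<^sup>2) / C * q" using C q by (intro mult_right_mono divide_right_mono) auto
  ultimately have "2 / C * q \<le> C * level 1 / 2" by linarith
  then have "4 * q \<le> C * C * level 1" using C by (simp add: field_simps)
  then show ?thesis using q unfolding C_def[symmetric] power2_eq_square[of C] by linarith
qed

lemma noise_factor: "1 + 1 / b \<le> 3 / (2 * b)" "0 < 1 + 1 / b"
  using b by (simp_all add: field_simps)

text \<open>The factor \<open>1 / b\<close> of the noise is compensated by 1 - \<tau>^2, which is at
  most n b / 2 by the last condition in \<open>X\<close>; \<open>\<psi>_X\<close> does the
  rest.\<close>

lemma tracking_level: "\<sigma>\<^sup>2 * X * (1 + 1 / b) * (1 + sqrt n)\<^sup>2 \<le> level 3"
proof -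
  have X0: "0 < X" using n X(1) by simp
  have t: "(1 - \<tau>\<^sup>2) \<le> n * b / 2"
  proof -
    have "(1 - \<tau>\<^sup>2) * n\<^sup>2 \<le> (1 - \<tau>\<^sup>2) * X\<^sup>2" using n X(1) c2 by (intro mult_left_mono power_mono) auto
    also have "\<dots> \<le> n ^ 3 * b\<^sup>2" by (rule X(4))
    also have "\<dots> = n * b * b * n\<^sup>2" by (simp add: power2_eq_square power3_eq_cube)
    finally have "1 - \<tau>\<^sup>2 \<le> n * b * b" using n by simp
    also have "\<dots> \<le> n * b * (1 / 2)" using b n by (intro mult_left_mono) auto
    finally show ?thesis by simp
  qed
  have "(1 + sqrt n)\<^sup>2 \<le> 2 + 2 * n"
    using sum_squares_bound[of 1 "sqrt n"] n by (simp add: power2_sum)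
  then have s: "(1 + sqrt n)\<^sup>2 \<le> 3 * n" using n2 by linarith
  have "(1 - \<tau>\<^sup>2) * (\<sigma>\<^sup>2 * X * (1 + 1 / b) * (1 + sqrt n)\<^sup>2) \<le> n * b / 2 * (\<sigma>\<^sup>2 * X * (3 / (2 * b)) * (3 * n))"
    using s t noise_factor c2 X0 n b by (intro mult_mono mult_nonneg_nonneg) auto
  also have "\<dots> = 9 / 2 * n * (n * X / 2) * \<sigma>\<^sup>2" using b by simp
  also have "\<dots> \<le> 8 * n * (n * X / 2) * \<sigma>\<^sup>2" using n X0 by (intro mult_right_mono) auto
  also have "\<dots> \<le> 8 * n * \<psi> * \<sigma>\<^sup>2" using n \<psi>_X by (intro mult_right_mono mult_left_mono) auto
  also have "\<dots> \<le> (1 - \<tau>\<^sup>2) * level 3" by (rule level_3)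
  finally show ?thesis using c2 by simp
qed

text \<open>The constant 64 is 8 from \<open>level_3\<close> times 12 from
  \<open>level_0_ge\<close>, divided by the 3/2 of \<open>noise_factor\<close>; the third condition
  in \<open>X\<close> removes \<eta> and \<tau>.\<close>

lemma level_0_noise: "64 * (\<sigma>\<^sup>2 * X\<^sup>2 * (1 + 1 / b)) \<le> mu\<^sup>2 * level 0"
proof -
  let ?T = "(1 - \<tau>\<^sup>2) * \<eta>\<^sup>2"
  have T: "0 < ?T" using c2 \<eta> by simp
  have "?T * (64 * (\<sigma>\<^sup>2 * X\<^sup>2 * (1 + 1 / b))) = 64 * \<sigma>\<^sup>2 * (?T * X\<^sup>2) * (1 + 1 / b)" by simp
  also have "\<dots> \<le> 64 * \<sigma>\<^sup>2 * (n * b\<^sup>2) * (3 / (2 * b))"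
    by (rule mult_mono[OF mult_left_mono[OF X(3)] noise_factor(1)]) (use n noise_factor in auto)
  also have "\<dots> = 96 * \<sigma>\<^sup>2 * n * b" using b by (simp add: power2_eq_square)
  also have "\<dots> \<le> 96 * \<sigma>\<^sup>2 * n * (1 / 2)" using b n by (intro mult_left_mono) auto
  also have "\<dots> \<le> 96 * \<sigma>\<^sup>2 * (\<psi> / n)"
  proof -
    have "n / 2 \<le> X / 2" using X(1) by simp
    also have "\<dots> \<le> \<psi> / n" using \<psi>_X n by (simp add: pos_le_divide_eq mult.commute)
    finally show ?thesis using mult_left_mono[of "n / 2" "\<psi> / n" "96 * \<sigma>\<^sup>2"] by simp
  qed
  also have "\<dots> = 12 * (8 * n * \<psi> * \<sigma>\<^sup>2) / n\<^sup>2" using n by (simp add: power2_eq_square)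
  also have "\<dots> \<le> 12 * ((1 - \<tau>\<^sup>2) * level 3) / n\<^sup>2" by (intro divide_right_mono mult_left_mono level_3) auto
  also have "\<dots> = (1 - \<tau>\<^sup>2) * (12 * level 3) / n\<^sup>2" by simp
  also have "\<dots> \<le> (1 - \<tau>\<^sup>2) * ((n * mu * \<eta>)\<^sup>2 * level 0) / n\<^sup>2"
    using level_0_ge c2 by (intro divide_right_mono mult_left_mono) auto
  also have "\<dots> = ?T * (mu\<^sup>2 * level 0)" using n by (simp add: power_mult_distrib)
  finally show ?thesis by (simp only: mult_le_cancel_left_pos[OF T])
qed

lemma optimality_level:
  assumes "Z\<^sup>2 = \<sigma>\<^sup>2 * X\<^sup>2 * (1 + 1 / b)"
  shows "(18 / 5 * Z / (mu * n))\<^sup>2 < level 0"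
proof -
  have X0: "0 < X" using n X(1) by simp
  have Z: "0 < Z\<^sup>2" unfolding assms using \<sigma> X0 noise_factor(2) by simp
  have "mu\<^sup>2 * (18 / 5 * Z / (mu * n))\<^sup>2 = (18 / 5)\<^sup>2 * Z\<^sup>2 / n\<^sup>2" using mu n by (simp add: power_mult_distrib power_divide)
  also have "\<dots> \<le> (18 / 5)\<^sup>2 * Z\<^sup>2 / 1" using n Z by (intro divide_left_mono) auto
  also have "\<dots> < 64 * Z\<^sup>2" using Z by (simp add: power2_eq_square)
  also have "\<dots> \<le> mu\<^sup>2 * level 0" using level_0_noise by (simp add: assms)
  finally show ?thesis using mu by simp
qed

lemma consensus_level:
  assumes "Z\<^sup>2 = \<sigma>\<^sup>2 * X\<^sup>2 * (1 + 1 / b)"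
  shows "(12 / 5 * \<phi> * \<alpha> * (143 / 25 * Z * L / mu) / G)\<^sup>2 \<le> level 1"
proof -
  define C where "C = 1 - c\<^sup>2"
  have C: "0 < C" "2 * C \<le> G" using c2 G by (simp_all add: C_def)
  have "(12 / 5 * \<phi> * \<alpha> * (143 / 25 * Z * L / mu) / G)\<^sup>2 = (12 / 5 * (143 / 25))\<^sup>2 * (\<phi>\<^sup>2 * \<alpha>\<^sup>2 * L\<^sup>2) * Z\<^sup>2 / mu\<^sup>2 / G\<^sup>2"
    using mu C by (simp add: power_mult_distrib power_divide)
  also have "\<dots> \<le> (12 / 5 * (143 / 25))\<^sup>2 * (\<phi>\<^sup>2 * \<alpha>\<^sup>2 * L\<^sup>2) * Z\<^sup>2 / mu\<^sup>2 / (2 * C)\<^sup>2"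
    using C by (intro divide_left_mono power_mono) auto
  \<comment> \<open>The numerical factor 12/5 * 143/25 is below 16, and 16^2 / 2^2 = 64 is the
    constant of \<open>level_0_noise\<close>.\<close>
  also have "\<dots> \<le> 256 * (\<phi>\<^sup>2 * \<alpha>\<^sup>2 * L\<^sup>2) * Z\<^sup>2 / mu\<^sup>2 / (2 * C)\<^sup>2"
    by (intro divide_right_mono mult_right_mono) (simp_all add: power2_eq_square)
  also have "\<dots> = (\<phi>\<^sup>2 * \<alpha>\<^sup>2 * L\<^sup>2) * (64 * Z\<^sup>2 / mu\<^sup>2) / C\<^sup>2"
    using C by (simp add: power_mult_distrib mult_ac)
  also have "\<dots> \<le> (\<phi>\<^sup>2 * \<alpha>\<^sup>2 * L\<^sup>2) * level 0 / C\<^sup>2"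
    using level_0_noise mu by (intro divide_right_mono mult_left_mono) (auto simp: assms pos_divide_le_eq mult.commute)
  also have "\<dots> \<le> 8 * n * (\<phi>\<^sup>2 * \<alpha>\<^sup>2 * L\<^sup>2) * level 0 / C\<^sup>2"
    using mult_right_mono[of 1 "8 * n" "(\<phi>\<^sup>2 * \<alpha>\<^sup>2 * L\<^sup>2) * level 0"] n level_nonneg[of 0]
    by (intro divide_right_mono) (simp_all add: mult.assoc)
  also have "\<dots> \<le> level 1" using level_1_ge C by (simp add: pos_divide_le_eq C_def mult_ac)
  finally show ?thesis .
qed

text \<open>The noise terms of the third row are exactly those of the recursion for the steps; strictness
  of the bound on the first component leaves room for the geometric transient.\<close>

lemma step_level:
  fixes e :: "nat \<Rightarrow> real"
  assumes "\<And>k. K \<le> k \<Longrightarrow> e (Suc k) \<le> 12 * \<phi>\<^sup>2 * D k + 3 * \<beta>\<^sup>2 * e k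
      + 3 * \<alpha>\<^sup>2 * (S k + 2 * n * L\<^sup>2 * \<phi>\<^sup>2 * (W k + D k) + 2 * n * \<sigma>\<^sup>2)"
    and "\<And>k. K \<le> k \<Longrightarrow> W k \<le> w \<and> D k \<le> level 1 \<and> S k \<le> level 3" and w: "w < level 0"
  shows "\<exists>K'\<ge>K. \<forall>k\<ge>K'. e k \<le> level 2"
proof -
  define q where "q = 3 * \<beta>\<^sup>2"
  have q: "0 \<le> q" "q \<le> 1 / 2"
  using budget_2 step_budget_nonneg by (simp_all add: q_def)
  define d where "d = 6 * n * L\<^sup>2 * \<phi>\<^sup>2 * \<alpha>\<^sup>2 * (level 0 - w)"
  have d: "0 < d" using n L \<phi> \<alpha> w by (simp add: d_def)
  have step: "e (Suc k) - level 2 \<le> q * (e k - level 2) - d" if "K \<le> k" for k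
  proof -
    have "e (Suc k) \<le> 12 * \<phi>\<^sup>2 * level 1 + 3 * \<beta>\<^sup>2 * e k
      + 3 * \<alpha>\<^sup>2 * (level 3 + 2 * n * L\<^sup>2 * \<phi>\<^sup>2 * (w + level 1) + 2 * n * \<sigma>\<^sup>2)"
      using assms(2)[OF that] n
      by (intro order_trans[OF assms(1)[OF that]] add_mono mult_left_mono order_refl) auto
    also have "\<dots> = 12 * \<phi>\<^sup>2 * level 1 + q * e k + 3 * (2 * n * L\<^sup>2 * \<phi>\<^sup>2 * \<alpha>\<^sup>2 * (level 0 + level 1) + \<alpha>\<^sup>2 * level 3)
      + 6 * n * \<sigma>\<^sup>2 * \<alpha>\<^sup>2 - d" by (simp add: q_def d_def algebra_simps)
    also have "\<dots> = level 2 - q * level 2 + q * e k - d"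
      using level_rows(3) by (simp add: q_def algebra_simps)
    finally show ?thesis by (simp add: algebra_simps)
  qed
  define T where "T = \<bar>e K - level 2\<bar>"
  have T: "0 \<le> T" by (simp add: T_def)
  have half: "q * (e (K + j) - level 2) \<le> (1 / 2) ^ Suc j * T" if "e (K + j) - level 2 \<le> (1 / 2) ^ j * T" for j
  proof -
    have "q * (e (K + j) - level 2) \<le> q * ((1 / 2) ^ j * T)" using that q by (intro mult_left_mono) auto
    also have "\<dots> \<le> 1 / 2 * ((1 / 2) ^ j * T)" using q T by (intro mult_right_mono) auto
    finally show ?thesis by simp
  qed
  have decay: "e (K + j) - level 2 \<le> (1 / 2) ^ j * T" for j
  proof (induction j)
    case (Suc j)
    then show ?case using step[of "K + j"] half[of j] d by simp
  qed (simp add: T_def)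
  obtain J where J: "(1 / 2) ^ J < d / (T + 1)"
    using real_arch_pow_inv[of "d / (T + 1)" "1 / 2"] d T by auto
  show ?thesis
  proof (intro exI[of _ "Suc (K + J)"] conjI allI impI)
    fix k assume k: "Suc (K + J) \<le> k"
    define j where "j = k - Suc K"
    have j: "k = Suc (K + j)" "J \<le> j" using k by (auto simp: j_def)
    have "(1 / 2) ^ Suc j * T \<le> (1 / 2) ^ J * (T + 1)"
      using j T by (intro mult_mono power_decreasing) auto
    also have "\<dots> \<le> d" using J T by (simp add: pos_less_divide_eq)
    finally have "q * (e (K + j) - level 2) - d \<le> 0" using half[OF decay, of j] by linarith
    then show "e k \<le> level 2" using step[of "K + j"] unfolding j by simp
  qed simp
qed

end

section \<open>Contraction factors of the mixing steps\<close>

lemma min_entry_le: "min_entry u \<le> u $ i"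
  unfolding min_entry_def by (rule Min_le) auto

lemma max_entry_ge: "u $ i \<le> max_entry u"
  unfolding max_entry_def by (rule Max_ge) auto

lemma min_entry_attained: obtains i where "min_entry u = u $ i"
proof -
  have "min_entry u \<in> range (\<lambda>i. u $ i)" unfolding min_entry_def by (rule Min_in) auto
  then show ?thesis using that by blast
qed

lemma min_pos_le: "0 < A $ i $ j \<Longrightarrow> min_pos A \<le> A $ i $ j"
proof -
  assume p: "0 < A $ i $ j"
  have "finite ((\<lambda>(i, j). A $ i $ j) ` UNIV)" by simp
  moreover have "{A $ i $ j | i j. 0 < A $ i $ j} \<subseteq> (\<lambda>(i, j). A $ i $ j) ` UNIV" by auto
  ultimately have "finite {A $ i $ j | i j. 0 < A $ i $ j}" by (rule rev_finite_subset)
  then show ?thesis unfolding min_pos_def using p by (intro Min_le) auto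
qed

lemma stochastic_vec_entries:
  fixes p :: "real^'n"
  assumes "stochastic_vec p"
  shows "min_entry p * CARD('n) \<le> 1" "1 \<le> max_entry p * CARD('n)"
proof -
  have s: "(\<Sum>i\<in>UNIV. p $ i) = 1" "\<And>i. 0 \<le> p $ i" using assms by (auto simp: stochastic_vec_def)
  have "(\<Sum>i\<in>(UNIV::'n set). min_entry p) \<le> 1" unfolding s(1)[symmetric] by (intro sum_mono min_entry_le)
  then show "min_entry p * CARD('n) \<le> 1" by (simp add: mult.commute)
  have "1 \<le> (\<Sum>i\<in>(UNIV::'n set). max_entry p)" unfolding s(1)[symmetric] by (intro sum_mono max_entry_ge)
  then show "1 \<le> max_entry p * CARD('n)" by (simp add: mult.commute)
qed

lemma weighted_sum_le_max_entry:
  assumes "stochastic_vec q"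
  shows "(\<Sum>i\<in>UNIV. q $ i * p $ i) \<le> max_entry p"
proof -
  have "(\<Sum>i\<in>UNIV. q $ i * p $ i) \<le> (\<Sum>i\<in>UNIV. q $ i * max_entry p)"
    using assms by (intro sum_mono mult_left_mono max_entry_ge) (auto simp: stochastic_vec_def)
  also have "\<dots> = max_entry p" using assms by (simp add: sum_distrib_right[symmetric] stochastic_vec_def)
  finally show ?thesis .
qed

lemma one_minus_le_of_sqrt_le:
  fixes r t :: real
  assumes "sqrt (1 - r) \<le> t"
  shows "1 - t\<^sup>2 \<le> r"
  using sqrt_le_D[OF assms] by simp

text \<open>\<open>c_k\<close> encodes the rate of \<open>row_stochastic_contraction\<close> without
  the factor \<open>max 2 (CARD('n) * M)\<close>, so this factor is a gain; \<open>\<eta>\<close> is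
  a lower bound for the maximal entry in it.\<close>

lemma consensus_step:
  fixes G :: "'n::finite pair_pre_digraph" and A :: "real^'n^'n" and x :: "'n \<Rightarrow> 'v::real_inner" and a c \<eta> :: real
  assumes graph: "pverts G = UNIV" "strongly_connected (with_proj G)" "CARD('n) \<ge> 2"
    and A: "row_stochastic A" "compatible_A G A" "0 < a" "a \<le> min_pos A"
    and q: "stochastic_vec q" "q' v* A = q" "\<And>i. 0 < q' $ i"
    and c: "c_k a (with_proj G) q q' \<le> c" "0 \<le> c" "c < 1" and \<eta>: "\<eta> \<le> max_entry q"
  shows "(\<Sum>i\<in>UNIV. q' $ i * (norm ((\<Sum>j\<in>UNIV. A $ i $ j *\<^sub>R x j) - (\<Sum>j\<in>UNIV. q $ j *\<^sub>R x j)))\<^sup>2)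
    \<le> (1 - (1 - c\<^sup>2) * max 2 (CARD('n) * \<eta>)) *
       (\<Sum>j\<in>UNIV. q $ j * (norm (x j - (\<Sum>j\<in>UNIV. q $ j *\<^sub>R x j)))\<^sup>2)"
proof -
  let ?D = "graph_diameter (with_proj G)" and ?K = "max_edge_utility (with_proj G)"
  obtain Q where "path_covering G Q ?D ?K" using strongly_connected_path_covering[OF graph] .
  then interpret path_covering G Q ?D ?K .
  let ?r = "min_entry q' * a\<^sup>2 / ((max_entry q)\<^sup>2 * ?D * ?K)"
  have r: "1 - c\<^sup>2 \<le> ?r"
    using one_minus_le_of_sqrt_le[OF c(1)[unfolded c_k_def]] .
  have c2: "0 \<le> 1 - c\<^sup>2" using c by (simp add: power_le_one)
  have rows: "(\<Sum>j\<in>UNIV. A $ i $ j) = 1" for i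
  proof -
    have "(A *v 1) $ i = (1 :: real^'n) $ i" using A(1) by (simp add: row_stochastic_def)
    then show ?thesis by (simp add: matrix_vector_mult_def)
  qed
  have Ae: "a \<le> A $ snd e $ fst e" if "e \<in> E" for e
  proof -
    obtain u v where uv: "e = (u, v)" by (cases e)
    then have e: "e = (u, v)" "(u, v) \<in> parcs G" using \<open>e \<in> E\<close> by (auto simp: E_def)
    then have "0 < A $ v $ u" using A(2) unfolding compatible_A_def by metis
    then show ?thesis using min_pos_le[of A v u] A(4) e by simp
  qed
  have Ai: "a \<le> A $ i $ i" for i
  proof -
    have "0 < A $ i $ i" using A(2) unfolding compatible_A_def by metis
    then show ?thesis using min_pos_le[of A i i] A(4) by simp
  qed
  have qA: "(\<Sum>i\<in>UNIV. q' $ i * A $ i $ j) = q $ j" for j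
    unfolding q(2)[symmetric] by (simp add: vector_matrix_mult_def mult.commute)
  obtain k where k: "min_entry q' = q' $ k" by (rule min_entry_attained)
  have q'k: "q' $ k \<le> q' $ i" for i using min_entry_le[of q' i] by (simp add: k)
  have "(\<Sum>i\<in>UNIV. q' $ i * (norm ((\<Sum>j\<in>UNIV. A $ i $ j *\<^sub>R x j) - (\<Sum>j\<in>UNIV. q $ j *\<^sub>R x j)))\<^sup>2)
    \<le> (1 - ?r * max 2 (CARD('n) * max_entry q)) *
       (\<Sum>j\<in>UNIV. q $ j * (norm (x j - (\<Sum>j\<in>UNIV. q $ j *\<^sub>R x j)))\<^sup>2)"
    using A(1,3) q(1,3) rows Ae Ai qA
    by (intro row_stochastic_contraction) (auto simp: row_stochastic_def stochastic_vec_def max_entry_ge q'k k)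
  also have "\<dots> \<le> (1 - (1 - c\<^sup>2) * max 2 (CARD('n) * \<eta>)) *
       (\<Sum>j\<in>UNIV. q $ j * (norm (x j - (\<Sum>j\<in>UNIV. q $ j *\<^sub>R x j)))\<^sup>2)"
  proof (intro mult_right_mono sum_nonneg mult_nonneg_nonneg)
    have "(1 - c\<^sup>2) * max 2 (CARD('n) * \<eta>) \<le> ?r * max 2 (CARD('n) * max_entry q)"
    proof (rule mult_mono[OF r])
      show "max 2 (CARD('n) * \<eta>) \<le> max 2 (CARD('n) * max_entry q)"
        using \<eta> by (intro max.mono mult_left_mono) auto
    qed (use order_trans[OF c2 r] in auto)
    then show "1 - ?r * max 2 (CARD('n) * max_entry q) \<le> 1 - (1 - c\<^sup>2) * max 2 (CARD('n) * \<eta>)" by simp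
  qed (use q(1) in \<open>auto simp: stochastic_vec_def\<close>)
  finally show ?thesis .
qed

locale tracking_step =
  fixes G :: "'n::finite pair_pre_digraph" and B :: "real^'n^'n" and p p' :: "real^'n" and b \<tau> \<eta> n :: real
  assumes n: "n = CARD('n)" and graph: "pverts G = UNIV" "strongly_connected (with_proj G)" "CARD('n) \<ge> 2"
    and B: "col_stochastic B" "compatible_B G B" "0 < b" "b \<le> min_pos B"
    and p: "stochastic_vec p" "B *v p = p'" "\<And>i. 0 < p $ i"
    and \<tau>: "tau_k b (with_proj G) p p' \<le> \<tau>" "0 \<le> \<tau>" "\<tau> < 1" and \<eta>: "0 < \<eta>" "\<eta> \<le> max_entry p"
begin

definition m :: real where "m = min_entry p"
definition M :: real where "M = max_entry p"
definition M' :: real where "M' = max_entry p'"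
definition D :: nat where "D = graph_diameter (with_proj G)"
definition K :: nat where "K = max_edge_utility (with_proj G)"
definition H :: real where "H = 1 - \<tau>\<^sup>2"
text \<open>The rate of \<open>column_stochastic_contraction\<close> with \<open>D * K\<close>
  eliminated through the bound of \<open>tau_k\<close> by \<open>\<tau>\<close>. Keeping the current
  extreme weights makes it grow like 1 / m for small m, enough to dominate the square root of 1 / m
  in \<open>chi_le\<close>.\<close>

definition \<kappa> :: real where "\<kappa> = H * n * M * M' / (2 * m)"

lemma columns: "(\<Sum>i\<in>UNIV. B $ i $ j) = 1"
proof -
  have "(1 v* B) $ j = (1 :: real^'n) $ j" using B(1) by (simp add: col_stochastic_def)
  then show ?thesis by (simp add: vector_matrix_mult_def)
qed

lemma B_nonneg: "0 \<le> B $ i $ j" using B(1) by (simp add: col_stochastic_def)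

lemma B_diag: "b \<le> B $ i $ i"
proof -
  have "0 < B $ i $ i" using B(2) unfolding compatible_B_def by metis
  then show ?thesis using min_pos_le[of B i i] B(4) by simp
qed

lemma p'_eq: "(\<Sum>j\<in>UNIV. B $ i $ j * p $ j) = p' $ i"
  unfolding p(2)[symmetric] by (simp add: matrix_vector_mult_def)

lemma p'_pos: "0 < p' $ i"
proof -
  have "0 < B $ i $ i * p $ i" using B_diag[of i] B(3) p(3)[of i] by simp
  also have "\<dots> \<le> (\<Sum>j\<in>UNIV. B $ i $ j * p $ j)"
    using B_nonneg p(3) by (intro member_le_sum) (auto simp: less_imp_le)
  finally show ?thesis by (simp add: p'_eq)
qed

lemma p'_stochastic: "stochastic_vec p'"
proof -
  have "(\<Sum>i\<in>UNIV. p' $ i) = (\<Sum>j\<in>UNIV. (\<Sum>i\<in>UNIV. B $ i $ j) * p $ j)"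
    unfolding p'_eq[symmetric] by (subst sum.swap) (simp add: sum_distrib_right)
  also have "\<dots> = 1" using p(1) by (simp add: columns stochastic_vec_def)
  finally show ?thesis using p'_pos by (simp add: stochastic_vec_def less_imp_le)
qed

lemma bounds: "0 < m" "m \<le> M" "\<eta> \<le> M" "m * n \<le> 1" "1 \<le> M * n" "1 \<le> M' * n" "0 < M'" "0 < M" "0 < H" "2 \<le> n"
proof -
  obtain k where k: "min_entry p = p $ k" by (rule min_entry_attained)
  show "0 < m" using k p(3) by (simp add: m_def)
  show "m \<le> M" using order_trans[OF min_entry_le max_entry_ge] by (simp add: m_def M_def)
  with \<open>0 < m\<close> show "0 < M" by simp
  show "\<eta> \<le> M" using \<eta> by (simp add: M_def)
  show "m * n \<le> 1" "1 \<le> M * n" "1 \<le> M' * n"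
    using stochastic_vec_entries[OF p(1)] stochastic_vec_entries[OF p'_stochastic] by (simp_all add: m_def M_def M'_def n)
  show "0 < M'" using p'_pos[of undefined] max_entry_ge[of p' undefined] by (simp add: M'_def)
  show "0 < H" using \<tau> by (simp add: H_def power_less_one_iff)
  show "2 \<le> n" using graph(3) by (simp add: n)
qed

lemma graph_bounds: "1 \<le> D" "1 \<le> K" "b \<le> 1 / 2" "n * b \<le> K"
  and contraction: "(\<Sum>i\<in>UNIV. p' $ i * (norm ((1 / p' $ i) *\<^sub>R (\<Sum>j\<in>UNIV. (B $ i $ j * p $ j) *\<^sub>R z j) - (\<Sum>j\<in>UNIV. p $ j *\<^sub>R z j)))\<^sup>2)
    \<le> (1 - n * m * b\<^sup>2 / (2 * M * D * K)) * (\<Sum>j\<in>UNIV. p $ j * (norm (z j - (\<Sum>j\<in>UNIV. p $ j *\<^sub>R z j)))\<^sup>2)"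
  for z :: "'n \<Rightarrow> 'v::real_inner"
proof -
  obtain Q where "path_covering G Q D K" using strongly_connected_path_covering[OF graph] unfolding D_def K_def .
  then interpret path_covering G Q D K .
  have Be: "b \<le> B $ snd e $ fst e" if "e \<in> E" for e
  proof -
    obtain u v where uv: "e = (u, v)" by (cases e)
    then have e: "e = (u, v)" "(u, v) \<in> parcs G" using \<open>e \<in> E\<close> by (auto simp: E_def)
    then have "0 < B $ v $ u" using B(2) unfolding compatible_B_def by metis
    then show ?thesis using min_pos_le[of B v u] B(4) e by simp
  qed
  show DK: "1 \<le> D" "1 \<le> K" by (rule D_K_pos)+
  have b: "b \<le> 1 / 2" "b * (CARD('n) - 1) \<le> (1 - b) * K"
    using min_weight_le_half[OF B_nonneg columns B(3) Be B_diag] by blast+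
  show "b \<le> 1 / 2" by (rule b)
  have "b * (n - 1) \<le> (1 - b) * K" using b(2) graph(3) by (simp add: n of_nat_diff)
  moreover have "b * 1 \<le> b * K" using DK B(3) by (intro mult_left_mono) auto
  ultimately show "n * b \<le> K" by (simp add: algebra_simps)
  show "(\<Sum>i\<in>UNIV. p' $ i * (norm ((1 / p' $ i) *\<^sub>R (\<Sum>j\<in>UNIV. (B $ i $ j * p $ j) *\<^sub>R z j) - (\<Sum>j\<in>UNIV. p $ j *\<^sub>R z j)))\<^sup>2)
    \<le> (1 - n * m * b\<^sup>2 / (2 * M * D * K)) * (\<Sum>j\<in>UNIV. p $ j * (norm (z j - (\<Sum>j\<in>UNIV. p $ j *\<^sub>R z j)))\<^sup>2)"
    unfolding n
  proof (rule column_stochastic_contraction[OF B_nonneg columns B(3) Be B_diag])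
    show "m \<le> p $ j" "p $ j \<le> M" for j by (simp_all add: m_def M_def min_entry_le max_entry_ge)
  qed (use p p'_eq p'_pos bounds in \<open>auto simp: stochastic_vec_def\<close>)
qed

lemma rate: "H * (M\<^sup>2 * M' * D * K) \<le> m\<^sup>2 * b\<^sup>2"
proof -
  have "H \<le> m\<^sup>2 * b\<^sup>2 / (M\<^sup>2 * M' * D * K)"
    using one_minus_le_of_sqrt_le[OF \<tau>(1)[unfolded tau_k_def]]
    by (simp add: H_def m_def M_def M'_def D_def K_def)
  moreover have "0 < M\<^sup>2 * M' * D * K" using bounds graph_bounds by simp
  ultimately show ?thesis by (simp add: pos_le_divide_eq)
qed

lemma rate': "H * (M\<^sup>2 * M') * K \<le> m\<^sup>2 * b\<^sup>2"
proof -
  have "H * (M\<^sup>2 * M') * K * 1 \<le> H * (M\<^sup>2 * M') * K * D"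
    using bounds graph_bounds by (intro mult_left_mono mult_nonneg_nonneg) auto
  then show ?thesis using rate by (simp add: mult_ac)
qed

lemma \<kappa>_le: "\<kappa> \<le> n * m * b\<^sup>2 / (2 * M * D * K)" "H / 2 \<le> \<kappa>" "\<kappa> \<le> 1"
proof -
  have pos: "0 < 2 * M * D * K" "0 < D * K" using bounds graph_bounds by simp_all
  have "\<kappa> * (2 * M * D * K) = n / m * (H * (M\<^sup>2 * M' * D * K))"
    using bounds by (simp add: \<kappa>_def power2_eq_square)
  also have "\<dots> \<le> n / m * (m\<^sup>2 * b\<^sup>2)" using bounds by (intro mult_left_mono rate) auto
  also have "\<dots> = n * m * b\<^sup>2" using bounds by (simp add: power2_eq_square)
  finally have k: "\<kappa> * (2 * M * D * K) \<le> n * m * b\<^sup>2" .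
  then show "\<kappa> \<le> n * m * b\<^sup>2 / (2 * M * D * K)" using pos by (simp only: pos_le_divide_eq)
  note k
  also have "n * m * b\<^sup>2 = m * b * (n * b)" by (simp add: power2_eq_square)
  also have "\<dots> \<le> M * 1 * K" using bounds graph_bounds B(3) by (intro mult_mono) auto
  also have "\<dots> \<le> M * D * K" using bounds graph_bounds by simp
  also have "\<dots> \<le> 1 * (2 * M * D * K)" using bounds by simp
  finally show "\<kappa> \<le> 1" using pos by (simp only: mult_le_cancel_right_pos)
  have "m * 1 \<le> M * (M' * n)" using bounds by (intro mult_mono) auto
  then have "H * (m * 1) \<le> H * (M * (M' * n))" using bounds by (intro mult_left_mono) auto
  then show "H / 2 \<le> \<kappa>" using bounds by (simp add: \<kappa>_def field_simps)
qed

lemma S_err_contraction: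
  fixes u :: "real^'p^'n"
  shows "(S_err (\<chi> i. \<Sum>j\<in>UNIV. B $ i $ j *\<^sub>R u $ j) p')\<^sup>2 \<le> (1 - \<kappa>) * (S_err u p)\<^sup>2"
proof -
  let ?z = "\<lambda>j. (1 / p $ j) *\<^sub>R u $ j"
  have nz: "p $ j \<noteq> 0" for j using p(3)[of j] by simp
  have S: "(S_err u p)\<^sup>2 = (\<Sum>i\<in>UNIV. p $ i * (norm ((1 / p $ i) *\<^sub>R u $ i - (\<Sum>j\<in>UNIV. u $ j)))\<^sup>2)"
    if "\<And>i. 0 < p $ i" for u :: "real^'p^'n" and p
    unfolding S_err_def using less_imp_le[OF that] by (intro real_sqrt_pow2 sum_nonneg mult_nonneg_nonneg) auto
  have sum: "(\<Sum>i\<in>UNIV. \<Sum>j\<in>UNIV. B $ i $ j *\<^sub>R u $ j) = (\<Sum>j\<in>UNIV. u $ j)"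
    by (subst sum.swap) (simp add: scaleR_left.sum[symmetric] columns)
  have "(S_err (\<chi> i. \<Sum>j\<in>UNIV. B $ i $ j *\<^sub>R u $ j) p')\<^sup>2 =
    (\<Sum>i\<in>UNIV. p' $ i * (norm ((1 / p' $ i) *\<^sub>R (\<Sum>j\<in>UNIV. (B $ i $ j * p $ j) *\<^sub>R ?z j) - (\<Sum>j\<in>UNIV. p $ j *\<^sub>R ?z j)))\<^sup>2)"
    using nz by (simp add: S[OF p'_pos] sum)
  also have "\<dots> \<le> (1 - n * m * b\<^sup>2 / (2 * M * D * K)) * (\<Sum>j\<in>UNIV. p $ j * (norm (?z j - (\<Sum>j\<in>UNIV. p $ j *\<^sub>R ?z j)))\<^sup>2)"
    by (rule contraction)
  also have "(\<Sum>j\<in>UNIV. p $ j * (norm (?z j - (\<Sum>j\<in>UNIV. p $ j *\<^sub>R ?z j)))\<^sup>2) = (S_err u p)\<^sup>2"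
    using nz by (simp add: S[OF p(3)])
  also have "(1 - n * m * b\<^sup>2 / (2 * M * D * K)) * (S_err u p)\<^sup>2 \<le> (1 - \<kappa>) * (S_err u p)\<^sup>2"
    using \<kappa>_le(1) by (intro mult_right_mono) auto
  finally show ?thesis .
qed

text \<open>From \<open>rate'\<close> with \<open>M' * n\<close> and \<open>K\<close> at least 1;
  the two forms estimate \<open>M\<close> from below by \<open>\<eta>\<close> and by 1 / n.\<close>

lemma min_entry_rate: "H * \<eta>\<^sup>2 \<le> n * b\<^sup>2 * m\<^sup>2" "H \<le> n ^ 3 * b\<^sup>2 * m\<^sup>2"
proof -
  have "H * M\<^sup>2 * 1 \<le> H * M\<^sup>2 * (M' * n * K)"
    using bounds graph_bounds mult_mono[of 1 "M' * n" 1 "real K"] by (intro mult_left_mono) auto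
  also have "\<dots> \<le> n * (m\<^sup>2 * b\<^sup>2)"
    using mult_left_mono[OF rate', of n] bounds by (simp add: mult_ac)
  finally have HM: "H * M\<^sup>2 \<le> n * b\<^sup>2 * m\<^sup>2" by (simp add: mult_ac)
  have "H * \<eta>\<^sup>2 \<le> H * M\<^sup>2" using bounds \<eta> by (intro mult_left_mono power_mono) auto
  with HM show "H * \<eta>\<^sup>2 \<le> n * b\<^sup>2 * m\<^sup>2" by linarith
  have "H * 1 \<le> H * (M * n)\<^sup>2" using bounds by (intro mult_left_mono one_le_power) auto
  also have "\<dots> = n\<^sup>2 * (H * M\<^sup>2)" by (simp add: power_mult_distrib)
  also have "\<dots> \<le> n\<^sup>2 * (n * b\<^sup>2 * m\<^sup>2)" using HM by (intro mult_left_mono) auto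
  finally show "H \<le> n ^ 3 * b\<^sup>2 * m\<^sup>2" by (simp add: power2_eq_square power3_eq_cube mult_ac)
qed

lemma chi_le: "sqrt (1 / m) \<le> \<kappa> * (2 / (H * sqrt n * \<eta>))" "sqrt (1 / m) * H \<le> sqrt n / 2"
proof -
  have sm: "0 < sqrt m" "sqrt m * sqrt m = m" and sn: "0 < sqrt n" "sqrt n * sqrt n = n"
    using bounds by simp_all
  have "sqrt m * sqrt n \<le> 1" using bounds(4) by (simp add: real_sqrt_mult[symmetric])
  also have "\<dots> \<le> M' * n" by (rule bounds)
  also have "\<dots> = M' * sqrt n * sqrt n" using sn by simp
  finally have "sqrt m \<le> M' * sqrt n" using sn by (simp only: mult_le_cancel_right_pos)
  then have "sqrt m * \<eta> \<le> M' * sqrt n * M" using bounds \<eta> sn by (intro mult_mono) auto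
  moreover have "\<kappa> * (2 / (H * sqrt n * \<eta>)) = M' * sqrt n * M / (m * \<eta>)"
    using bounds \<eta> sn by (simp add: \<kappa>_def field_simps)
  moreover have "sqrt (1 / m) = sqrt m * \<eta> / (m * \<eta>)"
    using sm \<eta> by (simp add: real_sqrt_divide field_simps)
  moreover have "0 \<le> m * \<eta>" using bounds \<eta> by simp
  ultimately show "sqrt (1 / m) \<le> \<kappa> * (2 / (H * sqrt n * \<eta>))"
    using divide_right_mono by metis
  \<comment> \<open>The aim is \<open>H\<^sup>2 \<le> n * m * b\<^sup>2\<close>. It comes from
    squaring \<open>rate'\<close>, replacing powers of \<open>M\<close> by powers of
    \<open>m\<close>, and cancelling \<open>K\<close> by means of
    \<open>n * b \<le> K\<close>.\<close>
  let ?t = "H * K"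
  have t: "0 < ?t" using bounds graph_bounds by simp
  have "1 * 1 \<le> (M * n) * (M' * n)\<^sup>2" using bounds by (intro mult_mono one_le_power) auto
  then have "?t\<^sup>2 * m ^ 3 * 1 \<le> ?t\<^sup>2 * m ^ 3 * ((M * n) * (M' * n)\<^sup>2)"
    using bounds by (intro mult_left_mono) auto
  also have "\<dots> = n ^ 3 * (?t\<^sup>2 * (M'\<^sup>2 * M * m ^ 3))" by (simp add: power2_eq_square power3_eq_cube)
  also have "\<dots> \<le> n ^ 3 * (?t\<^sup>2 * (M'\<^sup>2 * M * M ^ 3))"
    using bounds by (intro mult_left_mono power_mono) auto
  also have "\<dots> = n ^ 3 * (H * (M\<^sup>2 * M') * K)\<^sup>2" by (simp add: power2_eq_square power3_eq_cube)
  also have "\<dots> \<le> n ^ 3 * (m\<^sup>2 * b\<^sup>2)\<^sup>2"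
    using bounds by (intro mult_left_mono power_mono rate') auto
  also have "\<dots> = n * m * b\<^sup>2 * (n * b)\<^sup>2 * m ^ 3" by (simp add: power2_eq_square power3_eq_cube)
  finally have "?t\<^sup>2 \<le> n * m * b\<^sup>2 * (n * b)\<^sup>2" using bounds by simp
  also have "\<dots> \<le> n * m * b\<^sup>2 * K\<^sup>2"
    using bounds graph_bounds B(3) by (intro mult_left_mono power_mono) auto
  finally have "H\<^sup>2 * K\<^sup>2 \<le> n * m * b\<^sup>2 * K\<^sup>2" by (simp add: power_mult_distrib)
  then have "H\<^sup>2 \<le> n * m * b\<^sup>2" using graph_bounds by simp
  also have "\<dots> \<le> n * m * (1 / 2)\<^sup>2"
    using bounds graph_bounds B(3) by (intro mult_left_mono power_mono) auto
  also have "\<dots> = (sqrt n / 2 * sqrt m)\<^sup>2" using bounds by (simp add: power_mult_distrib power_divide)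
  finally have "H \<le> sqrt n / 2 * sqrt m"
    by (rule power2_le_imp_le) (use sm sn in simp)
  then show "sqrt (1 / m) * H \<le> sqrt n / 2" using sm by (simp add: real_sqrt_divide pos_divide_le_eq)
qed

end

section \<open>Strongly convex objectives\<close>

lemma GDERIV_global_minimum:
  assumes "GDERIV F x :> D" "\<And>y. F x \<le> F y"
  shows "D = 0"
proof -
  have "(F has_derivative (\<lambda>h. inner h D)) (at x)" using assms(1) by (simp add: gderiv_def)
  then have "(\<lambda>h. inner h D) = (\<lambda>h. 0)"
    using assms(2) by (intro differential_zero_maxmin[of x UNIV F]) auto
  then have "inner D D = 0" by metis
  then show ?thesis by simp
qed

text \<open>The convexity inequality on the segment is divided by t, and t tends to 0 from the
  right.\<close>

lemma strongly_convex_gradient_inequality: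
  fixes F :: "'a::euclidean_space \<Rightarrow> real"
  assumes "strongly_convex mu F" "GDERIV F x :> D"
  shows "F x + inner (y - x) D + mu / 2 * (norm (y - x))\<^sup>2 \<le> F y"
proof -
  let ?\<phi> = "\<lambda>t. F (x + t *\<^sub>R (y - x))"
  have "(F has_derivative (\<lambda>h. inner h D)) (at (x + 0 *\<^sub>R (y - x)))" using assms(2) by (simp add: gderiv_def)
  then have "(?\<phi> has_derivative (\<lambda>t. inner (t *\<^sub>R (y - x)) D)) (at 0)"
    by (rule has_derivative_compose[rotated]) (auto intro!: derivative_eq_intros)
  moreover have "(\<lambda>t. inner (t *\<^sub>R (y - x)) D) = (*) (inner (y - x) D)" by (auto simp: fun_eq_iff)
  ultimately have "DERIV ?\<phi> 0 :> inner (y - x) D"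
    by (simp only: has_field_derivative_def)
  then have lim: "((\<lambda>t. (?\<phi> t - ?\<phi> 0) / t) \<longlongrightarrow> inner (y - x) D) (at_right 0)"
    by (simp add: DERIV_def filterlim_at_split)
  have lim': "((\<lambda>t. F y - F x - mu / 2 * (1 - t) * (norm (y - x))\<^sup>2) \<longlongrightarrow> F y - F x - mu / 2 * (1 - 0) * (norm (y - x))\<^sup>2) (at_right 0)"
    by (intro tendsto_intros)
  have "eventually (\<lambda>t. (?\<phi> t - ?\<phi> 0) / t \<le> F y - F x - mu / 2 * (1 - t) * (norm (y - x))\<^sup>2) (at_right 0)"
    unfolding eventually_at_right_field
  proof (intro exI[of _ 1] conjI allI impI)
    fix t :: real assume t: "0 < t" "t < 1"
    have "(1 - t) *\<^sub>R x + t *\<^sub>R y = x + t *\<^sub>R (y - x)" by (simp add: algebra_simps)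
    then have "?\<phi> t \<le> (1 - t) * F x + t * F y - mu / 2 * t * (1 - t) * (norm (x - y))\<^sup>2"
      using assms(1)[unfolded strongly_convex_def, rule_format, of t x y] t by simp
    then have "?\<phi> t - ?\<phi> 0 \<le> (F y - F x - mu / 2 * (1 - t) * (norm (y - x))\<^sup>2) * t"
      by (simp add: algebra_simps norm_minus_commute)
    then show "(?\<phi> t - ?\<phi> 0) / t \<le> F y - F x - mu / 2 * (1 - t) * (norm (y - x))\<^sup>2"
      using t by (simp only: pos_divide_le_eq)
  qed simp
  from tendsto_le[OF _ lim' lim this] show ?thesis by (simp add: algebra_simps)
qed

text \<open>The gradient inequalities at u and at the minimiser are added; the gradient vanishes at
  the latter.\<close>

lemma strongly_convex_gradient_monotone:
  fixes F :: "'a::euclidean_space \<Rightarrow> real"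
  assumes "strongly_convex mu F" "\<And>x. GDERIV F x :> D x" "\<And>y. F xstar \<le> F y"
  shows "mu * (norm (u - xstar))\<^sup>2 \<le> inner (D u) (u - xstar)" "D xstar = 0"
proof -
  show 0: "D xstar = 0" using GDERIV_global_minimum[OF assms(2,3)] .
  have "F u + inner (xstar - u) (D u) + mu / 2 * (norm (u - xstar))\<^sup>2 \<le> F xstar"
    using strongly_convex_gradient_inequality[OF assms(1,2), of u xstar] by (simp add: norm_minus_commute)
  moreover have "F xstar + mu / 2 * (norm (u - xstar))\<^sup>2 \<le> F u"
    using strongly_convex_gradient_inequality[OF assms(1,2), of xstar u] by (simp add: 0)
  moreover have "inner (xstar - u) (D u) = - inner (D u) (u - xstar)"
    by (simp add: inner_commute inner_diff_right)
  ultimately show "mu * (norm (u - xstar))\<^sup>2 \<le> inner (D u) (u - xstar)" by linarith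
qed

lemma GDERIV_average:
  fixes f :: "'n::finite \<Rightarrow> 'a::real_inner \<Rightarrow> real"
  assumes "\<And>i. GDERIV (f i) x :> grad i"
  shows "GDERIV (\<lambda>x. r * (\<Sum>i\<in>UNIV. f i x)) x :> r *\<^sub>R (\<Sum>i\<in>UNIV. grad i)"
proof -
  have "((\<lambda>x. r * (\<Sum>i\<in>UNIV. f i x)) has_derivative (\<lambda>h. r * (\<Sum>i\<in>UNIV. inner h (grad i)))) (at x)"
    using assms by (intro has_derivative_mult_right has_derivative_sum) (simp add: gderiv_def)
  then show ?thesis by (simp add: gderiv_def inner_sum_right)
qed

text \<open>Both bounds are compared at distance 1 from \<open>xstar\<close>, along an arbitrary
  coordinate axis.\<close>

lemma strong_convexity_le_smoothness:
  fixes D :: "real^'p \<Rightarrow> real^'p"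
  assumes "\<And>u. r * (norm (u - xstar))\<^sup>2 \<le> inner (D u) (u - xstar)" "\<And>u. norm (D u) \<le> l * norm (u - xstar)"
  shows "r \<le> l"
proof -
  define u where "u = xstar + axis undefined 1"
  have u: "norm (u - xstar) = 1" by (simp add: u_def norm_axis_1)
  have "r \<le> inner (D u) (u - xstar)" using assms(1)[of u] u by simp
  also have "\<dots> \<le> norm (D u) * norm (u - xstar)" by (rule norm_cauchy_schwarz)
  also have "\<dots> \<le> l" using assms(2)[of u] u by simp
  finally show ?thesis .
qed

section \<open>Eventual bounds\<close>

text \<open>For a single agent the diameter is the \<open>Sup\<close> of the empty set, hence 0, and
  division by 0 makes \<open>c_k\<close> equal to 1.\<close>

lemma c_k_less_1_imp_card:
  fixes G :: "('n::finite, 'e) pre_digraph"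
  assumes "c_k a G q q' < 1"
  shows "2 \<le> CARD('n)"
proof (rule ccontr)
  assume "\<not> 2 \<le> CARD('n)"
  then have "CARD('n) = 1" using zero_less_card_finite[where 'a = 'n] by linarith
  then have "u = v" for u v :: 'n by (metis card_1_singletonE UNIV_I singletonD)
  then have "{length p | p u v. u \<in> verts G \<and> v \<in> verts G \<and> u \<noteq> v \<and> shortest_path G u p v} = {}" by blast
  then have "graph_diameter G = Sup ({} :: nat set)" unfolding graph_diameter_def by (rule arg_cong)
  then have "graph_diameter G = 0" by (simp add: Sup_nat_def)
  then show False using assms by (simp add: c_k_def)
qed

lemma geometric_envelope:
  fixes v :: "nat \<Rightarrow> nat \<Rightarrow> real"
  assumes "\<And>k i. K \<le> k \<Longrightarrow> i < m \<Longrightarrow> v k i \<le> r i" "\<And>i. i < m \<Longrightarrow> 0 \<le> r i" "0 < \<rho>"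
  shows "\<exists>C\<ge>0. \<forall>k. \<forall>i<m. v k i \<le> r i + C * \<rho> ^ k"
proof -
  define C where "C = (\<Sum>k<K. \<Sum>i<m. \<bar>v k i\<bar> / \<rho> ^ k)"
  have C: "0 \<le> C" unfolding C_def using assms(3) by (intro sum_nonneg) simp
  have "v k i \<le> r i + C * \<rho> ^ k" if i: "i < m" for k i
  proof (cases "K \<le> k")
    case True
    then show ?thesis using assms(1)[OF True i] C assms(3) by (simp add: add_increasing2)
  next
    case False
    have "\<bar>v k i\<bar> / \<rho> ^ k \<le> (\<Sum>i<m. \<bar>v k i\<bar> / \<rho> ^ k)"
      using i assms(3) by (intro member_le_sum) auto
    also have "\<dots> \<le> C" unfolding C_def using False assms(3)
      by (intro member_le_sum[where f = "\<lambda>k. \<Sum>i<m. \<bar>v k i\<bar> / \<rho> ^ k"] sum_nonneg) auto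
    finally have "\<bar>v k i\<bar> \<le> C * \<rho> ^ k" using assms(3) by (simp add: pos_divide_le_eq)
    then show ?thesis using assms(2)[OF i] by linarith
  qed
  with C show ?thesis by blast
qed

context push_pull_contracting begin

lemma errors:
  "optimality_err (\<phi> k) xstar (x k s) = (eX k s)\<^sup>2" "consensus_err (\<phi> k) (x k s) = (eD k s)\<^sup>2"
  "step_err (x k s) (prev_iterate xm1 x k s) = (eU k s)\<^sup>2"
  by (simp_all add: optimality_err_def eX_def xh_def consensus_err_def eD_def wn_power2 \<phi>_pos rep_def step_err_def eU_def)

lemma errors_integrable:
  "integrable P (\<lambda>s. (eX k s)\<^sup>2)" "integrable P (\<lambda>s. (eD k s)\<^sup>2)" "integrable P (\<lambda>s. (eU k s)\<^sup>2)"
  "integrable P (\<lambda>s. (S_err (y k s) (\<pi> k))\<^sup>2)"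
proof -
  have "sq_integrable P (\<lambda>s. S_err (y k s) (\<pi> k))" by (intro sq_integrable_S_err y_sq)
  then show "integrable P (\<lambda>s. (S_err (y k s) (\<pi> k))\<^sup>2)" by (simp add: sq_integrable_def)
qed (use e_sq(1-3)[of k] in \<open>simp_all add: sq_integrable_def\<close>)

lemma V_vec_simps:
  "vec_index (V_vec P \<phi> B xstar xm1 x y k) 0 = (\<integral>s. (eX k s)\<^sup>2 \<partial>P)"
  "vec_index (V_vec P \<phi> B xstar xm1 x y k) 1 = (\<integral>s. (eD k s)\<^sup>2 \<partial>P)"
  "vec_index (V_vec P \<phi> B xstar xm1 x y k) 2 = (\<integral>s. (eU k s)\<^sup>2 \<partial>P)"
  "vec_index (V_vec P \<phi> B xstar xm1 x y k) 3 = (\<integral>s. (S_err (y k s) (\<pi> k))\<^sup>2 \<partial>P)"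
  by (simp_all add: V_vec_def errors tracking_err_def numeral_eq_Suc)

end

theorem theorem1:
  fixes f :: "'n::finite \<Rightarrow> real^'p \<Rightarrow> real"
    and grad :: "'n \<Rightarrow> real^'p \<Rightarrow> real^'p"
    and F :: "real^'p \<Rightarrow> real"
    and xstar :: "real^'p"
    and P :: "'s measure" and Z :: "'n \<Rightarrow> 'z measure"
    and \<xi> :: "nat \<Rightarrow> 'n \<Rightarrow> 's \<Rightarrow> 'z"
    and g :: "'n \<Rightarrow> real^'p \<Rightarrow> 'z \<Rightarrow> real^'p"
    and G :: "nat \<Rightarrow> 'n pair_pre_digraph"
    and A B :: "nat \<Rightarrow> real^'n^'n"
    and \<alpha> \<beta> :: "real^'n"
    and xm1 x0 :: "real^'p^'n"
    and x y :: "nat \<Rightarrow> 's \<Rightarrow> real^'p^'n"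
    and \<phi> \<pi> :: "nat \<Rightarrow> real^'n"
    and V :: "nat \<Rightarrow> real Matrix.vec"
    and M :: "real Matrix.mat" and rhs :: "real Matrix.vec"
    and n L mu \<sigma> a b c \<tau> \<eta> \<psi> chi vphi \<nu> vsig abar bbar \<rho> :: real
  assumes n_def: "n = real CARD('n)"
    \<comment> \<open>objective\<close>
    and "L > 0" and "mu > 0" and "\<sigma> > 0"
    and "\<forall>i x. GDERIV (f i) x :> grad i x"
    and "\<forall>i. continuous_on UNIV (grad i)"
    and "\<forall>i. L-lipschitz_on UNIV (grad i)"
    and "F = (\<lambda>x. (1 / n) * (\<Sum>i\<in>UNIV. f i x))"
    and "strongly_convex mu F"
    and "\<forall>x. x \<noteq> xstar \<longrightarrow> F xstar < F x"
    and "stochastic_gradients P Z \<xi> g grad \<sigma>"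
    \<comment> \<open>graphs and mixing matrices\<close>
    and "\<forall>k. pverts (G k) = UNIV"
    and "\<forall>k. strongly_connected (with_proj (G k))"
    and "\<forall>k i. (i, i) \<in> parcs (G k)"
    and "\<forall>k. row_stochastic (A k) \<and> compatible_A (G k) (A k)"
    and "\<forall>k. col_stochastic (B k) \<and> compatible_B (G k) (B k)"
    and "a > 0" and "\<forall>k. min_pos (A k) \<ge> a"
    and "b > 0" and "\<forall>k. min_pos (B k) \<ge> b"
    \<comment> \<open>iterates\<close>
    and "\<forall>i. \<alpha> $ i > 0" and "\<forall>i. \<beta> $ i \<ge> 0"
    and "abar = max_entry \<alpha>" and "bbar = max_entry \<beta>"
    and "algorithm_iterates P \<xi> g A B \<alpha> \<beta> xm1 x0 x y"
    \<comment> \<open>weight vectors and constants\<close>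
    and "\<forall>k. stochastic_vec (\<phi> k)"
    and "\<forall>k. \<phi> (Suc k) v* A k = \<phi> k"
    and "\<forall>k i. \<phi> k $ i \<ge> a ^ CARD('n) / n"
    and "\<pi> = pi_seq B"
    and "0 < c" and "c < 1" and "\<forall>k. c_k a (with_proj (G k)) (\<phi> k) (\<phi> (Suc k)) \<le> c"
    and "0 < \<tau>" and "\<tau> < 1" and "\<forall>k. tau_k b (with_proj (G k)) (\<pi> k) (\<pi> (Suc k)) \<le> \<tau>"
    and "0 < \<eta>" and "\<eta> < 1" and "\<forall>k. (\<Sum>i\<in>UNIV. \<phi> (Suc k) $ i * \<pi> k $ i) \<ge> \<eta>"
    and "\<psi> > 0" and "\<forall>k. n * ((chi_k (\<pi> (Suc k)))\<^sup>2 - 1) \<le> \<psi>"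
    and "chi > 1" and "\<forall>k. chi_k (\<pi> k) \<le> chi"
    and "vphi > 1" and "\<forall>k. sqrt (1 / min_entry (\<phi> k)) \<le> vphi"
    and "\<nu> = nu_const L chi \<tau> \<psi>"
    and "vsig = varsigma_const n L mu \<eta> vphi \<tau> \<nu>"
    \<comment> \<open>step-size and momentum conditions\<close>
    and "0 < abar"
    and "abar < min (2 / (n * \<eta> * (L + mu)))
                    ((1 - c\<^sup>2) / (2 * vphi * vsig * sqrt (2 * (1 + c\<^sup>2))))"
    and "0 \<le> bbar"
    and "bbar < min (abar * sqrt ((n * \<eta> * L\<^sup>2 * (1 - \<tau>\<^sup>2) + 32 * \<nu>) / (48 * (1 - \<tau>\<^sup>2))))
                    (sqrt ((1 - c\<^sup>2)\<^sup>2 / (96 * (1 + c\<^sup>2) * vphi\<^sup>2) - vsig\<^sup>2 * abar\<^sup>2 / 12))"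
    \<comment> \<open>comparison system\<close>
    and "V = V_vec P \<phi> B xstar xm1 x y"
    and "M = M_mat n L mu \<eta> vphi c \<tau> \<nu> abar bbar"
    and "rhs = the (mat_inverse (1\<^sub>m 4 - M)) *\<^sub>v b_vec n L \<sigma> c \<psi> \<nu> abar"
    and "\<rho> = spectral_radius (map_mat complex_of_real M)"
  shows "\<rho> < 1
    \<and> (\<forall>i<4. 0 \<le> vec_index rhs i)
    \<and> (\<forall>k. integrable P (\<lambda>s. optimality_err (\<phi> k) xstar (x k s))
         \<and> integrable P (\<lambda>s. consensus_err (\<phi> k) (x k s))
         \<and> integrable P (\<lambda>s. step_err (x k s) (prev_iterate xm1 x k s))
         \<and> integrable P (\<lambda>s. tracking_err (y k s) (\<pi> k)))
    \<and> (\<forall>i<4. limsup (\<lambda>k. ereal (vec_index (V k) i)) \<le> ereal (vec_index rhs i))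
    \<and> limsup (\<lambda>k. ereal (\<integral>s. (norm (weighted_avg (\<phi> k) (x k s) - xstar))\<^sup>2 \<partial>P))
        \<le> ereal (vec_index rhs 0)
    \<and> limsup (\<lambda>k. ereal (\<integral>s. weighted_norm2 (\<phi> k)
                              (x k s - (\<chi> i. weighted_avg (\<phi> k) (x k s))) \<partial>P))
        \<le> ereal (vec_index rhs 1)
    \<and> (\<exists>C\<ge>0. \<forall>k\<ge>1. \<forall>i<4. vec_index (V k) i \<le> vec_index rhs i + C * \<rho> ^ k)"
proof -
  define H where "H = 1 - \<tau>\<^sup>2"
  define m where "m k = min_entry (\<pi> k)" for k
  have card: "2 \<le> CARD('n)"
    using assms(31,32) by (intro c_k_less_1_imp_card[of a "with_proj (G 0)" "\<phi> 0" "\<phi> (Suc 0)"]) (auto intro: le_less_trans)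
  have n: "2 \<le> n" "0 < n" using card n_def by simp_all
  have C: "0 < 1 - c\<^sup>2" and H: "0 < H" "H \<le> 1"
    using assms(30,31,33,34) by (simp_all add: power_less_one_iff H_def)
  have max_\<pi>: "\<eta> \<le> max_entry (\<pi> k)" for k
    using assms(38)[rule_format, of k] weighted_sum_le_max_entry[of "\<phi> (Suc k)" "\<pi> k"] assms(26) by simp
  have \<pi>_Suc: "B k *v \<pi> k = \<pi> (Suc k)" for k by (simp add: assms(29))
  have tracking: "tracking_step (G k) (B k) (\<pi> k) (\<pi> (Suc k)) b \<tau> \<eta> n" if "stochastic_vec (\<pi> k)" "\<And>i. 0 < \<pi> k $ i" for k
    by unfold_locales (use assms(12,13,16,19,20,33-36) n_def card max_\<pi> \<pi>_Suc that in auto)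
  have \<pi>: "stochastic_vec (\<pi> k) \<and> (\<forall>i. 0 < \<pi> k $ i)" for k
  proof (induction k)
    case 0
    then show ?case using n_def n by (simp add: assms(29) stochastic_vec_def)
  next
    case (Suc k)
    interpret tracking_step "G k" "B k" "\<pi> k" "\<pi> (Suc k)" b \<tau> \<eta> n using Suc by (intro tracking) auto
    show ?case using p'_stochastic p'_pos by blast
  qed
  have tracking_steps: "tracking_step (G k) (B k) (\<pi> k) (\<pi> (Suc k)) b \<tau> \<eta> n" for k
    using \<pi> by (intro tracking) auto
  \<comment> \<open>The rate belongs to a separate interpretation for each k, so it is exported
    existentially and a sequence is chosen afterwards.\<close>
  have "\<forall>k. \<exists>\<kappa>. (\<forall>u :: real^'p^'n. (S_err (\<chi> i. \<Sum>j\<in>UNIV. B k $ i $ j *\<^sub>R u $ j) (\<pi> (Suc k)))\<^sup>2 \<le> (1 - \<kappa>) * (S_err u (\<pi> k))\<^sup>2)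
      \<and> H / 2 \<le> \<kappa> \<and> \<kappa> \<le> 1 \<and> sqrt (1 / m k) \<le> \<kappa> * (2 / (H * sqrt n * \<eta>))"
  proof
    fix k
    interpret T: tracking_step "G k" "B k" "\<pi> k" "\<pi> (Suc k)" b \<tau> \<eta> n by (rule tracking_steps)
    have eq: "T.m = m k" "T.H = H" by (simp_all add: T.m_def m_def T.H_def H_def)
    show "\<exists>\<kappa>. (\<forall>u :: real^'p^'n. (S_err (\<chi> i. \<Sum>j\<in>UNIV. B k $ i $ j *\<^sub>R u $ j) (\<pi> (Suc k)))\<^sup>2 \<le> (1 - \<kappa>) * (S_err u (\<pi> k))\<^sup>2)
      \<and> H / 2 \<le> \<kappa> \<and> \<kappa> \<le> 1 \<and> sqrt (1 / m k) \<le> \<kappa> * (2 / (H * sqrt n * \<eta>))"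
      using T.S_err_contraction T.\<kappa>_le(2,3) T.chi_le(1) unfolding eq by blast
  qed
  from choice[OF this] obtain \<kappa> where \<kappa>:
      "\<And>k (u :: real^'p^'n). (S_err (\<chi> i. \<Sum>j\<in>UNIV. B k $ i $ j *\<^sub>R u $ j) (\<pi> (Suc k)))\<^sup>2 \<le> (1 - \<kappa> k) * (S_err u (\<pi> k))\<^sup>2"
      "\<And>k. H / 2 \<le> \<kappa> k" "\<And>k. \<kappa> k \<le> 1" "\<And>k. sqrt (1 / m k) \<le> \<kappa> k * (2 / (H * sqrt n * \<eta>))"
    by blast
  have step_bounds: "b \<le> 1 / 2" "b \<le> B k $ i $ i" "0 < m k" "m k * n \<le> 1" "sqrt (1 / m k) * H \<le> sqrt n / 2"
      "H * \<eta>\<^sup>2 \<le> n * b\<^sup>2 * (m k)\<^sup>2" "H \<le> n ^ 3 * b\<^sup>2 * (m k)\<^sup>2" for k i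
  proof -
    interpret T: tracking_step "G k" "B k" "\<pi> k" "\<pi> (Suc k)" b \<tau> \<eta> n by (rule tracking_steps)
    have eq: "T.m = m k" "T.H = H" by (simp_all add: T.m_def m_def T.H_def H_def)
    show "b \<le> 1 / 2" "b \<le> B k $ i $ i" "0 < m k" "m k * n \<le> 1" "sqrt (1 / m k) * H \<le> sqrt n / 2"
      "H * \<eta>\<^sup>2 \<le> n * b\<^sup>2 * (m k)\<^sup>2" "H \<le> n ^ 3 * b\<^sup>2 * (m k)\<^sup>2"
      using T.graph_bounds(3) T.B_diag T.bounds(1,4) T.chi_le(2) T.min_entry_rate unfolding eq by blast+
  qed
  \<comment> \<open>The infimum inherits every inequality that links the minimal weights to
    \<open>\<tau>\<close>, \<open>chi\<close> and \<open>\<psi>\<close>, which makes it a sharp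
    choice of the uniform lower bound.\<close>
  define mm where "mm = Inf (range m)"
  have mm_le: "mm \<le> m k" for k
    unfolding mm_def using step_bounds(3) by (intro cInf_lower bdd_belowI[of _ 0]) (auto intro: less_imp_le)
  have mm_ge: "l \<le> mm" if "\<And>k. l \<le> m k" for l
    unfolding mm_def using that by (intro cInf_greatest) auto
  have mm_square: "r \<le> s * mm\<^sup>2" if "\<And>k. r \<le> s * (m k)\<^sup>2" "0 < s" for r s
  proof -
    have "sqrt (r / s) \<le> m k" for k
      using that step_bounds(3)[of k] by (intro real_le_lsqrt) (auto simp: pos_divide_le_eq mult.commute)
    then have "r / s \<le> mm\<^sup>2" using mm_ge by (intro sqrt_le_D) blast
    then show ?thesis using \<open>0 < s\<close> by (simp add: pos_divide_le_eq mult.commute)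
  qed
  \<comment> \<open>The condition on \<open>\<psi>\<close> concerns the indices from 1 on; index 0
    is covered because the uniform vector has the largest possible minimum.\<close>
  have m_ge: "n / (n + \<psi>) \<le> m k" for k
  proof -
    have *: "n / (n + \<psi>) \<le> m (Suc k)" for k
    proof -
      have "(chi_k (\<pi> (Suc k)))\<^sup>2 = 1 / m (Suc k)" using step_bounds(3)[of "Suc k"] by (simp add: chi_k_def m_def)
      then have "n * (1 / m (Suc k) - 1) \<le> \<psi>" using assms(40) by metis
      then have "n \<le> m (Suc k) * (n + \<psi>)" using step_bounds(3)[of "Suc k"] by (simp add: field_simps)
      then show ?thesis using n assms(39) by (simp add: pos_divide_le_eq)
    qed
    have "m 1 \<le> m 0"
    proof -
      have "m 0 = 1 / n" by (simp add: m_def assms(29) min_entry_def n_def)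
      then show ?thesis using step_bounds(4)[of 1] n by (simp add: pos_le_divide_eq)
    qed
    then have "n / (n + \<psi>) \<le> m 0" using *[of 0] by simp
    then show ?thesis using * by (cases k) auto
  qed
  have mm: "0 < mm" by (rule less_le_trans[OF _ mm_ge[OF m_ge]]) (use n assms(39) in simp)
  have mm_\<psi>: "n * (1 / mm - 1) \<le> \<psi>"
  proof -
    have "n \<le> mm * (n + \<psi>)" using mm_ge[OF m_ge] n assms(39) by (simp add: pos_divide_le_eq)
    then show ?thesis using mm by (simp add: field_simps)
  qed
  have mm_n: "n \<le> 1 / mm"
  proof -
    have "mm * n \<le> m 0 * n" using mm_le[of 0] n by (intro mult_right_mono) auto
    then have "n * mm \<le> 1" using step_bounds(4)[of 0] by (simp add: mult.commute)
    then show ?thesis using mm by (simp add: pos_le_divide_eq)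
  qed
  have mm_chi: "1 / mm \<le> chi\<^sup>2"
  proof -
    have "1 / chi\<^sup>2 \<le> m k" for k
    proof -
      have "1 / m k \<le> chi\<^sup>2" using assms(42)[rule_format, of k] by (intro sqrt_le_D) (simp add: chi_k_def m_def)
      then show ?thesis using step_bounds(3)[of k] assms(41) by (simp add: field_simps)
    qed
    then have "1 / chi\<^sup>2 \<le> mm" by (rule mm_ge)
    then show ?thesis using mm assms(41) by (simp add: field_simps)
  qed
  have mm_rate: "H * \<eta>\<^sup>2 * (1 / mm)\<^sup>2 \<le> n * b\<^sup>2" "H * (1 / mm)\<^sup>2 \<le> n ^ 3 * b\<^sup>2"
    using mm_square[OF step_bounds(6)] mm_square[OF step_bounds(7)] n assms(19) mm
    by (simp_all add: power_divide pos_divide_le_eq)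
  \<comment> \<open>Multiplied by 1 - \<tau>^2, the constant \<nu> is a combination of
    \<open>chi\<^sup>2\<close> and \<open>\<psi>\<close>, and both are at least 1 / mm; for
    \<open>\<psi>\<close> this uses n >= 2.\<close>
  have \<nu>X: "3 * L\<^sup>2 * (1 / mm) \<le> H * \<nu>"
  proof -
    define X where "X = 1 / mm"
    have mX: "n \<le> X" "n * (X - 1) \<le> \<psi>" "X \<le> chi\<^sup>2" using mm_n mm_\<psi> mm_chi by (simp_all add: X_def)
    have "2 * (X - 1) \<le> n * (X - 1)" using n mX by (intro mult_right_mono) auto
    then have "2 * (X - 1) \<le> \<psi>" using mX(2) by (rule order_trans)
    then have X: "0 \<le> X" "X \<le> \<psi>" using mX(1) n by auto
    have "3 * L\<^sup>2 * X \<le> 6 * L\<^sup>2 * X * \<tau>\<^sup>2 + 3 * X * L\<^sup>2 * H"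
    proof -
      have "6 * L\<^sup>2 * X * \<tau>\<^sup>2 + 3 * X * L\<^sup>2 * H = 3 * L\<^sup>2 * X + 3 * L\<^sup>2 * X * \<tau>\<^sup>2"
        unfolding H_def by (simp add: algebra_simps)
      moreover have "0 \<le> 3 * L\<^sup>2 * X * \<tau>\<^sup>2" using X by (intro mult_nonneg_nonneg) auto
      ultimately show ?thesis by linarith
    qed
    also have "\<dots> \<le> 6 * L\<^sup>2 * chi\<^sup>2 * \<tau>\<^sup>2 + 3 * \<psi> * L\<^sup>2 * H"
      using mX X H by (intro add_mono mult_left_mono mult_right_mono) auto
    also have "\<dots> = H * \<nu>" using H by (simp add: assms(45) nu_const_def H_def[symmetric] field_simps)
    finally show ?thesis by (simp only: X_def)
  qed
  have \<nu>: "0 < \<nu>" unfolding assms(45) nu_const_def H_def[symmetric]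
    using assms(2,33,39,41) H by (intro add_nonneg_pos divide_nonneg_pos mult_pos_pos) auto
  have \<phi>_ge: "1 / vphi\<^sup>2 \<le> \<phi> k $ i" "0 < \<phi> k $ i" for k i
  proof -
    have pos: "0 < a ^ CARD('n) / n" using n assms(17) by simp
    then have \<phi>: "0 < \<phi> k $ i" for i using assms(28)[rule_format, of k i] by linarith
    then show "0 < \<phi> k $ i" .
    obtain j where j: "min_entry (\<phi> k) = \<phi> k $ j" by (rule min_entry_attained)
    have "1 / min_entry (\<phi> k) \<le> vphi\<^sup>2" using assms(44) by (intro sqrt_le_D) blast
    then have "1 / vphi\<^sup>2 \<le> min_entry (\<phi> k)" using j \<phi>[of j] assms(43) by (simp add: field_simps)
    then show "1 / vphi\<^sup>2 \<le> \<phi> k $ i" using min_entry_le[of "\<phi> k" i] by linarith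
  qed
  have \<phi>_n: "n \<le> vphi\<^sup>2"
  proof -
    have "1 / vphi\<^sup>2 * n \<le> min_entry (\<phi> 0) * n"
      using \<phi>_ge(1)[of 0] n min_entry_attained[of "\<phi> 0"] by (metis less_imp_le mult_right_mono)
    also have "\<dots> \<le> 1" using stochastic_vec_entries(1)[of "\<phi> 0"] assms(26) by (simp add: n_def)
    finally show ?thesis using assms(43) by (simp add: field_simps)
  qed
  define Gc where "Gc = (1 - c\<^sup>2) * max 2 (n * \<eta>)"
  have contraction: "(\<Sum>i\<in>UNIV. \<phi> (Suc k) $ i * (norm ((\<Sum>j\<in>UNIV. A k $ i $ j *\<^sub>R u j) - (\<Sum>j\<in>UNIV. \<phi> k $ j *\<^sub>R u j)))\<^sup>2)
    \<le> (1 - Gc) * (\<Sum>j\<in>UNIV. \<phi> k $ j * (norm (u j - (\<Sum>j\<in>UNIV. \<phi> k $ j *\<^sub>R u j)))\<^sup>2)"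
    if "1 \<le> k" for k and u :: "'n \<Rightarrow> 'v::real_inner"
  proof -
    obtain j where k: "k = Suc j" using \<open>1 \<le> k\<close> by (cases k) auto
    have "\<eta> \<le> (\<Sum>i\<in>UNIV. \<pi> j $ i * \<phi> k $ i)" using assms(38)[rule_format, of j] by (simp add: k mult.commute)
    also have "\<dots> \<le> max_entry (\<phi> k)" using \<pi> by (intro weighted_sum_le_max_entry) blast
    finally have "\<eta> \<le> max_entry (\<phi> k)" .
    then show ?thesis unfolding Gc_def n_def
      using assms(12,13,15,17,18,26,27,30-32) card \<phi>_ge by (intro consensus_step[of "G k" "A k" a]) auto
  qed
  have Gc: "2 * (1 - c\<^sup>2) \<le> Gc" "n * \<eta> * (1 - c\<^sup>2) \<le> Gc" "0 \<le> Gc" "Gc \<le> 1"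
  proof -
    have "(1 - c\<^sup>2) * 2 \<le> Gc" "(1 - c\<^sup>2) * (n * \<eta>) \<le> Gc"
      unfolding Gc_def using C by (intro mult_left_mono; simp)+
    then show "2 * (1 - c\<^sup>2) \<le> Gc" "n * \<eta> * (1 - c\<^sup>2) \<le> Gc" "0 \<le> Gc" using C by (simp_all add: mult.commute)
    show "Gc \<le> 1"
    proof (rule contraction_factor_le_1[of Gc "\<lambda>j. \<phi> 1 $ j"])
      fix u :: "'n \<Rightarrow> real"
      have "0 \<le> (\<Sum>i\<in>UNIV. \<phi> (Suc 1) $ i * (norm ((\<Sum>j\<in>UNIV. A 1 $ i $ j *\<^sub>R u j) - (\<Sum>j\<in>UNIV. \<phi> 1 $ j *\<^sub>R u j)))\<^sup>2)"
        using \<phi>_ge(2) by (intro sum_nonneg mult_nonneg_nonneg) (auto intro: less_imp_le)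
      also note contraction[of 1 u]
      finally show "0 \<le> (1 - Gc) * (\<Sum>j\<in>UNIV. \<phi> 1 $ j * (norm (u j - (\<Sum>j\<in>UNIV. \<phi> 1 $ j *\<^sub>R u j)))\<^sup>2)" by simp
    qed (use assms(26) \<phi>_ge card in \<open>auto simp: stochastic_vec_def\<close>)
  qed
  interpret CL: comparison_levels n L mu \<eta> vphi c \<tau> \<nu> abar bbar "vsig\<^sup>2" \<psi> \<sigma> b "1 / mm" Gc
  proof
    show "vsig\<^sup>2 = L\<^sup>2 * (n * \<eta> * mu\<^sup>2 + 12 * L\<^sup>2 * vphi\<^sup>2) / (\<eta> * mu\<^sup>2)
      + 8 * \<nu> * (n * \<eta>\<^sup>2 * mu\<^sup>2 + 48 * L\<^sup>2 * vphi\<^sup>2) / (n * \<eta>\<^sup>2 * mu\<^sup>2 * (1 - \<tau>\<^sup>2))"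
      unfolding assms(46) varsigma_const_def
      using n assms(36) \<nu> H by (intro real_sqrt_pow2 add_nonneg_nonneg divide_nonneg_nonneg mult_nonneg_nonneg) (auto simp: H_def)
    have "bbar < sqrt ((1 - c\<^sup>2)\<^sup>2 / (96 * (1 + c\<^sup>2) * vphi\<^sup>2) - vsig\<^sup>2 * abar\<^sup>2 / 12)" using assms(50) by simp
    moreover from this have "0 < sqrt ((1 - c\<^sup>2)\<^sup>2 / (96 * (1 + c\<^sup>2) * vphi\<^sup>2) - vsig\<^sup>2 * abar\<^sup>2 / 12)"
      using assms(49) by linarith
    ultimately have "bbar\<^sup>2 < (sqrt ((1 - c\<^sup>2)\<^sup>2 / (96 * (1 + c\<^sup>2) * vphi\<^sup>2) - vsig\<^sup>2 * abar\<^sup>2 / 12))\<^sup>2"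
      and "0 < (1 - c\<^sup>2)\<^sup>2 / (96 * (1 + c\<^sup>2) * vphi\<^sup>2) - vsig\<^sup>2 * abar\<^sup>2 / 12"
      using assms(49) by (intro power_strict_mono, simp_all)
    then have 1: "bbar\<^sup>2 < (1 - c\<^sup>2)\<^sup>2 / (96 * (1 + c\<^sup>2) * vphi\<^sup>2) - vsig\<^sup>2 * abar\<^sup>2 / 12" by simp
    have arith: "v + 12 * w < e" if "w < r - v / 12" "e = 12 * r" for e r v w :: real using that by linarith
    have 2: "(1 - c\<^sup>2)\<^sup>2 / (8 * (1 + c\<^sup>2) * vphi\<^sup>2) = 12 * ((1 - c\<^sup>2)\<^sup>2 / (96 * (1 + c\<^sup>2) * vphi\<^sup>2))"
      by (simp add: divide_simps)
    show "vsig\<^sup>2 * abar\<^sup>2 + 12 * bbar\<^sup>2 < (1 - c\<^sup>2)\<^sup>2 / (8 * (1 + c\<^sup>2) * vphi\<^sup>2)" by (rule arith[OF 1 2])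
    let ?Q = "(n * \<eta> * L\<^sup>2 * (1 - \<tau>\<^sup>2) + 32 * \<nu>) / (48 * (1 - \<tau>\<^sup>2))"
    have Q: "0 \<le> ?Q" using n assms(36) \<nu> H by (intro divide_nonneg_nonneg add_nonneg_nonneg) (auto simp: H_def)
    have "bbar < abar * sqrt ?Q" using assms(50) by simp
    then have "bbar\<^sup>2 < (abar * sqrt ?Q)\<^sup>2" using assms(49) by (intro power_strict_mono) auto
    then show "bbar\<^sup>2 < abar\<^sup>2 * ?Q" using Q by (simp add: power_mult_distrib)
    show "abar < 2 / (n * \<eta> * (L + mu))" using assms(48) by simp
    show "1 < vphi" "n \<le> vphi\<^sup>2" by (fact assms(43), fact \<phi>_n)
    show "3 * L\<^sup>2 * (1 / mm) \<le> (1 - \<tau>\<^sup>2) * \<nu>" using \<nu>X by (simp add: H_def)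
    show "(1 - \<tau>\<^sup>2) * \<eta>\<^sup>2 * (1 / mm)\<^sup>2 \<le> n * b\<^sup>2" "(1 - \<tau>\<^sup>2) * (1 / mm)\<^sup>2 \<le> n ^ 3 * b\<^sup>2"
      using mm_rate by (simp_all add: H_def)
  qed (use n assms \<nu> step_bounds(1) mm_n mm_\<psi> Gc in auto)
  have gradF: "GDERIV F u :> (1 / n) *\<^sub>R (\<Sum>i\<in>UNIV. grad i u)" for u
    unfolding assms(8) using assms(5) by (intro GDERIV_average) blast
  have minF: "F xstar \<le> F u" for u using assms(10) by (cases "u = xstar") (auto intro: less_imp_le)
  have lip: "norm (grad i u - grad i v) \<le> L * norm (u - v)" for i u v
    using lipschitz_onD[OF assms(7)[rule_format, of i], of u v] by (simp add: dist_norm)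
  note mono = strongly_convex_gradient_monotone[OF assms(9) gradF minF]
  have critical: "(\<Sum>i\<in>UNIV. grad i xstar) = 0" using mono(2) n by simp
  have mu_L: "mu \<le> L"
  proof (rule strong_convexity_le_smoothness)
    show "mu * (norm (u - xstar))\<^sup>2 \<le> inner ((1 / n) *\<^sub>R (\<Sum>i\<in>UNIV. grad i u)) (u - xstar)" for u by (rule mono)
    have "norm (\<Sum>i\<in>UNIV. grad i u) \<le> n * (L * norm (u - xstar))" for u
    proof -
      have "norm (\<Sum>i\<in>UNIV. grad i u - grad i xstar) \<le> (\<Sum>i\<in>(UNIV::'n set). L * norm (u - xstar))"
        by (intro order_trans[OF norm_sum] sum_mono lip)
      then show ?thesis by (simp add: sum_subtractf critical n_def)
    qed
    then show "norm ((1 / n) *\<^sub>R (\<Sum>i\<in>UNIV. grad i u)) \<le> L * norm (u - xstar)" for u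
      using n by (simp add: pos_divide_le_eq mult.commute)
  qed
  interpret pp: push_pull P Z \<xi> g grad A B \<alpha> \<beta> xm1 x0 x y \<phi> xstar n L mu \<sigma> b abar bbar vphi mm
  proof
    show "n * mu * (norm (u - xstar))\<^sup>2 \<le> inner (\<Sum>i\<in>UNIV. grad i u) (u - xstar)" for u
      using mono(1)[of u] n by (simp add: pos_le_divide_eq mult_ac)
    show "mm \<le> pi_seq B k $ i" for k i
      using mm_le[of k] min_entry_le[of "\<pi> k" i] by (simp add: m_def assms(29))
    show "\<alpha> $ i \<le> abar" "\<beta> $ i \<le> bbar" for i by (simp_all add: assms(23,24) max_entry_ge)
    show "n * abar * L\<^sup>2 \<le> mu / 96" by (rule CL.small_step)
    show "norm (grad i u - grad i v) \<le> L * norm (u - v)" for i u v by (rule lip)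
    show "b \<le> B k $ i $ i" for k i by (rule step_bounds)
  qed (use assms n_def \<phi>_ge mm critical mu_L in auto)
  interpret ps: push_pull_small P Z \<xi> g grad A B \<alpha> \<beta> xm1 x0 x y \<phi> xstar n L mu \<sigma> b abar bbar vphi mm
    Gc \<kappa> "\<lambda>k. sqrt (1 / m k)" \<eta> "1 - c\<^sup>2" H "H / 2"
  proof
    show "weighted_norm2 (\<phi> (Suc k)) (pp.mixA k u - rep (weighted_avg (\<phi> k) u))
        \<le> (1 - Gc) * weighted_norm2 (\<phi> k) (u - rep (weighted_avg (\<phi> k) u))" if "1 \<le> k" for k u
      using contraction[OF that, of "\<lambda>j. u $ j"] by (simp add: weighted_norm2_def weighted_avg_def pp.mixA_def)
    show "(S_err (pp.mixB k u) (pi_seq B (Suc k)))\<^sup>2 \<le> (1 - \<kappa> k) * (S_err u (pi_seq B k))\<^sup>2" for k u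
      using \<kappa>(1)[of k u] unfolding pp.mixB_def assms(29) .
    show "0 \<le> \<kappa> k" for k using \<kappa>(2)[of k] H by linarith
    show "1 / (sqrt (1 / m k))\<^sup>2 \<le> pi_seq B k $ i" for k i
      using step_bounds(3)[of k] min_entry_le[of "\<pi> k" i] by (simp add: m_def assms(29))
    show "0 < sqrt (1 / m k)" for k using step_bounds(3) by simp
    show "sqrt n \<le> vphi" using \<phi>_n assms(43) by (intro real_le_lsqrt) auto
    show "sqrt n \<le> 1 / sqrt mm" using real_sqrt_le_mono[OF mm_n] by (simp add: real_sqrt_divide)
    show "96 * abar * L\<^sup>2 * vphi\<^sup>2 * (1 / sqrt mm) \<le> (1 - c\<^sup>2) * H * sqrt n * \<eta> * mu"
      using CL.step_bound by (simp add: real_sqrt_divide H_def)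
    show "64 * bbar * L * vphi\<^sup>2 \<le> (1 - c\<^sup>2) * sqrt n * \<eta> * mu" by (rule CL.momentum_bound)
    show "sqrt (1 / m k) \<le> 1 / sqrt mm" for k
      using mm mm_le[of k] step_bounds(3)[of k] by (simp add: real_sqrt_divide frac_le)
    show "H / 2 \<le> \<kappa> k \<and> \<kappa> k \<le> 1" for k using \<kappa> by blast
    show "sqrt (1 / m k) \<le> \<kappa> k * (2 / (H * sqrt n * \<eta>))" for k by (rule \<kappa>)
    show "sqrt (1 / m k) * H \<le> sqrt n / 2" for k by (rule step_bounds)
  qed (use n assms(36) C H Gc in auto)
  have noise: "pp.noise_level\<^sup>2 = \<sigma>\<^sup>2 * (1 / mm)\<^sup>2 * (1 + 1 / b)"
    using assms(19) by (simp add: pp.noise_level_def power_mult_distrib power_divide add_nonneg_nonneg)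
  have lvl: "CL.level = vec_index rhs" by (simp add: CL.level_def assms(52,53))
  obtain K where K: "1 \<le> K" and levels: "\<And>k. K \<le> k \<Longrightarrow> (\<integral>s. (pp.eX k s)\<^sup>2 \<partial>P) \<le> (18 / 5 * pp.noise_level / (mu * n))\<^sup>2
    \<and> (\<integral>s. (pp.eD k s)\<^sup>2 \<partial>P) \<le> CL.level 1 \<and> (\<integral>s. (S_err (y k s) (pi_seq B k))\<^sup>2 \<partial>P) \<le> CL.level 3"
  proof -
    obtain K where "1 \<le> K" "\<And>k. K \<le> k \<Longrightarrow> (\<integral>s. (pp.eX k s)\<^sup>2 \<partial>P) \<le> (18 / 5 * pp.noise_level / (mu * n))\<^sup>2
      \<and> (\<integral>s. (pp.eD k s)\<^sup>2 \<partial>P) \<le> (12 / 5 * vphi * abar * (143 / 25 * pp.noise_level * L / mu) / Gc)\<^sup>2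
      \<and> (\<integral>s. (S_err (y k s) (pi_seq B k))\<^sup>2 \<partial>P) \<le> \<sigma>\<^sup>2 / mm * (1 + 1 / b) * (1 + sqrt n)\<^sup>2"
      using ps.eventually_levels by blast
    moreover have "\<sigma>\<^sup>2 / mm * (1 + 1 / b) * (1 + sqrt n)\<^sup>2 \<le> CL.level 3" using CL.tracking_level by simp
    ultimately show ?thesis using that CL.consensus_level[OF noise] by (meson order_trans)
  qed
  obtain K' where K': "K \<le> K'" and level2: "\<And>k. K' \<le> k \<Longrightarrow> (\<integral>s. (pp.eU k s)\<^sup>2 \<partial>P) \<le> CL.level 2"
  proof -
    have "\<exists>K'\<ge>K. \<forall>k\<ge>K'. (\<integral>s. (pp.eU k s)\<^sup>2 \<partial>P) \<le> CL.level 2"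
    proof (rule CL.step_level[where W = "\<lambda>k. \<integral>s. (pp.eX k s)\<^sup>2 \<partial>P" and D = "\<lambda>k. \<integral>s. (pp.eD k s)\<^sup>2 \<partial>P"
        and S = "\<lambda>k. \<integral>s. (S_err (y k s) (pi_seq B k))\<^sup>2 \<partial>P"])
      show "(18 / 5 * pp.noise_level / (mu * n))\<^sup>2 < CL.level 0" by (rule CL.optimality_level[OF noise])
    qed (use levels ps.step_err_recursion order_trans[OF K] in blast)+
    then show ?thesis using that by blast
  qed
  have ev: "vec_index (V k) i \<le> vec_index rhs i" if "K' \<le> k" "i < 4" for k i
  proof -
    have "(\<integral>s. (pp.eX k s)\<^sup>2 \<partial>P) \<le> CL.level 0"
      using levels[of k] K' that(1) CL.optimality_level[OF noise] by linarith
    then show ?thesis using levels[of k] level2[of k] K' that unfolding less_4_iff lvl[symmetric] assms(51)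
      by (elim disjE) (simp_all only: ps.V_vec_simps le_trans)
  qed
  have nonneg: "0 \<le> vec_index rhs i" if "i < 4" for i using CL.level_nonneg[OF that] by (simp add: lvl)
  have "0 < \<rho>" "\<rho> < 1"
    unfolding assms(54,52) by (rule CL.M_spectral_radius_pos, rule CL.spectral_radius_less_1)
  have lims: "limsup (\<lambda>k. ereal (vec_index (V k) i)) \<le> ereal (vec_index rhs i)" if "i < 4" for i
    using ev that by (intro Limsup_bounded) (auto simp: eventually_sequentially)
  have V: "vec_index (V k) 0 = (\<integral>s. (norm (weighted_avg (\<phi> k) (x k s) - xstar))\<^sup>2 \<partial>P)"
    "vec_index (V k) 1 = (\<integral>s. weighted_norm2 (\<phi> k) (x k s - (\<chi> i. weighted_avg (\<phi> k) (x k s))) \<partial>P)" for k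
    by (simp_all add: assms(51) V_vec_def optimality_err_def consensus_err_def)
  have "\<exists>C\<ge>0. \<forall>k. \<forall>i<4. vec_index (V k) i \<le> vec_index rhs i + C * \<rho> ^ k"
    using ev nonneg \<open>0 < \<rho>\<close> by (intro geometric_envelope) auto
  moreover have "limsup (\<lambda>k. ereal (\<integral>s. (norm (weighted_avg (\<phi> k) (x k s) - xstar))\<^sup>2 \<partial>P)) \<le> ereal (vec_index rhs 0)"
    using lims[of 0] by (simp add: V)
  moreover have "limsup (\<lambda>k. ereal (\<integral>s. weighted_norm2 (\<phi> k) (x k s - (\<chi> i. weighted_avg (\<phi> k) (x k s))) \<partial>P)) \<le> ereal (vec_index rhs 1)"
    using lims[of 1] unfolding V by simp
  moreover have "integrable P (\<lambda>s. optimality_err (\<phi> k) xstar (x k s))" "integrable P (\<lambda>s. consensus_err (\<phi> k) (x k s))"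
    "integrable P (\<lambda>s. step_err (x k s) (prev_iterate xm1 x k s))" "integrable P (\<lambda>s. tracking_err (y k s) (\<pi> k))" for k
    using ps.errors_integrable[of k] by (simp_all add: ps.errors tracking_err_def assms(29))
  ultimately show ?thesis using \<open>\<rho> < 1\<close> nonneg lims by blast
qed

end
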